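(* Let $\mathbb{Z}[X]$ be the polynomial ring over $\mathbb{Z}$ in the variables $X=\{g_1,x_1,y_1,z_1,X'_{n,\eta}: n\ge1,\ \eta\in\mathbb{C}P^1\}$, and let $J\subset\mathbb{Z}[X]$ be the ideal generated by the polynomials $$g_1^2-1,\quad x_1^3-2x_1(1+g_1),\quad x_1(y_1-1-2g_1),\quad x_1(y_1-z_1),\quad y_1z_1-1-2x_1^2,$$ $$x_1X'_{n,\eta}-n(1+g_1)x_1,\quad y_1X'_{n,\eta}-ng_1x_1^2-g_1X'_{n,\eta},\quad z_1X'_{n,\eta}-nx_1^2-g_1X'_{n,\eta},$$ $$X'_{n,\eta}X'_{s,\alpha}-nsg_1x_1^2,\quad X'_{n,\eta}X'_{t,\eta}-n(t-1)g_1x_1^2-X'_{n,\eta}-g_1X'_{n,\eta},$$ where $n,s,t\ge1$ with $t\ge n$, and $\eta,\alpha\in\mathbb{C}P^1$ with $\eta\ne\alpha$. Let $\mathbb{Z}[\tilde X]$ be the subring of $\mathbb{Z}[X]$ generated by $\tilde X=\{g_1,x_1^2,y_1,z_1,X'_{n,\eta}: n\ge1,\ \eta\in\mathbb{C}P^1\}$. Then, as a ring, the Green ring of $K_2$ satisfies $$r(K_2)\cong\mathbb{Z}[\tilde X]/J,$$ where $\mathbb{Z}[\tilde X]/J$ denotes the image of $\mathbb{Z}[\tilde X]$ in $\mathbb{Z}[X]/J$, i.e. $\mathbb{Z}[\tilde X]/(J\cap\mathbb{Z}[\tilde X])$.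
   Context: $K_2$ is the $8$-dimensional Hopf algebra over $\mathbb{C}$ generated by $K,\xi_1,\xi_2$ with $K^2=1$, $\xi_i^2=0$, $K\xi_i=-\xi_iK$, $\xi_1\xi_2=-\xi_2\xi_1$, and $\Delta(K)=K\otimes K$, $\Delta(\xi_i)=K\otimes\xi_i+\xi_i\otimes1$, $\epsilon(K)=1$, $\epsilon(\xi_i)=0$, $S(K)=K$, $S(\xi_i)=-K\xi_i$. The Green ring $r(K_2)$ is the abelian group generated by isomorphism classes $[M]$ of finite-dimensional $K_2$-modules modulo $[M\oplus N]=[M]+[N]$, with product $[M][N]=[M\otimes N]$. $\mathbb{C}P^1=\mathbb{C}\cup\{\infty\}$. *)

theory Defs
  imports
    "HOL-Library.Poly_Mapping"
    "HOL-Library.Product_Plus"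
    "HOL-Algebra.QuotRing"
    "HOL-Algebra.Generated_Rings"
    "HOL-Algebra.Generated_Groups"
    "HOL-Algebra.Free_Abelian_Groups"
    "HOL-Algebra.Algebraic_Closure_Type"
    "Jordan_Normal_Form.Matrix"
begin

section \<open>The Hopf algebra $K_2$\<close>

text \<open>
  $K_2$ is presented as the free associative unital algebra
  $F = \mathbb{C}\langle K, \xi_1, \xi_2\rangle$ modulo the two-sided ideal generated by the
  defining relations. $F$ is the monoid algebra of the free monoid of words, and
  $F \otimes F$ is the monoid algebra of the monoid of pairs of words; both products are the
  convolution product of \<^typ>\<open>'a \<Rightarrow>\<^sub>0 'b\<close>.
\<close>

datatype k2_gen = GK | GXi1 | GXi2

datatype k2_word = Word "k2_gen list"

fun letters :: "k2_word \<Rightarrow> k2_gen list" where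
  "letters (Word xs) = xs"

instantiation k2_word :: monoid_add
begin

definition zero_k2_word :: k2_word where
  "0 = Word []"

definition plus_k2_word :: "k2_word \<Rightarrow> k2_word \<Rightarrow> k2_word" where
  "u + v = Word (letters u @ letters v)"

instance
proof
  fix u v w :: k2_word
  show "u + v + w = u + (v + w)" by (simp add: plus_k2_word_def)
  show "0 + u = u" by (cases u) (simp add: plus_k2_word_def zero_k2_word_def)
  show "u + 0 = u" by (cases u) (simp add: plus_k2_word_def zero_k2_word_def)
qed

end

type_synonym k2_free = "k2_word \<Rightarrow>\<^sub>0 complex"
type_synonym k2_free2 = "(k2_word \<times> k2_word) \<Rightarrow>\<^sub>0 complex"

definition of_word :: "k2_word \<Rightarrow> k2_free" where
  "of_word w = Poly_Mapping.single w 1"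

definition kK :: k2_free where "kK = of_word (Word [GK])"
definition kXi1 :: k2_free where "kXi1 = of_word (Word [GXi1])"
definition kXi2 :: k2_free where "kXi2 = of_word (Word [GXi2])"

definition k2_relators :: "k2_free set" where
  "k2_relators =
    {kK * kK - 1,
     kXi1 * kXi1, kXi2 * kXi2,
     kK * kXi1 + kXi1 * kK, kK * kXi2 + kXi2 * kK,
     kXi1 * kXi2 + kXi2 * kXi1}"

text \<open>The two-sided ideal $I$ with $K_2 = F/I$.\<close>

definition k2_ideal :: "k2_free set" where
  "k2_ideal = Idl\<^bsub>ring_of_type_algebra\<^esub> k2_relators"

text \<open>
  The comultiplication and the counit, as the algebra maps $F \to F \otimes F$ and
  $F \to \mathbb{C}$ with the prescribed values on the generators. (They descend to $K_2$; the
  antipode is not needed for the Green ring.)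
\<close>

definition tens :: "k2_free \<Rightarrow> k2_free \<Rightarrow> k2_free2" (infixr "\<otimes>\<^sub>F" 75) where
  "p \<otimes>\<^sub>F q = (\<Sum>u \<in> Poly_Mapping.keys p. \<Sum>v \<in> Poly_Mapping.keys q.
     Poly_Mapping.single (u, v) (Poly_Mapping.lookup p u * Poly_Mapping.lookup q v))"

fun comult_gen :: "k2_gen \<Rightarrow> k2_free2" where
  "comult_gen GK = kK \<otimes>\<^sub>F kK"
| "comult_gen GXi1 = kK \<otimes>\<^sub>F kXi1 + kXi1 \<otimes>\<^sub>F 1"
| "comult_gen GXi2 = kK \<otimes>\<^sub>F kXi2 + kXi2 \<otimes>\<^sub>F 1"

definition comult :: "k2_free \<Rightarrow> k2_free2" where
  "comult p = (\<Sum>w \<in> Poly_Mapping.keys p.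
     Poly_Mapping.single 0 (Poly_Mapping.lookup p w) * prod_list (map comult_gen (letters w)))"

fun counit_gen :: "k2_gen \<Rightarrow> complex" where
  "counit_gen GK = 1"
| "counit_gen GXi1 = 0"
| "counit_gen GXi2 = 0"

definition counit :: "k2_free \<Rightarrow> complex" where
  "counit p = (\<Sum>w \<in> Poly_Mapping.keys p.
     Poly_Mapping.lookup p w * prod_list (map counit_gen (letters w)))"


section \<open>Finite-dimensional $K_2$-modules\<close>

text \<open>
  A module structure on $\mathbb{C}^n$ is an algebra homomorphism
  $K_2 = F/I \to M_n(\mathbb{C})$, i.e. an algebra homomorphism on $F$ that vanishes on $I$.
  Every finite-dimensional module is isomorphic to one of these; $n = 0$ (the zero module) is
  allowed. A module is represented by its homomorphism \<open>M\<close> alone, since $n$ is the size of \<open>M 1\<close>.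
  The element \<open>single 0 c\<close> is the scalar $c \cdot 1$ of $F$.
\<close>

type_synonym k2_rep = "k2_free \<Rightarrow> complex mat"

definition mdim :: "k2_rep \<Rightarrow> nat" where
  "mdim M = dim_row (M 1)"

definition k2_module :: "k2_rep \<Rightarrow> bool" where
  "k2_module M \<longleftrightarrow>
     (\<forall>p. M p \<in> carrier_mat (mdim M) (mdim M)) \<and>
     M 1 = 1\<^sub>m (mdim M) \<and>
     (\<forall>p q. M (p + q) = M p + M q) \<and>
     (\<forall>p q. M (p * q) = M p * M q) \<and>
     (\<forall>c p. M (Poly_Mapping.single 0 c * p) = c \<cdot>\<^sub>m M p) \<and>
     (\<forall>p \<in> k2_ideal. M p = 0\<^sub>m (mdim M) (mdim M))"

definition k2_iso :: "(k2_rep \<times> k2_rep) set" where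
  "k2_iso = {(M, N). k2_module M \<and> k2_module N \<and>
     (\<exists>P \<in> carrier_mat (mdim N) (mdim M). invertible_mat P \<and> (\<forall>p. P * M p = N p * P))}"

definition dsum :: "k2_rep \<Rightarrow> k2_rep \<Rightarrow> k2_rep" where
  "dsum M N = (\<lambda>p. four_block_mat (M p) (0\<^sub>m (mdim M) (mdim N)) (0\<^sub>m (mdim N) (mdim M)) (N p))"

definition kron :: "complex mat \<Rightarrow> complex mat \<Rightarrow> complex mat" where
  "kron A B = mat (dim_row A * dim_row B) (dim_col A * dim_col B)
     (\<lambda>(i, j). A $$ (i div dim_row B, j div dim_col B) * B $$ (i mod dim_row B, j mod dim_col B))"

text \<open>
  The action of $p$ on $M \otimes N$ is $(M \otimes N)(\Delta(p))$, where an element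
  $\sum c_{u,v}\, u \otimes v$ of $F \otimes F$ acts by $\sum c_{u,v}\, M(u) \otimes N(v)$.
\<close>

definition outer_action :: "k2_rep \<Rightarrow> k2_rep \<Rightarrow> k2_free2 \<Rightarrow> complex mat" where
  "outer_action M N T = mat (mdim M * mdim N) (mdim M * mdim N)
     (\<lambda>(i, j). \<Sum>(u, v) \<in> Poly_Mapping.keys T.
        Poly_Mapping.lookup T (u, v) * kron (M (of_word u)) (N (of_word v)) $$ (i, j))"

definition tprod :: "k2_rep \<Rightarrow> k2_rep \<Rightarrow> k2_rep" where
  "tprod M N = (\<lambda>p. outer_action M N (comult p))"

definition triv_module :: k2_rep where
  "triv_module = (\<lambda>p. mat 1 1 (\<lambda>_. counit p))"


section \<open>The Green ring\<close>

definition iso_class :: "k2_rep \<Rightarrow> k2_rep set" where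
  "iso_class M = k2_iso `` {M}"

definition iso_classes :: "k2_rep set set" where
  "iso_classes = Collect k2_module // k2_iso"

text \<open>$[M][N] = [M \otimes N]$; the union is over representatives of the two classes.\<close>

definition class_mult :: "k2_rep set \<Rightarrow> k2_rep set \<Rightarrow> k2_rep set" where
  "class_mult C D = (\<Union>M \<in> C. \<Union>N \<in> D. iso_class (tprod M N))"

text \<open>The free abelian group on the isomorphism classes, with the biadditive extension of the
  product of classes.\<close>

definition pre_green :: "(k2_rep set \<Rightarrow>\<^sub>0 int) ring" where
  "pre_green =
    \<lparr>carrier = carrier (free_Abelian_group iso_classes),
     monoid.mult = (\<lambda>f g. frag_extend (\<lambda>C. frag_extend (\<lambda>D. frag_of (class_mult C D)) g) f),
     one = frag_of (iso_class triv_module),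
     ring.zero = 0,
     add = (+)\<rparr>"

definition dsum_relations :: "(k2_rep set \<Rightarrow>\<^sub>0 int) set" where
  "dsum_relations =
    {frag_of (iso_class (dsum M N)) - (frag_of (iso_class M) + frag_of (iso_class N)) | M N.
       k2_module M \<and> k2_module N}"

text \<open>The subgroup generated by the relations is in fact an ideal, because the tensor product
  distributes over direct sums; so the coset product of \<open>Quot\<close> is the product induced by
  $[M][N] = [M \otimes N]$.\<close>

definition green_ring :: "(k2_rep set \<Rightarrow>\<^sub>0 int) set ring" where
  "green_ring = pre_green Quot (generate (add_monoid pre_green) dsum_relations)"


section \<open>The polynomial ring $\mathbb{Z}[X]$ and the ideal $J$\<close>

datatype cp1 = Finite complex | Infinity

typedef pos_nat = "{n :: nat. n \<ge> 1}"
  by auto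

datatype gvar = VG1 | VX1 | VY1 | VZ1 | VX' pos_nat cp1

text \<open>Polynomials with integer coefficients in the variables \<^typ>\<open>gvar\<close>; the exponent of a
  monomial is a finitely supported function \<^typ>\<open>gvar \<Rightarrow>\<^sub>0 nat\<close>.\<close>

type_synonym zx = "(gvar \<Rightarrow>\<^sub>0 nat) \<Rightarrow>\<^sub>0 int"

definition ZX :: "zx ring" where
  "ZX = ring_of_type_algebra"

definition pvar :: "gvar \<Rightarrow> zx" where
  "pvar v = Poly_Mapping.single (Poly_Mapping.single v 1) 1"

definition g1 :: zx where "g1 = pvar VG1"
definition x1 :: zx where "x1 = pvar VX1"
definition y1 :: zx where "y1 = pvar VY1"
definition z1 :: zx where "z1 = pvar VZ1"

text \<open>Only meaningful for $n \ge 1$, since \<open>Abs_pos_nat 0\<close> is unspecified.\<close>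

definition X' :: "nat \<Rightarrow> cp1 \<Rightarrow> zx" where
  "X' n \<eta> = pvar (VX' (Abs_pos_nat n) \<eta>)"

definition J_gens :: "zx set" where
  "J_gens =
     {g1^2 - 1,
      x1^3 - 2 * x1 * (1 + g1),
      x1 * (y1 - 1 - 2 * g1),
      x1 * (y1 - z1),
      y1 * z1 - 1 - 2 * x1^2}
   \<union> {x1 * X' n \<eta> - of_nat n * (1 + g1) * x1 | n \<eta>. n \<ge> 1}
   \<union> {y1 * X' n \<eta> - of_nat n * g1 * x1^2 - g1 * X' n \<eta> | n \<eta>. n \<ge> 1}
   \<union> {z1 * X' n \<eta> - of_nat n * x1^2 - g1 * X' n \<eta> | n \<eta>. n \<ge> 1}
   \<union> {X' n \<eta> * X' s \<alpha> - of_nat n * of_nat s * g1 * x1^2 | n s \<eta> \<alpha>.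
        n \<ge> 1 \<and> s \<ge> 1 \<and> \<eta> \<noteq> \<alpha>}
   \<union> {X' n \<eta> * X' t \<eta> - of_nat n * (of_nat t - 1) * g1 * x1^2 - X' n \<eta> - g1 * X' n \<eta> | n t \<eta>.
        n \<ge> 1 \<and> t \<ge> n}"

definition J :: "zx set" where
  "J = Idl\<^bsub>ZX\<^esub> J_gens"

definition ZX_tilde :: "zx set" where
  "ZX_tilde = generate_ring ZX ({g1, x1^2, y1, z1} \<union> {X' n \<eta> | n \<eta>. n \<ge> 1})"

text \<open>The image of \<^const>\<open>ZX_tilde\<close> in \<open>ZX Quot J\<close>.\<close>

definition ZX_tilde_mod_J :: "zx set ring" where
  "ZX_tilde_mod_J = (ZX Quot J)\<lparr>carrier := (\<lambda>p. J +>\<^bsub>ZX\<^esub> p) ` ZX_tilde\<rparr>"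

end

(* A module is a quadruple of matrices: an idempotent E for the identity and the actions of the
   generators. If xi_1 xi_2 acts nontrivially, a projective summand splits off, because K_2 is
   self-injective. Otherwise the module contains as a summand an indecomposable Kronecker pencil
   (xi_1, xi_2), placed in the two eigenspaces of K. So the non-projective indecomposables are
   k = LT_0, LT_1, ..., L_1, L_2, ..., the X'_(n,eta), and their twists by the sign character.

   The products in J are read off by exhibiting a free submodule of the tensor product together with
   a surjection onto the complementary summand. Hence the variables map to the Green ring, with x_1^2
   going to the class p of a projective cover, and the image of the even subring is everything. For x_1
   itself the Green ring is enlarged by a square root of p; J then lands in the elements b x_1 with p b = 0.

   For injectivity, modulo J every element of the even subring is an integral combination of
   x_1^2, y_1^k, z_1^k, X'_(n,eta) and their multiples by g_1. Up to projectives these are sent to pairwise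
   non-isomorphic modules with local endomorphism ring, and such modules are separated by the
   multiplicity functions, which are additive on direct sums. *)
theory Submission
  imports Defs "Jordan_Normal_Form.Jordan_Normal_Form_Existence"
begin

section \<open>Matrix calculus over arbitrary index types: products, Kronecker products, traces,
  blocks\<close>

section \<open>Finitely supported matrices\<close>

text \<open>Dimensions, ranks and inverses are handled through idempotents: the trace of a matrix
  idempotent is a natural number, and it is zero only for the zero matrix. Tensor products and
  direct sums change the index set of a module, so matrices carry arbitrary index types; indices
  become initial segments of the naturals only at the interface with representations on C^n.

  Two facts drive the relations. Free modules are coinduced, so a single coefficient functional
  yields a retraction onto a free submodule. The module y is a projective modulo its simple socle,
  so multiplication by y is the cosyzygy up to projectives; z inverts it, and the powers of y and z
  run through the two infinite families of odd-dimensional indecomposables. Commutativity comes from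
  a triangular structure on K_2, since the plain swap of tensor factors is not a homomorphism.

  Locality of endomorphism rings enters only in computing multiplicities between indecomposables;
  additivity of the multiplicities is subadditivity of rank and holds for every test module.\<close>

type_synonym ('i, 'j) fm = "('i \<times> 'j) \<Rightarrow>\<^sub>0 complex"

abbreviation ent :: "('i, 'j) fm \<Rightarrow> 'i \<Rightarrow> 'j \<Rightarrow> complex" where
  "ent A i j \<equiv> Poly_Mapping.lookup A (i, j)"

definition mk :: "'i set \<Rightarrow> 'j set \<Rightarrow> ('i \<Rightarrow> 'j \<Rightarrow> complex) \<Rightarrow> ('i, 'j) fm" where
  "mk S T f = Abs_poly_mapping (\<lambda>(i, j). if i \<in> S \<and> j \<in> T then f i j else 0)"

lemma ent_mk:
  assumes "finite S" "finite T"
  shows "ent (mk S T f) i j = (if i \<in> S \<and> j \<in> T then f i j else 0)"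
proof -
  have "{x. (case x of (i, j) \<Rightarrow> if i \<in> S \<and> j \<in> T then f i j else 0) \<noteq> 0} \<subseteq> S \<times> T"
    by (rule subsetI) (case_tac x, simp split: if_splits)
  then have "finite {x. (case x of (i, j) \<Rightarrow> if i \<in> S \<and> j \<in> T then f i j else 0) \<noteq> 0}"
    by (rule finite_subset) (simp add: assms)
  from lookup_Abs_poly_mapping[OF this] show ?thesis by (simp add: mk_def)
qed

definition rws :: "('i, 'j) fm \<Rightarrow> 'i set" where "rws A = {i. \<exists>j. ent A i j \<noteq> 0}"
definition cls :: "('i, 'j) fm \<Rightarrow> 'j set" where "cls A = {j. \<exists>i. ent A i j \<noteq> 0}"

lemma fin_rws[simp]: "finite (rws A)" and fin_cls[simp]: "finite (cls A)"
proof -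
  have "rws A \<subseteq> fst ` Poly_Mapping.keys A" "cls A \<subseteq> snd ` Poly_Mapping.keys A"
    by (force simp: rws_def cls_def in_keys_iff)+
  then show "finite (rws A)" "finite (cls A)" by (auto intro: finite_subset)
qed

lemma ent_nz: "ent A i j \<noteq> 0 \<Longrightarrow> i \<in> rws A" "ent A i j \<noteq> 0 \<Longrightarrow> j \<in> cls A"
  by (auto simp: rws_def cls_def)
lemma ent_z: "i \<notin> rws A \<Longrightarrow> ent A i j = 0" "j \<notin> cls A \<Longrightarrow> ent A i j = 0"
  by (auto simp: rws_def cls_def)

lemma fm_eqI: "(\<And>i j. ent A i j = ent B i j) \<Longrightarrow> A = B"
  by (rule poly_mapping_eqI) auto

definition mm :: "('i, 'j) fm \<Rightarrow> ('j, 'k) fm \<Rightarrow> ('i, 'k) fm" (infixl "\<diamondop>" 70) where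
  "A \<diamondop> B = mk (rws A) (cls B) (\<lambda>i k. \<Sum>j\<in>cls A. ent A i j * ent B j k)"

text \<open>The summation range in \<open>mm\<close> is an artefact of its definition. Any finite
  set that contains the nonzero terms gives the same sum, so later proofs pick the range that suits
  them.\<close>

lemma ent_mm: assumes "finite S" "\<And>j. ent A i j * ent B j k \<noteq> 0 \<Longrightarrow> j \<in> S"
  shows "ent (A \<diamondop> B) i k = (\<Sum>j\<in>S. ent A i j * ent B j k)"
proof -
  have 1: "ent (A \<diamondop> B) i k = (\<Sum>j\<in>cls A. ent A i j * ent B j k)"
  proof (cases "i \<in> rws A \<and> k \<in> cls B")
    case False
    then have "ent A i j * ent B j k = 0" for j using ent_nz by (metis mult_eq_0_iff)
    then have "(\<Sum>j\<in>cls A. ent A i j * ent B j k) = 0" by (simp only: sum.neutral_const)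
    then show ?thesis using False by (auto simp: mm_def ent_mk)
  qed (simp add: mm_def ent_mk)
  also have "\<dots> = (\<Sum>j\<in>cls A \<union> S. ent A i j * ent B j k)"
    by (intro sum.mono_neutral_left) (auto simp: assms ent_z)
  also have "\<dots> = (\<Sum>j\<in>S. ent A i j * ent B j k)"
    by (intro sum.mono_neutral_right) (use assms in auto)
  finally show ?thesis .
qed

lemma ent_mm_l: "finite S \<Longrightarrow> cls A \<subseteq> S \<Longrightarrow> ent (A \<diamondop> B) i k = (\<Sum>j\<in>S. ent A i j * ent B j k)"
  by (rule ent_mm) (auto dest!: ent_nz(2))
lemma ent_mm_r: "finite S \<Longrightarrow> rws B \<subseteq> S \<Longrightarrow> ent (A \<diamondop> B) i k = (\<Sum>j\<in>S. ent A i j * ent B j k)"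
  by (rule ent_mm) (auto dest!: ent_nz(1))

lemma cls_mm: "cls (A \<diamondop> B) \<subseteq> cls B" and rws_mm: "rws (A \<diamondop> B) \<subseteq> rws A"
  by (auto simp: mm_def cls_def[of "mk _ _ _"] rws_def[of "mk _ _ _"] ent_mk split: if_splits)

lemma mm_assoc: "(A \<diamondop> B) \<diamondop> C = A \<diamondop> (B \<diamondop> C)"
proof (rule fm_eqI)
  fix i l
  have "ent ((A \<diamondop> B) \<diamondop> C) i l = (\<Sum>k\<in>cls B. \<Sum>j\<in>cls A. ent A i j * ent B j k * ent C k l)"
    by (subst ent_mm_l[of "cls B"]) (auto intro!: sum.cong simp: cls_mm[THEN subsetD] ent_mm_l[of "cls A"] sum_distrib_right)
  also have "\<dots> = (\<Sum>j\<in>cls A. \<Sum>k\<in>cls B. ent A i j * (ent B j k * ent C k l))"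
    by (subst sum.swap) (simp add: mult.assoc)
  also have "\<dots> = ent (A \<diamondop> (B \<diamondop> C)) i l"
    by (subst ent_mm_l[of "cls A"]) (auto simp: ent_mm_l[of "cls B"] sum_distrib_left)
  finally show "ent ((A \<diamondop> B) \<diamondop> C) i l = ent (A \<diamondop> (B \<diamondop> C)) i l" .
qed

lemma mm_add_l: "(A + B) \<diamondop> C = A \<diamondop> C + B \<diamondop> C" and mm_add_r: "C' \<diamondop> (A + B) = C' \<diamondop> A + C' \<diamondop> B"
  by (rule fm_eqI, simp add: ent_mm_r[of "rws C"] ent_mm_l[of "cls C'"] lookup_add algebra_simps sum.distrib)+
lemma mm_minus_l: "(- A) \<diamondop> C = - (A \<diamondop> C)" and mm_minus_r: "C' \<diamondop> (- A) = - (C' \<diamondop> A)"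
  by (rule fm_eqI, simp add: ent_mm_r[of "rws C"] ent_mm_l[of "cls C'"] sum_negf)+
lemma mm_diff_l: "(A - B) \<diamondop> C = A \<diamondop> C - B \<diamondop> C" and mm_diff_r: "C' \<diamondop> (A - B) = C' \<diamondop> A - C' \<diamondop> B"
  by (rule fm_eqI, simp add: ent_mm_r[of "rws C"] ent_mm_l[of "cls C'"] lookup_minus algebra_simps sum_subtractf)+
lemma mm_zero_l[simp]: "0 \<diamondop> C = 0" and mm_zero_r[simp]: "C' \<diamondop> 0 = 0"
  by (rule fm_eqI, simp add: ent_mm_r[of "rws C"] ent_mm_l[of "cls C'"])+
lemma mm_sum_l: "sum f I \<diamondop> C = (\<Sum>i\<in>I. f i \<diamondop> C)" and mm_sum_r: "C' \<diamondop> sum f I = (\<Sum>i\<in>I. C' \<diamondop> f i)"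
  by (induction I rule: infinite_finite_induct) (auto simp: mm_add_l mm_add_r)

definition sc :: "complex \<Rightarrow> ('a \<Rightarrow>\<^sub>0 complex) \<Rightarrow> ('a \<Rightarrow>\<^sub>0 complex)" where
  "sc c A = Abs_poly_mapping (\<lambda>x. c * Poly_Mapping.lookup A x)"

lemma ent_sc: "Poly_Mapping.lookup (sc c A) x = c * Poly_Mapping.lookup A x"
  unfolding sc_def
  by (subst lookup_Abs_poly_mapping) (auto intro: finite_subset[OF _ finite_lookup[of A]])

lemma sc_add: "sc c (A + B) = sc c A + sc c B" and sc_diff: "sc c (A - B) = sc c A - sc c B"
  and sc_minus: "sc c (- A) = - sc c A" and sc_zero[simp]: "sc c 0 = 0" and sc_0[simp]: "sc 0 A = 0"
  and sc_1[simp]: "sc 1 A = A" and sc_sc: "sc c (sc d A) = sc (c * d) A"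
  and sc_add_l: "sc (c + d) A = sc c A + sc d A" and sc_diff_l: "sc (c - d) A = sc c A - sc d A"
  and sc_minus_l: "sc (- c) A = - sc c A"
  by (rule poly_mapping_eqI, simp add: ent_sc lookup_add lookup_minus algebra_simps)+
lemma sc_sum: "sc c (sum f I) = (\<Sum>i\<in>I. sc c (f i))"
  by (induction I rule: infinite_finite_induct) (auto simp: sc_add)
lemma mm_sc_l: "sc c A \<diamondop> C = sc c (A \<diamondop> C)" and mm_sc_r: "C' \<diamondop> sc c A = sc c (C' \<diamondop> A)"
  by (rule fm_eqI, simp add: ent_mm_r[of "rws C"] ent_mm_l[of "cls C'"] ent_sc sum_distrib_left algebra_simps)+

lemmas fm_alg = mm_assoc mm_add_l mm_add_r mm_minus_l mm_minus_r mm_diff_l mm_diff_r mm_sc_l mm_sc_r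
  sc_add sc_diff sc_minus sc_sc

text \<open>\<open>fm_alg\<close> keeps products associated to the right. This turns an equation for
  a product of two factors into a rule that also fires when further factors follow.\<close>

lemma mm_asc: "A \<diamondop> B = C \<Longrightarrow> A \<diamondop> (B \<diamondop> Z) = C \<diamondop> Z"
  by (metis mm_assoc)

definition krn :: "('i, 'j) fm \<Rightarrow> ('k, 'l) fm \<Rightarrow> ('i \<times> 'k, 'j \<times> 'l) fm" (infixr "\<boxtimes>" 75) where
  "A \<boxtimes> B = mk (rws A \<times> rws B) (cls A \<times> cls B) (\<lambda>(i, k) (j, l). ent A i j * ent B k l)"

lemma ent_krn: "ent (A \<boxtimes> B) x y = ent A (fst x) (fst y) * ent B (snd x) (snd y)"
  by (cases x; cases y) (auto simp: krn_def ent_mk ent_z)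

lemma krn_mm: "(A \<boxtimes> B) \<diamondop> (C \<boxtimes> D) = (A \<diamondop> C) \<boxtimes> (B \<diamondop> D)"
proof (rule fm_eqI)
  fix x y
  have "ent ((A \<boxtimes> B) \<diamondop> (C \<boxtimes> D)) x y
      = (\<Sum>z\<in>cls A \<times> cls B. ent (A \<boxtimes> B) x z * ent (C \<boxtimes> D) z y)"
    by (rule ent_mm) (auto simp: ent_krn dest: ent_nz)
  also have "\<dots> = (\<Sum>j\<in>cls A. \<Sum>l\<in>cls B. (ent A (fst x) j * ent C j (fst y)) * (ent B (snd x) l * ent D l (snd y)))"
    by (simp add: sum.cartesian_product ent_krn case_prod_beta algebra_simps)
  also have "\<dots> = ent ((A \<diamondop> C) \<boxtimes> (B \<diamondop> D)) x y"
    by (simp add: ent_krn sum_product ent_mm_l[of "cls A"] ent_mm_l[of "cls B"])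
  finally show "ent ((A \<boxtimes> B) \<diamondop> (C \<boxtimes> D)) x y = ent ((A \<diamondop> C) \<boxtimes> (B \<diamondop> D)) x y" .
qed

lemma krn_add_l: "(A + B) \<boxtimes> C = A \<boxtimes> C + B \<boxtimes> C" and krn_add_r: "C \<boxtimes> (A + B) = C \<boxtimes> A + C \<boxtimes> B"
  and krn_diff_l: "(A - B) \<boxtimes> C = A \<boxtimes> C - B \<boxtimes> C" and krn_diff_r: "C \<boxtimes> (A - B) = C \<boxtimes> A - C \<boxtimes> B"
  and krn_minus_l: "(- A) \<boxtimes> C = - (A \<boxtimes> C)" and krn_minus_r: "C \<boxtimes> (- A) = - (C \<boxtimes> A)"
  and krn_zero_l[simp]: "0 \<boxtimes> C = 0" and krn_zero_r[simp]: "C \<boxtimes> 0 = 0"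
  and krn_sc_l: "sc c A \<boxtimes> C = sc c (A \<boxtimes> C)" and krn_sc_r: "C \<boxtimes> sc c A = sc c (C \<boxtimes> A)"
  for A B :: "('i, 'j) fm"
  by (rule fm_eqI, simp add: ent_krn lookup_add lookup_minus ent_sc algebra_simps)+

lemmas krn_alg = krn_mm krn_mm[THEN mm_asc] krn_add_l krn_add_r krn_diff_l krn_diff_r krn_minus_l krn_minus_r
  krn_sc_l krn_sc_r

definition tp :: "('i, 'j) fm \<Rightarrow> ('j, 'i) fm" where
  "tp A = mk (cls A) (rws A) (\<lambda>i j. ent A j i)"

lemma ent_tp: "ent (tp A) i j = ent A j i"
  using ent_nz[of A j i] by (auto simp: tp_def ent_mk)
lemma tp_mm: "tp (A \<diamondop> B) = tp B \<diamondop> tp A"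
proof (rule fm_eqI)
  fix i j
  have "ent (tp B \<diamondop> tp A) i j = (\<Sum>k\<in>cls A. ent (tp B) i k * ent (tp A) k j)"
    by (rule ent_mm) (auto simp: ent_tp dest: ent_nz)
  then show "ent (tp (A \<diamondop> B)) i j = ent (tp B \<diamondop> tp A) i j"
    by (simp add: ent_tp ent_mm_l[of "cls A"] mult.commute)
qed
lemma tp_tp[simp]: "tp (tp A) = A"
  and tp_add: "tp (A + B) = tp A + tp B"
  and tp_minus: "tp (- A) = - tp A" and tp_zero[simp]: "tp 0 = 0" and tp_sc: "tp (sc c A) = sc c (tp A)"
  for A B :: "('i, 'j) fm"
  by (rule fm_eqI, simp add: ent_tp lookup_add lookup_minus ent_sc)+

definition tr :: "('i, 'i) fm \<Rightarrow> complex" where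
  "tr A = (\<Sum>i\<in>rws A. ent A i i)"

lemma tr_eq: "finite S \<Longrightarrow> (\<And>i. ent A i i \<noteq> 0 \<Longrightarrow> i \<in> S) \<Longrightarrow> tr A = (\<Sum>i\<in>S. ent A i i)"
proof -
  assume S: "finite S" "\<And>i. ent A i i \<noteq> 0 \<Longrightarrow> i \<in> S"
  have "tr A = (\<Sum>i\<in>rws A \<union> S. ent A i i)" unfolding tr_def
    by (intro sum.mono_neutral_left) (auto simp: S ent_z)
  also have "\<dots> = (\<Sum>i\<in>S. ent A i i)" by (intro sum.mono_neutral_right) (use S in auto)
  finally show ?thesis .
qed

lemma tr_add: "tr (A + B) = tr A + tr B"
proof -
  have "tr C = (\<Sum>i\<in>rws A \<union> rws B. ent C i i)" if "C \<in> {A, B, A + B}" for C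
    by (rule tr_eq, simp) (use that in \<open>auto simp: lookup_add rws_def\<close>)
  then show ?thesis by (simp add: lookup_add sum.distrib)
qed
lemma tr_sc: "tr (sc c A) = c * tr A"
  by (subst tr_eq[of "rws A"]) (auto simp: ent_sc tr_def sum_distrib_left dest: ent_nz)
lemma tr_minus: "tr (- A) = - tr A"
  using tr_sc[of "-1" A] by (simp add: sc_minus_l)
lemma tr_diff: "tr (A - B) = tr A - tr B"
  using tr_add[of A "- B"] by (simp add: tr_minus)
lemma tr_zero[simp]: "tr 0 = 0" by (simp add: tr_def)
lemma tr_sum: "tr (sum f I) = (\<Sum>i\<in>I. tr (f i))"
  by (induction I rule: infinite_finite_induct) (auto simp: tr_add)
lemma tr_comm: "tr (A \<diamondop> B) = tr (B \<diamondop> A)"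
proof -
  have 1: "tr (A \<diamondop> B) = (\<Sum>i\<in>rws A. ent (A \<diamondop> B) i i)"
    by (rule tr_eq, simp) (use ent_nz(1)[of "A \<diamondop> B"] rws_mm[of A B] in blast)
  have 2: "tr (B \<diamondop> A) = (\<Sum>i\<in>cls A. ent (B \<diamondop> A) i i)"
    by (rule tr_eq, simp) (use ent_nz(2)[of "B \<diamondop> A"] cls_mm[of B A] in blast)
  have "tr (A \<diamondop> B) = (\<Sum>i\<in>rws A. \<Sum>j\<in>cls A. ent A i j * ent B j i)"
    unfolding 1 by (simp add: ent_mm_l[of "cls A"])
  also have "\<dots> = (\<Sum>j\<in>cls A. \<Sum>i\<in>rws A. ent B j i * ent A i j)"
    by (subst sum.swap) (simp add: mult.commute)
  also have "\<dots> = tr (B \<diamondop> A)"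
    unfolding 2 by (simp add: ent_mm_r[of "rws A"])
  finally show ?thesis .
qed
lemma tr_krn: "tr (A \<boxtimes> B) = tr A * tr B"
  by (subst tr_eq[of "rws A \<times> rws B"])
     (auto simp: ent_krn tr_def sum_product sum.cartesian_product case_prod_beta dest: ent_nz)

definition un :: "'i \<Rightarrow> 'j \<Rightarrow> ('i, 'j) fm" where "un i j = Poly_Mapping.single (i, j) 1"

lemma ent_un: "ent (un i j) a b = (if a = i \<and> b = j then 1 else 0)"
  by (auto simp: un_def lookup_single when_def)
lemma un_mm: "un i j \<diamondop> un k l = (if j = k then un i l else 0)"
  by (rule fm_eqI) (subst ent_mm_l[of "{j}"], auto simp: ent_un cls_def)
lemma tr_un: "tr (un i j) = (if i = j then 1 else 0)"
  by (subst tr_eq[of "{i}"]) (auto simp: ent_un split: if_splits)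
lemma tp_un: "tp (un i j) = un j i"
  by (rule fm_eqI) (auto simp: ent_un ent_tp)
lemma un_nz[simp]: "un i j \<noteq> 0"
  using ent_un[of i j i j] by (metis lookup_zero zero_neq_one)
lemma ent_mm_un: "ent (A \<diamondop> un j k) i l = (if l = k then ent A i j else 0)"
  by (subst ent_mm_r[of "{j}"]) (auto simp: ent_un rws_def)
lemma ent_un_mm: "ent (un i j \<diamondop> A) k l = (if k = i then ent A j l else 0)"
  by (subst ent_mm_l[of "{j}"]) (auto simp: ent_un cls_def)

definition dg :: "'i set \<Rightarrow> ('i, 'i) fm" where "dg S = mk S S (\<lambda>i j. if i = j then 1 else 0)"

lemma ent_dg: "finite S \<Longrightarrow> ent (dg S) i j = (if i = j \<and> i \<in> S then 1 else 0)"
  by (auto simp: dg_def ent_mk)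
lemma ent_dg_mm: "finite S \<Longrightarrow> ent (dg S \<diamondop> A) i j = (if i \<in> S then ent A i j else 0)"
  by (subst ent_mm[of "{i}"]) (auto simp: ent_dg split: if_splits)
lemma ent_mm_dg: "finite S \<Longrightarrow> ent (A \<diamondop> dg S) i j = (if j \<in> S then ent A i j else 0)"
  by (subst ent_mm[of "{j}"]) (auto simp: ent_dg split: if_splits)
lemma dg_mm: "finite S \<Longrightarrow> finite T \<Longrightarrow> dg S \<diamondop> dg T = dg (S \<inter> T)"
  by (rule fm_eqI) (auto simp: ent_dg_mm ent_dg)
lemma dg_l: "finite S \<Longrightarrow> dg S \<diamondop> A = A \<longleftrightarrow> (\<forall>i j. ent A i j \<noteq> 0 \<longrightarrow> i \<in> S)"
  by (metis ent_dg_mm fm_eqI)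
lemma dg_r: "finite S \<Longrightarrow> A \<diamondop> dg S = A \<longleftrightarrow> (\<forall>i j. ent A i j \<noteq> 0 \<longrightarrow> j \<in> S)"
  by (metis ent_mm_dg fm_eqI)
lemma dg_ex: "\<exists>S. finite S \<and> dg S \<diamondop> A = A" "\<exists>S. finite S \<and> A \<diamondop> dg S = A"
  by (auto intro!: exI[of _ "rws A"] exI[of _ "cls A"] simp: dg_l dg_r dest: ent_nz)
lemma tr_dg: "finite S \<Longrightarrow> tr (dg S) = of_nat (card S)"
proof -
  assume S: "finite S"
  have "tr (dg S) = (\<Sum>i\<in>S. ent (dg S) i i)"
    by (rule tr_eq[OF S]) (simp add: ent_dg[OF S] split: if_split_asm)
  then show ?thesis by (simp add: ent_dg[OF S])
qed
lemma tp_dg: "finite S \<Longrightarrow> tp (dg S) = dg S"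
  by (rule fm_eqI) (auto simp: ent_tp ent_dg)
lemma dg_krn: "finite S \<Longrightarrow> finite T \<Longrightarrow> dg S \<boxtimes> dg T = dg (S \<times> T)"
  by (rule fm_eqI) (auto simp: ent_krn ent_dg prod_eq_iff)

abbreviation idn :: "nat \<Rightarrow> (nat, nat) fm" where "idn n \<equiv> dg {..<n}"

text \<open>For a direct sum indexed by the first component, \<open>lc b A\<close> is
  \<open>A\<close> followed by the inclusion of summand \<open>b\<close>, and \<open>rc b A\<close>
  is the projection onto summand \<open>b\<close> followed by \<open>A\<close>.\<close>

definition lc :: "'b \<Rightarrow> ('i, 'j) fm \<Rightarrow> ('b \<times> 'i, 'j) fm" where
  "lc b A = mk ({b} \<times> rws A) (cls A) (\<lambda>x j. ent A (snd x) j)"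
definition rc :: "'b \<Rightarrow> ('i, 'j) fm \<Rightarrow> ('i, 'b \<times> 'j) fm" where
  "rc b A = mk (rws A) ({b} \<times> cls A) (\<lambda>i y. ent A i (snd y))"

lemma ent_lc: "ent (lc b A) x j = (if fst x = b then ent A (snd x) j else 0)"
  by (cases x) (auto simp: lc_def ent_mk ent_z)
lemma ent_rc: "ent (rc b A) i y = (if fst y = b then ent A i (snd y) else 0)"
  by (cases y) (auto simp: rc_def ent_mk ent_z)

lemma lc_mm: "lc b A \<diamondop> C = lc b (A \<diamondop> C)" and mm_rc: "C' \<diamondop> rc b A = rc b (C' \<diamondop> A)"
  by (rule fm_eqI, simp add: ent_mm_r[of "rws C"] ent_mm_l[of "cls C'"] ent_lc ent_rc)+
lemma sum_fst_eq: "finite S \<Longrightarrow> (\<Sum>x\<in>{b} \<times> S. f (snd x)) = (\<Sum>j\<in>S. f j)"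
  by (rule sum.reindex_bij_witness[of _ "\<lambda>j. (b, j)" snd]) auto
lemma rc_lc: "rc b A \<diamondop> lc c B = (if b = c then A \<diamondop> B else 0)"
proof (rule fm_eqI)
  fix i k
  have "ent (rc b A \<diamondop> lc c B) i k = (\<Sum>x\<in>{b} \<times> cls A. ent (rc b A) i x * ent (lc c B) x k)"
    by (rule ent_mm) (auto simp: ent_rc ent_lc split: if_splits dest: ent_nz)
  also have "\<dots> = (\<Sum>x\<in>{b} \<times> cls A. if b = c then ent A i (snd x) * ent B (snd x) k else 0)"
    by (rule sum.cong) (auto simp: ent_rc ent_lc)
  also have "\<dots> = ent (if b = c then A \<diamondop> B else 0) i k"
    using sum_fst_eq[of "cls A" "\<lambda>j. ent A i j * ent B j k" c] by (auto simp: ent_mm_l[of "cls A"])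
  finally show "ent (rc b A \<diamondop> lc c B) i k = ent (if b = c then A \<diamondop> B else 0) i k" .
qed
lemma lc_rc: "lc b (rc c A) = un b c \<boxtimes> A"
  by (rule fm_eqI) (auto simp: ent_lc ent_rc ent_krn ent_un)
lemma rc_lc': "rc c (lc b A) = un b c \<boxtimes> A"
  by (rule fm_eqI) (auto simp: ent_lc ent_rc ent_krn ent_un)
lemma krn_lc: "(un b c \<boxtimes> A) \<diamondop> lc d B = (if c = d then lc b (A \<diamondop> B) else 0)"
proof -
  have "(un b c \<boxtimes> A) \<diamondop> lc d B = lc b (rc c A \<diamondop> lc d B)" by (simp add: lc_rc[symmetric] lc_mm)
  then show ?thesis by (auto simp: rc_lc fm_eqI ent_lc)
qed
lemma rc_krn: "rc d B \<diamondop> (un b c \<boxtimes> A) = (if d = b then rc c (B \<diamondop> A) else 0)"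
proof -
  have "rc d B \<diamondop> (un b c \<boxtimes> A) = rc c (rc d B \<diamondop> lc b A)" by (simp add: rc_lc'[symmetric] mm_rc)
  then show ?thesis by (auto simp: rc_lc fm_eqI ent_rc)
qed
lemma lc_add: "lc b (A + B) = lc b A + lc b B" and lc_diff: "lc b (A - B) = lc b A - lc b B"
  and lc_minus: "lc b (- A) = - lc b A" and lc_zero[simp]: "lc b 0 = 0" and lc_sc: "lc b (sc c A) = sc c (lc b A)"
  and rc_add: "rc b (A + B) = rc b A + rc b B" and rc_diff: "rc b (A - B) = rc b A - rc b B"
  and rc_minus: "rc b (- A) = - rc b A" and rc_zero[simp]: "rc b 0 = 0" and rc_sc: "rc b (sc c A) = sc c (rc b A)"
  for A B :: "('i, 'j) fm"
  by (rule fm_eqI, simp add: ent_lc ent_rc lookup_add lookup_minus ent_sc)+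

lemmas blk = lc_mm mm_rc rc_lc rc_lc[THEN mm_asc] lc_rc rc_lc' krn_lc krn_lc[THEN mm_asc] rc_krn rc_krn[THEN mm_asc]
  lc_add lc_diff lc_minus lc_sc rc_add rc_diff rc_minus rc_sc un_mm un_mm[THEN mm_asc]

section \<open>Linear algebra without bases: rank, splitting of idempotents, solvability of linear
  systems\<close>

section \<open>Ranks and idempotents\<close>

lemma dg_empty[simp]: "dg {} = 0"
  by (rule fm_eqI) (simp add: ent_dg)
lemma idn_Suc: "idn (Suc n) = idn n + un n n"
  by (rule fm_eqI) (auto simp: ent_dg lookup_add ent_un)
lemma idn_idn: "idn m \<diamondop> idn n = idn (min m n)"
  by (rule fm_eqI) (auto simp: ent_dg_mm ent_dg)
lemma idn_un: "idn n \<diamondop> un i j = (if i < n then un i j else 0)"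
  and un_idn: "un i' j' \<diamondop> idn n = (if j' < n then un i' j' else 0)"
  by (rule fm_eqI, auto simp: ent_dg_mm ent_mm_dg ent_un)+
lemma dg_insert: "finite S \<Longrightarrow> x \<notin> S \<Longrightarrow> dg (insert x S) = dg S + un x x"
  by (rule fm_eqI) (auto simp: ent_dg lookup_add ent_un)
lemma fm_cols_eqI: "(\<And>j. A \<diamondop> un j () = B \<diamondop> un j ()) \<Longrightarrow> A = B"
  by (rule fm_eqI) (metis ent_mm_un)

lemma row_functional:
  fixes c :: "('i, unit) fm"
  assumes "c \<noteq> 0"
  obtains h :: "(unit, 'i) fm" where "h \<diamondop> c = un () ()"
proof -
  obtain k where k: "ent c k () \<noteq> 0" using assms fm_eqI[of c 0] by auto
  have "sc (1 / ent c k ()) (un () k) \<diamondop> c = un () ()"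
    by (rule fm_eqI) (use k in \<open>auto simp: mm_sc_l ent_sc ent_un_mm ent_un\<close>)
  then show ?thesis by (rule that)
qed

text \<open>Induction on the columns: a new column either lies in the column space of
  \<open>i\<close>, and then only \<open>r\<close> changes, or its component outside that space
  raises the rank by one. The one-sided inverses \<open>l\<close> and \<open>s\<close> are carried
  along because they later replace every choice of a basis.\<close>

theorem rank_factorization:
  fixes A :: "('i, 'j) fm"
  shows "\<exists>n (i :: ('i, nat) fm) (r :: (nat, 'j) fm) (l :: (nat, 'i) fm) (s :: ('j, nat) fm).
    A = i \<diamondop> r \<and> i \<diamondop> idn n = i \<and> idn n \<diamondop> r = r \<and> idn n \<diamondop> l = l \<and> s \<diamondop> idn n = s \<and>
    l \<diamondop> i = idn n \<and> r \<diamondop> s = idn n" (is "?P A")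
proof -
  obtain S where S: "finite S" "A \<diamondop> dg S = A" using dg_ex(2) by blast
  have "\<forall>A. A \<diamondop> dg S = A \<longrightarrow> ?P A" using S(1)
  proof (induction S)
    case empty
    show ?case by (auto intro!: exI[of _ 0])
  next
    case (insert x S)
    show ?case
    proof (intro allI impI)
      fix A :: "('i, 'j) fm"
      assume A: "A \<diamondop> dg (insert x S) = A"
      define c where "c = A \<diamondop> un x ()"
      define f :: "(unit, 'j) fm" where "f = un () x"
      have Ac: "A = A \<diamondop> dg S + c \<diamondop> f"
        using A by (simp add: dg_insert insert c_def f_def mm_add_r mm_assoc un_mm)
      have fS: "f \<diamondop> dg S = 0" "dg S \<diamondop> un x () = 0" "f \<diamondop> un x () = un () ()" "dg S \<diamondop> un x (m :: nat) = 0"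
        "f \<diamondop> un x m = un () m" for m
        using insert by (auto simp: f_def un_mm intro!: fm_eqI simp: ent_mm_dg ent_dg_mm ent_un)
      have u1: "un () () \<diamondop> B = B" for B :: "(unit, 'b) fm"
        by (rule fm_eqI) (simp add: ent_un_mm)
      have "(A \<diamondop> dg S) \<diamondop> dg S = A \<diamondop> dg S" using insert by (simp add: mm_assoc dg_mm)
      with insert.IH obtain n i r l s where IH: "A \<diamondop> dg S = i \<diamondop> r"
        "i \<diamondop> idn n = i" "idn n \<diamondop> r = r" "idn n \<diamondop> l = l" "s \<diamondop> idn n = s" "l \<diamondop> i = idn n" "r \<diamondop> s = idn n"
        by blast
      note IHa = IH IH(2-)[THEN mm_asc]
      have "l \<diamondop> (i \<diamondop> r) = l \<diamondop> (i \<diamondop> r) \<diamondop> dg S"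
        using insert by (simp add: IH(1)[symmetric] mm_assoc dg_mm)
      then have rS: "r \<diamondop> dg S = r" by (simp add: fm_alg IHa)
      \<comment> \<open>Cutting \<open>s\<close> to the old columns makes it blind to the new one,
        \<open>f \<diamondop> s1 = 0\<close>, while it stays a section of \<open>r\<close>.\<close>
      define s1 where "s1 = dg S \<diamondop> s"
      have s1: "r \<diamondop> s1 = idn n" "s1 \<diamondop> idn n = s1" "f \<diamondop> s1 = 0" "r \<diamondop> un x () = 0" "r \<diamondop> un x (m :: nat) = 0" for m
        using rS[THEN mm_asc, of s] rS[THEN mm_asc, of "un x ()"] rS[THEN mm_asc, of "un x m"]
        by (simp_all add: s1_def mm_assoc IH fS fS[THEN mm_asc])
      \<comment> \<open>\<open>i \<diamondop> l\<close> projects onto the column space of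
        \<open>i\<close>, so the case distinction asks whether the new column depends on the old
        ones.\<close>
      show "?P A"
      proof (cases "c = i \<diamondop> (l \<diamondop> c)")
        case True
        have "A = i \<diamondop> (r + l \<diamondop> c \<diamondop> f)"
          using arg_cong[OF True, of "\<lambda>c. c \<diamondop> f"] by (subst Ac) (simp add: mm_add_r mm_assoc IH(1))
        then show ?thesis
          by (intro exI[of _ n] exI[of _ i] exI[of _ "r + l \<diamondop> c \<diamondop> f"] exI[of _ l] exI[of _ s1])
             (simp add: fm_alg IHa s1)
      next
        case False
        define c' where "c' = c - i \<diamondop> (l \<diamondop> c)"
        have "c' \<noteq> 0" using False by (simp add: c'_def)
        then obtain h where h: "h \<diamondop> c' = un () ()" by (rule row_functional)
        \<comment> \<open>The correction makes the functional vanish on the old column space and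
          keeps its value one on \<open>c'\<close>.\<close>
        define h' where "h' = h - h \<diamondop> (i \<diamondop> l)"
        have h'i: "h' \<diamondop> i = 0" by (simp add: h'_def fm_alg IHa)
        have "h' \<diamondop> c = un () ()" using h by (simp add: h'_def c'_def fm_alg)
        then have h'c: "h' \<diamondop> c' = un () ()" using mm_asc[OF h'i] by (simp add: c'_def fm_alg)
        have lc: "l \<diamondop> c' = 0" by (simp add: c'_def fm_alg IHa)
        have iu: "i \<diamondop> un n () = 0" "i \<diamondop> un n (m :: nat) = 0" for m
          using IH(2)[THEN mm_asc, of "un n ()"] IH(2)[THEN mm_asc, of "un n m"] by (simp_all add: idn_un)
        have ur: "un () n \<diamondop> r = 0" "un () n \<diamondop> l = 0" "un (m :: nat) n \<diamondop> l = 0" "un m n \<diamondop> r = 0" for m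
          using un_idn[THEN mm_asc, of m n n r] un_idn[THEN mm_asc, of m n n l] un_idn[THEN mm_asc, of "()" n n r] un_idn[THEN mm_asc, of "()" n n l] IH(3,4) by simp_all
        note E = IHa s1 s1[THEN mm_asc] h'i h'i[THEN mm_asc] h'c h'c[THEN mm_asc] lc lc[THEN mm_asc] iu iu[THEN mm_asc]
          ur ur[THEN mm_asc] fS fS[THEN mm_asc] u1 un_mm un_mm[THEN mm_asc] idn_Suc idn_un un_idn
          un_idn[THEN mm_asc] idn_un[THEN mm_asc]
        have iS: "s1 \<diamondop> un n () = 0" "s1 \<diamondop> un n (m :: nat) = 0" for m
          using s1(2)[THEN mm_asc, of "un n ()"] s1(2)[THEN mm_asc, of "un n m"] by (simp_all add: idn_un)
        have "A = (i + c' \<diamondop> un () n) \<diamondop> (r + l \<diamondop> c \<diamondop> f + un n () \<diamondop> f)"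
          by (subst Ac) (simp add: fm_alg E, simp add: c'_def fm_alg)
        then show ?thesis
          by (intro exI[of _ "Suc n"] exI[of _ "i + c' \<diamondop> un () n"] exI[of _ "r + l \<diamondop> c \<diamondop> f + un n () \<diamondop> f"]
                exI[of _ "l + un n () \<diamondop> h'"] exI[of _ "s1 + (un x () - s1 \<diamondop> l \<diamondop> c) \<diamondop> un () n"])
             (simp add: fm_alg E iS iS[THEN mm_asc])
      qed
    qed
  qed
  then show ?thesis using S(2) by blast
qed

lemma pseudo_inverse: "\<exists>G. A \<diamondop> (G \<diamondop> A) = A"
proof -
  obtain n i r l s where h: "A = i \<diamondop> r" "i \<diamondop> idn n = i" "idn n \<diamondop> r = r" "idn n \<diamondop> l = l"
    "s \<diamondop> idn n = s" "l \<diamondop> i = idn n" "r \<diamondop> s = idn n"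
    using rank_factorization[of A] by blast
  have "A \<diamondop> (s \<diamondop> l \<diamondop> A) = A" by (simp add: h(1) fm_alg h(2-) h(2-)[THEN mm_asc])
  then show ?thesis by blast
qed

text \<open>Cancelling the one-sided inverses in \<open>e \<diamondop> e = e\<close> leaves
  \<open>r \<diamondop> i = idn n\<close>.\<close>

lemma idem_factor:
  fixes e :: "('i, 'i) fm"
  assumes "e \<diamondop> e = e"
  obtains n and i :: "('i, nat) fm" and r where "e = i \<diamondop> r" "r \<diamondop> i = idn n" "i \<diamondop> idn n = i" "idn n \<diamondop> r = r"
    "e \<diamondop> i = i" "r \<diamondop> e = r"
proof -
  obtain n i r l s where h: "e = i \<diamondop> r" "i \<diamondop> idn n = i" "idn n \<diamondop> r = r" "idn n \<diamondop> l = l"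
    "s \<diamondop> idn n = s" "l \<diamondop> i = idn n" "r \<diamondop> s = idn n"
    using rank_factorization[of e] by blast
  have "l \<diamondop> (i \<diamondop> r \<diamondop> (i \<diamondop> r)) \<diamondop> s = l \<diamondop> (i \<diamondop> r) \<diamondop> s" using assms h(1) by simp
  then have ri: "r \<diamondop> i = idn n" by (simp add: fm_alg h(2-) h(2-)[THEN mm_asc])
  show ?thesis
    by (rule that[OF h(1) ri h(2,3)]) (simp_all add: h(1) fm_alg ri ri[THEN mm_asc] h(2,3))
qed

text \<open>This is the source of all dimension counts: the trace of \<open>i \<diamondop> r\<close>
  is that of \<open>r \<diamondop> i = idn n\<close>, and in characteristic zero it determines
  \<open>n\<close>.\<close>

lemma tr_idem: assumes "e \<diamondop> e = e" obtains n where "tr e = of_nat n" "n = 0 \<longleftrightarrow> e = 0"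
proof -
  obtain n i r where h: "e = i \<diamondop> r" "r \<diamondop> i = idn n" "i \<diamondop> idn n = i" by (rule idem_factor[OF assms])
  have "tr e = of_nat n" by (simp add: h(1) tr_comm[of i r] h(2) tr_dg)
  moreover have "n = 0 \<longleftrightarrow> e = 0"
  proof
    assume "n = 0" then have "i = 0" using h(3) by simp
    then show "e = 0" by (simp add: h(1))
  next
    assume "e = 0" then have "of_nat n = (0 :: complex)" using \<open>tr e = of_nat n\<close> by simp
    then show "n = 0" by simp
  qed
  ultimately show ?thesis by (rule that)
qed

text \<open>\<open>E' - p \<diamondop> q\<close> is an idempotent of trace zero.\<close>

lemma one_sided_inverse:
  assumes "q \<diamondop> p = E" "E' \<diamondop> E' = E'" "p \<diamondop> E = p" "E' \<diamondop> p = p" "q \<diamondop> E' = q" "tr E = tr E'"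
  shows "p \<diamondop> q = E'"
proof -
  have a: "p \<diamondop> (q \<diamondop> p) = p" using assms by simp
  have "(E' - p \<diamondop> q) \<diamondop> (E' - p \<diamondop> q) = E' - p \<diamondop> q"
    by (simp add: fm_alg assms(2,4,5) assms(2,4)[THEN mm_asc]) (use mm_asc[OF a, of q] in \<open>simp add: mm_assoc\<close>)
  moreover have "tr (E' - p \<diamondop> q) = 0" using assms by (simp add: tr_diff tr_comm[of p q])
  ultimately have "E' - p \<diamondop> q = 0" by (metis tr_idem of_nat_eq_0_iff)
  then show ?thesis by simp
qed

text \<open>For a pseudo-inverse \<open>G\<close> of \<open>T\<close>, each column of
  \<open>e - e \<diamondop> G \<diamondop> T\<close> is fixed by \<open>e\<close> and killed by
  \<open>T\<close>, so injectivity makes it zero.\<close>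

lemma left_inverse_ex:
  assumes "T \<diamondop> e = T" "e \<diamondop> e = e"
    and "\<And>x :: ('j, unit) fm. e \<diamondop> x = x \<Longrightarrow> T \<diamondop> x = 0 \<Longrightarrow> x = 0"
  shows "\<exists>G. G \<diamondop> T = e \<and> e \<diamondop> G = G"
proof -
  obtain G where G: "T \<diamondop> (G \<diamondop> T) = T" using pseudo_inverse by blast
  have "(e - e \<diamondop> G \<diamondop> T) \<diamondop> un j () = 0 \<diamondop> un j ()" for j
  proof -
    have "T \<diamondop> ((e - e \<diamondop> G \<diamondop> T) \<diamondop> un j ()) = (T - T \<diamondop> (G \<diamondop> T)) \<diamondop> un j ()"
      by (simp add: fm_alg assms(1) assms(1)[THEN mm_asc])
    then show ?thesis using assms(3)[of "(e - e \<diamondop> G \<diamondop> T) \<diamondop> un j ()"] G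
      by (simp add: fm_alg assms(2) assms(2)[THEN mm_asc])
  qed
  then have "e - e \<diamondop> G \<diamondop> T = 0" by (rule fm_cols_eqI)
  then show ?thesis using assms(2)[THEN mm_asc] by (intro exI[of _ "e \<diamondop> G"]) (auto simp: fm_alg)
qed

text \<open>For a pseudo-inverse \<open>G\<close> of \<open>Q\<close>, the columns of
  \<open>dg (S \<union> T) - G \<diamondop> Q\<close> lie in the kernel of \<open>Q\<close>, hence
  in that of \<open>b\<close>; so \<open>b \<diamondop> G\<close> is the factor.\<close>

lemma fredholm:
  fixes Q :: "('i, 'j) fm" and b :: "('u, 'j) fm"
  assumes "\<And>v :: ('j, unit) fm. Q \<diamondop> v = 0 \<Longrightarrow> b \<diamondop> v = 0"
  shows "\<exists>g. g \<diamondop> Q = b"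
proof -
  obtain G where G: "Q \<diamondop> (G \<diamondop> Q) = Q" using pseudo_inverse by blast
  obtain S T where S: "finite S" "Q \<diamondop> dg S = Q" "finite T" "b \<diamondop> dg T = b" using dg_ex(2) by metis
  have U: "Q \<diamondop> dg (S \<union> T) = Q" "b \<diamondop> dg (S \<union> T) = b" using S by (auto simp: dg_r)
  have "b \<diamondop> (dg (S \<union> T) - G \<diamondop> Q) \<diamondop> un j () = 0 \<diamondop> un j ()" for j
  proof -
    have "Q \<diamondop> ((dg (S \<union> T) - G \<diamondop> Q) \<diamondop> un j ()) = (Q - Q \<diamondop> (G \<diamondop> Q)) \<diamondop> un j ()"
      by (simp add: fm_alg U U[THEN mm_asc])
    then show ?thesis using assms[of "(dg (S \<union> T) - G \<diamondop> Q) \<diamondop> un j ()"] G by (simp add: mm_assoc)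
  qed
  then have "b \<diamondop> (dg (S \<union> T) - G \<diamondop> Q) = 0" by (rule fm_cols_eqI)
  then show ?thesis using U by (auto simp: fm_alg intro!: exI[of _ "b \<diamondop> G"])
qed

text \<open>Pushing indices forward along an injection changes the index type of a module but not
  the module. The associativity and unit isomorphisms of the tensor product are of this
  kind.\<close>

definition lrl :: "('i \<Rightarrow> 'k) \<Rightarrow> ('i, 'j) fm \<Rightarrow> ('k, 'j) fm" where
  "lrl h A = mk (h ` rws A) (cls A) (\<lambda>k j. ent A (inv_into UNIV h k) j)"
definition rrl :: "('j \<Rightarrow> 'k) \<Rightarrow> ('i, 'j) fm \<Rightarrow> ('i, 'k) fm" where
  "rrl h A = tp (lrl h (tp A))"

lemma ent_lrl: "inj h \<Longrightarrow> ent (lrl h A) (h i) j = ent A i j" "k \<notin> range h \<Longrightarrow> ent (lrl h A) k j = 0"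
  by (auto simp: lrl_def ent_mk ent_z inj_image_mem_iff)
lemma ent_rrl: "inj h \<Longrightarrow> ent (rrl h A) i (h j) = ent A i j" "k \<notin> range h \<Longrightarrow> ent (rrl h A) i k = 0"
  by (simp_all add: rrl_def ent_tp ent_lrl)
lemma lrl_eqI:
  assumes "inj h" "\<And>i j. ent B (h i) j = ent A i j" "\<And>k j. k \<notin> range h \<Longrightarrow> ent B k j = 0"
  shows "lrl h A = B"
proof (rule fm_eqI)
  fix k j show "ent (lrl h A) k j = ent B k j" by (cases "k \<in> range h") (auto simp: ent_lrl assms)
qed
lemma lrl_mm: assumes "inj h" shows "lrl h A \<diamondop> B = lrl h (A \<diamondop> B)"
  by (rule sym, rule lrl_eqI[OF assms]) (simp_all add: ent_mm_r[of "rws B"] ent_lrl assms)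
lemma mm_rrl: "inj h \<Longrightarrow> A \<diamondop> rrl h B = rrl h (A \<diamondop> B)"
proof -
  assume "inj h"
  then have "tp (A \<diamondop> rrl h B) = tp (rrl h (A \<diamondop> B))" by (simp add: rrl_def tp_mm lrl_mm)
  then show ?thesis by (metis tp_tp)
qed
lemma rrl_lrl: assumes "inj h" shows "rrl h A \<diamondop> lrl h B = A \<diamondop> B"
proof (rule fm_eqI)
  fix i k
  have "ent (rrl h A \<diamondop> lrl h B) i k = (\<Sum>x\<in>h ` cls A. ent (rrl h A) i x * ent (lrl h B) x k)"
  proof (rule ent_mm)
    fix j assume "ent (rrl h A) i j * ent (lrl h B) j k \<noteq> 0"
    then show "j \<in> h ` cls A" by (cases "j \<in> range h") (auto simp: ent_rrl assms intro!: imageI intro: ent_nz)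
  qed simp
  also have "\<dots> = (\<Sum>j\<in>cls A. ent A i j * ent B j k)"
    by (subst sum.reindex) (auto simp: ent_rrl ent_lrl assms intro: inj_on_subset[OF assms])
  finally show "ent (rrl h A \<diamondop> lrl h B) i k = ent (A \<diamondop> B) i k" by (simp add: ent_mm_l[of "cls A"])
qed
lemma lrl_lin: fixes h :: "'i \<Rightarrow> 'k" and A B :: "('i, 'j) fm" and A' B' :: "('l, 'i) fm" assumes "inj h"
  shows "lrl h (A + B) = lrl h A + lrl h B" "lrl h (- A) = - lrl h A" "lrl h 0 = 0"
    "rrl h (A' + B') = rrl h A' + rrl h B'" "rrl h (- A') = - rrl h A'" "rrl h 0 = 0"
proof -
  show *: "lrl h (A + B) = lrl h A + lrl h B" "lrl h (- A) = - lrl h A" "lrl h 0 = 0" for A B :: "('i, 'x) fm"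
    by (rule lrl_eqI[OF assms]; simp add: lookup_add ent_lrl assms)+
  show "rrl h (A' + B') = rrl h A' + rrl h B'" "rrl h (- A') = - rrl h A'" "rrl h 0 = 0"
    by (simp_all add: rrl_def * tp_add tp_minus)
qed

abbreviation rl :: "('i \<Rightarrow> 'k) \<Rightarrow> ('i, 'i) fm \<Rightarrow> ('k, 'k) fm" where "rl h A \<equiv> lrl h (rrl h A)"

lemma rl_eqI:
  assumes "inj h" "\<And>i j. ent B (h i) (h j) = ent A i j" "\<And>k j. k \<notin> range h \<Longrightarrow> ent B k j = 0"
    "\<And>k j. k \<notin> range h \<Longrightarrow> ent B j k = 0"
  shows "rl h A = B"
proof (rule fm_eqI)
  fix k l show "ent (rl h A) k l = ent B k l"
    by (cases "k \<in> range h"; cases "l \<in> range h") (auto simp: ent_lrl ent_rrl assms)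
qed

section \<open>The category of modules: homomorphisms, tensor products, direct sums\<close>

section \<open>Modules as quadruples of matrices\<close>

text \<open>The first component is an arbitrary idempotent matrix, the identity of the module; thus a direct
  summand of a module is cut out by a smaller idempotent over the same index type.\<close>

datatype 'i kmod = KM (mE: "('i, 'i) fm") (mK: "('i, 'i) fm") (mA: "('i, 'i) fm") (mB: "('i, 'i) fm")

definition vmod :: "'i kmod \<Rightarrow> bool" where
  "vmod M \<longleftrightarrow> mE M \<diamondop> mE M = mE M \<and> mE M \<diamondop> mK M = mK M \<and> mK M \<diamondop> mE M = mK M \<and>
    mE M \<diamondop> mA M = mA M \<and> mA M \<diamondop> mE M = mA M \<and> mE M \<diamondop> mB M = mB M \<and> mB M \<diamondop> mE M = mB M \<and>
    mK M \<diamondop> mK M = mE M \<and> mK M \<diamondop> mA M = - (mA M \<diamondop> mK M) \<and> mK M \<diamondop> mB M = - (mB M \<diamondop> mK M) \<and>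
    mA M \<diamondop> mA M = 0 \<and> mB M \<diamondop> mB M = 0 \<and> mB M \<diamondop> mA M = - (mA M \<diamondop> mB M)"

lemma vmod_eqs0:
  assumes "vmod M"
  shows "mE M \<diamondop> mE M = mE M" "mE M \<diamondop> mK M = mK M" "mK M \<diamondop> mE M = mK M"
    "mE M \<diamondop> mA M = mA M" "mA M \<diamondop> mE M = mA M" "mE M \<diamondop> mB M = mB M" "mB M \<diamondop> mE M = mB M"
    "mK M \<diamondop> mK M = mE M" "mK M \<diamondop> mA M = - (mA M \<diamondop> mK M)" "mK M \<diamondop> mB M = - (mB M \<diamondop> mK M)"
    "mA M \<diamondop> mA M = 0" "mB M \<diamondop> mB M = 0" "mB M \<diamondop> mA M = - (mA M \<diamondop> mB M)"
  using assms by (simp_all add: vmod_def)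
text \<open>The relations are oriented so that xi_1 comes before xi_2 and both before K. With the
  variants that have a trailing factor, rewriting reaches the normal form of the basis of ordered
  monomials.\<close>

lemma vmod_eqs:
  assumes "vmod M"
  shows "mE M \<diamondop> mE M = mE M" "mE M \<diamondop> mK M = mK M" "mK M \<diamondop> mE M = mK M"
    "mE M \<diamondop> mA M = mA M" "mA M \<diamondop> mE M = mA M" "mE M \<diamondop> mB M = mB M" "mB M \<diamondop> mE M = mB M"
    "mK M \<diamondop> mK M = mE M" "mK M \<diamondop> mA M = - (mA M \<diamondop> mK M)" "mK M \<diamondop> mB M = - (mB M \<diamondop> mK M)"
    "mA M \<diamondop> mA M = 0" "mB M \<diamondop> mB M = 0" "mB M \<diamondop> mA M = - (mA M \<diamondop> mB M)"
    "mE M \<diamondop> (mE M \<diamondop> Z) = mE M \<diamondop> Z" "mE M \<diamondop> (mK M \<diamondop> Z) = mK M \<diamondop> Z" "mK M \<diamondop> (mE M \<diamondop> Z) = mK M \<diamondop> Z"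
    "mE M \<diamondop> (mA M \<diamondop> Z) = mA M \<diamondop> Z" "mA M \<diamondop> (mE M \<diamondop> Z) = mA M \<diamondop> Z"
    "mE M \<diamondop> (mB M \<diamondop> Z) = mB M \<diamondop> Z" "mB M \<diamondop> (mE M \<diamondop> Z) = mB M \<diamondop> Z"
    "mK M \<diamondop> (mK M \<diamondop> Z) = mE M \<diamondop> Z" "mK M \<diamondop> (mA M \<diamondop> Z) = - (mA M \<diamondop> (mK M \<diamondop> Z))"
    "mK M \<diamondop> (mB M \<diamondop> Z) = - (mB M \<diamondop> (mK M \<diamondop> Z))" "mA M \<diamondop> (mA M \<diamondop> Z) = 0" "mB M \<diamondop> (mB M \<diamondop> Z) = 0"
    "mB M \<diamondop> (mA M \<diamondop> Z) = - (mA M \<diamondop> (mB M \<diamondop> Z))"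
  using vmod_eqs0[OF assms] vmod_eqs0[OF assms, THEN mm_asc] by (simp_all add: mm_minus_l mm_assoc)

definition kh :: "'i kmod \<Rightarrow> 'j kmod \<Rightarrow> ('j, 'i) fm \<Rightarrow> bool" where
  "kh M N f \<longleftrightarrow> f \<diamondop> mE M = f \<and> mE N \<diamondop> f = f \<and> f \<diamondop> mK M = mK N \<diamondop> f \<and>
    f \<diamondop> mA M = mA N \<diamondop> f \<and> f \<diamondop> mB M = mB N \<diamondop> f"

lemma kh_eqs:
  assumes "kh M N f"
  shows "f \<diamondop> mE M = f" "mE N \<diamondop> f = f" "f \<diamondop> mK M = mK N \<diamondop> f" "f \<diamondop> mA M = mA N \<diamondop> f" "f \<diamondop> mB M = mB N \<diamondop> f"
   "f \<diamondop> (mE M \<diamondop> Z) = f \<diamondop> Z" "mE N \<diamondop> (f \<diamondop> Z) = f \<diamondop> Z" "f \<diamondop> (mK M \<diamondop> Z) = mK N \<diamondop> (f \<diamondop> Z)"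
   "f \<diamondop> (mA M \<diamondop> Z) = mA N \<diamondop> (f \<diamondop> Z)" "f \<diamondop> (mB M \<diamondop> Z) = mB N \<diamondop> (f \<diamondop> Z)"
  using assms by (auto simp: kh_def mm_assoc[symmetric])

lemma kh_comp: "kh M N f \<Longrightarrow> kh N Q g \<Longrightarrow> kh M Q (g \<diamondop> f)"
  unfolding kh_def[of M Q] by (simp add: mm_assoc kh_eqs)
lemma kh_id: "vmod M \<Longrightarrow> kh M M (mE M)"
  by (simp add: kh_def vmod_eqs)
lemma kh_lin: "kh M N f \<Longrightarrow> kh M N g \<Longrightarrow> kh M N (f + g)" "kh M N f \<Longrightarrow> kh M N (sc c f)" "kh M N 0"
  by (simp_all add: kh_def fm_alg)
lemma kh_sum: "(\<And>i. i \<in> I \<Longrightarrow> kh M N (f i)) \<Longrightarrow> kh M N (sum f I)"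
  by (induction I rule: infinite_finite_induct) (auto simp: kh_lin)

definition kiso :: "'i kmod \<Rightarrow> 'j kmod \<Rightarrow> bool" where
  "kiso M N \<longleftrightarrow> (\<exists>f g. kh M N f \<and> kh N M g \<and> g \<diamondop> f = mE M \<and> f \<diamondop> g = mE N)"

lemma kiso_refl: "vmod M \<Longrightarrow> kiso M M"
  unfolding kiso_def using kh_id vmod_eqs(1) by blast
lemma kiso_sym: "kiso M N \<Longrightarrow> kiso N M"
  unfolding kiso_def by blast
lemma kiso_trans: assumes "kiso M N" "kiso N Q" shows "kiso M Q"
proof -
  from assms obtain f g f' g' where h: "kh M N f" "kh N M g" "g \<diamondop> f = mE M" "f \<diamondop> g = mE N"
    "kh N Q f'" "kh Q N g'" "g' \<diamondop> f' = mE N" "f' \<diamondop> g' = mE Q" unfolding kiso_def by blast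
  have "(g \<diamondop> g') \<diamondop> (f' \<diamondop> f) = mE M" "(f' \<diamondop> f) \<diamondop> (g \<diamondop> g') = mE Q"
    by (simp_all add: h(3,4,7,8) h(3,4,7,8)[THEN mm_asc] mm_assoc kh_eqs(1,2,6,7)[OF h(1)] kh_eqs(1,2,6,7)[OF h(2)]
        kh_eqs(1,2,6,7)[OF h(5)] kh_eqs(1,2,6,7)[OF h(6)])
  with kh_comp[OF h(1,5)] kh_comp[OF h(6,2)] show ?thesis unfolding kiso_def by blast
qed

lemma kiso_tr: assumes "vmod M" "vmod N" "kiso M N" shows "tr (mE M) = tr (mE N)" "tr (mK M) = tr (mK N)"
proof -
  from assms(3) obtain f g where h: "kh M N f" "kh N M g" "g \<diamondop> f = mE M" "f \<diamondop> g = mE N" unfolding kiso_def by blast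
  show "tr (mE M) = tr (mE N)" using tr_comm[of f g] h by simp
  have "tr (mK M) = tr (g \<diamondop> (f \<diamondop> mK M))" by (simp add: h(3)[THEN mm_asc] vmod_eqs[OF assms(1)])
  also have "\<dots> = tr (mK N \<diamondop> (f \<diamondop> g))" by (simp add: kh_eqs[OF h(1)] tr_comm[of g] mm_assoc)
  also have "\<dots> = tr (mK N)" by (simp add: h(4) vmod_eqs[OF assms(2)])
  finally show "tr (mK M) = tr (mK N)" .
qed

definition rlm :: "('i \<Rightarrow> 'j) \<Rightarrow> 'i kmod \<Rightarrow> 'j kmod" where
  "rlm h M = KM (rl h (mE M)) (rl h (mK M)) (rl h (mA M)) (rl h (mB M))"

lemma rrl_lrl_swap: assumes "inj h" shows "rrl h (lrl h A) = rl h A"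
proof (rule fm_eqI)
  fix k l show "ent (rrl h (lrl h A)) k l = ent (rl h A) k l"
    by (cases "k \<in> range h"; cases "l \<in> range h") (auto simp: ent_lrl ent_rrl assms)
qed

lemma kiso_rlm: assumes "inj h" "vmod M" shows "kiso M (rlm h M)"
  unfolding kiso_def
  by (rule exI[of _ "lrl h (mE M)"], rule exI[of _ "rrl h (mE M)"])
     (simp add: kh_def rlm_def lrl_mm[OF assms(1)] mm_rrl[OF assms(1)] rrl_lrl[OF assms(1)] rrl_lrl_swap[OF assms(1)] vmod_eqs[OF assms(2)])

subsection \<open>Tensor products\<close>

definition kten :: "'i kmod \<Rightarrow> 'j kmod \<Rightarrow> ('i \<times> 'j) kmod" where
  "kten M N = KM (mE M \<boxtimes> mE N) (mK M \<boxtimes> mK N) (mK M \<boxtimes> mA N + mA M \<boxtimes> mE N) (mK M \<boxtimes> mB N + mB M \<boxtimes> mE N)"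

lemma kten_sel[simp]: "mE (kten M N) = mE M \<boxtimes> mE N" "mK (kten M N) = mK M \<boxtimes> mK N"
  "mA (kten M N) = mK M \<boxtimes> mA N + mA M \<boxtimes> mE N" "mB (kten M N) = mK M \<boxtimes> mB N + mB M \<boxtimes> mE N"
  by (simp_all add: kten_def)

lemma vmod_kten: "vmod M \<Longrightarrow> vmod N \<Longrightarrow> vmod (kten M N)"
  unfolding vmod_def[of "kten M N"] by (simp add: fm_alg krn_alg vmod_eqs)

lemma kh_kten: "kh M M' f \<Longrightarrow> kh N N' g \<Longrightarrow> kh (kten M N) (kten M' N') (f \<boxtimes> g)"
  unfolding kh_def[of "kten M N"] by (simp add: fm_alg krn_alg kh_eqs)

lemma kiso_kten: "kiso M M' \<Longrightarrow> kiso N N' \<Longrightarrow> kiso (kten M N) (kten M' N')"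
  unfolding kiso_def[of M] kiso_def[of N]
proof (elim exE conjE)
  fix f g f' g'
  assume h: "kh M M' f" "kh M' M g" "g \<diamondop> f = mE M" "f \<diamondop> g = mE M'" "kh N N' f'" "kh N' N g'" "g' \<diamondop> f' = mE N" "f' \<diamondop> g' = mE N'"
  show ?thesis unfolding kiso_def
    by (rule exI[of _ "f \<boxtimes> f'"], rule exI[of _ "g \<boxtimes> g'"]) (use h in \<open>simp add: kh_kten krn_mm\<close>)
qed

lemma kiso_kten_assoc: assumes "vmod M" "vmod N" "vmod Q"
  shows "kiso (kten (kten M N) Q) (kten M (kten N Q))"
proof -
  define h :: "('a \<times> 'b) \<times> 'c \<Rightarrow> 'a \<times> ('b \<times> 'c)" where "h = (\<lambda>((a, b), c). (a, (b, c)))"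
  have h: "inj h" "range h = UNIV" by (auto simp: inj_def h_def image_iff)
  have "rl h ((F \<boxtimes> G) \<boxtimes> H) = F \<boxtimes> (G \<boxtimes> H)" for F G H
    by (rule rl_eqI[OF h(1)]) (simp add: ent_krn h_def split_beta, simp_all add: h(2))
  then have "rlm h (kten (kten M N) Q) = kten M (kten N Q)"
    by (simp add: rlm_def kten_def krn_alg lrl_lin[OF h(1)] add.assoc)
  with kiso_rlm[OF h(1) vmod_kten[OF vmod_kten]] assms show ?thesis by metis
qed

text \<open>Relabelling by the swap produces the opposite coproduct, so a correction is required.
  \<open>f\<close> is the action of the R-matrix (1/2)(1 tensor 1 + 1 tensor K + K tensor 1 - K
  tensor K). It is -1 where K is -1 on both factors and 1 elsewhere, hence its own inverse.\<close>

lemma kiso_kten_comm: assumes "vmod M" "vmod N" shows "kiso (kten M N) (kten N M)"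
proof -
  have i: "inj (prod.swap :: 'a \<times> 'b \<Rightarrow> _)" by simp
  have "rl prod.swap (F \<boxtimes> G) = G \<boxtimes> F" for F :: "('a, 'a) fm" and G :: "('b, 'b) fm"
    by (rule rl_eqI[OF i]) (auto simp: ent_krn)
  then have *: "rlm prod.swap (kten M N) = KM (mE N \<boxtimes> mE M) (mK N \<boxtimes> mK M) (mA N \<boxtimes> mK M + mE N \<boxtimes> mA M) (mB N \<boxtimes> mK M + mE N \<boxtimes> mB M)"
    (is "_ = ?R") by (simp add: rlm_def kten_def lrl_lin[OF i])
  define f where "f = sc (1/2) (mE N \<boxtimes> mE M + mE N \<boxtimes> mK M + mK N \<boxtimes> mE M - mK N \<boxtimes> mK M)"
  have four: "sc (1/4) Z + (sc (1/4) Z + (sc (1/4) Z + sc (1/4) Z)) = Z" for Z :: "('x \<Rightarrow>\<^sub>0 complex)"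
    by (simp add: sc_add_l[symmetric])
  have "kiso ?R (kten N M)" unfolding kiso_def
    by (rule exI[of _ f], rule exI[of _ f])
       (simp add: kh_def f_def fm_alg krn_alg vmod_eqs[OF assms(1)] vmod_eqs[OF assms(2)] algebra_simps four)
  then show ?thesis using kiso_rlm[OF i vmod_kten[OF assms]] unfolding * by (rule kiso_trans[rotated])
qed

subsection \<open>Direct sums\<close>

definition is_dsum :: "'i kmod \<Rightarrow> 'j kmod \<Rightarrow> 'k kmod \<Rightarrow> bool" where
  "is_dsum M N1 N2 \<longleftrightarrow> (\<exists>i1 r1 i2 r2. kh N1 M i1 \<and> kh M N1 r1 \<and> kh N2 M i2 \<and> kh M N2 r2 \<and>
     r1 \<diamondop> i1 = mE N1 \<and> r2 \<diamondop> i2 = mE N2 \<and> r1 \<diamondop> i2 = 0 \<and> r2 \<diamondop> i1 = 0 \<and> i1 \<diamondop> r1 + i2 \<diamondop> r2 = mE M)"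

lemma is_dsum_cong:
  assumes "is_dsum M N1 N2" "kiso M M'" "kiso N1 N1'" "kiso N2 N2'" shows "is_dsum M' N1' N2'"
proof -
  from assms obtain i1 r1 i2 r2 where d: "kh N1 M i1" "kh M N1 r1" "kh N2 M i2" "kh M N2 r2"
     "r1 \<diamondop> i1 = mE N1" "r2 \<diamondop> i2 = mE N2" "r1 \<diamondop> i2 = 0" "r2 \<diamondop> i1 = 0" "i1 \<diamondop> r1 + i2 \<diamondop> r2 = mE M"
    unfolding is_dsum_def by blast
  from assms obtain f g f1 g1 f2 g2 where h: "kh M M' f" "kh M' M g" "kh N1 N1' f1" "kh N1' N1 g1" "kh N2 N2' f2" "kh N2' N2 g2"
    "g \<diamondop> f = mE M" "f \<diamondop> g = mE M'" "g1 \<diamondop> f1 = mE N1" "f1 \<diamondop> g1 = mE N1'" "g2 \<diamondop> f2 = mE N2" "f2 \<diamondop> g2 = mE N2'"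
    unfolding kiso_def by blast
  note r = d(5-8) d(5-8)[THEN mm_asc] h(7-) h(7-)[THEN mm_asc] kh_eqs(1,2,6,7)[OF d(1)] kh_eqs(1,2,6,7)[OF d(2)]
    kh_eqs(1,2,6,7)[OF d(3)] kh_eqs(1,2,6,7)[OF d(4)] kh_eqs(1,2,6,7)[OF h(1)] kh_eqs(1,2,6,7)[OF h(2)]
     kh_eqs(1,2,6,7)[OF h(3)] kh_eqs(1,2,6,7)[OF h(4)] kh_eqs(1,2,6,7)[OF h(5)] kh_eqs(1,2,6,7)[OF h(6)]
  have "f \<diamondop> (i1 \<diamondop> r1 + i2 \<diamondop> r2) \<diamondop> g = mE M'" unfolding d(9) by (simp add: mm_assoc r)
  then have "(f \<diamondop> (i1 \<diamondop> g1)) \<diamondop> (f1 \<diamondop> (r1 \<diamondop> g)) + (f \<diamondop> (i2 \<diamondop> g2)) \<diamondop> (f2 \<diamondop> (r2 \<diamondop> g)) = mE M'"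
    by (simp add: fm_alg r)
  moreover have "kh N1' M' (f \<diamondop> (i1 \<diamondop> g1))" "kh M' N1' (f1 \<diamondop> (r1 \<diamondop> g))" "kh N2' M' (f \<diamondop> (i2 \<diamondop> g2))" "kh M' N2' (f2 \<diamondop> (r2 \<diamondop> g))"
    using d h by (meson kh_comp)+
  ultimately show ?thesis unfolding is_dsum_def
    by (intro exI[of _ "f \<diamondop> (i1 \<diamondop> g1)"] exI[of _ "f1 \<diamondop> (r1 \<diamondop> g)"] exI[of _ "f \<diamondop> (i2 \<diamondop> g2)"] exI[of _ "f2 \<diamondop> (r2 \<diamondop> g)"])
       (simp add: mm_assoc r)
qed

lemma is_dsum_unique:
  assumes "is_dsum M N1 N2" "is_dsum M' N1 N2" shows "kiso M M'"
proof -
  from assms(1) obtain i1 r1 i2 r2 where d: "kh N1 M i1" "kh M N1 r1" "kh N2 M i2" "kh M N2 r2"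
     "r1 \<diamondop> i1 = mE N1" "r2 \<diamondop> i2 = mE N2" "r1 \<diamondop> i2 = 0" "r2 \<diamondop> i1 = 0" "i1 \<diamondop> r1 + i2 \<diamondop> r2 = mE M"
    unfolding is_dsum_def by blast
  from assms(2) obtain i1' r1' i2' r2' where d': "kh N1 M' i1'" "kh M' N1 r1'" "kh N2 M' i2'" "kh M' N2 r2'"
     "r1' \<diamondop> i1' = mE N1" "r2' \<diamondop> i2' = mE N2" "r1' \<diamondop> i2' = 0" "r2' \<diamondop> i1' = 0" "i1' \<diamondop> r1' + i2' \<diamondop> r2' = mE M'"
    unfolding is_dsum_def by blast
  show ?thesis unfolding kiso_def
    by (rule exI[of _ "i1' \<diamondop> r1 + i2' \<diamondop> r2"], rule exI[of _ "i1 \<diamondop> r1' + i2 \<diamondop> r2'"])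
       (use d d' in \<open>simp add: kh_lin kh_comp fm_alg d(5-8)[THEN mm_asc] d'(5-8)[THEN mm_asc] kh_eqs[OF d(2)] kh_eqs[OF d(4)] kh_eqs[OF d'(2)] kh_eqs[OF d'(4)]\<close>)
qed

lemma is_dsum_kten:
  assumes "is_dsum M N1 N2" "vmod Q" shows "is_dsum (kten M Q) (kten N1 Q) (kten N2 Q)"
proof -
  from assms(1) obtain i1 r1 i2 r2 where d: "kh N1 M i1" "kh M N1 r1" "kh N2 M i2" "kh M N2 r2"
     "r1 \<diamondop> i1 = mE N1" "r2 \<diamondop> i2 = mE N2" "r1 \<diamondop> i2 = 0" "r2 \<diamondop> i1 = 0" "i1 \<diamondop> r1 + i2 \<diamondop> r2 = mE M"
    unfolding is_dsum_def by blast
  note k = kh_kten[OF _ kh_id[OF assms(2)]]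
  have "(i1 \<boxtimes> mE Q) \<diamondop> (r1 \<boxtimes> mE Q) + (i2 \<boxtimes> mE Q) \<diamondop> (r2 \<boxtimes> mE Q) = mE (kten M Q)"
    by (simp only: krn_mm vmod_eqs(1)[OF assms(2)] krn_add_l[symmetric] d(9) kten_sel)
  moreover have "(r1 \<boxtimes> mE Q) \<diamondop> (i1 \<boxtimes> mE Q) = mE (kten N1 Q)" "(r2 \<boxtimes> mE Q) \<diamondop> (i2 \<boxtimes> mE Q) = mE (kten N2 Q)"
    "(r1 \<boxtimes> mE Q) \<diamondop> (i2 \<boxtimes> mE Q) = 0" "(r2 \<boxtimes> mE Q) \<diamondop> (i1 \<boxtimes> mE Q) = 0"
    by (simp_all only: krn_mm vmod_eqs(1)[OF assms(2)] d(5-8) kten_sel krn_zero_l)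
  ultimately show ?thesis unfolding is_dsum_def using k[OF d(1)] k[OF d(2)] k[OF d(3)] k[OF d(4)] by blast
qed

lemma is_dsum_tr: assumes "is_dsum M N1 N2" shows "tr (mE M) = tr (mE N1) + tr (mE N2)"
proof -
  from assms(1) obtain i1 r1 i2 r2 where d: "r1 \<diamondop> i1 = mE N1" "r2 \<diamondop> i2 = mE N2" "i1 \<diamondop> r1 + i2 \<diamondop> r2 = mE M"
    unfolding is_dsum_def by blast
  show ?thesis by (simp only: d(3)[symmetric] tr_add tr_comm[of i1 r1] tr_comm[of i2 r2] d(1,2))
qed

definition cut :: "'i kmod \<Rightarrow> ('i, 'i) fm \<Rightarrow> 'i kmod" where
  "cut M e = KM e (mK M \<diamondop> e) (mA M \<diamondop> e) (mB M \<diamondop> e)"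

lemma cut_sel[simp]: "mE (cut M e) = e" "mK (cut M e) = mK M \<diamondop> e" "mA (cut M e) = mA M \<diamondop> e" "mB (cut M e) = mB M \<diamondop> e"
  by (simp_all add: cut_def)

lemma cut:
  assumes "vmod M" "kh M M e" "e \<diamondop> e = e"
  shows "vmod (cut M e)" "kh (cut M e) M e" "kh M (cut M e) e"
proof -
  note r = kh_eqs[OF assms(2)] assms(3) assms(3)[THEN mm_asc] vmod_eqs[OF assms(1)]
  show "vmod (cut M e)" unfolding vmod_def by (simp add: fm_alg r)
  show "kh (cut M e) M e" "kh M (cut M e) e" by (simp_all add: kh_def fm_alg r)
qed

text \<open>As \<open>i\<close> and \<open>r\<close> are homomorphisms, so is the idempotent
  \<open>mE M - i \<diamondop> r\<close>. The complement it cuts out stays over the index type of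
  \<open>M\<close>, which later allows inductions that remove summands one at a time.\<close>

lemma summand:
  assumes "vmod M" "kh N M i" "kh M N r" "r \<diamondop> i = mE N"
  shows "vmod (cut M (mE M - i \<diamondop> r))" "is_dsum M N (cut M (mE M - i \<diamondop> r))"
proof -
  have ir: "kh M M (i \<diamondop> r)" using assms(2,3) by (rule kh_comp[rotated])
  have e: "kh M M (mE M - i \<diamondop> r)" using kh_lin(1)[OF kh_id[OF assms(1)] kh_lin(2)[OF ir, of "-1"]] by (simp add: sc_minus_l)
  note q = assms(4) assms(4)[THEN mm_asc] kh_eqs(1,2,6,7)[OF assms(2)] kh_eqs(1,2,6,7)[OF assms(3)] vmod_eqs[OF assms(1)]
  have ee: "(mE M - i \<diamondop> r) \<diamondop> (mE M - i \<diamondop> r) = mE M - i \<diamondop> r" by (simp add: fm_alg q)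
  note c = cut[OF assms(1) e ee]
  show "vmod (cut M (mE M - i \<diamondop> r))" by (rule c)
  show "is_dsum M N (cut M (mE M - i \<diamondop> r))" unfolding is_dsum_def
    by (intro exI[of _ i] exI[of _ r] exI[of _ "mE M - i \<diamondop> r"]) (use assms c ee in \<open>simp add: fm_alg q\<close>)
qed

section \<open>Free modules are injective: splitting them off with explicit retractions\<close>

section \<open>Free summands\<close>

text \<open>The basis is w, xi_1 w, xi_2 w, xi_1 xi_2 w with K w = w, so this is the projective
  cover of the trivial module. The entry \<open>- un 3 1\<close> is xi_2 xi_1 = - xi_1 xi_2.\<close>

definition P0m :: "nat kmod" where
  "P0m = KM (un 0 0 + un 1 1 + un 2 2 + un 3 3) (un 0 0 - un 1 1 - un 2 2 + un 3 3) (un 1 0 + un 3 2) (un 2 0 - un 3 1)"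

lemma P0m_sel: "mE P0m = un 0 0 + un 1 1 + un 2 2 + un 3 3" "mK P0m = un 0 0 - un 1 1 - un 2 2 + un 3 3"
  "mA P0m = un 1 0 + un 3 2" "mB P0m = un 2 0 - un 3 1"
  by (simp_all add: P0m_def)

lemma vmod_P0m: "vmod P0m"
  by (simp add: vmod_def P0m_sel fm_alg un_mm)

text \<open>A K-stable space on which xi_1 xi_2 is injective generates a free submodule. It splits
  because a homomorphism into a free module is determined by its coefficient at xi_1 xi_2, and
  \<open>q\<close> can be adjusted until it is the right coefficient functional.\<close>

lemma peel:
  fixes M :: "'i kmod" and D :: "'d kmod"
  assumes M: "vmod M" and D: "vmod D" "mA D = 0" "mB D = 0"
    and j: "j \<diamondop> mE D = j" "mE M \<diamondop> j = j" "mK M \<diamondop> j = j \<diamondop> mK D"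
    and q: "q \<diamondop> (mA M \<diamondop> (mB M \<diamondop> j)) = mE D"
  defines "i \<equiv> rc 0 j + rc 1 (mA M \<diamondop> j) + rc 2 (mB M \<diamondop> j) + rc 3 (mA M \<diamondop> (mB M \<diamondop> j))"
  shows "kh (kten P0m D) M i" "\<exists>r. kh M (kten P0m D) r \<and> r \<diamondop> i = mE (kten P0m D)"
proof -
  note eM = vmod_eqs[OF M] and eD = vmod_eqs[OF D(1)] and ej = j j[THEN mm_asc]
  show i: "kh (kten P0m D) M i"
    unfolding kh_def i_def by (simp add: fm_alg krn_alg blk P0m_sel D eM ej)
  \<comment> \<open>Averaging over K makes the functional K-equivariant.\<close>
  define q' where "q' = sc (1/2) (mE D \<diamondop> q \<diamondop> mE M + mK D \<diamondop> q \<diamondop> mK M)"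
  have q': "mE D \<diamondop> q' = q'" "q' \<diamondop> mE M = q'" "mK D \<diamondop> q' = q' \<diamondop> mK M"
    by (simp_all add: q'_def fm_alg eM eD add.commute)
  have "q \<diamondop> (mA M \<diamondop> (mB M \<diamondop> (j \<diamondop> mK D))) = mK D" using mm_asc[OF q, of "mK D"] by (simp add: mm_assoc eD)
  then have "q' \<diamondop> (mA M \<diamondop> (mB M \<diamondop> j)) = mE D"
    by (simp add: q'_def fm_alg eM eD ej q sc_add_l[symmetric])
  note q' = q' this
  note eq' = q' q'[THEN mm_asc]
  \<comment> \<open>The two corrections remove the values on xi_1 \<open>j\<close> and xi_2
    \<open>j\<close>; \<open>q2\<close> below then removes the values on \<open>j\<close>
    itself.\<close>
  define q1 where "q1 = q' + q' \<diamondop> mA M \<diamondop> j \<diamondop> q' \<diamondop> mB M - q' \<diamondop> mB M \<diamondop> j \<diamondop> q' \<diamondop> mA M"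
  have q1: "mE D \<diamondop> q1 = q1" "q1 \<diamondop> mE M = q1" "mK D \<diamondop> q1 = q1 \<diamondop> mK M"
    "q1 \<diamondop> (mA M \<diamondop> j) = 0" "q1 \<diamondop> (mB M \<diamondop> j) = 0" "q1 \<diamondop> (mA M \<diamondop> (mB M \<diamondop> j)) = mE D"
    by (simp_all add: q1_def fm_alg eM eD ej eq')
  note eq1 = q1 q1[THEN mm_asc]
  define q2 where "q2 = q1 - q1 \<diamondop> j \<diamondop> q1 \<diamondop> mA M \<diamondop> mB M"
  have q2: "mE D \<diamondop> q2 = q2" "q2 \<diamondop> mE M = q2" "mK D \<diamondop> q2 = q2 \<diamondop> mK M" "q2 \<diamondop> j = 0"
    "q2 \<diamondop> (mA M \<diamondop> j) = 0" "q2 \<diamondop> (mB M \<diamondop> j) = 0" "q2 \<diamondop> (mA M \<diamondop> (mB M \<diamondop> j)) = mE D"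
    by (simp_all add: q2_def fm_alg eM eD ej eq1)
  note eq2 = q2 q2[THEN mm_asc]
  \<comment> \<open>The coefficient at a basis monomial of \<open>P0m\<close> is \<open>q2\<close>
    after the complementary monomial; the minus sign is the anticommutation of xi_1 and
    xi_2.\<close>
  define r :: "(nat \<times> 'd, 'i) fm" where "r = lc 3 q2 + lc 0 (q2 \<diamondop> mA M \<diamondop> mB M) - lc 1 (q2 \<diamondop> mB M) + lc 2 (q2 \<diamondop> mA M)"
  have "kh M (kten P0m D) r"
    unfolding kh_def r_def by (simp add: fm_alg krn_alg blk P0m_sel D eM eD eq2)
  moreover have "r \<diamondop> i = mE (kten P0m D)"
    unfolding i_def r_def by (simp add: fm_alg krn_alg blk P0m_sel D eM eD ej eq2)
  ultimately show "\<exists>r. kh M (kten P0m D) r \<and> r \<diamondop> i = mE (kten P0m D)" by blast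
qed

text \<open>A surjection that kills the generators of a free submodule of complementary dimension splits,
  because free modules are injective.\<close>

lemma peel_complement:
  fixes M :: "'i kmod" and D :: "'d kmod" and N :: "'n kmod"
  assumes M: "vmod M" and D: "vmod D" "mA D = 0" "mB D = 0" and N: "vmod N"
    and j: "j \<diamondop> mE D = j" "mE M \<diamondop> j = j" "mK M \<diamondop> j = j \<diamondop> mK D"
    and q: "q \<diamondop> (mA M \<diamondop> (mB M \<diamondop> j)) = mE D"
    and r: "kh M N r" "r \<diamondop> t = mE N" "r \<diamondop> j = 0"
    and dim: "tr (mE M) = tr (mE N) + 4 * tr (mE D)"
  shows "is_dsum M (kten P0m D) N"
proof -
  define i :: "('i, nat \<times> 'd) fm" where "i = rc 0 j + rc 1 (mA M \<diamondop> j) + rc 2 (mB M \<diamondop> j) + rc 3 (mA M \<diamondop> (mB M \<diamondop> j))"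
  from peel[OF M D j q] obtain p where i: "kh (kten P0m D) M i" and p: "kh M (kten P0m D) p" "p \<diamondop> i = mE (kten P0m D)"
    unfolding i_def[symmetric] by blast
  define e where "e = mE M - i \<diamondop> p"
  note h12 = kh_eqs(1,2,6,7)[OF r(1)] kh_eqs(1,2,6,7)[OF i, unfolded kten_sel] kh_eqs(1,2,6,7)[OF p(1), unfolded kten_sel]
    vmod_eqs[OF M] vmod_eqs[OF N] p(2)[unfolded kten_sel] p(2)[THEN mm_asc, unfolded kten_sel]
  have ri: "r \<diamondop> i = 0" by (simp add: i_def fm_alg mm_rc kh_eqs[OF r(1)] r(3))
  have khe: "kh M M e" unfolding e_def using kh_lin(1)[OF kh_id[OF M] kh_lin(2)[OF kh_comp[OF p(1) i], of "-1"]]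
    by (simp add: sc_minus_l)
  have ee: "e \<diamondop> e = e" and re: "r \<diamondop> e = r" and ei: "e \<diamondop> i = 0" and pe: "p \<diamondop> e = 0" and ipe: "i \<diamondop> p + e = mE M"
    by (simp_all add: e_def fm_alg h12 ri ri[THEN mm_asc])
  have "tr (mE P0m) = 4" by (simp add: P0m_sel tr_add tr_un)
  then have "tr e = tr (mE N)" using dim tr_comm[of i p] by (simp add: e_def tr_diff p(2) tr_krn)
  \<comment> \<open>The section \<open>t\<close> is pushed into the complement \<open>e\<close>.
    Since \<open>e\<close> and \<open>mE N\<close> have equal trace, this one-sided inverse of
    \<open>r\<close> is two-sided there.\<close>
  define g where "g = e \<diamondop> t \<diamondop> mE N"
  have rg: "r \<diamondop> g = mE N" by (simp add: g_def re[THEN mm_asc] r(2)[THEN mm_asc] mm_assoc vmod_eqs[OF N])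
  have gr: "g \<diamondop> r = e"
    by (rule one_sided_inverse[of r g "mE N"])
       (simp_all add: rg ee re \<open>tr e = tr (mE N)\<close>, simp_all add: g_def mm_assoc vmod_eqs[OF N] ee[THEN mm_asc])
  have eg: "e \<diamondop> g = g" "mE M \<diamondop> g = g" "g \<diamondop> mE N = g"
    by (simp_all add: g_def mm_assoc ee[THEN mm_asc] vmod_eqs[OF N] kh_eqs(7)[OF khe])
  have "g \<diamondop> W = V \<diamondop> g" if "r \<diamondop> V = W \<diamondop> r" "e \<diamondop> V = V \<diamondop> e" "mE N \<diamondop> W = W" "W \<diamondop> mE N = W" for V W
  proof -
    have "g \<diamondop> W = g \<diamondop> (W \<diamondop> (r \<diamondop> g))" by (simp add: rg that)
    also have "\<dots> = (g \<diamondop> r) \<diamondop> (V \<diamondop> g)" by (metis mm_assoc that(1))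
    also have "\<dots> = V \<diamondop> (e \<diamondop> g)" by (metis gr mm_assoc that(2))
    finally show ?thesis by (simp add: eg)
  qed
  then have "kh N M g" unfolding kh_def using eg kh_eqs[OF r(1)] kh_eqs[OF khe] vmod_eqs[OF N] by simp
  moreover have "p \<diamondop> g = 0" using pe[THEN mm_asc, of g] eg by simp
  ultimately show ?thesis unfolding is_dsum_def
    using i p r(1) rg ri gr ipe by blast
qed

section \<open>Simple modules, pencil modules and multiplication by projectives and by y\<close>

section \<open>Standard modules\<close>

definition S :: "complex \<Rightarrow> unit kmod" where "S s = KM (un () ()) (sc s (un () ())) 0 0"
text \<open>Tensoring with the sign character negates all three generators. Conjugation by K
  restores xi_1 and xi_2, so up to isomorphism only K changes its sign.\<close>

definition flip :: "'i kmod \<Rightarrow> 'i kmod" where "flip M = KM (mE M) (- mK M) (mA M) (mB M)"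
definition semis :: "'i kmod \<Rightarrow> 'i kmod" where "semis M = KM (mE M) (mK M) 0 0"
text \<open>Exchanging xi_1 and xi_2 is an automorphism of K_2; it carries results at the parameter
  0 to the parameter infinity.\<close>

definition sw :: "'i kmod \<Rightarrow> 'i kmod" where "sw M = KM (mE M) (mK M) (mB M) (mA M)"
text \<open>\<open>True\<close> marks the source of the pencil, where K is \<open>s\<close>, and
  \<open>False\<close> its target, where K is \<open>- s\<close>; the opposite signs express that K
  anticommutes with both xi.\<close>

definition Kr :: "complex \<Rightarrow> nat \<Rightarrow> nat \<Rightarrow> (nat, nat) fm \<Rightarrow> (nat, nat) fm \<Rightarrow> (bool \<times> nat) kmod" where
  "Kr s u w A B = KM (un True True \<boxtimes> idn u + un False False \<boxtimes> idn w)
    (sc s (un True True \<boxtimes> idn u - un False False \<boxtimes> idn w)) (un False True \<boxtimes> A) (un False True \<boxtimes> B)"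
definition xsum :: "'i kmod \<Rightarrow> 'i kmod \<Rightarrow> (bool \<times> 'i) kmod" where
  "xsum M N = KM (un True True \<boxtimes> mE M + un False False \<boxtimes> mE N) (un True True \<boxtimes> mK M + un False False \<boxtimes> mK N)
    (un True True \<boxtimes> mA M + un False False \<boxtimes> mA N) (un True True \<boxtimes> mB M + un False False \<boxtimes> mB N)"
definition pencil :: "nat \<Rightarrow> nat \<Rightarrow> (nat, nat) fm \<Rightarrow> (nat, nat) fm \<Rightarrow> bool" where
  "pencil u w A B \<longleftrightarrow> idn w \<diamondop> A = A \<and> A \<diamondop> idn u = A \<and> idn w \<diamondop> B = B \<and> B \<diamondop> idn u = B"

lemma kmod_sel[simp]:
  "mE (S s) = un () ()" "mK (S s) = sc s (un () ())" "mA (S s) = 0" "mB (S s) = 0"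
  "mE (flip M) = mE M" "mK (flip M) = - mK M" "mA (flip M) = mA M" "mB (flip M) = mB M"
  "mE (semis M) = mE M" "mK (semis M) = mK M" "mA (semis M) = 0" "mB (semis M) = 0"
  "mE (sw M) = mE M" "mK (sw M) = mK M" "mA (sw M) = mB M" "mB (sw M) = mA M"
  by (simp_all add: S_def flip_def semis_def sw_def)
lemma Kr_sel[simp]:
  "mE (Kr s u w A B) = un True True \<boxtimes> idn u + un False False \<boxtimes> idn w"
  "mK (Kr s u w A B) = sc s (un True True \<boxtimes> idn u - un False False \<boxtimes> idn w)"
  "mA (Kr s u w A B) = un False True \<boxtimes> A" "mB (Kr s u w A B) = un False True \<boxtimes> B"
  by (simp_all add: Kr_def)
lemma xsum_sel[simp]:
  "mE (xsum M N) = un True True \<boxtimes> mE M + un False False \<boxtimes> mE N" "mK (xsum M N) = un True True \<boxtimes> mK M + un False False \<boxtimes> mK N"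
  "mA (xsum M N) = un True True \<boxtimes> mA M + un False False \<boxtimes> mA N" "mB (xsum M N) = un True True \<boxtimes> mB M + un False False \<boxtimes> mB N"
  by (simp_all add: xsum_def)

lemma pencil_eqs:
  assumes "pencil u w A B"
  shows "idn w \<diamondop> A = A" "A \<diamondop> idn u = A" "idn w \<diamondop> B = B" "B \<diamondop> idn u = B"
    "idn w \<diamondop> (A \<diamondop> Z) = A \<diamondop> Z" "A \<diamondop> (idn u \<diamondop> Z) = A \<diamondop> Z" "idn w \<diamondop> (B \<diamondop> Z) = B \<diamondop> Z" "B \<diamondop> (idn u \<diamondop> Z) = B \<diamondop> Z"
  using assms by (auto simp: pencil_def mm_assoc[symmetric])

lemma idn_idn1: "idn n \<diamondop> idn n = idn n" "idn n \<diamondop> (idn n \<diamondop> Z) = idn n \<diamondop> Z"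
  by (simp_all add: idn_idn mm_assoc[symmetric])

lemma vmod_S: "s * s = 1 \<Longrightarrow> vmod (S s)"
  by (simp add: vmod_def fm_alg un_mm)
lemma vmod_semis: "vmod M \<Longrightarrow> vmod (semis M)" and vmod_sw: "vmod M \<Longrightarrow> vmod (sw M)"
  unfolding vmod_def[of "semis M"] vmod_def[of "sw M"] by (simp_all add: fm_alg vmod_eqs)
lemma vmod_Kr: "s * s = 1 \<Longrightarrow> pencil u w A B \<Longrightarrow> vmod (Kr s u w A B)"
  by (simp add: vmod_def fm_alg krn_alg un_mm pencil_eqs idn_idn1)
lemma vmod_xsum: "vmod M \<Longrightarrow> vmod N \<Longrightarrow> vmod (xsum M N)"
  unfolding vmod_def[of "xsum M N"] by (simp add: fm_alg krn_alg un_mm vmod_eqs)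
lemma is_dsum_xsum: "vmod M \<Longrightarrow> vmod N \<Longrightarrow> is_dsum (xsum M N) M N"
  unfolding is_dsum_def
  by (rule exI[of _ "lc True (mE M)"], rule exI[of _ "rc True (mE M)"], rule exI[of _ "lc False (mE N)"], rule exI[of _ "rc False (mE N)"])
     (simp add: kh_def fm_alg krn_alg blk vmod_eqs)

lemma kh_sw: "kh M N f \<Longrightarrow> kh (sw M) (sw N) f"
  by (simp_all add: kh_def mm_minus_l mm_minus_r)
lemma is_dsum_sw: "is_dsum M N1 N2 \<Longrightarrow> is_dsum (sw M) (sw N1) (sw N2)"
  unfolding is_dsum_def kmod_sel by (blast intro: kh_sw)
lemma sw_kten: "sw (kten M N) = kten (sw M) (sw N)" and sw_xsum: "sw (xsum M' N') = xsum (sw M') (sw N')"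
  and sw_Kr: "sw (Kr s u w A B) = Kr s u w B A" and flip_Kr: "flip (Kr s u w A B) = Kr (- s) u w A B"
  by (simp_all add: sw_def kten_def xsum_def flip_def semis_def Kr_def sc_minus_l)

lemma kiso_sw_P0m: "kiso P0m (sw P0m)"
  unfolding kiso_def
  by (rule exI[of _ "un 0 0 + un 1 2 + un 2 1 - un 3 3"], rule exI[of _ "un 0 0 + un 1 2 + un 2 1 - un 3 3"])
     (simp add: kh_def P0m_sel fm_alg un_mm algebra_simps)

lemma kiso_S1: assumes "vmod M" shows "kiso (kten (S 1) M) M"
proof -
  have i: "inj (snd :: unit \<times> 'a \<Rightarrow> 'a)" by (auto simp: inj_def)
  have "rl snd (un () () \<boxtimes> Z) = Z" for Z :: "('a, 'a) fm"
    by (rule rl_eqI[OF i]) (auto simp: ent_krn ent_un)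
  then have "rlm snd (kten (S 1) M) = M" by (cases M) (simp add: rlm_def)
  with kiso_rlm[OF i vmod_kten[OF vmod_S assms], of 1] show ?thesis by simp
qed

lemma kiso_Sm1: assumes "vmod M" shows "kiso (kten (S (-1)) M) (flip M)"
proof -
  have i: "inj (snd :: unit \<times> 'a \<Rightarrow> 'a)" by (auto simp: inj_def)
  have "rl snd (un () () \<boxtimes> Z) = Z" for Z :: "('a, 'a) fm"
    by (rule rl_eqI[OF i]) (auto simp: ent_krn ent_un)
  then have "rlm snd (kten (S (-1)) M) = KM (mE M) (- mK M) (- mA M) (- mB M)" (is "_ = ?R")
    by (simp add: rlm_def sc_minus_l krn_alg lrl_lin[OF i])
  moreover have "kiso ?R (flip M)"
    unfolding kiso_def by (rule exI[of _ "mK M"], rule exI[of _ "mK M"]) (simp add: kh_def fm_alg vmod_eqs assms)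
  ultimately show ?thesis using kiso_rlm[OF i vmod_kten[OF vmod_S assms], of "-1"] kiso_trans by fastforce
qed

abbreviation zmod :: "unit kmod" where "zmod \<equiv> KM 0 0 0 0"
lemma vmod_zmod: "vmod zmod" by (simp add: vmod_def)

text \<open>On w tensor \<open>M\<close> the operator xi_1 xi_2 has the identity as its component in
  the last layer of \<open>P0m\<close>. Hence w tensor \<open>M\<close> generates a free module of
  full dimension, and a product with a projective sees only the K-action on
  \<open>M\<close>.\<close>

lemma P0m_tensor: assumes M: "vmod M" shows "is_dsum (kten P0m M) (kten P0m (semis M)) zmod"
  by (rule peel_complement[where j = "lc 0 (mE M)" and q = "rc 3 (mE M)" and r = 0 and t = 0])
     (simp_all add: vmod_kten vmod_P0m vmod_semis vmod_zmod M kh_def P0m_sel fm_alg krn_alg blk vmod_eqs[OF M] tr_krn tr_add tr_un)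

text \<open>This is \<open>P0m\<close> modulo its socle.\<close>

definition ymod :: "(bool \<times> nat) kmod" where "ymod = Kr 1 1 2 (un 1 0) (un 0 0)"

definition Sn :: "complex \<Rightarrow> 'i set \<Rightarrow> 'i kmod" where "Sn s I = KM (dg I) (sc s (dg I)) 0 0"
lemma Sn_sel[simp]: "mE (Sn s I) = dg I" "mK (Sn s I) = sc s (dg I)" "mA (Sn s I) = 0" "mB (Sn s I) = 0"
  by (simp_all add: Sn_def)
lemma vmod_Sn: "finite I \<Longrightarrow> s * s = 1 \<Longrightarrow> vmod (Sn s I)"
  by (simp add: vmod_def fm_alg dg_mm)

lemma krn_un: "un a b \<boxtimes> un c d = un (a, c) (b, d)"
  by (rule fm_eqI) (auto simp: ent_krn ent_un prod_eq_iff)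

lemma ymod_sel: 
  "mE ymod = un (True, 0) (True, 0) + un (False, 1) (False, 1) + un (False, 0) (False, 0)"
  "mK ymod = un (True, 0) (True, 0) - un (False, 1) (False, 1) - un (False, 0) (False, 0)"
  "mA ymod = un (False, 1) (True, 0)" "mB ymod = un (False, 0) (True, 0)"
proof -
  have "idn 1 = un 0 0" "idn 2 = un 0 0 + un 1 1"
    by (rule fm_eqI, auto simp: ent_dg ent_un lookup_add)+
  then show "mE ymod = un (True, 0) (True, 0) + un (False, 1) (False, 1) + un (False, 0) (False, 0)"
  "mK ymod = un (True, 0) (True, 0) - un (False, 1) (False, 1) - un (False, 0) (False, 0)"
  "mA ymod = un (False, 1) (True, 0)" "mB ymod = un (False, 0) (True, 0)"
    by (simp_all add: ymod_def krn_un krn_add_r)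
qed
lemma vmod_ymod: "vmod ymod"
  by (simp add: vmod_def ymod_sel fm_alg un_mm)

text \<open>The hypotheses say that 0 -> C^u -> C^w + C^w -> C^v -> 0 with maps (B, -A) and
  (\<open>\<alpha>\<close>, \<open>\<beta>\<close>) is exact: \<open>q1\<close>, \<open>q2\<close>
  split the first map, \<open>s1\<close>, \<open>s2\<close> the second, and \<open>d\<close> counts
  dimensions. Source tensor source generates the free part, and the quotient is the pencil of the
  second map: a cosyzygy.\<close>

lemma ymod_tensor:
  assumes s: "s * s = 1" and p: "pencil u w A B" "pencil w v \<alpha> \<beta>" and c: "\<alpha> \<diamondop> B = \<beta> \<diamondop> A"
    and q: "q1 \<diamondop> B - q2 \<diamondop> A = idn u" and t: "\<alpha> \<diamondop> s1 + \<beta> \<diamondop> s2 = idn v" and d: "2 * w = u + v"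
  shows "is_dsum (kten ymod (Kr s u w A B)) (kten P0m (Sn s {..<u})) (Kr (- s) w v \<alpha> \<beta>)"
proof (rule peel_complement[where j = "lc (True, 0) (lc True (idn u))"
      and q = "rc (False, 1) (rc False q1) + rc (False, 0) (rc False q2)"
      and r = "un True (False, 1) \<boxtimes> rc True (- A) + un True (False, 0) \<boxtimes> rc True (- B) + un True (True, 0) \<boxtimes> rc False (idn w)
        + un False (False, 1) \<boxtimes> rc False \<alpha> + un False (False, 0) \<boxtimes> rc False \<beta>"
      and t = "un (True, 0) True \<boxtimes> lc False (idn w) + un (False, 1) False \<boxtimes> lc False s1 + un (False, 0) False \<boxtimes> lc False s2"])
  show "vmod (kten ymod (Kr s u w A B))" "vmod (Sn s {..<u})" "vmod (Kr (- s) w v \<alpha> \<beta>)"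
    using s p by (auto intro: vmod_kten vmod_ymod vmod_Kr vmod_Sn)
  have w: "of_nat v = 2 * of_nat w - (of_nat u :: complex)" using arg_cong[OF d, of "of_nat :: nat \<Rightarrow> complex"] by simp
  note e = fm_alg krn_alg blk ymod_sel pencil_eqs[OF p(1)] pencil_eqs[OF p(2)] idn_idn1
  show "kh (kten ymod (Kr s u w A B)) (Kr (- s) w v \<alpha> \<beta>) (un True (False, 1) \<boxtimes> rc True (- A) + un True (False, 0) \<boxtimes> rc True (- B)
       + un True (True, 0) \<boxtimes> rc False (idn w) + un False (False, 1) \<boxtimes> rc False \<alpha> + un False (False, 0) \<boxtimes> rc False \<beta>)"
    by (simp add: kh_def e c sc_minus_l algebra_simps)
  show "tr (mE (kten ymod (Kr s u w A B))) = tr (mE (Kr (- s) w v \<alpha> \<beta>)) + 4 * tr (mE (Sn s {..<u}))"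
    by (simp add: ymod_sel tr_krn tr_add tr_un tr_dg w algebra_simps)
  show "(rc (False, 1) (rc False q1) + rc (False, 0) (rc False q2)) \<diamondop>
    (mA (kten ymod (Kr s u w A B)) \<diamondop> (mB (kten ymod (Kr s u w A B)) \<diamondop> lc (True, 0) (lc True (idn u)))) = mE (Sn s {..<u})"
    using q by (simp add: e)
  show "(un True (False, 1 :: nat) \<boxtimes> rc True (- A) + un True (False, 0) \<boxtimes> rc True (- B) + un True (True, 0) \<boxtimes> rc False (idn w)
        + un False (False, 1) \<boxtimes> rc False \<alpha> + un False (False, 0) \<boxtimes> rc False \<beta>) \<diamondop>
        (un (True, 0) True \<boxtimes> lc False (idn w) + un (False, 1) False \<boxtimes> lc False s1 + un (False, 0) False \<boxtimes> lc False s2)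
        = mE (Kr (- s) w v \<alpha> \<beta>)"
    by (simp add: e t[symmetric])
qed (simp_all add: fm_alg krn_alg blk ymod_sel idn_idn1)

section \<open>Products of the explicit indecomposables, computed with shift matrices\<close>

section \<open>Tensor products of the standard modules\<close>

definition pm :: "'j set \<Rightarrow> ('j \<Rightarrow> 'i) \<Rightarrow> ('i, 'j) fm" where
  "pm T f = mk (f ` T) T (\<lambda>i j. if i = f j then 1 else 0)"

lemma ent_pm: "finite T \<Longrightarrow> ent (pm T f) i j = (if j \<in> T \<and> i = f j then 1 else 0)"
  by (auto simp: pm_def ent_mk)
lemma ent_mm_pm: "finite T \<Longrightarrow> ent (Z \<diamondop> pm T f) k j = (if j \<in> T then ent Z k (f j) else 0)"
  by (subst ent_mm[of "{f j}"]) (auto simp: ent_pm split: if_split_asm)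
lemma ent_pm_mm: assumes "finite T" "inj_on f T"
  shows "i \<in> T \<Longrightarrow> ent (pm T f \<diamondop> Z) (f i) l = ent Z i l" "k \<notin> f ` T \<Longrightarrow> ent (pm T f \<diamondop> Z) k l = 0"
proof -
  assume i: "i \<in> T"
  show "ent (pm T f \<diamondop> Z) (f i) l = ent Z i l"
    by (subst ent_mm[of "{i}"]) (use assms i in \<open>auto simp: ent_pm inj_on_def split: if_split_asm\<close>)
next
  assume "k \<notin> f ` T"
  then show "ent (pm T f \<diamondop> Z) k l = 0"
    by (subst ent_mm[of "{}"]) (use assms in \<open>auto simp: ent_pm split: if_split_asm\<close>)
qed
lemma pm_mm: "finite T \<Longrightarrow> finite R \<Longrightarrow> pm R f \<diamondop> pm T g = pm {x \<in> T. g x \<in> R} (f \<circ> g)"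
  by (rule fm_eqI) (auto simp: ent_mm_pm ent_pm)
lemma pm_krn: "finite T \<Longrightarrow> finite R \<Longrightarrow> pm R f \<boxtimes> pm T g = pm (R \<times> T) (map_prod f g)"
  by (rule fm_eqI) (auto simp: ent_krn ent_pm)
lemma dg_pm: "finite T \<Longrightarrow> dg T = pm T (\<lambda>x. x)"
  by (rule fm_eqI) (auto simp: ent_dg ent_pm)
lemma pm_cong: "T = R \<Longrightarrow> (\<And>x. x \<in> R \<Longrightarrow> f x = g x) \<Longrightarrow> pm T f = pm R g"
proof -
  assume 1: "T = R" "\<And>x. x \<in> R \<Longrightarrow> f x = g x"
  then have 2: "f ` R = g ` R" by (simp cong: image_cong)
  have "(\<lambda>(i, j). if i \<in> g ` R \<and> j \<in> R then if i = f j then 1 else 0 else (0 :: complex)) =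
    (\<lambda>(i, j). if i \<in> g ` R \<and> j \<in> R then if i = g j then 1 else 0 else 0)"
  proof (rule ext)
    fix x show "(case x of (i, j) \<Rightarrow> if i \<in> g ` R \<and> j \<in> R then if i = f j then 1 else 0 else (0 :: complex)) =
      (case x of (i, j) \<Rightarrow> if i \<in> g ` R \<and> j \<in> R then if i = g j then 1 else 0 else 0)"
      using 1(2)[of "snd x"] by (cases x; cases "snd x \<in> R") (simp_all only: prod.case snd_conv simp_thms if_False)
  qed
  then show ?thesis by (simp only: pm_def mk_def 1(1) 2)
qed

definition sh :: "nat \<Rightarrow> (nat, nat) fm" where "sh n = pm {j. Suc j < n} Suc"

lemma fin_sh[simp]: "finite {j. Suc j < n}"
  by (rule finite_subset[of _ "{..<n}"]) auto
lemma sh_idn: "sh n \<diamondop> idn m = sh (min n (Suc m))" "idn m \<diamondop> sh n = sh (min m n)"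
  by (auto simp: sh_def dg_pm pm_mm intro!: pm_cong)
lemma idn_sh_idn: "idn n \<diamondop> sh n = sh n" "sh n \<diamondop> idn n = sh n"
  by (simp_all add: sh_idn min_def)
lemma sh_un: "sh n \<diamondop> un i j = (if Suc i < n then un (Suc i) j else 0)"
  by (rule fm_eqI) (auto simp: ent_mm_un ent_un sh_def ent_pm)

fun XA :: "nat \<Rightarrow> cp1 \<Rightarrow> (nat, nat) fm" where
  "XA n (Finite l) = sc l (idn n) + sh n" | "XA n Infinity = idn n"
fun XB :: "nat \<Rightarrow> cp1 \<Rightarrow> (nat, nat) fm" where
  "XB n (Finite l) = idn n" | "XB n Infinity = sh n"

text \<open>In terms of the paper, \<open>LTm\<close> and \<open>Lm\<close> are the syzygies and cosyzygies of the simple modules, and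
  \<open>Xm 1 n \<eta>\<close> represents $X'_{n,\eta}$.\<close>

definition LTm :: "complex \<Rightarrow> nat \<Rightarrow> (bool \<times> nat) kmod" where "LTm s k = Kr s k (Suc k) (sh (Suc k)) (idn k)"
definition Lm :: "complex \<Rightarrow> nat \<Rightarrow> (bool \<times> nat) kmod" where "Lm s k = Kr s (Suc k) k (tp (sh (Suc k))) (idn k)"
definition Xm :: "complex \<Rightarrow> nat \<Rightarrow> cp1 \<Rightarrow> (bool \<times> nat) kmod" where "Xm s n \<eta> = Kr s n n (XA n \<eta>) (XB n \<eta>)"

lemma pencil_X: "pencil n n (XA n \<eta>) (XB n \<eta>)"
  by (cases \<eta>) (simp_all add: pencil_def fm_alg idn_sh_idn idn_idn)
lemma pencil_LT: "pencil k (Suc k) (sh (Suc k)) (idn k)"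
  by (simp add: pencil_def sh_idn idn_idn)
lemma pencil_tp: "pencil u w A B \<Longrightarrow> pencil w u (tp A) (tp B)"
  unfolding pencil_def by (metis finite_lessThan tp_dg tp_mm)
lemma pencil_L: "pencil (Suc k) k (tp (sh (Suc k))) (idn k)"
  using pencil_tp[OF pencil_LT[of k]] by (simp add: tp_dg)
lemma vmod_std: "s * s = 1 \<Longrightarrow> vmod (LTm s k)" "s * s = 1 \<Longrightarrow> vmod (Lm s k)" "s * s = 1 \<Longrightarrow> vmod (Xm s n \<eta>)"
  by (simp_all add: LTm_def Lm_def Xm_def vmod_Kr pencil_L pencil_LT pencil_X)
lemma flip_std: "flip (LTm s k) = LTm (- s) k" "flip (Lm s k) = Lm (- s) k" "flip (Xm s n \<eta>) = Xm (- s) n \<eta>"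
  by (simp_all add: LTm_def Lm_def Xm_def flip_Kr)

text \<open>The pencil is its own successor in \<open>ymod_tensor\<close>, since its two matrices
  commute; the one that is the identity provides both splittings.\<close>

lemma ymod_X: assumes "s * s = 1" shows "is_dsum (kten ymod (Xm s n \<eta>)) (kten P0m (Sn s {..<n})) (Xm (- s) n \<eta>)"
proof (cases \<eta>)
  case (Finite l)
  then show ?thesis unfolding Xm_def
    by (intro ymod_tensor[where ?q1.0 = "idn n" and ?q2.0 = 0 and ?s1.0 = 0 and ?s2.0 = "idn n"])
       (simp_all add: assms pencil_X del: XA.simps XB.simps, simp_all add: fm_alg idn_idn idn_sh_idn)
next
  case Infinity
  then show ?thesis unfolding Xm_def
    by (intro ymod_tensor[where ?q1.0 = 0 and ?q2.0 = "- idn n" and ?s1.0 = "idn n" and ?s2.0 = 0])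
       (simp_all add: assms pencil_X del: XA.simps XB.simps, simp_all add: fm_alg idn_idn idn_sh_idn)
qed

lemma ymod_LT: "s * s = 1 \<Longrightarrow> is_dsum (kten ymod (LTm s k)) (kten P0m (Sn s {..<k})) (LTm (- s) (Suc k))"
  unfolding LTm_def
  \<comment> \<open>The witness \<open>un k (Suc k)\<close> reaches the last basis vector, which
    \<open>idn (Suc k)\<close> misses.\<close>
  by (rule ymod_tensor[where ?q1.0 = "idn k" and ?q2.0 = 0 and ?s1.0 = "un k (Suc k)" and ?s2.0 = "idn (Suc k)"])
     (simp_all add: pencil_LT sh_idn idn_idn sh_un idn_Suc[of "Suc k", symmetric] add.commute[of "un _ _"])

lemma ymod_L: "s * s = 1 \<Longrightarrow> is_dsum (kten ymod (Lm s (Suc k))) (kten P0m (Sn s {..<Suc (Suc k)})) (Lm (- s) k)"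
proof -
  have 1: "tp (sh (Suc k)) \<diamondop> idn (Suc k) = tp (sh (Suc k))" "idn k \<diamondop> tp (sh (Suc (Suc k))) = tp (sh (Suc k))"
    using arg_cong[OF sh_idn(1)[of "Suc (Suc k)" k], of tp] arg_cong[OF sh_idn(2)[of "Suc k" "Suc k"], of tp]
    by (simp_all add: tp_mm tp_dg)
  \<comment> \<open>The second matrix of the pencil kills the last basis vector; the first one
    recovers it, through \<open>un (Suc k) k\<close>.\<close>
  have 2: "un (Suc k) k \<diamondop> tp (sh (Suc (Suc k))) = un (Suc k) (Suc k)"
    using arg_cong[OF sh_un[of "Suc (Suc k)" k "Suc k"], of tp] by (simp add: tp_mm tp_un)
  show "s * s = 1 \<Longrightarrow> ?thesis" unfolding Lm_def
    by (rule ymod_tensor[where ?q1.0 = "idn (Suc k)" and ?q2.0 = "- un (Suc k) k" and ?s1.0 = 0 and ?s2.0 = "idn k"])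
       (simp_all add: pencil_L 1 2 idn_idn mm_minus_l idn_Suc[of "Suc k", symmetric])
qed

lemma rc_krn_rc: "A \<diamondop> idn n = A \<Longrightarrow> B \<diamondop> idn t = B \<Longrightarrow> rc b A \<boxtimes> rc c B = (A \<boxtimes> B) \<diamondop> (rc b (idn n) \<boxtimes> rc c (idn t))"
  by (simp add: krn_mm mm_rc)

lemma rc_rc_lc_lc: "rc c (rc d (lc a (lc b Z))) = un a c \<boxtimes> (un b d \<boxtimes> Z)"
  by (rule fm_eqI) (auto simp: ent_lc ent_rc ent_krn ent_un)

text \<open>From source tensor source to target tensor target, xi_1 xi_2 acts as
  \<open>A \<boxtimes> idn t - idn n \<boxtimes> A'\<close>. It is injective on the vectors with
  second index below \<open>t - 1\<close>, which generate the free part. \<open>\<psi>\<close> kills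
  these vectors and carries the first remaining summand; \<open>\<Delta>\<close> identifies the two
  actions on target tensor target and carries the sign-twisted one.\<close>

lemma kten_regular_same:
  fixes A A' :: "(nat, nat) fm" and \<psi> \<Delta> :: "(nat, nat \<times> nat) fm"
  assumes p: "pencil n n A (idn n)" "pencil t t A' (idn t)" and t: "1 \<le> t"
    and P: "idn n \<diamondop> \<psi> = \<psi>" "\<psi> \<diamondop> (idn n \<boxtimes> idn t) = \<psi>" "idn n \<diamondop> \<Delta> = \<Delta>" "\<Delta> \<diamondop> (idn n \<boxtimes> idn t) = \<Delta>"
    and c: "\<psi> \<diamondop> (A \<boxtimes> idn t) = A \<diamondop> \<psi>" "\<Delta> \<diamondop> (A \<boxtimes> idn t) = A \<diamondop> \<Delta>" "\<Delta> \<diamondop> (idn n \<boxtimes> A') = A \<diamondop> \<Delta>"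
    and sec: "\<psi> \<diamondop> s1 = idn n" "\<Delta> \<diamondop> s2 = idn n" "(idn n \<boxtimes> idn t) \<diamondop> s1 = s1" "(idn n \<boxtimes> idn t) \<diamondop> s2 = s2"
    and k: "\<psi> \<diamondop> (idn n \<boxtimes> idn (t - 1)) = 0"
    and q: "q \<diamondop> ((A \<boxtimes> idn t - idn n \<boxtimes> A') \<diamondop> (idn n \<boxtimes> idn (t - 1))) = idn n \<boxtimes> idn (t - 1)"
  shows "is_dsum (kten (Kr 1 n n A (idn n)) (Kr 1 t t A' (idn t))) (kten P0m (Sn 1 ({..<n} \<times> {..<t - 1})))
    (xsum (Kr 1 n n A (idn n)) (Kr (-1) n n A (idn n)))"
proof -
  define R where "R b c = rc b (idn n) \<boxtimes> rc c (idn t)" for b c :: bool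
  define L where "L b c = lc b (idn n) \<boxtimes> lc c (idn t)" for b c :: bool
  \<comment> \<open>The middle layer is shared: its symmetric part continues \<open>\<psi>\<close>,
    and the difference of its two halves under \<open>\<Delta>\<close> is the source of the twisted
    summand.\<close>
  define r where "r = lc True (lc True (\<psi> \<diamondop> R True True) + lc False (\<psi> \<diamondop> R False True)) +
    lc False (lc False (\<Delta> \<diamondop> R False False) + lc True (\<Delta> \<diamondop> R True False - \<Delta> \<diamondop> R False True))"
  define g where "g = L True True \<diamondop> s1 \<diamondop> rc True (rc True (idn n)) + (L False True + L True False) \<diamondop> s1 \<diamondop> rc True (rc False (idn n)) +
    L True False \<diamondop> s2 \<diamondop> rc False (rc True (idn n)) + L False False \<diamondop> s2 \<diamondop> rc False (rc False (idn n))"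
  define e where "e = idn n \<boxtimes> idn (t - 1)"
  have e: "e = dg ({..<n} \<times> {..<t - 1})" by (simp add: e_def dg_krn)
  have emm: "(idn n \<boxtimes> idn t) \<diamondop> e = e" "e \<diamondop> e = e" using t by (simp_all add: e_def krn_mm idn_idn)
  note pe = pencil_eqs[OF p(1)] pencil_eqs[OF p(2)] idn_idn1
  have RL: "R b c \<diamondop> L b' c' = (if b = b' \<and> c = c' then idn n \<boxtimes> idn t else 0)"
     "R b c \<diamondop> (L b' c' \<diamondop> Z) = (if b = b' \<and> c = c' then (idn n \<boxtimes> idn t) \<diamondop> Z else 0)" for b c b' c' and Z :: "(nat \<times> nat, 'z) fm"
    by (simp_all add: R_def L_def krn_mm krn_mm[THEN mm_asc] rc_lc idn_idn1)
  have Rc: "rc b A \<boxtimes> rc c (idn t) = (A \<boxtimes> idn t) \<diamondop> R b c" "rc b (idn n) \<boxtimes> rc c A' = (idn n \<boxtimes> A') \<diamondop> R b c"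
    "rc b (idn n) \<boxtimes> rc c (idn t) = R b c" for b c
    unfolding R_def by (simp_all add: rc_krn_rc[symmetric] pe)
  have Lc: "lc b A \<boxtimes> lc c (idn t) = L b c \<diamondop> (A \<boxtimes> idn t)" "lc b (idn n) \<boxtimes> lc c A' = L b c \<diamondop> (idn n \<boxtimes> A')"
    "lc b (idn n) \<boxtimes> lc c (idn t) = L b c" for b c
    unfolding L_def by (simp_all add: krn_mm lc_mm pe)
  let ?M = "kten (Kr 1 n n A (idn n)) (Kr 1 t t A' (idn t))"
  have RM: "R b c \<diamondop> mE ?M = R b c" "R b c \<diamondop> mK ?M = (if b = c then R b c else - R b c)"
    "R b c \<diamondop> mA ?M = (if b then 0 else (A \<boxtimes> idn t) \<diamondop> R True c) + (if c then 0 else if b then (idn n \<boxtimes> A') \<diamondop> R b True else - ((idn n \<boxtimes> A') \<diamondop> R b True))"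
    "R b c \<diamondop> mB ?M = (if b then 0 else R True c) + (if c then 0 else if b then R b True else - R b True)" for b c
    unfolding Rc(1,2)[symmetric] unfolding R_def
    by (cases b; cases c; simp add: fm_alg krn_alg rc_krn pe)+
  have opL: "mE ?M \<diamondop> L b c = L b c" "mK ?M \<diamondop> L b c = (if b = c then L b c else - L b c)"
    "mA ?M \<diamondop> L b c = (if b then L False c \<diamondop> (A \<boxtimes> idn t) else 0) + (if c then if b then L b False \<diamondop> (idn n \<boxtimes> A') else - (L b False \<diamondop> (idn n \<boxtimes> A')) else 0)"
    "mB ?M \<diamondop> L b c = (if b then L False c else 0) + (if c then if b then L b False else - L b False else 0)" for b c
    unfolding Lc(1,2)[symmetric] unfolding L_def
    by (cases b; cases c; simp add: fm_alg krn_alg krn_lc pe)+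
  note opL' = opL opL[THEN mm_asc]
  show ?thesis
  proof (rule peel_complement[where j = "L True True \<diamondop> e" and q = "q \<diamondop> R False False" and r = r and t = g])
    show "vmod ?M" "vmod (xsum (Kr 1 n n A (idn n)) (Kr (- 1) n n A (idn n)))"
      using p by (auto intro!: vmod_kten vmod_xsum vmod_Kr)
    show "kh ?M (xsum (Kr 1 n n A (idn n)) (Kr (- 1) n n A (idn n))) r"
      unfolding kh_def r_def
      by (simp add: fm_alg lc_mm lc_add lc_diff lc_minus lc_sc RM del: kten_sel)
         (simp add: fm_alg krn_alg krn_lc lc_mm lc_add lc_diff lc_minus lc_sc c[THEN mm_asc] P P[THEN mm_asc] c pe sc_minus_l)
    show "r \<diamondop> g = mE (xsum (Kr 1 n n A (idn n)) (Kr (- 1) n n A (idn n)))"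
      unfolding r_def g_def
      by (simp add: fm_alg lc_mm lc_add lc_diff lc_minus RL sec sec[THEN mm_asc] mm_rc idn_idn1 rc_rc_lc_lc krn_add_r krn_diff_r)
    show "r \<diamondop> (L True True \<diamondop> e) = 0" unfolding r_def
      by (simp add: fm_alg lc_mm lc_add RL emm) (simp add: e_def k[simplified])
    show "q \<diamondop> R False False \<diamondop> (mA ?M \<diamondop> (mB ?M \<diamondop> (L True True \<diamondop> e))) = mE (Sn 1 ({..<n} \<times> {..<t - 1}))"
    proof -
      have "q \<diamondop> R False False \<diamondop> (mA ?M \<diamondop> (mB ?M \<diamondop> (L True True \<diamondop> e))) = q \<diamondop> ((A \<boxtimes> idn t - idn n \<boxtimes> A') \<diamondop> e)"
        by (simp add: fm_alg opL' RL del: kten_sel) (simp add: krn_alg pe)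
      also have "\<dots> = e" using q unfolding e_def .
      finally show ?thesis unfolding Sn_sel e .
    qed
    show "tr (mE ?M) = tr (mE (xsum (Kr 1 n n A (idn n)) (Kr (- 1) n n A (idn n)))) + 4 * tr (mE (Sn 1 ({..<n} \<times> {..<t - 1})))"
      using t by (simp add: tr_krn tr_add tr_un tr_dg of_nat_diff algebra_simps)
    show "L True True \<diamondop> e \<diamondop> mE (Sn 1 ({..<n} \<times> {..<t - 1})) = L True True \<diamondop> e" "mE ?M \<diamondop> (L True True \<diamondop> e) = L True True \<diamondop> e"
      "mK ?M \<diamondop> (L True True \<diamondop> e) = L True True \<diamondop> e \<diamondop> mK (Sn 1 ({..<n} \<times> {..<t - 1}))"
      by (simp_all add: fm_alg e[symmetric, simplified] emm opL' del: kten_sel)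
  qed (simp_all add: vmod_Sn)
qed

text \<open>Here xi_1 xi_2 is injective on all of source tensor source, so the free submodule
  already has the full dimension.\<close>

lemma kten_regular_diff:
  fixes A A' B B' :: "(nat, nat) fm"
  assumes p: "pencil n n A B" "pencil t t A' B'"
    and q: "q \<diamondop> (A \<boxtimes> B' - B \<boxtimes> A') = idn n \<boxtimes> idn t"
  shows "is_dsum (kten (Kr 1 n n A B) (Kr 1 t t A' B')) (kten P0m (Sn 1 ({..<n} \<times> {..<t}))) zmod"
proof -
  note pe = pencil_eqs[OF p(1)] pencil_eqs[OF p(2)] idn_idn1
  have e: "dg ({..<n} \<times> {..<t}) = idn n \<boxtimes> idn t" by (simp add: dg_krn)
  show ?thesis
    by (rule peel_complement[where j = "lc True (idn n) \<boxtimes> lc True (idn t)" and q = "q \<diamondop> (rc False (idn n) \<boxtimes> rc False (idn t))"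
        and r = 0 and t = 0])
       (use p q in \<open>simp_all add: vmod_kten vmod_Kr vmod_Sn vmod_zmod kh_def fm_alg krn_alg krn_lc rc_lc lc_mm e pe tr_krn tr_add tr_un tr_dg\<close>)
qed

lemma sh_krn: "sh n \<boxtimes> idn t = pm ({j. Suc j < n} \<times> {..<t}) (map_prod Suc (\<lambda>x. x))"
  "idn n \<boxtimes> sh t = pm ({..<n} \<times> {j. Suc j < t}) (map_prod (\<lambda>x. x) Suc)"
  "sh n \<boxtimes> sh t = pm ({j. Suc j < n} \<times> {j. Suc j < t}) (map_prod Suc Suc)"
  by (simp_all add: sh_def dg_pm pm_krn)
lemma ent_sh_krn:
  "ent ((sh n \<boxtimes> idn t) \<diamondop> Z) (i, j) l = (if 0 < i \<and> i < n \<and> j < t then ent Z (i - 1, j) l else 0)"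
  "ent ((idn n \<boxtimes> sh t) \<diamondop> Z) (i, j) l = (if i < n \<and> 0 < j \<and> j < t then ent Z (i, j - 1) l else 0)"
  "ent ((sh n \<boxtimes> sh t) \<diamondop> Z) (i, j) l = (if 0 < i \<and> i < n \<and> 0 < j \<and> j < t then ent Z (i - 1, j - 1) l else 0)"
proof -
  have i: "inj_on (map_prod Suc (\<lambda>x. x)) T" "inj_on (map_prod (\<lambda>x. x) Suc) T" "inj_on (map_prod Suc Suc) T" for T :: "(nat \<times> nat) set"
    by (auto simp: inj_on_def)
  have f: "finite ({j. Suc j < n} \<times> {..<t})" "finite ({..<n} \<times> {j. Suc j < t})" "finite ({j. Suc j < n} \<times> {j. Suc j < t})"
    by auto
  show "ent ((sh n \<boxtimes> idn t) \<diamondop> Z) (i, j) l = (if 0 < i \<and> i < n \<and> j < t then ent Z (i - 1, j) l else 0)"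
  proof (cases "0 < i \<and> i < n \<and> j < t")
    case True
    then show ?thesis using ent_pm_mm(1)[OF f(1) i(1), of "(i - 1, j)" Z l] by (simp add: sh_krn)
  next
    case False
    then have "(i, j) \<notin> map_prod Suc (\<lambda>x. x) ` ({j. Suc j < n} \<times> {..<t})" by auto
    from ent_pm_mm(2)[OF f(1) i(1) this] show ?thesis by (simp only: sh_krn False if_False)
  qed
  show "ent ((idn n \<boxtimes> sh t) \<diamondop> Z) (i, j) l = (if i < n \<and> 0 < j \<and> j < t then ent Z (i, j - 1) l else 0)"
  proof (cases "i < n \<and> 0 < j \<and> j < t")
    case True
    then show ?thesis using ent_pm_mm(1)[OF f(2) i(2), of "(i, j - 1)" Z l] by (simp add: sh_krn)
  next
    case False
    then have "(i, j) \<notin> map_prod (\<lambda>x. x) Suc ` ({..<n} \<times> {j. Suc j < t})" by auto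
    from ent_pm_mm(2)[OF f(2) i(2) this] show ?thesis by (simp only: sh_krn False if_False)
  qed
  show "ent ((sh n \<boxtimes> sh t) \<diamondop> Z) (i, j) l = (if 0 < i \<and> i < n \<and> 0 < j \<and> j < t then ent Z (i - 1, j - 1) l else 0)"
  proof (cases "0 < i \<and> i < n \<and> 0 < j \<and> j < t")
    case True
    then show ?thesis using ent_pm_mm(1)[OF f(3) i(3), of "(i - 1, j - 1)" Z l] by (simp add: sh_krn)
  next
    case False
    then have "(i, j) \<notin> map_prod Suc Suc ` ({j. Suc j < n} \<times> {j. Suc j < t})" by auto
    from ent_pm_mm(2)[OF f(3) i(3) this] show ?thesis by (simp only: sh_krn False if_False)
  qed
qed

lemma dgE: "finite I \<Longrightarrow> dg I \<diamondop> Z = Z \<Longrightarrow> i \<notin> I \<Longrightarrow> ent Z i l = 0"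
  by (metis ent_dg_mm)

lemma krn_idn: "idn n \<boxtimes> idn t = dg ({..<n} \<times> {..<t})"
  by (simp add: dg_krn)

text \<open>For a kernel vector, the entry at \<open>(i, Suc j)\<close> says that x(i, j) = x(i - 1,
  j + 1). Row 0 therefore vanishes, and induction on \<open>i\<close> propagates this. The bound
  \<open>t - 1\<close> keeps \<open>Suc j\<close> in range.\<close>

lemma left_inverse_same:
  assumes "n \<le> t"
  shows "\<exists>q. q \<diamondop> ((sh n \<boxtimes> idn t - idn n \<boxtimes> sh t) \<diamondop> (idn n \<boxtimes> idn (t - 1))) = idn n \<boxtimes> idn (t - 1)"
proof -
  let ?e = "idn n \<boxtimes> idn (t - 1)"
  have ee: "?e \<diamondop> ?e = ?e" by (simp add: krn_mm idn_idn)
  have "x = 0" if x: "?e \<diamondop> x = x" "(sh n \<boxtimes> idn t - idn n \<boxtimes> sh t) \<diamondop> ?e \<diamondop> x = 0" for x :: "(nat \<times> nat, unit) fm"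
  proof -
    have z: "ent x (i, j) l = 0" if "\<not> (i < n \<and> j < t - 1)" for i j l
      by (rule dgE[of "{..<n} \<times> {..<t - 1}"]) (use x(1) that in \<open>auto simp: krn_idn\<close>)
    have x2: "ent ((sh n \<boxtimes> idn t) \<diamondop> x) p l = ent ((idn n \<boxtimes> sh t) \<diamondop> x) p l" for p l
      using arg_cong[OF x(2), of "\<lambda>y. ent y p l"] x(1) by (simp add: mm_assoc mm_diff_l lookup_minus)
    have "\<forall>j. ent x (i, j) l = 0" for i l
    proof (induction i)
      case 0
      show ?case
      proof
        fix j show "ent x (0, j) l = 0"
          using x2[of "(0, Suc j)" l] z[of 0 j l] by (cases "0 < n \<and> Suc j < t") (auto simp: ent_sh_krn less_diff_conv)
      qed
    next
      case (Suc i)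
      show ?case
      proof
        fix j show "ent x (Suc i, j) l = 0"
          using x2[of "(Suc i, Suc j)" l] z[of "Suc i" j l] Suc by (cases "Suc i < n \<and> Suc j < t") (auto simp: ent_sh_krn less_diff_conv)
      qed
    qed
    then show "x = 0" by (intro fm_eqI) (metis lookup_zero prod.exhaust)
  qed
  from left_inverse_ex[of "(sh n \<boxtimes> idn t - idn n \<boxtimes> sh t) \<diamondop> ?e" ?e, OF _ ee this] ee show ?thesis
    by (auto simp: mm_assoc)
qed

text \<open>The other terms raise i + j, so the entries of a kernel vector vanish by induction on i
  + j. The four coefficients cover two distinct finite parameters as well as a finite one against
  infinity.\<close>

lemma left_inverse_diff:
  assumes "c \<noteq> 0"
  shows "\<exists>q. q \<diamondop> (sc c (idn n \<boxtimes> idn t) + (sc a (sh n \<boxtimes> idn t) + sc b (idn n \<boxtimes> sh t) + sc d (sh n \<boxtimes> sh t))) = idn n \<boxtimes> idn t"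
proof -
  let ?e = "idn n \<boxtimes> idn t"
  let ?T = "sc c ?e + (sc a (sh n \<boxtimes> idn t) + sc b (idn n \<boxtimes> sh t) + sc d (sh n \<boxtimes> sh t))"
  have ee: "?e \<diamondop> ?e = ?e" by (simp add: krn_mm idn_idn)
  have "x = 0" if x: "?e \<diamondop> x = x" "?T \<diamondop> x = 0" for x :: "(nat \<times> nat, unit) fm"
  proof -
    have z: "ent x (i, j) l = 0" if "\<not> (i < n \<and> j < t)" for i j l
      by (rule dgE[of "{..<n} \<times> {..<t}"]) (use x(1) that in \<open>auto simp: krn_idn\<close>)
    have x2: "c * ent x p l + (a * ent ((sh n \<boxtimes> idn t) \<diamondop> x) p l + b * ent ((idn n \<boxtimes> sh t) \<diamondop> x) p l + d * ent ((sh n \<boxtimes> sh t) \<diamondop> x) p l) = 0" for p l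
      using arg_cong[OF x(2), of "\<lambda>y. ent y p l"] x(1) by (simp add: fm_alg lookup_add ent_sc)
    have "\<forall>i j. i + j = m \<longrightarrow> ent x (i, j) l = 0" for m l
    proof (induction m rule: less_induct)
      case (less m)
      show ?case
      proof (intro allI impI)
        fix i j assume m: "i + j = m"
        show "ent x (i, j) l = 0"
        proof (cases "i < n \<and> j < t")
          case True
          have "ent x (i - 1, j) l = 0" if "0 < i" using less[of "i - 1 + j"] that m by auto
          moreover have "ent x (i, j - 1) l = 0" if "0 < j" using less[of "i + (j - 1)"] that m by auto
          moreover have "ent x (i - 1, j - 1) l = 0" if "0 < i" "0 < j" using less[of "i - 1 + (j - 1)"] that m by auto
          ultimately have "c * ent x (i, j) l = 0" using x2[of "(i, j)" l] by (auto simp: ent_sh_krn split: if_split_asm)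
          then show ?thesis using assms by simp
        qed (rule z)
      qed
    qed
    then show "x = 0" by (intro fm_eqI) (metis lookup_zero prod.exhaust)
  qed
  moreover have "?T \<diamondop> ?e = ?T" by (simp add: fm_alg krn_mm idn_idn idn_sh_idn)
  ultimately obtain q where "q \<diamondop> ?T = ?e" using left_inverse_ex[of ?T ?e, OF _ ee] by blast
  then show ?thesis by blast
qed

lemma kten_X_same:
  assumes "1 \<le> n" "n \<le> t"
  shows "is_dsum (kten (Xm 1 n \<eta>) (Xm 1 t \<eta>)) (kten P0m (Sn 1 ({..<n} \<times> {..<t - 1}))) (xsum (Xm 1 n \<eta>) (Xm (-1) n \<eta>))"
proof -
  \<comment> \<open>With the factors read as C[x]/x^n and C[x]/x^t, \<open>\<psi>\<close> takes the
    coefficient of x^(t-1) in the second factor and \<open>\<Delta>\<close> is multiplication into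
    C[x]/x^n.\<close>
  define \<psi> :: "(nat, nat \<times> nat) fm" where "\<psi> = pm ({..<n} \<times> {t - 1}) fst"
  define \<Delta> :: "(nat, nat \<times> nat) fm" where "\<Delta> = pm {x \<in> {..<n} \<times> {..<t}. fst x + snd x < n} (\<lambda>x. fst x + snd x)"
  define s1 :: "(nat \<times> nat, nat) fm" where "s1 = pm {..<n} (\<lambda>k. (k, t - 1))"
  define s2 :: "(nat \<times> nat, nat) fm" where "s2 = pm {..<n} (\<lambda>k. (k, 0))"
  obtain q where q: "q \<diamondop> ((sh n \<boxtimes> idn t - idn n \<boxtimes> sh t) \<diamondop> (idn n \<boxtimes> idn (t - 1))) = idn n \<boxtimes> idn (t - 1)"
    using left_inverse_same[OF assms(2)] by blast
  have fin: "idn n \<diamondop> \<psi> = \<psi>" "\<psi> \<diamondop> (idn n \<boxtimes> idn t) = \<psi>" "idn n \<diamondop> \<Delta> = \<Delta>" "\<Delta> \<diamondop> (idn n \<boxtimes> idn t) = \<Delta>"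
    "\<psi> \<diamondop> s1 = idn n" "\<Delta> \<diamondop> s2 = idn n" "(idn n \<boxtimes> idn t) \<diamondop> s1 = s1" "(idn n \<boxtimes> idn t) \<diamondop> s2 = s2"
    unfolding krn_idn using assms by (auto simp: \<psi>_def \<Delta>_def s1_def s2_def dg_pm pm_mm intro!: pm_cong)
  have k: "\<psi> \<diamondop> (idn n \<boxtimes> idn (t - 1)) = 0"
    unfolding krn_idn by (rule fm_eqI) (auto simp: ent_mm_dg \<psi>_def ent_pm)
  have c: "\<psi> \<diamondop> (sh n \<boxtimes> idn t) = sh n \<diamondop> \<psi>" "\<Delta> \<diamondop> (sh n \<boxtimes> idn t) = sh n \<diamondop> \<Delta>" "\<Delta> \<diamondop> (idn n \<boxtimes> sh t) = sh n \<diamondop> \<Delta>"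
    unfolding sh_krn unfolding sh_def \<psi>_def \<Delta>_def using assms by (auto simp: pm_mm intro!: pm_cong)
  have main: "is_dsum (kten (Xm 1 n (Finite l)) (Xm 1 t (Finite l))) (kten P0m (Sn 1 ({..<n} \<times> {..<t - 1})))
    (xsum (Xm 1 n (Finite l)) (Xm (-1) n (Finite l)))" for l
    unfolding Xm_def XB.simps
  proof (rule kten_regular_same[where \<psi> = \<psi> and \<Delta> = \<Delta> and ?s1.0 = s1 and ?s2.0 = s2 and q = q])
    show "pencil n n (XA n (Finite l)) (idn n)" "pencil t t (XA t (Finite l)) (idn t)"
      using pencil_X[of n "Finite l"] pencil_X[of t "Finite l"] by simp_all
    show "q \<diamondop> ((XA n (Finite l) \<boxtimes> idn t - idn n \<boxtimes> XA t (Finite l)) \<diamondop> (idn n \<boxtimes> idn (t - 1))) = idn n \<boxtimes> idn (t - 1)"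
      using q by (simp add: krn_alg)
  qed (use assms fin k c in \<open>simp_all add: fm_alg krn_alg\<close>)
  show ?thesis
  proof (cases \<eta>)
    case Infinity
    \<comment> \<open>Infinity is obtained from the parameter 0 by exchanging xi_1 and xi_2.\<close>
    have e: "sw (Xm s n (Finite 0)) = Xm s n Infinity" for s n by (simp add: Xm_def sw_Kr)
    have "sw (Sn s I) = Sn s I" for s and I :: "(nat \<times> nat) set" by (simp add: sw_def Sn_def)
    with is_dsum_sw[OF main[of 0]] have d: "is_dsum (kten (Xm 1 n \<eta>) (Xm 1 t \<eta>)) (kten (sw P0m) (Sn 1 ({..<n} \<times> {..<t - 1}))) (xsum (Xm 1 n \<eta>) (Xm (-1) n \<eta>))"
      by (simp add: sw_kten sw_xsum e Infinity)
    have v: "vmod (Sn 1 ({..<n} \<times> {..<t - 1}))" "vmod (kten (Xm 1 n \<eta>) (Xm 1 t \<eta>))" "vmod (xsum (Xm 1 n \<eta>) (Xm (-1) n \<eta>))"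
      by (auto intro!: vmod_Sn vmod_kten vmod_std vmod_xsum)
    show ?thesis
      by (rule is_dsum_cong[OF d kiso_refl[OF v(2)] kiso_kten[OF kiso_sym[OF kiso_sw_P0m] kiso_refl[OF v(1)]] kiso_refl[OF v(3)]])
  qed (use main in simp)
qed

lemma kten_X_diff:
  assumes "\<eta> \<noteq> \<alpha>" "\<eta> \<noteq> Infinity"
  shows "is_dsum (kten (Xm 1 n \<eta>) (Xm 1 t \<alpha>)) (kten P0m (Sn 1 ({..<n} \<times> {..<t}))) zmod"
proof -
  obtain l where l: "\<eta> = Finite l" using assms(2) by (cases \<eta>) auto
  have "\<exists>q. q \<diamondop> (XA n \<eta> \<boxtimes> XB t \<alpha> - XB n \<eta> \<boxtimes> XA t \<alpha>) = idn n \<boxtimes> idn t"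
  proof (cases \<alpha>)
    case (Finite m)
    then show ?thesis using left_inverse_diff[of "l - m" n t 1 "-1" 0] l assms(1)
      by (auto simp: krn_alg fm_alg sc_minus_l sc_diff_l algebra_simps)
  next
    case Infinity
    then show ?thesis using left_inverse_diff[of "-1" n t 0 l 1] l
      by (auto simp: krn_alg fm_alg sc_minus_l algebra_simps)
  qed
  then obtain q where "q \<diamondop> (XA n \<eta> \<boxtimes> XB t \<alpha> - XB n \<eta> \<boxtimes> XA t \<alpha>) = idn n \<boxtimes> idn t" by blast
  from kten_regular_diff[OF pencil_X pencil_X this] show ?thesis unfolding Xm_def .
qed

section \<open>Kronecker's theorem: a nonzero pencil has a standard summand\<close>

section \<open>Kronecker pencils\<close>

text \<open>The \<open>f k\<close> are the coefficients of a polynomial vector f(x) of degree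
  \<open>d\<close> with (A - x B) f(x) = 0.\<close>

definition chain :: "nat \<Rightarrow> (nat, nat) fm \<Rightarrow> (nat, nat) fm \<Rightarrow> nat \<Rightarrow> (nat \<Rightarrow> (nat, unit) fm) \<Rightarrow> bool" where
  "chain u A B d f \<longleftrightarrow> (\<forall>k. idn u \<diamondop> f k = f k) \<and> A \<diamondop> f 0 = 0 \<and> (\<forall>k. A \<diamondop> f (Suc k) = B \<diamondop> f k) \<and>
     (\<forall>k>d. f k = 0) \<and> f d \<noteq> 0"

lemma ent_mm_idn: "idn u \<diamondop> v = v \<Longrightarrow> ent (A \<diamondop> v) i j = (\<Sum>k<u. ent A i k * ent v k j)"
  by (rule ent_mm) (auto simp: dg_l)

text \<open>A singular matrix over the domain C[x] kills a nonzero polynomial vector, whose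
  coefficients form the chain.\<close>

lemma poly_matrix_kernel:
  assumes det: "det (mat n n (\<lambda>(i, j). [:ent A i j, - ent B i j:])) = (0 :: complex poly)" and p: "pencil n n A B"
  shows "\<exists>d f. chain n A B d f"
proof -
  let ?M = "mat n n (\<lambda>(i, j). [:ent A i j, - ent B i j:])"
  have M: "?M \<in> carrier_mat n n" by simp
  from det_0_iff_vec_prod_zero[OF M] det obtain v where v: "v \<in> carrier_vec n" "v \<noteq> 0\<^sub>v n" "?M *\<^sub>v v = 0\<^sub>v n" by blast
  have row: "(\<Sum>j<n. [:ent A i j, - ent B i j:] * v $ j) = 0" if "i < n" for i
    using arg_cong[OF v(3), of "\<lambda>w. vec_index w i"] that v(1) by (simp add: scalar_prod_def atLeast0LessThan row_def)
  define f where "f k = (mk {..<n} UNIV (\<lambda>j _. coeff (v $ j) k) :: (nat, unit) fm)" for k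
  have ent_f: "ent (f k) j l = (if j < n then coeff (v $ j) k else 0)" for k j l
    by (simp add: f_def ent_mk)
  have idf: "idn n \<diamondop> f k = f k" for k by (simp add: dg_l ent_f)
  have zrow: "ent A i j = 0" "ent B i j = 0" if "\<not> i < n" for i j
    using p that by (auto simp: pencil_def dg_l)
  have co: "coeff ([:a, b:] * q) k = a * coeff q k + (if k = 0 then 0 else b * coeff q (k - 1))" for a b and q :: "complex poly" and k
    by (cases k) (simp_all add: coeff_pCons)
  have eq: "(\<Sum>j<n. ent A i j * coeff (v $ j) k) = (if k = 0 then 0 else (\<Sum>j<n. ent B i j * coeff (v $ j) (k - 1)))" for i k
  proof (cases "i < n")
    case True
    have "(\<Sum>j<n. coeff ([:ent A i j, - ent B i j:] * v $ j) k) = 0"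
      using arg_cong[OF row[OF True], of "\<lambda>p. coeff p k"] by (simp only: coeff_sum coeff_0)
    then show ?thesis unfolding co by (cases k) (simp_all add: sum.distrib sum_negf sum_subtractf)
  qed (simp add: zrow)
  have eA: "ent (A \<diamondop> f k) i l = (\<Sum>j<n. ent A i j * coeff (v $ j) k)" "ent (B \<diamondop> f k) i l = (\<Sum>j<n. ent B i j * coeff (v $ j) k)" for k i l
    by (simp_all add: ent_mm_idn[OF idf] ent_f)
  have "f 0 \<noteq> 0 \<or> (\<exists>k. f k \<noteq> 0)"
  proof -
    obtain j where j: "j < n" "v $ j \<noteq> 0" using v(1,2) by (metis carrier_vecD eq_vecI index_zero_vec)
    then obtain k where "coeff (v $ j) k \<noteq> 0" by (metis leading_coeff_0_iff)
    then have "ent (f k) j () \<noteq> 0" using j by (simp add: ent_f)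
    then show ?thesis by (metis lookup_zero)
  qed
  then obtain k0 where k0: "f k0 \<noteq> 0" by blast
  define D where "D = Max (insert 0 ((\<lambda>j. degree (v $ j)) ` {..<n}))"
  have big: "f k = 0" if "k > D" for k
  proof (rule fm_eqI)
    fix j l
    have "degree (v $ j) < k" if "j < n" using that \<open>k > D\<close> unfolding D_def by (subst (asm) Max_less_iff) auto
    then show "ent (f k) j l = ent 0 j l" by (auto simp: ent_f coeff_eq_0)
  qed
  define d where "d = Max {k. f k \<noteq> 0}"
  have "{k. f k \<noteq> 0} \<subseteq> {..D}" using big by (auto simp flip: not_less)
  then have fin: "finite {k. f k \<noteq> 0}" by (rule finite_subset) simp
  have "f d \<noteq> 0" using Max_in[OF fin] k0 unfolding d_def by blast
  moreover have "f k = 0" if "k > d" for k using Max_ge[OF fin, of k] that unfolding d_def by fastforce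
  moreover have "A \<diamondop> f 0 = 0" "A \<diamondop> f (Suc k) = B \<diamondop> f k" for k
    by (rule fm_eqI, simp add: eA eq)+
  ultimately show ?thesis unfolding chain_def using idf by blast
qed

text \<open>If every A - c B is singular, then det(A - x B) has every complex number as a root, so
  it is the zero polynomial.\<close>

lemma pencil_dichotomy:
  assumes p: "pencil n n A B"
  shows "(\<exists>d f. chain n A B d f) \<or> (\<exists>c G. G \<diamondop> (A - sc c B) = idn n \<and> idn n \<diamondop> G = G)"
proof (rule disjCI)
  assume nr: "\<nexists>c G. G \<diamondop> (A - sc c B) = idn n \<and> idn n \<diamondop> G = G"
  let ?M = "mat n n (\<lambda>(i, j). [:ent A i j, - ent B i j:])"
  have "poly (det ?M) c = 0" for c
  proof -
    have h: "comm_ring_hom (\<lambda>p. poly p c)" by (unfold_locales) auto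
    let ?N = "mat n n (\<lambda>(i, j). ent A i j - c * ent B i j)"
    have "poly (det ?M) c = det (map_mat (\<lambda>p. poly p c) ?M)" by (rule comm_ring_hom.hom_det[OF h, symmetric])
    also have "map_mat (\<lambda>p. poly p c) ?M = ?N" by (rule eq_matI) auto
    also have "det ?N = 0"
    proof (rule ccontr)
      assume d: "det ?N \<noteq> 0"
      have "x = 0" if x: "idn n \<diamondop> x = x" "(A - sc c B) \<diamondop> x = 0" for x :: "(nat, unit) fm"
      proof -
        let ?v = "vec n (\<lambda>j. ent x j ())"
        have "?N *\<^sub>v ?v = 0\<^sub>v n"
        proof (rule eq_vecI)
          fix i assume i: "i < dim_vec (0\<^sub>v n)"
          have "ent ((A - sc c B) \<diamondop> x) i () = 0" unfolding x(2) by simp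
          then show "(?N *\<^sub>v ?v) $ i = 0\<^sub>v n $ i" using i
            by (simp add: ent_mm_idn[OF x(1)] lookup_minus ent_sc scalar_prod_def atLeast0LessThan row_def)
        qed simp
        then have N0: "?N *\<^sub>v ?v = 0\<^sub>v n" .
        have "?v = 0\<^sub>v n"
        proof (rule ccontr)
          assume "?v \<noteq> 0\<^sub>v n"
          then have "\<exists>v. v \<in> carrier_vec n \<and> v \<noteq> 0\<^sub>v n \<and> ?N *\<^sub>v v = 0\<^sub>v n" by (intro exI[of _ ?v] conjI N0) auto
          then show False using det_0_iff_vec_prod_zero[of ?N n] d by simp
        qed
        then have "ent x j () = 0" if "j < n" for j using that by (metis index_vec index_zero_vec(1))
        moreover have "ent x j () = 0" if "\<not> j < n" for j using x(1) that by (auto simp: dg_l)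
        ultimately show "x = 0" by (intro fm_eqI) (metis lookup_zero unit.exhaust)
      qed
      moreover have "(A - sc c B) \<diamondop> idn n = A - sc c B" "idn n \<diamondop> idn n = idn n"
        by (simp_all add: fm_alg pencil_eqs[OF p] idn_idn)
      ultimately have "\<exists>G. G \<diamondop> (A - sc c B) = idn n \<and> idn n \<diamondop> G = G" using left_inverse_ex[of "A - sc c B" "idn n"] by blast
      then show False using nr by blast
    qed
    finally show ?thesis .
  qed
  then have "det ?M = 0" by (simp add: poly_all_0_iff_0[symmetric])
  then show "\<exists>d f. chain n A B d f" by (rule poly_matrix_kernel[OF _ p])
qed

definition psplit :: "nat \<Rightarrow> nat \<Rightarrow> (nat, nat) fm \<Rightarrow> (nat, nat) fm \<Rightarrow> nat \<Rightarrow> nat \<Rightarrow> (nat, nat) fm \<Rightarrow> (nat, nat) fm \<Rightarrow> bool" where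
  "psplit u w A B u0 w0 A0 B0 \<longleftrightarrow> (\<exists>iU iW rU rW. idn u \<diamondop> iU = iU \<and> iU \<diamondop> idn u0 = iU \<and> idn w \<diamondop> iW = iW \<and> iW \<diamondop> idn w0 = iW \<and>
    idn u0 \<diamondop> rU = rU \<and> rU \<diamondop> idn u = rU \<and> idn w0 \<diamondop> rW = rW \<and> rW \<diamondop> idn w = rW \<and>
    rU \<diamondop> iU = idn u0 \<and> rW \<diamondop> iW = idn w0 \<and> A \<diamondop> iU = iW \<diamondop> A0 \<and> B \<diamondop> iU = iW \<diamondop> B0 \<and>
    A0 \<diamondop> rU = rW \<diamondop> A \<and> B0 \<diamondop> rU = rW \<diamondop> B)"

lemma psplit_tp: assumes "psplit u w A B u0 w0 A0 B0" shows "psplit w u (tp A) (tp B) w0 u0 (tp A0) (tp B0)"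
proof -
  from assms obtain iU iW rU rW where h: "idn u \<diamondop> iU = iU" "iU \<diamondop> idn u0 = iU" "idn w \<diamondop> iW = iW" "iW \<diamondop> idn w0 = iW"
    "idn u0 \<diamondop> rU = rU" "rU \<diamondop> idn u = rU" "idn w0 \<diamondop> rW = rW" "rW \<diamondop> idn w = rW"
    "rU \<diamondop> iU = idn u0" "rW \<diamondop> iW = idn w0" "A \<diamondop> iU = iW \<diamondop> A0" "B \<diamondop> iU = iW \<diamondop> B0"
    "A0 \<diamondop> rU = rW \<diamondop> A" "B0 \<diamondop> rU = rW \<diamondop> B" unfolding psplit_def by blast
  note t = h[THEN arg_cong[of _ _ tp], unfolded tp_mm]
  show ?thesis unfolding psplit_def
    by (rule exI[of _ "tp rW"], rule exI[of _ "tp rU"], rule exI[of _ "tp iW"], rule exI[of _ "tp iU"])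
       (use t in \<open>simp add: tp_dg\<close>)
qed

lemma psplit_trans: assumes "psplit u w A B u0 w0 A0 B0" "psplit u0 w0 A0 B0 u1 w1 A1 B1" shows "psplit u w A B u1 w1 A1 B1"
proof -
  from assms(1) obtain iU iW rU rW where h: "idn u \<diamondop> iU = iU" "iU \<diamondop> idn u0 = iU" "idn w \<diamondop> iW = iW" "iW \<diamondop> idn w0 = iW"
    "idn u0 \<diamondop> rU = rU" "rU \<diamondop> idn u = rU" "idn w0 \<diamondop> rW = rW" "rW \<diamondop> idn w = rW"
    "rU \<diamondop> iU = idn u0" "rW \<diamondop> iW = idn w0" "A \<diamondop> iU = iW \<diamondop> A0" "B \<diamondop> iU = iW \<diamondop> B0"
    "A0 \<diamondop> rU = rW \<diamondop> A" "B0 \<diamondop> rU = rW \<diamondop> B" unfolding psplit_def by blast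
  from assms(2) obtain jU jW sU sW where k: "idn u0 \<diamondop> jU = jU" "jU \<diamondop> idn u1 = jU" "idn w0 \<diamondop> jW = jW" "jW \<diamondop> idn w1 = jW"
    "idn u1 \<diamondop> sU = sU" "sU \<diamondop> idn u0 = sU" "idn w1 \<diamondop> sW = sW" "sW \<diamondop> idn w0 = sW"
    "sU \<diamondop> jU = idn u1" "sW \<diamondop> jW = idn w1" "A0 \<diamondop> jU = jW \<diamondop> A1" "B0 \<diamondop> jU = jW \<diamondop> B1"
    "A1 \<diamondop> sU = sW \<diamondop> A0" "B1 \<diamondop> sU = sW \<diamondop> B0" unfolding psplit_def by blast
  note r1 = h(1-10) h(1-10)[THEN mm_asc] k(1-10) k(1-10)[THEN mm_asc]
  have e: "A \<diamondop> (iU \<diamondop> jU) = iW \<diamondop> (jW \<diamondop> A1)" "B \<diamondop> (iU \<diamondop> jU) = iW \<diamondop> (jW \<diamondop> B1)"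
    "A1 \<diamondop> (sU \<diamondop> rU) = sW \<diamondop> (rW \<diamondop> A)" "B1 \<diamondop> (sU \<diamondop> rU) = sW \<diamondop> (rW \<diamondop> B)"
    using h(11,12)[THEN mm_asc, of jU] k(13,14)[THEN mm_asc, of rU] by (simp_all add: mm_assoc k(11,12) h(13,14))
  show ?thesis unfolding psplit_def
    by (rule exI[of _ "iU \<diamondop> jU"], rule exI[of _ "iW \<diamondop> jW"], rule exI[of _ "sU \<diamondop> rU"], rule exI[of _ "sW \<diamondop> rW"])
       (simp add: mm_assoc e r1)
qed

subsection \<open>Singular pencils\<close>

text \<open>The only obstruction to prescribing a functional on \<open>Z\<close> while it kills
  \<open>Y\<close> is a relation between their columns on which \<open>b\<close> does not vanish.
  Projecting away the image of \<open>Y\<close> reduces this to \<open>fredholm\<close>.\<close>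

lemma fredholm2:
  fixes Y :: "('i, 'j) fm" and Z :: "('i, 'k) fm" and b :: "('u, 'k) fm"
  assumes "\<And>v v' :: (_, unit) fm. Y \<diamondop> v + Z \<diamondop> v' = 0 \<Longrightarrow> b \<diamondop> v' = 0"
  shows "\<exists>g. g \<diamondop> Y = 0 \<and> g \<diamondop> Z = b"
proof -
  obtain G where G: "Y \<diamondop> (G \<diamondop> Y) = Y" using pseudo_inverse by blast
  obtain R T where S: "finite R" "dg R \<diamondop> Y = Y" "finite T" "dg T \<diamondop> Z = Z" using dg_ex(1) by metis
  have U: "dg (R \<union> T) \<diamondop> Y = Y" "dg (R \<union> T) \<diamondop> Z = Z" using S by (auto simp: dg_l)
  have "b \<diamondop> v = 0" if "(Z - Y \<diamondop> G \<diamondop> Z) \<diamondop> v = 0" for v :: "('k, unit) fm"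
    using assms[of "- (G \<diamondop> (Z \<diamondop> v))" v] that by (simp add: fm_alg)
  then obtain g where g: "g \<diamondop> (Z - Y \<diamondop> G \<diamondop> Z) = b" using fredholm by blast
  show ?thesis
    by (rule exI[of _ "g \<diamondop> (dg (R \<union> T) - Y \<diamondop> G)"]) (use g in \<open>simp add: fm_alg U G\<close>)
qed

definition minimal_chain :: "nat \<Rightarrow> (nat, nat) fm \<Rightarrow> (nat, nat) fm \<Rightarrow> nat \<Rightarrow> (nat \<Rightarrow> (nat, unit) fm) \<Rightarrow> bool" where
  "minimal_chain u A B d f \<longleftrightarrow> chain u A B d f \<and> (\<forall>d' f'. chain u A B d' f' \<longrightarrow> d \<le> d')"

text \<open>Otherwise the largest index with a nonzero entry would be the degree of a shorter
  chain.\<close>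

lemma minimal_chain_zero:
  fixes F :: "nat \<Rightarrow> (nat, unit) fm"
  assumes "minimal_chain u A B d f" "\<And>k. idn u \<diamondop> F k = F k" "A \<diamondop> F 0 = 0" "\<And>k. A \<diamondop> F (Suc k) = B \<diamondop> F k" "\<And>k. k \<ge> d \<Longrightarrow> F k = 0"
  shows "F k = 0"
proof (rule ccontr)
  assume k: "F k \<noteq> 0"
  have "{k. F k \<noteq> 0} \<subseteq> {..d}" using assms(5)[OF less_imp_le] by (auto simp flip: not_less)
  then have fin: "finite {k. F k \<noteq> 0}" by (rule finite_subset) simp
  define m where "m = Max {k. F k \<noteq> 0}"
  have "F m \<noteq> 0" using Max_in[OF fin] k unfolding m_def by blast
  moreover have "F k = 0" if "k > m" for k using Max_ge[OF fin, of k] that unfolding m_def by fastforce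
  ultimately have "chain u A B m F" using assms(2-4) unfolding chain_def by blast
  then have "d \<le> m" using assms(1) unfolding minimal_chain_def by blast
  then show False using assms(5) \<open>F m \<noteq> 0\<close> by blast
qed

text \<open>A dual chain of functionals is a solution of a linear system, and minimality of the
  degree is exactly what makes the system solvable. It suffices to prescribe the pairings with i = 0
  or j = 0; the others follow along diagonals.\<close>

lemma minimal_chain_functionals:
  assumes m: "minimal_chain u A B d f" and p: "pencil u w A B" and d: "0 < d"
  shows "\<exists>g :: nat \<Rightarrow> (unit, nat) fm. (\<forall>i. g i \<diamondop> idn w = g i) \<and> (\<forall>i. Suc i < d \<longrightarrow> g i \<diamondop> A = g (Suc i) \<diamondop> B) \<and>
    (\<forall>i<d. \<forall>j<d. g i \<diamondop> (B \<diamondop> f j) = (if i = j then un () () else 0))"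
proof -
  have c: "idn u \<diamondop> f k = f k" "A \<diamondop> f 0 = 0" "A \<diamondop> f (Suc k) = B \<diamondop> f k" "k > d \<Longrightarrow> f k = 0" "f d \<noteq> 0" for k
    using m unfolding minimal_chain_def chain_def by auto
  note pe = pencil_eqs[OF p]
  \<comment> \<open>\<open>Y\<close> encodes the equations between neighbouring functionals. Column
    j < d of \<open>Z\<close> is the pairing of functional 0 with B \<open>f j\<close>, column d + i
    + 1 that of functional i + 1 with B \<open>f 0\<close>; only column 0 gets the value
    one.\<close>
  define Y :: "(nat \<times> nat, nat \<times> nat) fm" where "Y = (\<Sum>i<d - 1. un i i \<boxtimes> A - un (Suc i) i \<boxtimes> B)"
  define Z :: "(nat \<times> nat, nat) fm" where
    "Z = (\<Sum>j<d. lc 0 (B \<diamondop> f j) \<diamondop> un () j) + (\<Sum>i<d - 1. lc (Suc i) (B \<diamondop> f 0) \<diamondop> un () (d + Suc i))"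
  have "\<exists>g. g \<diamondop> Y = 0 \<and> g \<diamondop> Z = un () (0 :: nat)"
  proof (rule fredholm2)
    fix v :: "(nat \<times> nat, unit) fm" and v' :: "(nat, unit) fm"
    assume h: "Y \<diamondop> v + Z \<diamondop> v' = 0"
    define V where "V k = (if k < d - 1 then rc k (idn u) \<diamondop> v else 0)" for k
    define b where "b j = ent v' j ()" for j
    have unv: "un () j \<diamondop> v' = sc (b j) (un () ())" for j
      by (rule fm_eqI) (simp add: ent_un_mm ent_sc ent_un b_def)
    have uu: "z \<diamondop> un () () = z" for z :: "('z, unit) fm"
      by (rule fm_eqI) (simp add: ent_mm_un)
    have ru: "rc i A \<diamondop> v = A \<diamondop> (rc i (idn u) \<diamondop> v)" "rc i B \<diamondop> v = B \<diamondop> (rc i (idn u) \<diamondop> v)" for i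
      by (simp_all add: mm_assoc[symmetric] mm_rc pe)
    have row: "rc k (idn w) \<diamondop> (Y \<diamondop> v) + rc k (idn w) \<diamondop> (Z \<diamondop> v') = 0" for k
      using arg_cong[OF h, of "\<lambda>z. rc k (idn w) \<diamondop> z"] by (simp add: mm_add_r)
    have rY: "rc k (idn w) \<diamondop> (Y \<diamondop> v) = A \<diamondop> V k - (if k = 0 then 0 else B \<diamondop> V (k - 1))" for k
    proof -
      have "rc k (idn w) \<diamondop> (Y \<diamondop> v) = (\<Sum>i<d - 1. (if i = k then A \<diamondop> V k else 0) - (if Suc i = k then B \<diamondop> V (k - 1) else 0))"
        unfolding Y_def mm_sum_l mm_sum_r
        by (rule sum.cong) (auto simp: fm_alg rc_krn rc_krn[THEN mm_asc] pe ru V_def)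
      also have "\<dots> = A \<diamondop> V k - (if k = 0 then 0 else B \<diamondop> V (k - 1))"
        unfolding sum_subtractf by (cases k) (auto simp: V_def)
      finally show ?thesis .
    qed
    have rZ0: "rc 0 (idn w) \<diamondop> (Z \<diamondop> v') = (\<Sum>j<d. sc (b j) (B \<diamondop> f j))"
      unfolding Z_def by (simp add: mm_add_l mm_add_r mm_sum_l mm_sum_r mm_assoc unv mm_sc_r uu rc_lc pe)
    have rZ: "rc (Suc k) (idn w) \<diamondop> (Z \<diamondop> v') = (if Suc k < d then sc (b (d + Suc k)) (B \<diamondop> f 0) else 0)" for k
    proof -
      have "rc (Suc k) (idn w) \<diamondop> (Z \<diamondop> v') = (\<Sum>i<d - 1. sc (b (d + Suc i)) (rc (Suc k) (idn w) \<diamondop> lc (Suc i) (B \<diamondop> f 0)))"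
        unfolding Z_def mm_add_l mm_add_r mm_sum_l mm_sum_r mm_assoc unv mm_sc_r uu by (simp add: rc_lc)
      also have "\<dots> = (\<Sum>i<d - 1. if i = k then sc (b (d + Suc k)) (B \<diamondop> f 0) else 0)"
        by (rule sum.cong) (auto simp: rc_lc pe)
      finally have "rc (Suc k) (idn w) \<diamondop> (Z \<diamondop> v') = (\<Sum>i<d - 1. if i = k then sc (b (d + Suc k)) (B \<diamondop> f 0) else 0)" .
      then show ?thesis by (auto simp: less_diff_conv)
    qed
    \<comment> \<open>A relation between the columns of \<open>Y\<close> and \<open>Z\<close> is
      rewritten as a sequence satisfying the chain recurrence: the shifted copies of
      \<open>f\<close> absorb the terms of row 0, the multiples of \<open>f 0\<close> those of the
      later rows.\<close>
    define F where "F k = V k + (\<Sum>j<d. sc (b j) (f (Suc j + k))) - (if Suc k < d then sc (b (d + Suc k)) (f 0) else 0)" for k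
    have F0: "F k = 0" for k
    proof (rule minimal_chain_zero[OF m])
      show "idn u \<diamondop> F k = F k" for k
        by (simp add: F_def V_def fm_alg mm_sum_r c(1) idn_idn1 mm_rc[of "idn u"] mm_assoc[symmetric] idn_idn)
      show "A \<diamondop> F 0 = 0" using row[of 0]
        by (simp add: F_def fm_alg mm_sum_r rY rZ0 c(2,3))
      show "A \<diamondop> F (Suc k) = B \<diamondop> F k" for k
        using row[of "Suc k"] by (auto simp: F_def fm_alg mm_sum_r rY rZ c(2,3) algebra_simps eq_neg_iff_add_eq_0)
      show "F k = 0" if "k \<ge> d" for k
        using that by (auto simp: F_def V_def c(4))
    qed
    \<comment> \<open>At index d - 1 only b_0 \<open>f d\<close> survives, so the vanishing of
      \<open>F\<close> forces b_0 = 0.\<close>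
    have "(\<Sum>j<d. sc (b j) (f (Suc j + (d - 1)))) = (\<Sum>j\<in>{0}. sc (b j) (f (Suc j + (d - 1))))"
      by (rule sum.mono_neutral_right) (use d in \<open>auto simp: c(4)\<close>)
    then have "sc (b 0) (f d) = 0" using F0[of "d - 1"] d by (simp add: F_def V_def)
    then have "sc (1 / b 0) (sc (b 0) (f d)) = 0" by simp
    then have "b 0 = 0" using c(5) by (cases "b 0 = 0") (auto simp: sc_sc)
    then show "un () 0 \<diamondop> v' = 0" by (simp add: unv)
  qed
  then obtain G where G: "G \<diamondop> Y = 0" "G \<diamondop> Z = un () (0 :: nat)" by blast
  define g where "g i = G \<diamondop> lc i (idn w)" for i
  have ge: "g i \<diamondop> B = G \<diamondop> lc i B" "g i \<diamondop> A = G \<diamondop> lc i A" "g i \<diamondop> (B \<diamondop> z) = G \<diamondop> lc i (B \<diamondop> z)" for i and z :: "(nat, unit) fm"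
    by (simp_all add: g_def mm_assoc lc_mm pe)
  have gg: "g i \<diamondop> A = g (Suc i) \<diamondop> B" if "Suc i < d" for i
  proof -
    have "Y \<diamondop> lc i (idn u) = (\<Sum>k<d - 1. if k = i then lc i A - lc (Suc i) B else 0)"
      unfolding Y_def mm_sum_l by (rule sum.cong) (auto simp: mm_diff_l krn_lc pe)
    also have "\<dots> = lc i A - lc (Suc i) B" using that by (simp add: less_diff_conv)
    finally show ?thesis using G(1)[THEN mm_asc, of "lc i (idn u)"] by (simp add: ge mm_diff_r)
  qed
  have unun: "un () (j :: nat) \<diamondop> un j' () = (if j = j' then un () () else 0)" for j j' by (simp add: un_mm)
  have uu: "z \<diamondop> un () () = z" for z :: "('z, unit) fm" by (rule fm_eqI) (simp add: ent_mm_un)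
  have Z1: "Z \<diamondop> un j () = lc 0 (B \<diamondop> f j)" if "j < d" for j
  proof -
    have "Z \<diamondop> un j () = (\<Sum>k<d. if k = j then lc 0 (B \<diamondop> f j) else 0) + (\<Sum>i<d - 1. (0 :: (nat \<times> nat, unit) fm))"
      unfolding Z_def mm_add_l mm_sum_l
      by (intro arg_cong2[of _ _ _ _ "(+)"] sum.cong) (use that in \<open>auto simp: mm_assoc unun uu\<close>)
    then show ?thesis using that by simp
  qed
  have Z2: "Z \<diamondop> un (d + Suc i) () = lc (Suc i) (B \<diamondop> f 0)" if "Suc i < d" for i
  proof -
    have "Z \<diamondop> un (d + Suc i) () = (\<Sum>k<d. (0 :: (nat \<times> nat, unit) fm)) + (\<Sum>k<d - 1. if k = i then lc (Suc i) (B \<diamondop> f 0) else 0)"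
      unfolding Z_def mm_add_l mm_sum_l
      by (intro arg_cong2[of _ _ _ _ "(+)"] sum.cong) (use that in \<open>auto simp: mm_assoc unun uu\<close>)
    then show ?thesis using that by (simp add: less_diff_conv)
  qed
  have g0: "g 0 \<diamondop> (B \<diamondop> f j) = (if 0 = j then un () () else 0)" if "j < d" for j
    using G(2)[THEN mm_asc, of "un j ()"] by (simp add: ge Z1[OF that] unun)
  have gS: "g (Suc i) \<diamondop> (B \<diamondop> f 0) = 0" if "Suc i < d" for i
    using G(2)[THEN mm_asc, of "un (d + Suc i) ()"] by (simp add: ge Z2[OF that, simplified] unun)
  \<comment> \<open>The pairings are constant along diagonals: g_(i+1) B f_(j+1) = g_i A f_(j+1) =
    g_i B f_j.\<close>
  have "g i \<diamondop> (B \<diamondop> f j) = (if i = j then un () () else 0)" if "i < d" "j < d" for i j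
    using that
  proof (induction i arbitrary: j)
    case 0 then show ?case using g0 by simp
  next
    case (Suc i)
    show ?case
    proof (cases j)
      case 0 then show ?thesis using gS Suc by simp
    next
      case (Suc j')
      have "g (Suc i) \<diamondop> (B \<diamondop> f (Suc j')) = g i \<diamondop> (A \<diamondop> f (Suc j'))"
        using gg[of i] Suc.prems by (simp add: mm_assoc[symmetric])
      then show ?thesis using Suc.IH[of j'] Suc.prems Suc by (simp add: c(3))
    qed
  qed
  moreover have "g i \<diamondop> idn w = g i" for i by (simp add: g_def mm_assoc lc_mm idn_idn1)
  ultimately show ?thesis using gg by blast
qed

lemma tp_sh_sum: "tp (sh (Suc d)) = (\<Sum>j<d. un j (Suc j))"
proof (rule fm_eqI)
  fix i j
  have "ent (\<Sum>j<d. un j (Suc j)) i j = (\<Sum>k<d. if k = i then if j = Suc i then 1 else 0 else 0)"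
    unfolding lookup_sum by (rule sum.cong) (auto simp: ent_un)
  then show "ent (tp (sh (Suc d))) i j = ent (\<Sum>j<d. un j (Suc j)) i j"
    by (auto simp: ent_tp sh_def ent_pm)
qed
lemma idn_sum: "idn d = (\<Sum>j<d. un j j)"
proof (rule fm_eqI)
  fix i j
  have "ent (\<Sum>j<d. un j j) i j = (\<Sum>k<d. if k = i then if j = i then 1 else 0 else 0)"
    unfolding lookup_sum by (rule sum.cong) (auto simp: ent_un)
  then show "ent (idn d) i j = ent (\<Sum>j<d. un j j) i j" by (auto simp: ent_dg)
qed
lemma un_unit_r: "z \<diamondop> un () () = z" and un_unit_l: "un () () \<diamondop> z' = z'"
  by (rule fm_eqI, simp add: ent_mm_un ent_un_mm)+

lemma un_diag_sum:
  assumes "\<And>i j. i < n \<Longrightarrow> j < n \<Longrightarrow> h i \<diamondop> f j = (if i = j then un () () else 0)"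
  shows "(\<Sum>i<n. un i () \<diamondop> h i) \<diamondop> (\<Sum>j<n. f j \<diamondop> un () j) = idn n"
proof -
  have "(un i () \<diamondop> h i) \<diamondop> (f j \<diamondop> un () j) = (if i = j then un i i else 0)" if "i < n" "j < n" for i j
  proof -
    have "(un i () \<diamondop> h i) \<diamondop> (f j \<diamondop> un () j) = un i () \<diamondop> (h i \<diamondop> f j) \<diamondop> un () j" by (simp add: mm_assoc)
    also have "\<dots> = (if i = j then un i i else 0)" by (simp add: assms that un_mm un_unit_r)
    finally show ?thesis .
  qed
  then show ?thesis by (simp add: mm_sum_l mm_sum_r idn_sum)
qed

text \<open>The f_0, ..., f_d and B f_0, ..., B f_(d-1) span a subpencil of standard form. The
  functionals g_i, together with g_i B and finally g_(d-1) A, are coordinates that retract onto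
  it.\<close>

lemma minimal_chain_split:
  assumes m: "minimal_chain u A B d f" and p: "pencil u w A B"
  shows "psplit u w A B (Suc d) d (tp (sh (Suc d))) (idn d)"
proof -
  have c: "idn u \<diamondop> f k = f k" "A \<diamondop> f 0 = 0" "A \<diamondop> f (Suc k) = B \<diamondop> f k" "B \<diamondop> f d = 0" "f d \<noteq> 0" for k
    using m unfolding minimal_chain_def chain_def by (auto, metis lessI mm_zero_r)
  note pe = pencil_eqs[OF p]
  have "\<exists>(g :: nat \<Rightarrow> (unit, nat) fm) h. (\<forall>i. g i \<diamondop> idn w = g i) \<and> (\<forall>i<d. \<forall>j<d. g i \<diamondop> (B \<diamondop> f j) = (if i = j then un () () else 0)) \<and>
    (\<forall>i<d. h i = g i \<diamondop> B) \<and> (\<forall>i<d. h (Suc i) = g i \<diamondop> A) \<and> (\<forall>i\<le>d. h i \<diamondop> idn u = h i) \<and>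
    (\<forall>i\<le>d. \<forall>j\<le>d. h i \<diamondop> f j = (if i = j then un () () else 0))"
  proof (cases "d = 0")
    \<comment> \<open>In degree 0 the chain is a common kernel vector of both matrices, the target
      of the block is zero, and any functional equal to one on that vector serves.\<close>
    case True
    obtain h0 :: "(unit, nat) fm" where h0: "h0 \<diamondop> f 0 = un () ()" using row_functional c(5) True by blast
    have "(h0 \<diamondop> idn u) \<diamondop> f 0 = un () ()" by (simp add: mm_assoc c h0)
    then show ?thesis using True
      by (intro exI[of _ "\<lambda>_. 0"] exI[of _ "\<lambda>_. h0 \<diamondop> idn u"]) (auto simp: mm_assoc idn_idn1)
  next
    case False
    then obtain g :: "nat \<Rightarrow> (unit, nat) fm" where g: "\<And>i. g i \<diamondop> idn w = g i" "\<And>i. Suc i < d \<Longrightarrow> g i \<diamondop> A = g (Suc i) \<diamondop> B"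
      "\<And>i j. i < d \<Longrightarrow> j < d \<Longrightarrow> g i \<diamondop> (B \<diamondop> f j) = (if i = j then un () () else 0)"
      using minimal_chain_functionals[OF m p] by blast
    define h where "h i = (if i < d then g i \<diamondop> B else g (d - 1) \<diamondop> A)" for i
    have h: "h (Suc i) = g i \<diamondop> A" if "i < d" for i
      using that g(2)[of i] by (cases "Suc i < d") (auto simp: h_def dest: less_antisym)
    have "h i \<diamondop> f j = (if i = j then un () () else 0)" if ij: "i \<le> d" "j \<le> d" for i j
    proof (cases "i < d")
      case True
      then show ?thesis using g(3)[OF True, of j] ij c(4) by (cases "j < d") (auto simp: h_def mm_assoc)
    next
      case f: False
      then have "i = d" "h i = g (d - 1) \<diamondop> A" using ij by (auto simp: h_def)
      then show ?thesis using g(3)[of "d - 1" "j - 1"] c(2) c(3)[of "j - 1"] ij False by (cases j) (auto simp: mm_assoc)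
    qed
    moreover have "h i \<diamondop> idn u = h i" for i by (simp add: h_def mm_assoc pe)
    moreover have "\<forall>i<d. h i = g i \<diamondop> B" by (simp add: h_def)
    ultimately show ?thesis using g h by blast
  qed
  then obtain g :: "nat \<Rightarrow> (unit, nat) fm" and h where gh: "\<forall>i. g i \<diamondop> idn w = g i"
    "\<forall>i<d. \<forall>j<d. g i \<diamondop> (B \<diamondop> f j) = (if i = j then un () () else 0)"
    "\<forall>i<d. h i = g i \<diamondop> B" "\<forall>i<d. h (Suc i) = g i \<diamondop> A" "\<forall>i\<le>d. h i \<diamondop> idn u = h i"
    "\<forall>i\<le>d. \<forall>j\<le>d. h i \<diamondop> f j = (if i = j then un () () else 0)"
    by (elim exE conjE) (rule that; assumption)
  note g = gh(1,2)[rule_format] and h = gh(3-6)[rule_format]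
  define iU where "iU = (\<Sum>j<Suc d. f j \<diamondop> un () j)"
  define iW where "iW = (\<Sum>j<d. (B \<diamondop> f j) \<diamondop> un () j)"
  define rU where "rU = (\<Sum>j<Suc d. un j () \<diamondop> h j)"
  define rW where "rW = (\<Sum>j<d. un j () \<diamondop> g j)"
  have 1: "rU \<diamondop> iU = idn (Suc d)" "rW \<diamondop> iW = idn d"
    unfolding rU_def iU_def rW_def iW_def by (rule un_diag_sum; simp add: h g)+
  have 2: "A \<diamondop> iU = iW \<diamondop> tp (sh (Suc d))"
  proof -
    have "A \<diamondop> iU = (\<Sum>j<d. B \<diamondop> f j \<diamondop> un () (Suc j))"
      unfolding iU_def sum.lessThan_Suc_shift by (simp add: mm_add_r mm_sum_r mm_assoc[symmetric] c)
    also have "\<dots> = iW \<diamondop> tp (sh (Suc d))"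
      unfolding iW_def tp_sh_sum by (auto simp: mm_sum_l mm_sum_r mm_assoc un_mm if_distrib[of "\<lambda>z. _ \<diamondop> z"] cong: if_cong intro!: sum.cong)
    finally show ?thesis .
  qed
  have 3: "B \<diamondop> iU = iW \<diamondop> idn d" "iW \<diamondop> idn d = iW"
    unfolding iU_def iW_def by (simp_all add: mm_add_r mm_sum_r mm_sum_l mm_assoc un_idn mm_asc[OF c(4)])
  have 4: "tp (sh (Suc d)) \<diamondop> rU = rW \<diamondop> A"
  proof -
    have "un k (Suc k) \<diamondop> rU = un k () \<diamondop> g k \<diamondop> A" if "k < d" for k
    proof -
      have "un k (Suc k) \<diamondop> rU = (\<Sum>j<Suc d. if j = Suc k then un k () \<diamondop> h j else 0)"
        unfolding rU_def mm_sum_r by (rule sum.cong) (auto simp: mm_assoc[symmetric] un_mm)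
      then have "un k (Suc k) \<diamondop> rU = un k () \<diamondop> h (Suc k)" using that by auto
      then show ?thesis by (simp only: h(2)[OF that] mm_assoc)
    qed
    then show ?thesis unfolding tp_sh_sum by (simp add: mm_sum_l rW_def)
  qed
  have 5: "idn d \<diamondop> rU = rW \<diamondop> B"
  proof -
    have "idn d \<diamondop> rU = (\<Sum>j<d. un j () \<diamondop> h j)"
      unfolding rU_def by (simp add: mm_add_r mm_sum_r mm_assoc[symmetric] idn_un)
    then show ?thesis by (simp add: rW_def mm_sum_l h mm_assoc)
  qed
  have 6: "idn u \<diamondop> iU = iU" "iU \<diamondop> idn (Suc d) = iU" "idn w \<diamondop> iW = iW"
    unfolding iU_def iW_def by (simp_all add: mm_sum_r mm_sum_l mm_assoc un_idn mm_asc[OF c(1)] pe del: sum.lessThan_Suc)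
  have 7: "idn (Suc d) \<diamondop> rU = rU" "rU \<diamondop> idn u = rU" "idn d \<diamondop> rW = rW" "rW \<diamondop> idn w = rW"
    unfolding rU_def rW_def by (simp_all add: mm_sum_r mm_sum_l mm_assoc[symmetric] idn_un del: sum.lessThan_Suc)
      (simp_all add: mm_assoc h g)
  show ?thesis unfolding psplit_def using 1 2 3 4 5 6 7 by blast
qed

subsection \<open>Regular pencils\<close>

definition to_fm :: "complex mat \<Rightarrow> (nat, nat) fm" where
  "to_fm M = mk {..<dim_row M} {..<dim_col M} (\<lambda>i j. M $$ (i, j))"
lemma ent_to_fm: "ent (to_fm M) i j = (if i < dim_row M \<and> j < dim_col M then M $$ (i, j) else 0)"
  by (auto simp: to_fm_def ent_mk)
lemma to_fm_mult: assumes "dim_col M = dim_row N" shows "to_fm (M * N) = to_fm M \<diamondop> to_fm N"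
proof (rule fm_eqI)
  fix i j
  have "ent (to_fm M \<diamondop> to_fm N) i j = (\<Sum>k<dim_row N. ent (to_fm M) i k * ent (to_fm N) k j)"
    by (rule ent_mm) (auto simp: ent_to_fm split: if_split_asm)
  then show "ent (to_fm (M * N)) i j = ent (to_fm M \<diamondop> to_fm N) i j"
    using assms by (auto simp: ent_to_fm scalar_prod_def atLeast0LessThan intro!: sum.cong)
qed
lemma to_fm_one: "to_fm (1\<^sub>m n) = idn n"
  by (rule fm_eqI) (auto simp: ent_to_fm ent_dg)

text \<open>Only the first Jordan block is used; its coordinates give the inclusion and the
  retraction.\<close>

lemma jordan_summand:
  assumes n: "1 \<le> n" and T: "idn n \<diamondop> T = T" "T \<diamondop> idn n = T"
  shows "\<exists>m \<mu> i r. 1 \<le> m \<and> idn n \<diamondop> i = i \<and> i \<diamondop> idn m = i \<and> idn m \<diamondop> r = r \<and> r \<diamondop> idn n = r \<and> r \<diamondop> i = idn m \<and>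
    T \<diamondop> i = i \<diamondop> (sc \<mu> (idn m) + sh m) \<and> (sc \<mu> (idn m) + sh m) \<diamondop> r = r \<diamondop> T"
proof -
  \<comment> \<open>The transpose is put into Jordan form, because \<open>jordan_block\<close> has
    its ones above the diagonal and \<open>sh\<close> below it.\<close>
  define M where "M = mat n n (\<lambda>(i, j). ent T j i)"
  have M: "M \<in> carrier_mat n n" by (simp add: M_def)
  have MT: "to_fm M = tp T"
    using T by (intro fm_eqI) (auto simp: ent_to_fm M_def ent_tp dg_l dg_r)
  from char_poly_factorized[OF M] obtain as where "char_poly M = (\<Prod>a\<leftarrow>as. [:- a, 1:])" by blast
  from jordan_nf_exists[OF M this] obtain nas where nas: "0 \<notin> fst ` set nas" "similar_mat M (jordan_matrix nas)"
    unfolding jordan_nf_def by blast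
  from nas(2) obtain P Q where w: "similar_mat_wit M (jordan_matrix nas) P Q" unfolding similar_mat_def by blast
  let ?J = "jordan_matrix nas"
  from w M have c: "?J \<in> carrier_mat n n" "P \<in> carrier_mat n n" "Q \<in> carrier_mat n n" "P * Q = 1\<^sub>m n" "Q * P = 1\<^sub>m n" "M = P * ?J * Q"
    unfolding similar_mat_wit_def Let_def by auto
  obtain m a rest where ma: "nas = (m, a) # rest" using c(1) n by (cases nas) (auto simp: jordan_matrix_def)
  have m: "1 \<le> m" using nas(1) ma by (cases m) auto
  have sl: "sum_list (map fst nas) = n" using c(1) by (metis carrier_matD(1) jordan_matrix_dim(1))
  define L where "L = sum_list (map fst rest)"
  have nL: "n = m + L" using sl by (simp add: ma L_def)
  have J: "?J = four_block_mat (jordan_block m a) (0\<^sub>m m L) (0\<^sub>m L m) (jordan_matrix rest)"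
    unfolding ma L_def by (rule jordan_matrix_Cons)
  have dr: "dim_row (jordan_matrix rest) = L" "dim_col (jordan_matrix rest) = L" by (simp_all add: L_def)
  define Pf Qf Jf where "Pf = to_fm P" "Qf = to_fm Q" "Jf = to_fm ?J"
  define Jb where "Jb = sc a (idn m) + tp (sh m)"
  have ed: "tp T = Pf \<diamondop> (Jf \<diamondop> Qf)" "Qf \<diamondop> Pf = idn n"
  proof -
    have "to_fm M = to_fm P \<diamondop> to_fm ?J \<diamondop> to_fm Q" unfolding c(6)
      using to_fm_mult[of "P * ?J" Q] to_fm_mult[of P ?J] c(1-3) sl by (simp del: assoc_mult_mat)
    then show "tp T = Pf \<diamondop> (Jf \<diamondop> Qf)" by (simp add: MT Pf_Qf_Jf_def mm_assoc)
    have "to_fm (Q * P) = to_fm Q \<diamondop> to_fm P" using c(1-3) by (simp add: to_fm_mult)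
    then show "Qf \<diamondop> Pf = idn n" by (simp add: c(5) to_fm_one Pf_Qf_Jf_def)
  qed
  have eJ: "Jf \<diamondop> idn m = Jb" "idn m \<diamondop> Jf = Jb"
    by (rule fm_eqI, auto simp: Pf_Qf_Jf_def ent_mm_dg ent_dg_mm ent_to_fm J dr Jb_def lookup_add ent_sc ent_dg ent_tp sh_def ent_pm simp del: jordan_matrix_dim)+
  have mn: "idn m \<diamondop> idn n = idn m" "idn n \<diamondop> idn m = idn m" using nL by (simp_all add: idn_idn)
  have PQ: "idn n \<diamondop> Pf = Pf" "Qf \<diamondop> idn n = Qf" using c(2,3) by (auto simp: dg_l dg_r Pf_Qf_Jf_def ent_to_fm split: if_split_asm)
  define i' where "i' = Pf \<diamondop> idn m"
  define r' where "r' = idn m \<diamondop> Qf"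
  have tps: "idn m \<diamondop> tp (sh m) = tp (sh m)" "tp (sh m) \<diamondop> idn m = tp (sh m)"
    using idn_sh_idn[of m, THEN arg_cong[of _ _ tp]] by (simp_all add: tp_mm tp_dg)
  have Jbm: "idn m \<diamondop> Jb = Jb" "Jb \<diamondop> idn m = Jb" by (simp_all add: Jb_def fm_alg idn_idn1 tps)
  have e1: "r' \<diamondop> i' = idn m" by (simp add: r'_def i'_def mm_assoc mm_asc[OF ed(2)] mn idn_idn1)
  have e2: "tp T \<diamondop> i' = i' \<diamondop> Jb" by (simp add: i'_def ed(1) mm_assoc mm_asc[OF ed(2)] mn Jbm eJ(1))
  have e3: "r' \<diamondop> tp T = Jb \<diamondop> r'"
  proof -
    have "r' \<diamondop> tp T = idn m \<diamondop> (Jf \<diamondop> Qf)" unfolding r'_def ed(1) by (simp add: mm_assoc mm_asc[OF ed(2)] mm_asc[OF mn(1)])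
    also have "\<dots> = Jb \<diamondop> Qf" by (rule mm_asc[OF eJ(2)])
    finally show ?thesis by (simp add: r'_def mm_asc[OF Jbm(2)])
  qed
  have e: "tp i' \<diamondop> tp r' = idn m" "tp i' \<diamondop> T = tp Jb \<diamondop> tp i'" "T \<diamondop> tp r' = tp r' \<diamondop> tp Jb"
    using arg_cong[OF e1, of tp] arg_cong[OF e2, of tp] arg_cong[OF e3, of tp] by (simp_all add: tp_mm tp_dg)
  have b: "idn n \<diamondop> i' = i'" "i' \<diamondop> idn m = i'" "idn m \<diamondop> r' = r'" "r' \<diamondop> idn n = r'"
    by (simp_all add: i'_def r'_def mm_assoc idn_idn1 PQ mm_asc[OF PQ(1)])
  note b' = b[THEN arg_cong[of _ _ tp], unfolded tp_mm tp_dg[OF finite_lessThan]]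
  have "tp Jb = sc a (idn m) + sh m" by (simp add: Jb_def tp_add tp_sc tp_dg)
  then show ?thesis using m e b' by (intro exI[of _ m] exI[of _ a] exI[of _ "tp r'"] exI[of _ "tp i'"]) simp
qed

lemma ent_sh_mm: "ent (sh n \<diamondop> Z) i l = (if 0 < i \<and> i < n then ent Z (i - 1) l else 0)"
proof (cases "0 < i \<and> i < n")
  case True
  then show ?thesis using ent_pm_mm(1)[OF fin_sh[of n] inj_on_subset[OF inj_Suc subset_UNIV], of "i - 1" Z l] by (simp add: sh_def)
next
  case False
  then have "i \<notin> Suc ` {j. Suc j < n}" by auto
  from ent_pm_mm(2)[OF fin_sh inj_on_subset[OF inj_Suc subset_UNIV] this] show ?thesis by (simp only: sh_def False if_False)
qed

lemma triangular_inverse: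
  assumes "c \<noteq> 0"
  shows "\<exists>G. G \<diamondop> (sc c (idn n) + sc a (sh n)) = idn n \<and> (sc c (idn n) + sc a (sh n)) \<diamondop> G = idn n \<and> idn n \<diamondop> G = G \<and> G \<diamondop> idn n = G"
proof -
  let ?T = "sc c (idn n) + sc a (sh n)"
  have "x = 0" if x: "idn n \<diamondop> x = x" "?T \<diamondop> x = 0" for x :: "(nat, unit) fm"
  proof -
    have z: "c * ent x i l + a * ent (sh n \<diamondop> x) i l = 0" for i l
      using arg_cong[OF x(2), of "\<lambda>y. ent y i l"] x(1) by (simp add: fm_alg lookup_add ent_sc)
    have "ent x i l = 0" for i l
    proof (induction i)
      case 0 then show ?case using z[of 0 l] assms by (simp add: ent_sh_mm)
    next
      case (Suc i) then show ?case using z[of "Suc i" l] assms by (simp add: ent_sh_mm split: if_split_asm)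
    qed
    then show "x = 0" by (intro fm_eqI) simp
  qed
  moreover have T: "?T \<diamondop> idn n = ?T" "idn n \<diamondop> ?T = ?T" by (simp_all add: fm_alg idn_idn1 idn_sh_idn)
  ultimately obtain G where G: "G \<diamondop> ?T = idn n" "idn n \<diamondop> G = G" using left_inverse_ex[of ?T "idn n"] idn_idn1 by blast
  have G': "(G \<diamondop> idn n) \<diamondop> ?T = idn n" using G T by (simp only: mm_assoc)
  have "?T \<diamondop> (G \<diamondop> idn n) = idn n"
    by (rule one_sided_inverse[OF G' idn_idn1(1) T]) (simp_all add: mm_assoc idn_idn1)
  then show ?thesis using G' G(2) by (intro exI[of _ "G \<diamondop> idn n"]) (simp add: mm_assoc[symmetric], simp add: mm_assoc idn_idn1)
qed

text \<open>The plane of matrices spanned by \<open>A\<close> and \<open>B\<close> may be described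
  by other generators \<open>C\<close> and \<open>D\<close>. With \<open>C\<close> invertible the
  pencil amounts to the single operator \<open>G \<diamondop> D\<close>, and a Jordan block of it
  splits off.\<close>

lemma regular_reduction:
  assumes p: "pencil n n A B" and n: "1 \<le> n" and C: "C = sc a A + sc b B"
    and G: "G \<diamondop> C = idn n" "C \<diamondop> G = idn n" "idn n \<diamondop> G = G" "G \<diamondop> idn n = G"
    and D: "D = sc c A + sc d B" and A: "A = sc a1 C + sc d1 D" and B: "B = sc b1 C + sc c1 D"
  shows "\<exists>m \<mu> i r. 1 \<le> m \<and> G \<diamondop> D \<diamondop> i = i \<diamondop> (sc \<mu> (idn m) + sh m) \<and> r \<diamondop> i = idn m \<and> idn n \<diamondop> i = i \<and> i \<diamondop> idn m = i \<and>
    psplit n n A B m m (sc a1 (idn m) + sc d1 (sc \<mu> (idn m) + sh m)) (sc b1 (idn m) + sc c1 (sc \<mu> (idn m) + sh m))"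
proof -
  note pe = pencil_eqs[OF p]
  have Cn: "idn n \<diamondop> C = C" "C \<diamondop> idn n = C" "idn n \<diamondop> D = D" "D \<diamondop> idn n = D" by (simp_all add: C D fm_alg pe)
  have T: "idn n \<diamondop> (G \<diamondop> D) = G \<diamondop> D" "(G \<diamondop> D) \<diamondop> idn n = G \<diamondop> D"
    by (simp add: mm_asc[OF G(3)], simp add: mm_assoc Cn)
  from jordan_summand[OF n T] obtain m \<mu> i r where j: "1 \<le> m" "idn n \<diamondop> i = i" "i \<diamondop> idn m = i" "idn m \<diamondop> r = r" "r \<diamondop> idn n = r"
     "r \<diamondop> i = idn m" "G \<diamondop> D \<diamondop> i = i \<diamondop> (sc \<mu> (idn m) + sh m)" "(sc \<mu> (idn m) + sh m) \<diamondop> r = r \<diamondop> (G \<diamondop> D)" by blast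
  define U where "U = sc \<mu> (idn m) + sh m"
  have "C \<diamondop> (G \<diamondop> D \<diamondop> i) = D \<diamondop> i" by (simp add: mm_assoc mm_asc[OF G(2)] mm_asc[OF Cn(3)])
  then have Di: "D \<diamondop> i = C \<diamondop> (i \<diamondop> U)" by (simp add: j(7) U_def)
  have Ur: "U \<diamondop> r = r \<diamondop> (G \<diamondop> D)" using j(8) by (simp add: U_def)
  have Um: "idn m \<diamondop> U = U" by (simp add: U_def fm_alg idn_idn1 idn_sh_idn)
  have rGC: "r \<diamondop> (G \<diamondop> C) = r" by (simp add: G j)
  have A': "A \<diamondop> i = C \<diamondop> i \<diamondop> (sc a1 (idn m) + sc d1 U)" "B \<diamondop> i = C \<diamondop> i \<diamondop> (sc b1 (idn m) + sc c1 U)"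
    by (subst A, simp add: fm_alg j Di, subst B, simp add: fm_alg j Di)
  have B': "(sc a1 (idn m) + sc d1 U) \<diamondop> r = r \<diamondop> G \<diamondop> A" "(sc b1 (idn m) + sc c1 U) \<diamondop> r = r \<diamondop> G \<diamondop> B"
    by (subst A, simp add: fm_alg j Ur rGC, subst B, simp add: fm_alg j Ur rGC)
  have "psplit n n A B m m (sc a1 (idn m) + sc d1 U) (sc b1 (idn m) + sc c1 U)"
    unfolding psplit_def
    by (rule exI[of _ i], rule exI[of _ "C \<diamondop> i"], rule exI[of _ r], rule exI[of _ "r \<diamondop> G"])
       (simp add: A' B' j mm_assoc G Cn mm_asc[OF Cn(1)] mm_asc[OF G(1)] mm_asc[OF j(4)])
  then show ?thesis using j unfolding U_def by blast
qed

text \<open>A first reduction with C = A - c B and D = B leaves the pencil (1 + c T, T) with T a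
  Jordan block. If its eigenvalue is nonzero, T is invertible and a second reduction gives a finite
  parameter; otherwise 1 + c T is invertible and the parameter is infinity.\<close>

lemma regular_split:
  assumes p: "pencil n n A B" and n: "1 \<le> n" and G: "G \<diamondop> (A - sc c B) = idn n" "idn n \<diamondop> G = G"
  shows "\<exists>m \<eta>. 1 \<le> m \<and> psplit n n A B m m (XA m \<eta>) (XB m \<eta>)"
proof -
  note pe = pencil_eqs[OF p]
  define C where "C = A - sc c B"
  have Cn: "idn n \<diamondop> C = C" "C \<diamondop> idn n = C" by (simp_all add: C_def fm_alg pe)
  have G1: "(G \<diamondop> idn n) \<diamondop> C = idn n" using G by (simp add: mm_assoc Cn) (simp add: C_def)
  have G2: "C \<diamondop> (G \<diamondop> idn n) = idn n"
    by (rule one_sided_inverse[OF G1 idn_idn1(1) Cn(2,1)]) (simp_all add: mm_assoc idn_idn1)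
  have G3: "idn n \<diamondop> (G \<diamondop> idn n) = G \<diamondop> idn n" "(G \<diamondop> idn n) \<diamondop> idn n = G \<diamondop> idn n"
    by (simp_all add: mm_asc[OF G(2)] mm_assoc idn_idn1)
  have C1: "C = sc 1 A + sc (- c) B" "B = sc 0 A + sc 1 B" "A = sc 1 C + sc c B" "B = sc 0 C + sc 1 B"
    by (simp_all add: C_def sc_minus_l)
  from regular_reduction[OF p n C1(1) G1 G2 G3 C1(2-4)] obtain m \<mu> where m: "1 \<le> m"
    "psplit n n A B m m (idn m + sc c (sc \<mu> (idn m) + sh m)) (sc \<mu> (idn m) + sh m)" by auto
  let ?T = "sc \<mu> (idn m) + sh m"
  let ?A1 = "idn m + sc c ?T"
  have p1: "pencil m m ?A1 ?T" by (simp add: pencil_def fm_alg idn_idn1 idn_sh_idn)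
  show ?thesis
  proof (cases "\<mu> = 0")
    case False
    then obtain H where H: "H \<diamondop> ?T = idn m" "?T \<diamondop> H = idn m" "idn m \<diamondop> H = H" "H \<diamondop> idn m = H"
      using triangular_inverse[of \<mu> m 1] by auto
    have e: "?T = sc 0 ?A1 + sc 1 ?T" "?A1 = sc 1 ?A1 + sc 0 ?T" "?A1 = sc 0 ?T + sc 1 ?A1" "?T = sc 1 ?T + sc 0 ?A1" by simp_all
    from regular_reduction[OF p1 m(1) e(1) H e(2-4)] obtain k \<nu> where "1 \<le> k" "psplit m m ?A1 ?T k k (sc \<nu> (idn k) + sh k) (idn k)"
      by auto
    then show ?thesis using psplit_trans[OF m(2)] by (intro exI[of _ k] exI[of _ "Finite \<nu>"]) simp
  next
    case True
    have A1: "?A1 = sc 1 (idn m) + sc c (sh m)" "?T = sh m" using True by simp_all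
    obtain H where H: "H \<diamondop> ?A1 = idn m" "?A1 \<diamondop> H = idn m" "idn m \<diamondop> H = H" "H \<diamondop> idn m = H"
      using triangular_inverse[of 1 m c] unfolding A1(1) by auto
    have e: "?A1 = sc 1 ?A1 + sc 0 ?T" "?T = sc 0 ?A1 + sc 1 ?T" "?A1 = sc 1 ?A1 + sc 0 ?T" "?T = sc 0 ?A1 + sc 1 ?T" by simp_all
    from regular_reduction[OF p1 m(1) e(1) H e(2-4)] obtain k \<nu> i r where k: "1 \<le> k" "H \<diamondop> ?T \<diamondop> i = i \<diamondop> (sc \<nu> (idn k) + sh k)"
      "r \<diamondop> i = idn k" "idn m \<diamondop> i = i" "i \<diamondop> idn k = i"
      and ps: "psplit m m ?A1 ?T k k (idn k) (sc \<nu> (idn k) + sh k)" by auto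
    \<comment> \<open>\<open>H \<diamondop> ?T\<close> is nilpotent. The last basis vector of the
      block would be an eigenvector for \<open>\<nu>\<close>, and multiplying by \<open>?A1\<close>
      would make it a kernel vector of an invertible triangular matrix.\<close>
    have "\<nu> = 0"
    proof (rule ccontr)
      assume nu: "\<nu> \<noteq> 0"
      define v where "v = i \<diamondop> un (k - 1) ()"
      have "H \<diamondop> ?T \<diamondop> v = sc \<nu> v"
      proof -
        have "H \<diamondop> ?T \<diamondop> v = (H \<diamondop> ?T \<diamondop> i) \<diamondop> un (k - 1) ()" by (simp add: v_def mm_assoc)
        also have "\<dots> = sc \<nu> v" unfolding k(2) v_def using k(1) by (simp add: fm_alg sh_un idn_un)
        finally show ?thesis .
      qed
      then have "?A1 \<diamondop> (H \<diamondop> ?T \<diamondop> v) = ?A1 \<diamondop> sc \<nu> v" by simp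
      moreover have "idn m \<diamondop> v = v" unfolding v_def by (simp add: mm_asc[OF k(4)])
      ultimately have "sh m \<diamondop> v = sc \<nu> v + sc (\<nu> * c) (sh m \<diamondop> v)"
        by (simp only: mm_assoc mm_asc[OF H(2)]) (simp add: A1 fm_alg idn_sh_idn mm_asc[OF idn_sh_idn(1)])
      then have "sc \<nu> v + sc (\<nu> * c) (sh m \<diamondop> v) - sh m \<diamondop> v = 0" by (metis diff_self)
      then have "(sc \<nu> (idn m) + sc (\<nu> * c - 1) (sh m)) \<diamondop> v = 0"
        using \<open>idn m \<diamondop> v = v\<close> by (simp add: fm_alg sc_diff_l add_diff_eq)
      moreover obtain H' where "H' \<diamondop> (sc \<nu> (idn m) + sc (\<nu> * c - 1) (sh m)) = idn m" using triangular_inverse[OF nu] by blast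
      ultimately have "idn m \<diamondop> v = 0" by (metis mm_assoc mm_zero_r)
      then have "r \<diamondop> v = 0" using \<open>idn m \<diamondop> v = v\<close> by simp
      moreover have "r \<diamondop> v = un (k - 1) ()" using k(1) by (simp add: v_def mm_asc[OF k(3)] idn_un)
      ultimately show False by simp
    qed
    then show ?thesis using psplit_trans[OF m(2) ps] k(1) by (intro exI[of _ k] exI[of _ Infinity]) simp
  qed
qed

inductive std_pencil :: "nat \<Rightarrow> nat \<Rightarrow> (nat, nat) fm \<Rightarrow> (nat, nat) fm \<Rightarrow> bool" where
  std_L: "std_pencil (Suc k) k (tp (sh (Suc k))) (idn k)"
| std_LT: "std_pencil k (Suc k) (sh (Suc k)) (idn k)"
| std_X: "1 \<le> m \<Longrightarrow> std_pencil m m (XA m \<eta>) (XB m \<eta>)"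

lemma chain_split: assumes "chain u A B d f" "pencil u w A B"
  shows "\<exists>k. psplit u w A B (Suc k) k (tp (sh (Suc k))) (idn k)"
proof -
  define d0 where "d0 = (LEAST d. \<exists>f. chain u A B d f)"
  have "\<exists>f. chain u A B d0 f" unfolding d0_def by (rule LeastI[of "\<lambda>d. \<exists>f. chain u A B d f" d]) (use assms(1) in blast)
  then obtain f0 where "chain u A B d0 f0" by blast
  then have "minimal_chain u A B d0 f0" unfolding minimal_chain_def d0_def by (blast intro: Least_le)
  from minimal_chain_split[OF this assms(2)] show ?thesis by blast
qed

text \<open>Zero rows make the pencil square. Its members have rank at most \<open>w\<close>, so
  none is invertible and \<open>pencil_dichotomy\<close> leaves only a chain.\<close>

lemma pencil_wide: assumes "pencil u w A B" "w < u"
  shows "\<exists>k. psplit u w A B (Suc k) k (tp (sh (Suc k))) (idn k)"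
proof -
  note pe = pencil_eqs[OF assms(1)]
  have uw: "idn u \<diamondop> idn w = idn w" using assms(2) by (simp add: idn_idn)
  have "idn u \<diamondop> (idn w \<diamondop> A) = idn w \<diamondop> A" "idn u \<diamondop> (idn w \<diamondop> B) = idn w \<diamondop> B" by (simp_all only: mm_assoc[symmetric] uw)
  then have p: "pencil u u A B" using pe by (simp add: pencil_def)
  have "\<not> G \<diamondop> (A - sc c B) = idn u" for c G
  proof
    assume G: "G \<diamondop> (A - sc c B) = idn u"
    define C where "C = A - sc c B"
    have C: "idn w \<diamondop> C = C" "C \<diamondop> idn u = C" "G \<diamondop> C = idn u" using G by (simp_all add: C_def fm_alg pe)
    define e where "e = C \<diamondop> (G \<diamondop> idn w)"
    have "(idn w - e) \<diamondop> (idn w - e) = idn w - e"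
      by (simp add: e_def fm_alg idn_idn1 C mm_asc[OF C(1)] mm_asc[OF C(2)] mm_asc[OF C(3)])
    then obtain k where "tr (idn w - e) = of_nat k" by (rule tr_idem)
    moreover have "tr e = of_nat u"
      unfolding e_def by (subst tr_comm) (simp add: mm_assoc C tr_dg)
    ultimately have "of_nat w = (of_nat (u + k) :: complex)" by (simp add: tr_diff tr_dg algebra_simps)
    then have "w = u + k" unfolding of_nat_eq_iff .
    then show False using assms(2) by simp
  qed
  then show ?thesis using pencil_dichotomy[OF p] chain_split[OF _ assms(1)] by blast
qed

theorem pencil_classification:
  assumes p: "pencil u w A B" and "0 < u + w"
  shows "\<exists>u0 w0 A0 B0. std_pencil u0 w0 A0 B0 \<and> psplit u w A B u0 w0 A0 B0"
proof (cases u w rule: linorder_cases)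
  case less
  from pencil_wide[OF pencil_tp[OF p] less] obtain k where
    "psplit w u (tp A) (tp B) (Suc k) k (tp (sh (Suc k))) (idn k)" by blast
  from psplit_tp[OF this] show ?thesis using std_LT[of k] by (auto simp: tp_dg)
next
  case equal
  then have n: "1 \<le> u" "pencil u u A B" using assms by auto
  from pencil_dichotomy[OF n(2)] show ?thesis
  proof
    assume "\<exists>d f. chain u A B d f"
    then show ?thesis using chain_split[OF _ p] std_L by blast
  next
    assume "\<exists>c G. G \<diamondop> (A - sc c B) = idn u \<and> idn u \<diamondop> G = G"
    then show ?thesis using regular_split[OF n(2,1)] std_X equal by blast
  qed
next
  case greater
  then show ?thesis using pencil_wide[OF p] std_L by blast
qed

section \<open>Every nonzero module has a standard direct summand\<close>

section \<open>Classification of modules\<close>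

definition sg :: "bool \<Rightarrow> complex" where "sg b = (if b then 1 else -1)"
lemma sg_sq: "sg b * sg b = 1" and sg_nz: "sg b \<noteq> 0" and sg_not: "sg (\<not> b) = - sg b" and sg_inj: "sg b = sg b' \<longleftrightarrow> b = b'"
  by (auto simp: sg_def)

definition Pm :: "bool \<Rightarrow> (nat \<times> unit) kmod" where "Pm b = kten P0m (Sn (sg b) {()})"
lemma vmod_Pm: "vmod (Pm b)" by (simp add: Pm_def vmod_kten vmod_P0m vmod_Sn sg_sq)

lemma dg_unit: "dg {()} = un () ()" by (rule fm_eqI) (simp add: ent_dg ent_un)
lemma half: "sc (1/2) (Z + Z) = Z" "sc (1/2) Z + sc (1/2) Z = Z" for Z :: "'a \<Rightarrow>\<^sub>0 complex"
  by (simp_all add: sc_add sc_add_l[symmetric])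

text \<open>Since the two operators 1 + K and 1 - K add up to 2, one of them has a column that
  survives xi_1 xi_2. That column is an eigenvector of K and generates a free summand by
  \<open>peel\<close>.\<close>

lemma projective_summand:
  fixes M :: "'i kmod"
  assumes M: "vmod M" and AB: "mA M \<diamondop> mB M \<noteq> 0"
  shows "\<exists>b M' :: 'i kmod. vmod M' \<and> is_dsum M (Pm b) M'"
proof -
  note e = vmod_eqs[OF M]
  have "\<exists>b. mA M \<diamondop> (mB M \<diamondop> (mE M + sc (sg b) (mK M))) \<noteq> 0"
  proof (rule ccontr)
    assume "\<nexists>b. mA M \<diamondop> (mB M \<diamondop> (mE M + sc (sg b) (mK M))) \<noteq> 0"
    then have "mA M \<diamondop> (mB M \<diamondop> (mE M + sc (sg True) (mK M))) + mA M \<diamondop> (mB M \<diamondop> (mE M + sc (sg False) (mK M))) = 0" by simp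
    then have "sc (1/2) (mA M \<diamondop> mB M + mA M \<diamondop> mB M) = sc (1/2) 0" by (simp add: sg_def fm_alg e sc_minus_l)
    then show False using AB by (simp add: half)
  qed
  then obtain b where b: "mA M \<diamondop> (mB M \<diamondop> (mE M + sc (sg b) (mK M))) \<noteq> 0" by blast
  then obtain x where x: "mA M \<diamondop> (mB M \<diamondop> (mE M + sc (sg b) (mK M))) \<diamondop> un x () \<noteq> 0"
    using fm_cols_eqI[of "mA M \<diamondop> (mB M \<diamondop> (mE M + sc (sg b) (mK M)))" 0] by auto
  define j where "j = (mE M + sc (sg b) (mK M)) \<diamondop> un x ()"
  have nz: "mA M \<diamondop> (mB M \<diamondop> j) \<noteq> 0" using x by (simp add: j_def mm_assoc)
  have j: "mE M \<diamondop> j = j" "mK M \<diamondop> j = sc (sg b) j"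
    by (simp_all add: j_def fm_alg e sg_sq add.commute)
  obtain q where q: "q \<diamondop> (mA M \<diamondop> (mB M \<diamondop> j)) = un () ()" using row_functional[OF nz] by blast
  have "\<exists>i r. kh (Pm b) M i \<and> kh M (Pm b) r \<and> r \<diamondop> i = mE (Pm b)"
    using peel[OF M, of "Sn (sg b) {()}" j q] j q unfolding Pm_def
    by (auto simp: vmod_Sn sg_sq dg_unit un_unit_r un_unit_l mm_sc_r)
  then show ?thesis using summand[OF M] by blast
qed

text \<open>When xi_1 xi_2 = 0, the images of xi_1 and xi_2 lie in their common kernel. A K-stable
  complement of that kernel and the kernel itself, in opposite eigenspaces of K, carry a
  pencil.\<close>

lemma kronecker_summand:
  fixes M :: "'i kmod"
  assumes M: "vmod M" and AB: "mA M \<diamondop> mB M = 0" and nz: "mE M \<noteq> 0"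
  shows "\<exists>b u w A B (M' :: 'i kmod). std_pencil u w A B \<and> vmod M' \<and> is_dsum M (Kr (sg b) u w A B) M'"
proof -
  have AB': "mA M \<diamondop> (mB M \<diamondop> Z) = 0" for Z :: "('i, 'z) fm" using mm_asc[OF AB] by simp
  note e = vmod_eqs[OF M] AB AB'
  define T where "T = lc True (mA M) + lc False (mB M)"
  obtain G where G: "T \<diamondop> (G \<diamondop> T) = T" using pseudo_inverse by blast
  have rT: "rc True (mE M) \<diamondop> T = mA M" "rc False (mE M) \<diamondop> T = mB M" by (simp_all add: T_def fm_alg rc_lc e)
  have GT: "mA M \<diamondop> (G \<diamondop> T) = mA M" "mB M \<diamondop> (G \<diamondop> T) = mB M"
    using arg_cong[OF G, of "\<lambda>z. rc True (mE M) \<diamondop> z"] arg_cong[OF G, of "\<lambda>z. rc False (mE M) \<diamondop> z"]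
    by (simp_all add: mm_assoc[symmetric] rT)
  \<comment> \<open>\<open>T\<close> stacks xi_1 and xi_2, so this is a projection onto their common
    kernel; averaging it over K gives the equivariant \<open>F\<close>.\<close>
  define E1 where "E1 = mE M - mE M \<diamondop> G \<diamondop> T"
  have TE: "T \<diamondop> mE M = T" "T \<diamondop> mA M = 0" "T \<diamondop> mB M = 0" by (simp_all add: T_def fm_alg lc_mm e)
  have E1: "mE M \<diamondop> E1 = E1" "E1 \<diamondop> mE M = E1" "mA M \<diamondop> E1 = 0" "mB M \<diamondop> E1 = 0" "E1 \<diamondop> mA M = mA M" "E1 \<diamondop> mB M = mB M"
    by (simp_all add: E1_def fm_alg e TE GT)
  have fix1: "E1 \<diamondop> Z = Z" if "mE M \<diamondop> Z = Z" "mA M \<diamondop> Z = 0" "mB M \<diamondop> Z = 0" for Z :: "('i, 'z) fm"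
    using that by (simp add: E1_def fm_alg T_def lc_mm)
  define F where "F = sc (1/2) (E1 + mK M \<diamondop> E1 \<diamondop> mK M)"
  have "mA M \<diamondop> (mK M \<diamondop> (E1 \<diamondop> Z)) = 0" "mB M \<diamondop> (mK M \<diamondop> (E1 \<diamondop> Z)) = 0" for Z :: "('i, 'i) fm"
    using vmod_eqs(22)[OF M, of "E1 \<diamondop> Z"] vmod_eqs(23)[OF M, of "E1 \<diamondop> Z"] mm_asc[OF E1(3), of Z] mm_asc[OF E1(4), of Z] by simp_all
  note e1 = E1 E1[THEN mm_asc] e this
  have F0: "mE M \<diamondop> F = F" "F \<diamondop> mE M = F" "mA M \<diamondop> F = 0" "mB M \<diamondop> F = 0" "mK M \<diamondop> F = F \<diamondop> mK M" "F \<diamondop> mA M = mA M" "F \<diamondop> mB M = mB M"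
    by (simp_all add: F_def fm_alg e1 half sc_add_l[symmetric] add.commute)
  have E1F: "E1 \<diamondop> F = F" by (rule fix1) (simp_all add: F0)
  have "mK M \<diamondop> E1 \<diamondop> mK M \<diamondop> F = F"
  proof -
    have "mK M \<diamondop> E1 \<diamondop> mK M \<diamondop> F = mK M \<diamondop> ((E1 \<diamondop> F) \<diamondop> mK M)" by (simp add: mm_assoc F0)
    also have "\<dots> = F" by (simp add: E1F mm_assoc[symmetric] F0) (simp add: mm_assoc e F0)
    finally show ?thesis .
  qed
  then have FF: "F \<diamondop> F = F" by (subst (1) F_def) (simp add: mm_sc_l mm_add_l E1F half)
  note f = F0 F0[THEN mm_asc] FF FF[THEN mm_asc] e
  \<comment> \<open>\<open>eU b\<close> is the complement of the common kernel in one eigenspace of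
    K, \<open>eW b\<close> the common kernel in the other. Both xi send the first into the second
    and vanish on the second.\<close>
  define eU where "eU b = sc (1/2) ((mE M - F) \<diamondop> (mE M + sc (sg b) (mK M)))" for b
  define eW where "eW b = sc (1/2) (F \<diamondop> (mE M - sc (sg b) (mK M)))" for b
  have q: "sc (1/4) Z + sc (1/4) Z = sc (1/2) Z" for Z :: "'a \<Rightarrow>\<^sub>0 complex" by (simp add: sc_add_l[symmetric])
  have "\<exists>b. eU b \<noteq> 0 \<or> eW b \<noteq> 0"
  proof (rule ccontr)
    assume "\<nexists>b. eU b \<noteq> 0 \<or> eW b \<noteq> 0"
    then have "eU True + eU False + (eW True + eW False) = 0" by simp
    moreover have "eU True + eU False + (eW True + eW False) = sc (1/2) (mE M + mE M)"
      by (simp add: eU_def eW_def fm_alg f sg_def sc_minus_l)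
    ultimately show False using nz by (simp add: half)
  qed
  then obtain b where b: "eU b \<noteq> 0 \<or> eW b \<noteq> 0" by blast
  let ?s = "sg b"
  have U: "eU b \<diamondop> eU b = eU b" "eW b \<diamondop> eW b = eW b" "mE M \<diamondop> eU b = eU b" "mE M \<diamondop> eW b = eW b" "eU b \<diamondop> mE M = eU b" "eW b \<diamondop> mE M = eW b"
    "mK M \<diamondop> eU b = sc ?s (eU b)" "mK M \<diamondop> eW b = - sc ?s (eW b)" "eU b \<diamondop> mK M = sc ?s (eU b)" "eW b \<diamondop> mK M = - sc ?s (eW b)"
    "eU b \<diamondop> eW b = 0" "eW b \<diamondop> eU b = 0"
    "mA M \<diamondop> eW b = 0" "mB M \<diamondop> eW b = 0" "eU b \<diamondop> mA M = 0" "eU b \<diamondop> mB M = 0"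
    "mA M \<diamondop> eU b = eW b \<diamondop> mA M" "mB M \<diamondop> eU b = eW b \<diamondop> mB M"
    by (simp_all add: eU_def eW_def fm_alg f sg_sq mult.assoc[symmetric] algebra_simps q half sc_add_l[symmetric])
  obtain u i r where i: "eU b = i \<diamondop> r" "r \<diamondop> i = idn u" "i \<diamondop> idn u = i" "idn u \<diamondop> r = r" "eU b \<diamondop> i = i" "r \<diamondop> eU b = r"
    using idem_factor[OF U(1)] by metis
  obtain w i' r' where i': "eW b = i' \<diamondop> r'" "r' \<diamondop> i' = idn w" "i' \<diamondop> idn w = i'" "idn w \<diamondop> r' = r'" "eW b \<diamondop> i' = i'" "r' \<diamondop> eW b = r'"
    using idem_factor[OF U(2)] by metis
  have "0 < u + w"
  proof (rule ccontr)
    assume "\<not> 0 < u + w"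
    then have "i = 0" "i' = 0" using i(3) i'(3) by auto
    then show False using b i(1) i'(1) by auto
  qed
  define A where "A = r' \<diamondop> mA M \<diamondop> i"
  define B where "B = r' \<diamondop> mB M \<diamondop> i"
  have "pencil u w A B" by (simp add: pencil_def A_def B_def mm_assoc i mm_asc[OF i'(4)])
  from pencil_classification[OF this \<open>0 < u + w\<close>] obtain u0 w0 A0 B0 where sp: "std_pencil u0 w0 A0 B0" "psplit u w A B u0 w0 A0 B0"
    by blast
  from sp(2) obtain iU iW rU rW where h: "idn u \<diamondop> iU = iU" "iU \<diamondop> idn u0 = iU" "idn w \<diamondop> iW = iW" "iW \<diamondop> idn w0 = iW"
    "idn u0 \<diamondop> rU = rU" "rU \<diamondop> idn u = rU" "idn w0 \<diamondop> rW = rW" "rW \<diamondop> idn w = rW"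
    "rU \<diamondop> iU = idn u0" "rW \<diamondop> iW = idn w0" "A \<diamondop> iU = iW \<diamondop> A0" "B \<diamondop> iU = iW \<diamondop> B0"
    "A0 \<diamondop> rU = rW \<diamondop> A" "B0 \<diamondop> rU = rW \<diamondop> B" unfolding psplit_def by blast
  have k: "mE M \<diamondop> i = i" "mE M \<diamondop> i' = i'" "r \<diamondop> mE M = r" "r' \<diamondop> mE M = r'"
    "mK M \<diamondop> i = sc ?s i" "mK M \<diamondop> i' = - sc ?s i'" "r \<diamondop> mK M = sc ?s r" "r' \<diamondop> mK M = - sc ?s r'"
    "mA M \<diamondop> i' = 0" "mB M \<diamondop> i' = 0" "r \<diamondop> mA M = 0" "r \<diamondop> mB M = 0" "r \<diamondop> i' = 0" "r' \<diamondop> i = 0"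
    "mA M \<diamondop> i = i' \<diamondop> A" "mB M \<diamondop> i = i' \<diamondop> B" "r' \<diamondop> mA M = A \<diamondop> r" "r' \<diamondop> mB M = B \<diamondop> r"
  proof -
    have l: "mE M \<diamondop> (eU b \<diamondop> i) = eU b \<diamondop> i" "mE M \<diamondop> (eW b \<diamondop> i') = eW b \<diamondop> i'" "mK M \<diamondop> (eU b \<diamondop> i) = sc ?s (eU b \<diamondop> i)"
      "mK M \<diamondop> (eW b \<diamondop> i') = - sc ?s (eW b \<diamondop> i')" "mA M \<diamondop> (eW b \<diamondop> i') = 0" "mB M \<diamondop> (eW b \<diamondop> i') = 0"
      "eU b \<diamondop> (eW b \<diamondop> i') = 0" "eW b \<diamondop> (eU b \<diamondop> i) = 0"
      by (simp_all add: U[THEN mm_asc] mm_sc_l mm_minus_l)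
    have m: "(r \<diamondop> eU b) \<diamondop> mE M = r \<diamondop> eU b" "(r' \<diamondop> eW b) \<diamondop> mE M = r' \<diamondop> eW b" "(r \<diamondop> eU b) \<diamondop> mK M = sc ?s (r \<diamondop> eU b)"
      "(r' \<diamondop> eW b) \<diamondop> mK M = - sc ?s (r' \<diamondop> eW b)" "(r \<diamondop> eU b) \<diamondop> mA M = 0" "(r \<diamondop> eU b) \<diamondop> mB M = 0"
      by (simp_all only: mm_assoc U) (simp_all add: mm_sc_r mm_minus_r)
    show "mE M \<diamondop> i = i" "mE M \<diamondop> i' = i'" "mK M \<diamondop> i = sc ?s i" "mK M \<diamondop> i' = - sc ?s i'" "mA M \<diamondop> i' = 0" "mB M \<diamondop> i' = 0"
      using l by (simp_all add: i(5) i'(5))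
    show "r \<diamondop> mE M = r" "r' \<diamondop> mE M = r'" "r \<diamondop> mK M = sc ?s r" "r' \<diamondop> mK M = - sc ?s r'" "r \<diamondop> mA M = 0" "r \<diamondop> mB M = 0"
      using m by (simp_all add: i(6) i'(6))
    have "r \<diamondop> (eU b \<diamondop> (eW b \<diamondop> i')) = 0" "r' \<diamondop> (eW b \<diamondop> (eU b \<diamondop> i)) = 0" using l(7,8) by simp_all
    then show "r \<diamondop> i' = 0" "r' \<diamondop> i = 0" using i(5) i'(5) mm_asc[OF i(6), of i'] mm_asc[OF i'(6), of i] by simp_all
    have "mA M \<diamondop> (eU b \<diamondop> i) = eW b \<diamondop> (mA M \<diamondop> i)" "mB M \<diamondop> (eU b \<diamondop> i) = eW b \<diamondop> (mB M \<diamondop> i)"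
      by (simp_all only: mm_assoc[symmetric] U(17,18))
    then show "mA M \<diamondop> i = i' \<diamondop> A" "mB M \<diamondop> i = i' \<diamondop> B" unfolding A_def B_def by (simp_all add: i(5) i'(1) mm_assoc)
    have m: "(r' \<diamondop> eW b) \<diamondop> mA M = r' \<diamondop> mA M \<diamondop> eU b" "(r' \<diamondop> eW b) \<diamondop> mB M = r' \<diamondop> mB M \<diamondop> eU b"
      by (simp_all only: mm_assoc U(17,18)[symmetric])
    show "r' \<diamondop> mA M = A \<diamondop> r" "r' \<diamondop> mB M = B \<diamondop> r"
      unfolding A_def B_def using m unfolding i'(6) i(1) mm_assoc by simp_all
  qed
  define jN where "jN = rc True (i \<diamondop> iU) + rc False (i' \<diamondop> iW)"
  define rN where "rN = lc True (rU \<diamondop> r) + lc False (rW \<diamondop> r')"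
  note hk = h(1-10) h(1-10)[THEN mm_asc] k(1-14) k(1-14)[THEN mm_asc] i(2) i(2)[THEN mm_asc] i'(2) i'(2)[THEN mm_asc] i(3,4) i'(3,4)
  have c: "mA M \<diamondop> (i \<diamondop> iU) = i' \<diamondop> (iW \<diamondop> A0)" "mB M \<diamondop> (i \<diamondop> iU) = i' \<diamondop> (iW \<diamondop> B0)"
     "rW \<diamondop> (r' \<diamondop> mA M) = A0 \<diamondop> (rU \<diamondop> r)" "rW \<diamondop> (r' \<diamondop> mB M) = B0 \<diamondop> (rU \<diamondop> r)"
    using mm_asc[OF k(15), of iU] mm_asc[OF k(16), of iU] mm_asc[OF h(13), of r] mm_asc[OF h(14), of r]
    by (simp_all add: mm_assoc h(11,12) k(17,18))
  have "kh (Kr ?s u0 w0 A0 B0) M jN" unfolding kh_def jN_def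
    by (simp add: fm_alg blk rc_krn hk c)
  moreover have "kh M (Kr ?s u0 w0 A0 B0) rN" unfolding kh_def rN_def
    by (simp add: fm_alg blk krn_lc hk c)
  moreover have "rN \<diamondop> jN = mE (Kr ?s u0 w0 A0 B0)" unfolding rN_def jN_def
    by (simp add: fm_alg blk hk)
  ultimately show ?thesis using summand[OF M] sp(1) by blast
qed

section \<open>Additive invariants that count summands\<close>

section \<open>Multiplicities\<close>

text \<open>For \<open>N\<close> with local endomorphism ring, the rank of the trace pairing between \<open>Hom(N, M)\<close> and
  \<open>Hom(M, N)\<close> counts the summands of \<open>M\<close> isomorphic to \<open>N\<close>. It is additive in \<open>M\<close> for every \<open>N\<close>.\<close>

definition dual_families :: "'n kmod \<Rightarrow> 'm kmod \<Rightarrow> nat \<Rightarrow> bool" where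
  "dual_families N M k \<longleftrightarrow> (\<exists>i r. (\<forall>a<k. kh N M (i a) \<and> kh M N (r a)) \<and>
     (\<forall>a<k. \<forall>b<k. tr (r a \<diamondop> i b) = (if a = b then 1 else 0)))"
definition kmult :: "'n kmod \<Rightarrow> 'm kmod \<Rightarrow> nat" where "kmult N M = Max {k. dual_families N M k}"

lemma idn_rank_le:
  assumes q: "q \<diamondop> p = idn k" and F: "finite F" "dg F \<diamondop> p = p"
  shows "k \<le> card F"
proof -
  have p: "p \<diamondop> idn k = p \<diamondop> (q \<diamondop> p)" by (simp add: q)
  define e where "e = p \<diamondop> idn k \<diamondop> (q \<diamondop> dg F)"
  have FF: "dg F \<diamondop> dg F = dg F" using F(1) by (simp add: dg_mm)
  have q3: "q \<diamondop> (p \<diamondop> Z) = idn k \<diamondop> Z" for Z :: "(nat, 'z) fm" by (rule mm_asc[OF q])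
  have "(dg F - e) \<diamondop> (dg F - e) = dg F - e"
    by (simp add: e_def fm_alg FF FF[THEN mm_asc] F(2)[THEN mm_asc] q3 idn_idn1)
  then obtain m where "tr (dg F - e) = of_nat m" by (rule tr_idem)
  moreover have "tr e = of_nat k"
    unfolding e_def by (subst tr_comm) (simp add: mm_assoc F(2)[THEN mm_asc] q3 idn_idn1 tr_dg)
  ultimately have "of_nat (card F) = (of_nat (k + m) :: complex)" by (simp add: tr_diff tr_dg F algebra_simps)
  then have "card F = k + m" unfolding of_nat_eq_iff .
  then show ?thesis by simp
qed

text \<open>Flattening homomorphisms into vectors turns the trace pairing into a matrix product;
  dual families then factor an identity matrix through a space of bounded dimension.\<close>

lemma dual_families_bound: assumes "dual_families N M k" shows "k \<le> card (rws (mE N) \<times> cls (mE M))"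
proof -
  from assms obtain i r where h: "\<And>a. a < k \<Longrightarrow> kh N M (i a)" "\<And>a. a < k \<Longrightarrow> kh M N (r a)"
    "\<And>a b. a < k \<Longrightarrow> b < k \<Longrightarrow> tr (r a \<diamondop> i b) = (if a = b then 1 else 0)" unfolding dual_families_def by blast
  let ?F = "rws (mE N) \<times> cls (mE M)"
  have r0: "ent (r a) x y = 0" if "a < k" "(x, y) \<notin> ?F" for a x y
  proof -
    have "ent (mE N \<diamondop> r a) x y = 0 \<or> ent (r a \<diamondop> mE M) x y = 0"
      using that(2) rws_mm[of "mE N" "r a"] cls_mm[of "r a" "mE M"] by (auto intro: ent_z)
    then show ?thesis using kh_eqs(1,2)[OF h(2)[OF that(1)]] by simp
  qed
  define R :: "(nat, 'a \<times> 'b) fm" where "R = mk {..<k} ?F (\<lambda>a xy. ent (r a) (fst xy) (snd xy))"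
  define I :: "('a \<times> 'b, nat) fm" where "I = mk ?F {..<k} (\<lambda>xy b. ent (i b) (snd xy) (fst xy))"
  have eR: "ent R a xy = (if a < k then ent (r a) (fst xy) (snd xy) else 0)" for a xy
    using r0[of a "fst xy" "snd xy"] by (auto simp: R_def ent_mk)
  have eI: "ent I xy b = (if xy \<in> ?F \<and> b < k then ent (i b) (snd xy) (fst xy) else 0)" for xy b
    by (simp add: I_def ent_mk)
  have "R \<diamondop> I = idn k"
  proof (rule fm_eqI)
    fix a b
    show "ent (R \<diamondop> I) a b = ent (idn k) a b"
    proof (cases "a < k \<and> b < k")
      case True
      have "ent (R \<diamondop> I) a b = (\<Sum>xy\<in>?F. ent R a xy * ent I xy b)"
        by (rule ent_mm) (auto simp: I_def ent_mk split: if_split_asm)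
      also have "\<dots> = (\<Sum>x\<in>rws (mE N). \<Sum>y\<in>cls (mE M). ent (r a) x y * ent (i b) y x)"
        using True by (simp add: sum.cartesian_product eR I_def ent_mk split_beta cong: sum.cong)
      also have "\<dots> = (\<Sum>x\<in>rws (mE N). ent (r a \<diamondop> i b) x x)"
      proof (rule sum.cong[OF refl])
        fix x
        show "(\<Sum>y\<in>cls (mE M). ent (r a) x y * ent (i b) y x) = ent (r a \<diamondop> i b) x x"
        proof (rule ent_mm[symmetric])
          fix y assume "ent (r a) x y * ent (i b) y x \<noteq> 0"
          then show "y \<in> cls (mE M)" using r0[of a x y] True by auto
        qed simp
      qed
      also have "\<dots> = tr (r a \<diamondop> i b)"
      proof (rule tr_eq[symmetric])
        fix x assume "ent (r a \<diamondop> i b) x x \<noteq> 0"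
        then have "x \<in> rws (r a)" using rws_mm[of "r a" "i b"] ent_nz(1)[of "r a \<diamondop> i b" x x] by blast
        then show "x \<in> rws (mE N)" using r0[of a x] True by (auto simp: rws_def[of "r a"])
      qed simp
      finally show ?thesis using h(3) True by (simp add: ent_dg)
    next
      case False
      then have "a \<notin> rws R \<or> b \<notin> cls I" by (auto simp: rws_def[of R] eR cls_def[of I] eI)
      then have "ent (R \<diamondop> I) a b = 0" using rws_mm[of R I] cls_mm[of R I] by (auto intro: ent_z)
      then show ?thesis using False by (auto simp: ent_dg)
    qed
  qed
  moreover have "dg ?F \<diamondop> I = I" by (auto simp: dg_l I_def ent_mk split: if_split_asm)
  ultimately show ?thesis using idn_rank_le[of R I k ?F] by simp
qed

lemma dual_families_0: "dual_families N M 0" by (simp add: dual_families_def)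
lemma kmult_max: "dual_families N M k \<Longrightarrow> k \<le> kmult N M" and kmult_in: "dual_families N M (kmult N M)"
proof -
  have f: "finite {k. dual_families N M k}"
    by (rule finite_subset[of _ "{..card (rws (mE N) \<times> cls (mE M))}"]) (auto dest: dual_families_bound)
  show "dual_families N M k \<Longrightarrow> k \<le> kmult N M" using f by (simp add: kmult_def)
  show "dual_families N M (kmult N M)" using Max_in[OF f] dual_families_0[of N M] by (auto simp: kmult_def)
qed

text \<open>The one-sided inverses in a rank factorization of the Gram matrix are base changes that
  normalise the two families.\<close>

lemma dual_families_gram:
  assumes h: "\<And>a. a < k \<Longrightarrow> kh N M (i a)" "\<And>a. a < k \<Longrightarrow> kh M N (r a)"
    and G: "\<And>a b. a < k \<Longrightarrow> b < k \<Longrightarrow> ent G a b = tr (r a \<diamondop> i b)" "idn k \<diamondop> G = G" "G \<diamondop> idn k = G"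
  shows "\<exists>n x y. G = x \<diamondop> y \<and> idn n \<diamondop> y = y \<and> x \<diamondop> idn n = x \<and> dual_families N M n"
proof -
  obtain n x y l s where f: "G = x \<diamondop> y" "x \<diamondop> idn n = x" "idn n \<diamondop> y = y" "idn n \<diamondop> l = l" "s \<diamondop> idn n = s" "l \<diamondop> x = idn n" "y \<diamondop> s = idn n"
    using rank_factorization[of G] by blast
  have lGs: "l \<diamondop> G \<diamondop> s = idn n" by (simp add: f(1) mm_assoc mm_asc[OF f(6)] f(7) idn_idn1)
  have e: "(\<Sum>b<k. (\<Sum>a<k. ent l c a * tr (r a \<diamondop> i b)) * ent s b d) = ent (idn n) c d" for c d
  proof -
    have "ent (idn n) c d = ent ((l \<diamondop> G) \<diamondop> s) c d" by (simp add: lGs)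
    also have "\<dots> = (\<Sum>b<k. ent (l \<diamondop> G) c b * ent s b d)"
    proof (rule ent_mm)
      fix b assume "ent (l \<diamondop> G) c b * ent s b d \<noteq> 0"
      then have "ent ((l \<diamondop> G) \<diamondop> idn k) c b \<noteq> 0" using G(3) by (simp add: mm_assoc)
      then show "b \<in> {..<k}" by (simp add: ent_mm_dg split: if_split_asm)
    qed simp
    also have "\<dots> = (\<Sum>b<k. (\<Sum>a<k. ent l c a * tr (r a \<diamondop> i b)) * ent s b d)"
      by (intro sum.cong refl arg_cong2[of _ _ _ _ "(*)"]) (simp add: ent_mm_idn[OF G(2)] G(1))
    finally show ?thesis by simp
  qed
  have "dual_families N M n" unfolding dual_families_def
  proof (intro exI conjI allI impI)
    show "kh N M (\<Sum>b<k. sc (ent s b d) (i b))" for d using h by (intro kh_sum kh_lin(2)) auto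
    show "kh M N (\<Sum>a<k. sc (ent l c a) (r a))" for c using h by (intro kh_sum kh_lin(2)) auto
    fix c d assume "c < n" "d < n"
    then show "tr ((\<Sum>a<k. sc (ent l c a) (r a)) \<diamondop> (\<Sum>b<k. sc (ent s b d) (i b))) = (if c = d then 1 else 0)"
      using e[of c d] by (simp add: mm_sum_l mm_sum_r mm_sc_l mm_sc_r sc_sc tr_sum tr_sc ent_dg sum_distrib_right sum_distrib_left algebra_simps)
  qed
  then show ?thesis using f by blast
qed

text \<open>For the upper bound, an identity Gram matrix is the sum of the Gram matrices through the
  two summands, and rank is subadditive. For the lower bound, families of the summands are
  concatenated.\<close>

lemma kmult_dsum: assumes d: "is_dsum M M1 M2" shows "kmult N M = kmult N M1 + kmult N M2"
proof (rule antisym)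
  from d obtain i1 r1 i2 r2 where d: "kh M1 M i1" "kh M M1 r1" "kh M2 M i2" "kh M M2 r2"
     "r1 \<diamondop> i1 = mE M1" "r2 \<diamondop> i2 = mE M2" "r1 \<diamondop> i2 = 0" "r2 \<diamondop> i1 = 0" "i1 \<diamondop> r1 + i2 \<diamondop> r2 = mE M"
    unfolding is_dsum_def by blast
  show "kmult N M \<le> kmult N M1 + kmult N M2"
  proof -
    define k where "k = kmult N M"
    from kmult_in[of N M] obtain i r where h: "\<And>a. a < k \<Longrightarrow> kh N M (i a)" "\<And>a. a < k \<Longrightarrow> kh M N (r a)"
      "\<And>a b. a < k \<Longrightarrow> b < k \<Longrightarrow> tr (r a \<diamondop> i b) = (if a = b then 1 else 0)" unfolding dual_families_def k_def by blast
    define G1 where "G1 = mk {..<k} {..<k} (\<lambda>a b. tr ((r a \<diamondop> i1) \<diamondop> (r1 \<diamondop> i b)))"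
    define G2 where "G2 = mk {..<k} {..<k} (\<lambda>a b. tr ((r a \<diamondop> i2) \<diamondop> (r2 \<diamondop> i b)))"
    have GG: "G1 + G2 = idn k"
    proof (rule fm_eqI)
      fix a b
      have "r a \<diamondop> (i1 \<diamondop> r1 + i2 \<diamondop> r2) \<diamondop> i b = r a \<diamondop> i b" if "a < k" "b < k" unfolding d(9)
        using kh_eqs(1)[OF h(2)[OF that(1)]] by simp
      then have "tr ((r a \<diamondop> i1) \<diamondop> (r1 \<diamondop> i b)) + tr ((r a \<diamondop> i2) \<diamondop> (r2 \<diamondop> i b)) = tr (r a \<diamondop> i b)" if "a < k" "b < k"
        using that by (simp add: tr_add[symmetric] fm_alg)
      then show "ent (G1 + G2) a b = ent (idn k) a b" by (auto simp: lookup_add G1_def G2_def ent_mk ent_dg h(3))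
    qed
    have g1: "idn k \<diamondop> G1 = G1" "G1 \<diamondop> idn k = G1"
      by (auto simp: G1_def ent_mk dg_l dg_r split: if_split_asm)
    have "\<exists>n x y. G1 = x \<diamondop> y \<and> idn n \<diamondop> y = y \<and> x \<diamondop> idn n = x \<and> dual_families N M1 n"
      by (rule dual_families_gram[OF kh_comp[OF h(1) d(2)] kh_comp[OF d(1) h(2)] _ g1]) (simp_all add: G1_def ent_mk)
    then obtain n1 x1 y1 where 1: "G1 = x1 \<diamondop> y1" "idn n1 \<diamondop> y1 = y1" "x1 \<diamondop> idn n1 = x1" "dual_families N M1 n1"
      by blast
    have g2: "idn k \<diamondop> G2 = G2" "G2 \<diamondop> idn k = G2"
      by (auto simp: G2_def ent_mk dg_l dg_r split: if_split_asm)
    have "\<exists>n x y. G2 = x \<diamondop> y \<and> idn n \<diamondop> y = y \<and> x \<diamondop> idn n = x \<and> dual_families N M2 n"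
      by (rule dual_families_gram[OF kh_comp[OF h(1) d(4)] kh_comp[OF d(3) h(2)] _ g2]) (simp_all add: G2_def ent_mk)
    then obtain n2 x2 y2 where 2: "G2 = x2 \<diamondop> y2" "idn n2 \<diamondop> y2 = y2" "x2 \<diamondop> idn n2 = x2" "dual_families N M2 n2"
      by blast
    have "k \<le> card ({True} \<times> {..<n1} \<union> {False} \<times> {..<n2})"
    proof (rule idn_rank_le)
      show "(rc True x1 + rc False x2) \<diamondop> (lc True y1 + lc False y2) = idn k"
        using GG 1(1) 2(1) by (simp add: mm_add_l mm_add_r rc_lc)
      show "dg ({True} \<times> {..<n1} \<union> {False} \<times> {..<n2}) \<diamondop> (lc True y1 + lc False y2) = lc True y1 + lc False y2"
        using 1(2) 2(2) by (auto simp: dg_l lookup_add ent_lc split: if_split_asm)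
    qed simp
    also have "card ({True} \<times> {..<n1} \<union> {False} \<times> {..<n2}) = n1 + n2"
      by (subst card_Un_disjoint) (auto simp: card_cartesian_product)
    finally show ?thesis using kmult_max[OF 1(4)] kmult_max[OF 2(4)] by (simp add: k_def)
  qed
  show "kmult N M1 + kmult N M2 \<le> kmult N M"
  proof (rule kmult_max)
    define k1 where "k1 = kmult N M1"
    define k2 where "k2 = kmult N M2"
    from kmult_in[of N M1] obtain i r where h: "\<And>a. a < k1 \<Longrightarrow> kh N M1 (i a)" "\<And>a. a < k1 \<Longrightarrow> kh M1 N (r a)"
      "\<And>a b. a < k1 \<Longrightarrow> b < k1 \<Longrightarrow> tr (r a \<diamondop> i b) = (if a = b then 1 else 0)" unfolding dual_families_def k1_def by blast
    from kmult_in[of N M2] obtain i' r' where h': "\<And>a. a < k2 \<Longrightarrow> kh N M2 (i' a)" "\<And>a. a < k2 \<Longrightarrow> kh M2 N (r' a)"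
      "\<And>a b. a < k2 \<Longrightarrow> b < k2 \<Longrightarrow> tr (r' a \<diamondop> i' b) = (if a = b then 1 else 0)" unfolding dual_families_def k2_def by blast
    define j where "j a = (if a < k1 then i1 \<diamondop> i a else i2 \<diamondop> i' (a - k1))" for a
    define s where "s a = (if a < k1 then r a \<diamondop> r1 else r' (a - k1) \<diamondop> r2)" for a
    have "dual_families N M (k1 + k2)" unfolding dual_families_def
    proof (intro exI conjI allI impI)
      fix a assume a: "a < k1 + k2"
      show "kh N M (j a)" using a kh_comp[OF h(1) d(1)] kh_comp[OF h'(1)[of "a - k1"] d(3)] by (auto simp: j_def)
      show "kh M N (s a)" using a kh_comp[OF d(2) h(2)] kh_comp[OF d(4) h'(2)[of "a - k1"]] by (auto simp: s_def)
      fix b assume b: "b < k1 + k2"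
      have c: "s a \<diamondop> j b = (if a < k1 then if b < k1 then r a \<diamondop> i b else 0 else if b < k1 then 0 else r' (a - k1) \<diamondop> i' (b - k1))"
        using a b kh_eqs(1,2)[OF h(1)[of b]] kh_eqs(1,2)[OF h'(1)[of "b - k1"]]
        by (auto simp: s_def j_def mm_assoc mm_asc[OF d(5)] mm_asc[OF d(6)] mm_asc[OF d(7)] mm_asc[OF d(8)])
      show "tr (s a \<diamondop> j b) = (if a = b then 1 else 0)"
        unfolding c using a b h(3)[of a b] h'(3)[of "a - k1" "b - k1"] by auto
    qed
    then show "dual_families N M (kmult N M1 + kmult N M2)" by (simp add: k1_def k2_def)
  qed
qed

lemma kmult_iso: assumes "kiso M M'" shows "kmult N M = kmult N M'"
proof -
  have "kmult N M1 \<le> kmult N M2" if i: "kiso M1 M2" for M1 :: "'x kmod" and M2 :: "'y kmod"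
  proof (rule kmult_max)
    define k where "k = kmult N M1"
    from i obtain f g where fg: "kh M1 M2 f" "kh M2 M1 g" "g \<diamondop> f = mE M1" unfolding kiso_def by blast
    from kmult_in[of N M1] obtain i r where h: "\<And>a. a < k \<Longrightarrow> kh N M1 (i a)" "\<And>a. a < k \<Longrightarrow> kh M1 N (r a)"
      "\<And>a b. a < k \<Longrightarrow> b < k \<Longrightarrow> tr (r a \<diamondop> i b) = (if a = b then 1 else 0)" unfolding dual_families_def k_def by blast
    have "tr ((r a \<diamondop> g) \<diamondop> (f \<diamondop> i b)) = (if a = b then 1 else 0)" if "a < k" "b < k" for a b
      using h(3)[OF that] by (simp add: mm_assoc mm_asc[OF fg(3)] kh_eqs(2)[OF h(1)[OF that(2)]])
    then show "dual_families N M2 (kmult N M1)" unfolding dual_families_def k_def[symmetric]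
      by (intro exI[of _ "\<lambda>a. f \<diamondop> i a"] exI[of _ "\<lambda>a. r a \<diamondop> g"]) (use kh_comp[OF h(1) fg(1)] kh_comp[OF fg(2) h(2)] in auto)
  qed
  with assms show ?thesis by (metis antisym kiso_sym)
qed

text \<open>Over the complex numbers an element of a local endomorphism ring is a scalar plus a
  nilpotent, so its trace is the scalar times the dimension. In this form locality speaks directly
  about the trace pairing.\<close>

definition klocal :: "'i kmod \<Rightarrow> bool" where
  "klocal N \<longleftrightarrow> (\<forall>f. kh N N f \<longrightarrow> tr f \<noteq> 0 \<longrightarrow> (\<exists>G. G \<diamondop> f = mE N))"

lemma kh_inverse:
  assumes v: "vmod M" "vmod N" and f: "kh M N f" and g: "g \<diamondop> f = mE M" "f \<diamondop> g = mE N" "g \<diamondop> mE N = g" "mE M \<diamondop> g = g"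
  shows "kh N M g"
proof -
  have "g \<diamondop> W = V \<diamondop> g" if "f \<diamondop> V = W \<diamondop> f" "mE M \<diamondop> V = V" "W \<diamondop> mE N = W" for V W
  proof -
    have "g \<diamondop> W = g \<diamondop> (W \<diamondop> f) \<diamondop> g" by (simp add: mm_assoc g that)
    also have "\<dots> = (g \<diamondop> f) \<diamondop> (V \<diamondop> g)" by (simp only: that(1)[symmetric] mm_assoc)
    also have "\<dots> = V \<diamondop> g" by (simp only: g(1) mm_asc[OF that(2)])
    finally show ?thesis .
  qed
  then show ?thesis unfolding kh_def using g kh_eqs[OF f] vmod_eqs[OF v(1)] vmod_eqs[OF v(2)] by simp
qed

lemma left_invertible_tr: 
  assumes "kh M N f" "G \<diamondop> f = mE M" "vmod M" "vmod N"
  shows "\<exists>k. tr (mE N) = tr (mE M) + of_nat k"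
proof -
  note e = kh_eqs(1,2,6,7)[OF assms(1)] vmod_eqs[OF assms(3)] vmod_eqs[OF assms(4)] assms(2) mm_asc[OF assms(2)]
  define p where "p = f \<diamondop> (G \<diamondop> mE N)"
  have "(mE N - p) \<diamondop> (mE N - p) = mE N - p" by (simp add: p_def fm_alg e)
  then obtain k where k: "tr (mE N - p) = of_nat k" by (rule tr_idem)
  have "tr p = tr (mE M)" unfolding p_def by (subst tr_comm) (simp add: mm_assoc e)
  with k show ?thesis by (intro exI[of _ k]) (simp add: tr_diff algebra_simps)
qed

text \<open>\<open>r \<diamondop> i\<close> and \<open>i \<diamondop> r\<close> have the same
  nonzero trace, so both are left invertible. Then each module embeds in the other, the dimensions
  agree, and \<open>i\<close> is an isomorphism.\<close>

lemma local_pair: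
  assumes v: "vmod N" "vmod N'" and l: "klocal N" "klocal N'" and h: "kh N N' i" "kh N' N r" and t: "tr (r \<diamondop> i) \<noteq> 0"
  shows "kiso N N'"
proof -
  obtain G where G: "G \<diamondop> (r \<diamondop> i) = mE N" using l(1) kh_comp[OF h] t unfolding klocal_def by blast
  have "tr (i \<diamondop> r) \<noteq> 0" using t by (simp add: tr_comm[of i r])
  then obtain G' where G': "G' \<diamondop> (i \<diamondop> r) = mE N'" using l(2) kh_comp[OF h(2,1)] unfolding klocal_def by blast
  have GG: "(G \<diamondop> r) \<diamondop> i = mE N" "(G' \<diamondop> i) \<diamondop> r = mE N'" using G G' by (simp_all add: mm_assoc)
  obtain k k' where k: "tr (mE N') = tr (mE N) + of_nat k" "tr (mE N) = tr (mE N') + of_nat k'"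
    using left_invertible_tr[OF h(1) GG(1) v] left_invertible_tr[OF h(2) GG(2) v(2,1)] by blast
  then have "of_nat (k + k') = (0 :: complex)" by (simp add: algebra_simps)
  then have "k + k' = 0" unfolding of_nat_eq_0_iff .
  then have T: "tr (mE N) = tr (mE N')" using k by simp
  define g where "g = mE N \<diamondop> (G \<diamondop> (r \<diamondop> mE N'))"
  note e = kh_eqs(1,2,6,7)[OF h(1)] vmod_eqs[OF v(1)] vmod_eqs[OF v(2)]
  have g: "g \<diamondop> i = mE N" "g \<diamondop> mE N' = g" "mE N \<diamondop> g = g" by (simp_all add: g_def mm_assoc e G)
  have "i \<diamondop> g = mE N'" by (rule one_sided_inverse[OF g(1)]) (simp_all add: e g T)
  with g show ?thesis unfolding kiso_def using h(1) kh_inverse[OF v h(1) g(1)] by blast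
qed

lemma kmult_other: assumes "vmod N" "vmod N'" "klocal N" "klocal N'" "\<not> kiso N N'" shows "kmult N N' = 0"
proof (rule ccontr)
  assume "kmult N N' \<noteq> 0"
  then have k: "0 < kmult N N'" by simp
  obtain i r where *: "\<forall>a<kmult N N'. kh N N' (i a) \<and> kh N' N (r a)"
    "\<forall>a<kmult N N'. \<forall>b<kmult N N'. tr (r a \<diamondop> i b) = (if a = b then 1 else 0)"
    using kmult_in[of N N'] unfolding dual_families_def by blast
  have "kh N N' (i 0)" "kh N' N (r 0)" "tr (r 0 \<diamondop> i 0) = 1" using *(1)[rule_format, OF k] *(2)[rule_format, OF k k] by auto
  then show False using local_pair[OF assms(1-4), of "i 0" "r 0"] assms(5) by simp
qed

lemma kmult_self: assumes "vmod N" "tr (mE N) \<noteq> 0" shows "1 \<le> kmult N N"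
proof (rule kmult_max)
  show "dual_families N N 1" unfolding dual_families_def
    by (intro exI[of _ "\<lambda>_. mE N"] exI[of _ "\<lambda>_. sc (1 / tr (mE N)) (mE N)"])
       (use assms in \<open>simp add: kh_id kh_lin mm_sc_l vmod_eqs tr_sc\<close>)
qed

section \<open>Endomorphism rings and invariants of the indecomposables\<close>

section \<open>The standard modules are local and pairwise non-isomorphic\<close>

text \<open>K has the eigenvalue \<open>s\<close> on one block and \<open>- s\<close> on the other,
  so the off-diagonal blocks vanish.\<close>

lemma kr_block:
  assumes s: "s \<noteq> 0" and f: "kh (Kr s u w A B) (Kr s u' w' A' B') f"
  shows "\<exists>fU fW. f = un True True \<boxtimes> fU + un False False \<boxtimes> fW \<and> idn u' \<diamondop> fU = fU \<and> fU \<diamondop> idn u = fU \<and>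
    idn w' \<diamondop> fW = fW \<and> fW \<diamondop> idn w = fW \<and> fW \<diamondop> A \<diamondop> idn u = idn w' \<diamondop> A' \<diamondop> fU \<and> fW \<diamondop> B \<diamondop> idn u = idn w' \<diamondop> B' \<diamondop> fU"
proof -
  note e = kh_eqs(1-5)[OF f]
  let ?m = "\<lambda>b. if b then idn u else idn w" and ?m' = "\<lambda>b. if b then idn u' else idn w'"
  define g where "g b c = rc b (?m' b) \<diamondop> (f \<diamondop> lc c (?m c))" for b c
  have K: "rc b (?m' b) \<diamondop> mK (Kr s u' w' A' B') = (if b then sc s (rc b (?m' b)) else - sc s (rc b (?m' b)))"
    "mK (Kr s u w A B) \<diamondop> lc b (?m b) = (if b then sc s (lc b (?m b)) else - sc s (lc b (?m b)))" for b
    by (auto simp: fm_alg rc_krn krn_lc idn_idn1)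
  have off: "g b c = 0" if "b \<noteq> c" for b c
  proof -
    have "rc b (?m' b) \<diamondop> mK (Kr s u' w' A' B') \<diamondop> (f \<diamondop> lc c (?m c)) = rc b (?m' b) \<diamondop> (f \<diamondop> (mK (Kr s u w A B) \<diamondop> lc c (?m c)))"
      using e(3) by (simp only: mm_assoc[symmetric])
    then have "sc s (g b c) + sc s (g b c) = 0"
      using that unfolding K g_def by (cases b; cases c) (simp_all add: mm_sc_l mm_sc_r mm_minus_l mm_minus_r eq_neg_iff_add_eq_0 neg_eq_iff_add_eq_0)
    then have "sc (1 / (2 * s)) (sc (2 * s) (g b c)) = 0" by (simp add: sc_add_l[symmetric])
    then show ?thesis using s by (simp add: sc_sc)
  qed
  have E: "mE (Kr s u w A B) = lc True (idn u) \<diamondop> rc True (idn u) + lc False (idn w) \<diamondop> rc False (idn w)"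
     "mE (Kr s u' w' A' B') = lc True (idn u') \<diamondop> rc True (idn u') + lc False (idn w') \<diamondop> rc False (idn w')"
    by (simp_all add: lc_mm mm_rc lc_rc rc_lc' idn_idn1)
  have n: "idn u' \<diamondop> g True True = g True True" "g True True \<diamondop> idn u = g True True" "idn w' \<diamondop> g False False = g False False" "g False False \<diamondop> idn w = g False False"
    using mm_asc[OF mm_rc[of "idn u'" True "idn u'"], of "f \<diamondop> lc True (idn u)"] mm_asc[OF mm_rc[of "idn w'" False "idn w'"], of "f \<diamondop> lc False (idn w)"]
    by (simp_all add: g_def mm_assoc lc_mm idn_idn1)
  have "f = mE (Kr s u' w' A' B') \<diamondop> f \<diamondop> mE (Kr s u w A B)" using e(1,2) by simp
  also have "\<dots> = lc True (idn u') \<diamondop> g True True \<diamondop> rc True (idn u) + lc False (idn w') \<diamondop> g False False \<diamondop> rc False (idn w) +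
     (lc True (idn u') \<diamondop> g True False \<diamondop> rc False (idn w) + lc False (idn w') \<diamondop> g False True \<diamondop> rc True (idn u))"
    unfolding E g_def by (simp add: mm_add_l mm_add_r mm_assoc)
  also have "\<dots> = un True True \<boxtimes> g True True + un False False \<boxtimes> g False False"
    by (simp add: off) (simp add: lc_mm mm_rc lc_rc rc_lc' mm_assoc n)
  finally have fb: "f = un True True \<boxtimes> g True True + un False False \<boxtimes> g False False" .
  have "rc False (idn w') \<diamondop> (f \<diamondop> mA (Kr s u w A B)) \<diamondop> lc True (idn u) = rc False (idn w') \<diamondop> (mA (Kr s u' w' A' B') \<diamondop> f) \<diamondop> lc True (idn u)"
    "rc False (idn w') \<diamondop> (f \<diamondop> mB (Kr s u w A B)) \<diamondop> lc True (idn u) = rc False (idn w') \<diamondop> (mB (Kr s u' w' A' B') \<diamondop> f) \<diamondop> lc True (idn u)"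
    using e(4,5) by simp_all
  then have "g False False \<diamondop> A \<diamondop> idn u = idn w' \<diamondop> A' \<diamondop> g True True" "g False False \<diamondop> B \<diamondop> idn u = idn w' \<diamondop> B' \<diamondop> g True True"
    unfolding fb by (simp_all add: fm_alg krn_mm un_mm rc_krn rc_lc mm_rc n mm_asc[OF n(3)])
  with fb n show ?thesis by blast
qed

lemma toeplitz_ent:
  assumes H: "\<And>i j. Suc j < m \<Longrightarrow> ent F i (Suc j) = (if 0 < i \<and> i < m then ent F (i - 1) j else 0)" and F: "idn m \<diamondop> F = F"
  shows "j < m \<Longrightarrow> ent F i j = (if j \<le> i \<and> i < m then ent F (i - j) 0 else 0)"
proof (induction j arbitrary: i)
  case 0
  then show ?case using F by (auto simp: dg_l)
next
  case (Suc j)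
  then show ?case using H[of j i] Suc.IH[of "i - 1"] by (cases i) auto
qed

lemma toeplitz_invertible:
  assumes t: "\<And>i j. j < m \<Longrightarrow> ent F i j = (if j \<le> i \<and> i < m then ent F (i - j) 0 else 0)" and F: "F \<diamondop> idn m = F"
    and nz: "ent F 0 0 \<noteq> 0"
  shows "\<exists>G. G \<diamondop> F = idn m"
proof -
  have "x = 0" if x: "idn m \<diamondop> x = x" "F \<diamondop> x = 0" for x :: "(nat, unit) fm"
  proof -
    have "ent x i l = 0" for i l
    proof (induction i rule: less_induct)
      case (less i)
      show ?case
      proof (cases "i < m")
        case True
        have "0 = (\<Sum>j<m. ent F i j * ent x j l)"
          using arg_cong[OF x(2), of "\<lambda>y. ent y i l"] by (simp add: ent_mm_idn[OF x(1)])
        also have "\<dots> = (\<Sum>j<m. if j = i then ent F i i * ent x i l else 0)"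
        proof (rule sum.cong[OF refl])
          fix j assume "j \<in> {..<m}"
          then show "ent F i j * ent x j l = (if j = i then ent F i i * ent x i l else 0)"
            using less[of j] t[of j i] by (cases j i rule: linorder_cases) auto
        qed
        finally show ?thesis using True t[of i i] nz by auto
      qed (use x(1) in \<open>auto simp: dg_l\<close>)
    qed
    then show "x = 0" by (intro fm_eqI) simp
  qed
  then show ?thesis using left_inverse_ex[of F "idn m"] F idn_idn1 by blast
qed

lemma toeplitz_tr:
  assumes t: "\<And>i j. j < m \<Longrightarrow> ent F i j = (if j \<le> i \<and> i < m then ent F (i - j) 0 else 0)" and F: "F \<diamondop> idn m = F"
  shows "tr F = of_nat m * ent F 0 0"
proof -
  have "tr F = (\<Sum>i<m. ent F i i)" by (rule tr_eq) (use F in \<open>auto simp: dg_r\<close>)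
  also have "\<dots> = (\<Sum>i<m. ent F 0 0)" by (rule sum.cong[OF refl], subst t) auto
  finally show ?thesis by simp
qed

lemma klocal_blocks:
  assumes "\<And>fU fW. idn u \<diamondop> fU = fU \<Longrightarrow> fU \<diamondop> idn u = fU \<Longrightarrow> idn w \<diamondop> fW = fW \<Longrightarrow> fW \<diamondop> idn w = fW \<Longrightarrow>
      fW \<diamondop> A = A \<diamondop> fU \<Longrightarrow> fW \<diamondop> B = B \<diamondop> fU \<Longrightarrow> tr fU + tr fW \<noteq> 0 \<Longrightarrow> \<exists>G G'. G \<diamondop> fU = idn u \<and> G' \<diamondop> fW = idn w"
    and p: "pencil u w A B" and s: "s \<noteq> 0"
  shows "klocal (Kr s u w A B)"
  unfolding klocal_def
proof (intro allI impI)
  fix f assume "kh (Kr s u w A B) (Kr s u w A B) f" and t: "tr f \<noteq> 0"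
  from kr_block[OF s this(1)] obtain fU fW where f: "f = un True True \<boxtimes> fU + un False False \<boxtimes> fW"
    "idn u \<diamondop> fU = fU" "fU \<diamondop> idn u = fU" "idn w \<diamondop> fW = fW" "fW \<diamondop> idn w = fW"
    "fW \<diamondop> A \<diamondop> idn u = idn w \<diamondop> A \<diamondop> fU" "fW \<diamondop> B \<diamondop> idn u = idn w \<diamondop> B \<diamondop> fU" by blast
  have "fW \<diamondop> A = A \<diamondop> fU" "fW \<diamondop> B = B \<diamondop> fU" using f(6,7) by (simp_all add: mm_assoc pencil_eqs[OF p])
  moreover have "tr fU + tr fW \<noteq> 0" using t by (simp add: f(1) tr_add tr_krn tr_un)
  ultimately obtain G G' where G: "G \<diamondop> fU = idn u" "G' \<diamondop> fW = idn w" using assms(1)[OF f(2-5)] by blast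
  have "(un True True \<boxtimes> G + un False False \<boxtimes> G') \<diamondop> f = mE (Kr s u w A B)"
    by (simp add: f(1) fm_alg krn_mm un_mm G)
  then show "\<exists>G. G \<diamondop> f = mE (Kr s u w A B)" by blast
qed

lemma ent_sh: "ent (F \<diamondop> sh n) i j = (if Suc j < n then ent F i (Suc j) else 0)"
  by (simp add: sh_def ent_mm_pm)

lemma klocal_Xm: assumes "s \<noteq> 0" shows "klocal (Xm s n \<eta>)"
  unfolding Xm_def
proof (rule klocal_blocks[OF _ pencil_X assms])
  fix fU fW assume f: "idn n \<diamondop> fU = fU" "fU \<diamondop> idn n = fU" "idn n \<diamondop> fW = fW" "fW \<diamondop> idn n = fW"
    "fW \<diamondop> XA n \<eta> = XA n \<eta> \<diamondop> fU" "fW \<diamondop> XB n \<eta> = XB n \<eta> \<diamondop> fU" and t: "tr fU + tr fW \<noteq> 0"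
  \<comment> \<open>Whichever matrix of the pencil is the identity gives \<open>fW = fU\<close>; the
    other one then makes it commute with the shift.\<close>
  have e: "fW = fU" "fU \<diamondop> sh n = sh n \<diamondop> fU"
    using f by (cases \<eta>; simp add: fm_alg)+
  have H: "Suc j < n \<Longrightarrow> ent fU i (Suc j) = (if 0 < i \<and> i < n then ent fU (i - 1) j else 0)" for i j
    using arg_cong[OF e(2), of "\<lambda>z. ent z i j"] by (simp add: ent_sh ent_sh_mm)
  have T: "j < n \<Longrightarrow> ent fU i j = (if j \<le> i \<and> i < n then ent fU (i - j) 0 else 0)" for i j
    by (rule toeplitz_ent[OF H f(1)])
  have "tr fU = of_nat n * ent fU 0 0" by (rule toeplitz_tr[OF T f(2)])
  then have "ent fU 0 0 \<noteq> 0" using t e(1) by auto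
  then obtain G where "G \<diamondop> fU = idn n" using toeplitz_invertible[OF T f(2)] by blast
  then show "\<exists>G G'. G \<diamondop> fU = idn n \<and> G' \<diamondop> fW = idn n" using e(1) by blast
qed

text \<open>Compatibility with the shift makes \<open>F\<close> a lower triangular Toeplitz matrix.
  Compatibility with \<open>idn k\<close> clears its last row up to the corner, and the Toeplitz
  form carries these zeros to every subdiagonal.\<close>

lemma LT_endo:
  assumes f: "idn k \<diamondop> F' = F'" "F' \<diamondop> idn k = F'" "idn (Suc k) \<diamondop> F = F" "F \<diamondop> idn (Suc k) = F"
    "F \<diamondop> sh (Suc k) = sh (Suc k) \<diamondop> F'" "F \<diamondop> idn k = idn k \<diamondop> F'"
  shows "\<exists>c. F = sc c (idn (Suc k)) \<and> F' = sc c (idn k)"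
proof -
  have F': "F' = F \<diamondop> idn k" using f by simp
  have H: "ent F i (Suc j) = (if 0 < i \<and> i < Suc k then ent F (i - 1) j else 0)" if "Suc j < Suc k" for i j
    using arg_cong[OF f(5), of "\<lambda>z. ent z i j"] that by (simp add: ent_sh ent_sh_mm F' ent_mm_dg)
  have T: "j < Suc k \<Longrightarrow> ent F i j = (if j \<le> i \<and> i < Suc k then ent F (i - j) 0 else 0)" for i j
    by (rule toeplitz_ent[OF H f(3)])
  have z: "ent F k j = 0" if "j < k" for j
    using arg_cong[OF f(1), of "\<lambda>z. ent z k j"] that by (simp add: F' ent_mm_dg ent_dg_mm)
  have z': "ent F m 0 = 0" if "0 < m" for m
  proof (cases "m \<le> k")
    case True
    then have "ent F k (k - m) = ent F m 0" using T[of "k - m" k] by simp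
    then show ?thesis using z[of "k - m"] that True by simp
  next
    case False
    then show ?thesis using f(3) by (auto simp: dg_l)
  qed
  have "F = sc (ent F 0 0) (idn (Suc k))"
  proof (rule fm_eqI)
    fix i j
    show "ent F i j = ent (sc (ent F 0 0) (idn (Suc k))) i j"
    proof (cases "j < Suc k")
      case True
      then show ?thesis using T[OF True, of i] z'[of "i - j"] by (auto simp: ent_sc ent_dg)
    next
      case False
      then show ?thesis using f(4) by (auto simp: dg_r ent_sc ent_dg)
    qed
  qed
  then have F: "F = sc (ent F 0 0) (idn (Suc k))" .
  have "F' = sc (ent F 0 0) (idn (Suc k)) \<diamondop> idn k" unfolding F' by (rule arg_cong[OF F])
  then have "F' = sc (ent F 0 0) (idn k)" by (simp add: mm_sc_l idn_idn)
  with F show ?thesis by blast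
qed

lemma scalar_inverse: "c \<noteq> 0 \<Longrightarrow> \<exists>G. G \<diamondop> sc c (idn n) = idn n"
  by (rule exI[of _ "sc (1 / c) (idn n)"]) (simp add: mm_sc_l mm_sc_r sc_sc idn_idn1)

lemma klocal_LTm: assumes "s \<noteq> 0" shows "klocal (LTm s k)"
  unfolding LTm_def
proof (rule klocal_blocks[OF _ pencil_LT assms])
  fix fU fW assume f: "idn k \<diamondop> fU = fU" "fU \<diamondop> idn k = fU" "idn (Suc k) \<diamondop> fW = fW" "fW \<diamondop> idn (Suc k) = fW"
    "fW \<diamondop> sh (Suc k) = sh (Suc k) \<diamondop> fU" "fW \<diamondop> idn k = idn k \<diamondop> fU" and t: "tr fU + tr fW \<noteq> 0"
  from LT_endo[OF f] obtain c where c: "fW = sc c (idn (Suc k))" "fU = sc c (idn k)" by blast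
  then have "c \<noteq> 0" using t by auto
  then show "\<exists>G G'. G \<diamondop> fU = idn k \<and> G' \<diamondop> fW = idn (Suc k)" using scalar_inverse unfolding c by blast
qed

lemma klocal_Lm: assumes "s \<noteq> 0" shows "klocal (Lm s k)"
  unfolding Lm_def
proof (rule klocal_blocks[OF _ pencil_L assms])
  fix fU fW assume f: "idn (Suc k) \<diamondop> fU = fU" "fU \<diamondop> idn (Suc k) = fU" "idn k \<diamondop> fW = fW" "fW \<diamondop> idn k = fW"
    "fW \<diamondop> tp (sh (Suc k)) = tp (sh (Suc k)) \<diamondop> fU" "fW \<diamondop> idn k = idn k \<diamondop> fU" and t: "tr fU + tr fW \<noteq> 0"
  note g = f[THEN arg_cong[of _ _ tp], unfolded tp_mm tp_tp tp_dg[OF finite_lessThan]]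
  from LT_endo[OF g(4,3,2,1) g(5)[symmetric] g(6)[symmetric]] obtain c where "tp fU = sc c (idn (Suc k))" "tp fW = sc c (idn k)" by blast
  then have c: "fU = sc c (idn (Suc k))" "fW = sc c (idn k)" by (metis tp_tp tp_sc tp_dg finite_lessThan)+
  then have "c \<noteq> 0" using t by auto
  then show "\<exists>G G'. G \<diamondop> fU = idn (Suc k) \<and> G' \<diamondop> fW = idn k" using scalar_inverse unfolding c by blast
qed

lemma Pm_sel:
  "mE (Pm b) = un (0, ()) (0, ()) + un (1, ()) (1, ()) + un (2, ()) (2, ()) + un (3, ()) (3, ())"
  "mK (Pm b) = sc (sg b) (un (0, ()) (0, ()) - un (1, ()) (1, ()) - un (2, ()) (2, ()) + un (3, ()) (3, ()))"
  "mA (Pm b) = un (1, ()) (0, ()) + un (3, ()) (2, ())" "mB (Pm b) = un (2, ()) (0, ()) - un (3, ()) (1, ())"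
  by (simp_all add: Pm_def P0m_sel dg_unit krn_alg krn_un)

text \<open>An endomorphism is determined by the image of the generator, which lies in the
  K-eigenspace spanned by basis vectors 0 and 3. So it is a scalar plus a multiple of the nilpotent
  map from the top to the socle.\<close>

lemma klocal_Pm: "klocal (Pm b)"
  unfolding klocal_def
proof (intro allI impI)
  fix f assume f: "kh (Pm b) (Pm b) f" and t: "tr f \<noteq> 0"
  note e = kh_eqs(1-5)[OF f]
  let ?w = "\<lambda>i. un (i, ()) () :: (nat \<times> unit, unit) fm"
  define c where "c = f \<diamondop> ?w 0"
  define x where "x i = ent c (i, ()) ()" for i
  have row: "un () (i, ()) \<diamondop> c = sc (x i) (un () ())" for i
    by (rule fm_eqI) (simp add: ent_un_mm ent_sc ent_un x_def)
  have "mK (Pm b) \<diamondop> c = f \<diamondop> (mK (Pm b) \<diamondop> ?w 0)" unfolding c_def by (simp only: mm_assoc[symmetric] e(3))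
  then have K: "mK (Pm b) \<diamondop> c = sc (sg b) c" by (simp add: Pm_sel fm_alg un_mm c_def)
  have x12: "x i = 0" if "un () (i, ()) \<diamondop> mK (Pm b) = - sc (sg b) (un () (i, ()))" for i
  proof -
    have "(un () (i, ()) \<diamondop> mK (Pm b)) \<diamondop> c = sc (sg b) (un () (i, ()) \<diamondop> c)" by (simp only: mm_assoc K mm_sc_r)
    then have "- sc (sg b * x i) (un () ()) = sc (sg b * x i) (un () () :: (unit, unit) fm)"
      unfolding that by (simp only: mm_minus_l mm_sc_l row sc_sc)
    then have "ent (- sc (sg b * x i) (un () ())) () () = ent (sc (sg b * x i) (un () () :: (unit, unit) fm)) () ()" by simp
    then show ?thesis using sg_nz[of b] by (simp add: ent_sc ent_un)
  qed
  have x0: "x 1 = 0" "x 2 = 0" by (rule x12, simp add: Pm_sel fm_alg un_mm)+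
  have wx: "?w i \<diamondop> (un () (i, ()) \<diamondop> c) = sc (x i) (?w i)" for i by (simp add: row mm_sc_r un_mm)
  have "c = mE (Pm b) \<diamondop> c" unfolding c_def using e(2) by (simp only: mm_assoc[symmetric])
  also have "\<dots> = ?w 0 \<diamondop> (un () (0, ()) \<diamondop> c) + ?w 1 \<diamondop> (un () (1, ()) \<diamondop> c) + ?w 2 \<diamondop> (un () (2, ()) \<diamondop> c) + ?w 3 \<diamondop> (un () (3, ()) \<diamondop> c)"
    by (simp add: Pm_sel mm_add_l mm_assoc[symmetric] un_mm)
  finally have w0: "f \<diamondop> ?w 0 = sc (x 0) (?w 0) + sc (x 3) (?w 3)" unfolding wx by (simp add: x0 x0[unfolded One_nat_def] c_def[symmetric])
  have w1: "f \<diamondop> ?w 1 = sc (x 0) (?w 1)"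
  proof -
    have "f \<diamondop> ?w 1 = mA (Pm b) \<diamondop> (f \<diamondop> ?w 0)" unfolding mm_assoc[symmetric] e(4)[symmetric] by (simp add: Pm_sel mm_assoc mm_add_l un_mm)
    then show ?thesis by (simp add: w0 Pm_sel fm_alg un_mm)
  qed
  have w2: "f \<diamondop> ?w 2 = sc (x 0) (?w 2)"
  proof -
    have "f \<diamondop> ?w 2 = mB (Pm b) \<diamondop> (f \<diamondop> ?w 0)" unfolding mm_assoc[symmetric] e(5)[symmetric] by (simp add: Pm_sel mm_assoc mm_diff_l un_mm)
    then show ?thesis by (simp add: w0 Pm_sel fm_alg un_mm)
  qed
  have w3: "f \<diamondop> ?w 3 = sc (x 0) (?w 3)"
  proof -
    have "f \<diamondop> ?w 3 = mA (Pm b) \<diamondop> (f \<diamondop> ?w 2)" unfolding mm_assoc[symmetric] e(4)[symmetric] by (simp add: Pm_sel mm_assoc mm_add_l un_mm)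
    then show ?thesis by (simp add: w2 Pm_sel fm_alg un_mm)
  qed
  have uw: "un (i, ()) (j, ()) = ?w i \<diamondop> un () (j, ())" for i j :: nat by (simp add: un_mm)
  have "f = f \<diamondop> mE (Pm b)" using e(1) by simp
  also have "\<dots> = sc (x 0) (mE (Pm b)) + sc (x 3) (un (3, ()) (0, ()))"
    unfolding Pm_sel uw mm_add_r mm_assoc[symmetric] w0 w1[unfolded One_nat_def] w1 w2 w3
    by (simp add: fm_alg un_mm algebra_simps)
  finally have ff: "f = sc (x 0) (mE (Pm b)) + sc (x 3) (un (3, ()) (0, ()))" .
  then have "tr f = tr (sc (x 0) (mE (Pm b)) + sc (x 3) (un (3, ()) (0, ())))" by simp
  also have "\<dots> = 4 * x 0" by (simp add: Pm_sel tr_add tr_sc tr_un)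
  finally have "x 0 \<noteq> 0" using t by auto
  then have "(sc (1 / x 0) (mE (Pm b) - sc (x 3 / x 0) (un (3, ()) (0, ())))) \<diamondop> f = mE (Pm b)"
    by (subst ff) (simp add: Pm_sel fm_alg un_mm algebra_simps)
  then show "\<exists>G. G \<diamondop> f = mE (Pm b)" by blast
qed

text \<open>In \<open>kstd\<close> the indices of \<open>KL\<close> and \<open>KX\<close> are
  shifted by one: this excludes the empty regular block and lists each simple module only once,
  because \<open>LTm s 0\<close> and \<open>Lm (- s) 0\<close> are isomorphic.\<close>

datatype klab = KT bool nat | KL bool nat | KX bool nat cp1

fun kstd :: "klab \<Rightarrow> (bool \<times> nat) kmod" where
  "kstd (KT b k) = LTm (sg b) k" | "kstd (KL b k) = Lm (sg b) (Suc k)" | "kstd (KX b n \<eta>) = Xm (sg b) (Suc n) \<eta>"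

lemma vmod_kstd: "vmod (kstd l)" by (cases l) (simp_all add: vmod_std sg_sq)
lemma klocal_kstd: "klocal (kstd l)" by (cases l) (simp_all add: klocal_LTm klocal_Lm klocal_Xm sg_nz)

lemma tr_Kr: "tr (mE (Kr s u w A B)) = of_nat (u + w)" "tr (mK (Kr s u w A B)) = s * (of_nat u - of_nat w)"
  by (simp_all add: tr_add tr_diff tr_sc tr_krn tr_un tr_dg)
fun kdim :: "klab \<Rightarrow> nat" where
  "kdim (KT b k) = 2 * k + 1" | "kdim (KL b k) = 2 * k + 3" | "kdim (KX b n \<eta>) = 2 * n + 2"
lemma tr_kstd: "tr (mE (kstd l)) = of_nat (kdim l)"
proof -
  have e: "k + Suc k = 2 * k + 1" "Suc (Suc k) + Suc k = 2 * k + 3" "Suc k + Suc k = 2 * k + 2" for k by simp_all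
  show ?thesis by (cases l; simp only: kstd.simps LTm_def Lm_def Xm_def tr_Kr kdim.simps e)
qed
lemma tr_kstd_nz: "tr (mE (kstd l)) \<noteq> 0"
proof -
  have "kdim l \<noteq> 0" by (cases l) simp_all
  then show ?thesis unfolding tr_kstd of_nat_eq_0_iff .
qed
lemma trK_kstd: "tr (mK (kstd l)) = (case l of KT b k \<Rightarrow> - sg b | KL b k \<Rightarrow> sg b | KX b n \<eta> \<Rightarrow> 0)"
  by (cases l; simp only: kstd.simps LTm_def Lm_def Xm_def tr_Kr klab.case) simp_all

lemma sign_zero:
  assumes "kh M N f" "g \<diamondop> f = mE M" "vmod M" "mB M \<diamondop> mK M = sc s (mB M)" "mB N \<diamondop> mK N = - sc s (mB N)" "s \<noteq> 0"
  shows "mB M = 0"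
proof -
  have "sc s (f \<diamondop> mB M) = (f \<diamondop> mB M) \<diamondop> mK M" by (simp only: mm_assoc assms(4) mm_sc_r)
  also have "\<dots> = mB N \<diamondop> (f \<diamondop> mK M)" by (simp only: kh_eqs(5)[OF assms(1)] mm_assoc)
  also have "\<dots> = (mB N \<diamondop> mK N) \<diamondop> f" by (simp only: kh_eqs(3)[OF assms(1)] mm_assoc)
  also have "\<dots> = - sc s (f \<diamondop> mB M)" by (simp only: assms(5) kh_eqs(5)[OF assms(1)] mm_minus_l mm_sc_l)
  finally have "sc s (f \<diamondop> mB M) + sc s (f \<diamondop> mB M) = 0" by (simp only: eq_neg_iff_add_eq_0)
  then have "g \<diamondop> (sc s (f \<diamondop> mB M) + sc s (f \<diamondop> mB M)) = 0" by simp
  then have "sc s (mB M) + sc s (mB M) = 0" by (simp only: mm_add_r mm_sc_r mm_asc[OF assms(2)] vmod_eqs[OF assms(3)])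
  then have "sc (1 / (2 * s)) (sc (2 * s) (mB M)) = 0" by (simp add: sc_add_l[symmetric])
  then show ?thesis using assms(6) by (simp add: sc_sc)
qed

lemma krn_un_zero: "un x y \<boxtimes> Z = 0 \<Longrightarrow> Z = 0"
proof (rule fm_eqI)
  fix i j assume "un x y \<boxtimes> Z = 0"
  then have "ent (un x y \<boxtimes> Z) (x, i) (y, j) = 0" by simp
  then show "ent Z i j = ent 0 i j" by (simp add: ent_krn ent_un)
qed

text \<open>Both xi lead from the eigenvalue \<open>s\<close> to \<open>- s\<close> in one module
  and the other way round in the other, so a map commuting with K is compatible with them only if
  they vanish.\<close>

lemma kiso_sign:
  assumes "kiso (Kr s u w A B) (Kr (- s) u' w' A' B')" "pencil u w A B" "pencil u' w' A' B'" "s * s = 1"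
  shows "A = 0 \<and> B = 0"
proof -
  from assms(1) obtain f g where h: "kh (Kr s u w A B) (Kr (- s) u' w' A' B') f" "g \<diamondop> f = mE (Kr s u w A B)"
    unfolding kiso_def by blast
  have s: "s \<noteq> 0" using assms(4) by auto
  have v: "vmod (Kr s u w A B)" using vmod_Kr[OF assms(4,2)] .
  have "mB (Kr s u w A B) = 0"
    by (rule sign_zero[OF h v _ _ s]) (simp_all add: fm_alg krn_mm un_mm pencil_eqs[OF assms(2)] pencil_eqs[OF assms(3)] sc_minus_l)
  moreover have "mB (sw (Kr s u w A B)) = 0"
    by (rule sign_zero[where g = g, OF kh_sw[OF h(1)] _ vmod_sw[OF v] _ _ s])
       (simp_all add: fm_alg krn_mm un_mm pencil_eqs[OF assms(2)] pencil_eqs[OF assms(3)] sc_minus_l h(2))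
  ultimately show ?thesis by (auto dest: krn_un_zero)
qed

lemma idn_nz: "idn (Suc n) \<noteq> 0"
  using ent_dg[of "{..<Suc n}" 0 0] by (metis lessThan_Suc_eq_insert_0 insertI1 finite_lessThan lookup_zero zero_neq_one)

lemma tr_sh: "tr (sh n) = 0"
  by (subst tr_eq[of "{}"]) (auto simp: sh_def ent_pm)

lemma Xm_iso_blocks:
  assumes i: "kiso (Xm s n \<alpha>) (Xm s n \<beta>)" and s: "s \<noteq> 0"
  shows "\<exists>F G H. F \<diamondop> XA n \<alpha> = XA n \<beta> \<diamondop> G \<and> F \<diamondop> XB n \<alpha> = XB n \<beta> \<diamondop> G \<and> F \<diamondop> H = idn n \<and> H \<diamondop> F = idn n \<and>
    idn n \<diamondop> G = G \<and> F \<diamondop> idn n = F"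
proof -
  from i obtain f g where h: "kh (Xm s n \<alpha>) (Xm s n \<beta>) f" "kh (Xm s n \<beta>) (Xm s n \<alpha>) g"
    "g \<diamondop> f = mE (Xm s n \<alpha>)" "f \<diamondop> g = mE (Xm s n \<beta>)" unfolding kiso_def by blast
  from kr_block[OF s h(1)[unfolded Xm_def]] obtain fU fW where f: "f = un True True \<boxtimes> fU + un False False \<boxtimes> fW"
    "idn n \<diamondop> fU = fU" "idn n \<diamondop> fW = fW" "fW \<diamondop> idn n = fW" "fW \<diamondop> XA n \<alpha> \<diamondop> idn n = idn n \<diamondop> XA n \<beta> \<diamondop> fU" "fW \<diamondop> XB n \<alpha> \<diamondop> idn n = idn n \<diamondop> XB n \<beta> \<diamondop> fU" by blast
  from kr_block[OF s h(2)[unfolded Xm_def]] obtain gU gW where g: "g = un True True \<boxtimes> gU + un False False \<boxtimes> gW"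
    "idn n \<diamondop> gW = gW" "gW \<diamondop> idn n = gW" by blast
  have e: "fW \<diamondop> XA n \<alpha> = XA n \<beta> \<diamondop> fU" "fW \<diamondop> XB n \<alpha> = XB n \<beta> \<diamondop> fU"
    using f(5,6) by (simp_all only: mm_assoc pencil_eqs[OF pencil_X])
  have "fW \<diamondop> gW = idn n" "gW \<diamondop> fW = idn n"
    using arg_cong[OF h(4), of "\<lambda>z. rc False (idn n) \<diamondop> (z \<diamondop> lc False (idn n))"] arg_cong[OF h(3), of "\<lambda>z. rc False (idn n) \<diamondop> (z \<diamondop> lc False (idn n))"]
    unfolding f(1) g(1) Xm_def Kr_sel
    by (simp_all add: fm_alg krn_mm un_mm krn_lc rc_lc f(3,4) g(2,3) idn_idn1 f(3)[THEN mm_asc] g(2)[THEN mm_asc])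
  then show ?thesis using f e by blast
qed

text \<open>For a finite second parameter, \<open>XA\<close> has trace n times the parameter, a
  conjugation invariant. Infinity is excluded since it would make the invertible \<open>F\<close>
  equal to \<open>sh ?n \<diamondop> G\<close>, whose first row is zero.\<close>

lemma Xm_iso_finite:
  assumes i: "kiso (Xm s (Suc n) (Finite l)) (Xm s (Suc n) \<beta>)" and s: "s \<noteq> 0" shows "\<beta> = Finite l"
proof -
  let ?n = "Suc n"
  from Xm_iso_blocks[OF assms] obtain F G H where x: "F \<diamondop> XA ?n (Finite l) = XA ?n \<beta> \<diamondop> G" "F \<diamondop> XB ?n (Finite l) = XB ?n \<beta> \<diamondop> G"
    "F \<diamondop> H = idn ?n" "H \<diamondop> F = idn ?n" "idn ?n \<diamondop> G = G" "F \<diamondop> idn ?n = F" by blast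
  show ?thesis
  proof (cases \<beta>)
    case (Finite m)
    have G: "G = F" using x(2,5,6) Finite by simp
    have trX: "tr (XA ?n (Finite z)) = of_nat ?n * z" for z by (simp only: XA.simps tr_add tr_sc tr_sh tr_dg finite_lessThan card_lessThan) simp
    have idX: "idn ?n \<diamondop> XA ?n (Finite z) = XA ?n (Finite z)" "XA ?n (Finite z) \<diamondop> idn ?n = XA ?n (Finite z)" for z
      using pencil_eqs(1,2)[OF pencil_X[of ?n "Finite z"]] by simp_all
    have "tr (XA ?n (Finite l)) = tr (H \<diamondop> (F \<diamondop> XA ?n (Finite l)))" by (simp only: mm_asc[OF x(4)] idX)
    also have "\<dots> = tr (H \<diamondop> (XA ?n (Finite m) \<diamondop> F))" by (simp only: x(1) Finite G)
    also have "\<dots> = tr (XA ?n (Finite m) \<diamondop> (F \<diamondop> H))" by (subst tr_comm) (simp only: mm_assoc)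
    also have "\<dots> = tr (XA ?n (Finite m))" by (simp only: x(3) idX)
    finally have "of_nat ?n * l = of_nat ?n * m" unfolding trX .
    then show ?thesis using Finite by (simp del: of_nat_Suc)
  next
    case Infinity
    have "un () 0 \<diamondop> sh ?n = 0" by (rule fm_eqI) (auto simp: ent_un_mm sh_def ent_pm)
    from mm_asc[OF this] have "un () 0 \<diamondop> (sh ?n \<diamondop> G) = 0" by simp
    moreover have "F = sh ?n \<diamondop> G" using x(2,6) Infinity by simp
    ultimately have "un () 0 \<diamondop> F = 0" by simp
    from mm_asc[OF this] have "un () 0 \<diamondop> (F \<diamondop> H) = 0" by simp
    then show ?thesis unfolding x(3) by (simp add: un_idn)
  qed
qed

lemma Xm_iso: assumes i: "kiso (Xm s (Suc n) \<eta>) (Xm s (Suc n) \<eta>')" and s: "s \<noteq> 0" shows "\<eta> = \<eta>'"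
  using Xm_iso_finite[OF _ s] i kiso_sym[OF i] by (cases \<eta>; cases \<eta>') auto

text \<open>Dimension and trace of K separate the labels except for a \<open>KT\<close> against a
  \<open>KL\<close> of opposite sign and for two \<open>KX\<close> of equal size. Signs settle the
  former, and signs together with \<open>Xm_iso\<close> the latter.\<close>

lemma kstd_inj: assumes i: "kiso (kstd l) (kstd l')" shows "l = l'"
proof -
  have "kdim l = kdim l'" using kiso_tr(1)[OF vmod_kstd vmod_kstd i] unfolding tr_kstd of_nat_eq_iff .
  note d = this kiso_tr(2)[OF vmod_kstd vmod_kstd i, unfolded trK_kstd]
  have TL: False if "kiso (kstd (KT b k)) (kstd (KL b' k'))" for b k b' k'
  proof -
    have "kdim (KT b k) = kdim (KL b' k')" using kiso_tr(1)[OF vmod_kstd vmod_kstd that] unfolding tr_kstd of_nat_eq_iff .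
    then have k: "k = Suc k'" by simp
    have "- sg b = sg b'" using kiso_tr(2)[OF vmod_kstd vmod_kstd that] unfolding trK_kstd by simp
    then have s: "sg b' = - sg b" by simp
    have "idn k = 0" using kiso_sign[OF that[unfolded kstd.simps LTm_def Lm_def s] pencil_LT pencil_L sg_sq] by simp
    then show False using k idn_nz by simp
  qed
  show ?thesis
  proof (cases l)
    case l: (KT b k)
    show ?thesis
    proof (cases l')
      case (KL b' k') then show ?thesis using TL i l by blast
    qed (use d l in \<open>auto simp: sg_inj, presburger?\<close>)
  next
    case l: (KL b k)
    show ?thesis
    proof (cases l')
      case (KT b' k') then show ?thesis using TL kiso_sym[OF i] l by blast
    qed (use d l in \<open>auto simp: sg_inj, presburger?\<close>)
  next
    case l: (KX b n \<eta>)
    show ?thesis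
    proof (cases l')
      case l': (KX b' n' \<eta>')
      have n: "n' = n" using d(1) by (simp add: l l')
      show ?thesis
      proof (cases "b = b'")
        case True
        then show ?thesis using Xm_iso[of "sg b" n \<eta> \<eta>'] i n sg_nz by (simp add: l l')
      next
        case False
        then have "sg b' = - sg b" by (cases b; cases b') (auto simp: sg_def)
        then have "kiso (Kr (sg b) (Suc n) (Suc n) (XA (Suc n) \<eta>) (XB (Suc n) \<eta>)) (Kr (- sg b) (Suc n) (Suc n) (XA (Suc n) \<eta>') (XB (Suc n) \<eta>'))"
          using i n by (simp add: l l' Xm_def)
        from kiso_sign[OF this pencil_X pencil_X sg_sq] have "XA (Suc n) \<eta> = 0" "XB (Suc n) \<eta> = 0" by simp_all
        then show ?thesis using idn_nz by (cases \<eta>) auto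
      qed
    next
      case (KT b' k') then show ?thesis using d(1) l by simp presburger
    next
      case (KL b' k') then show ?thesis using d(1) l by simp presburger
    qed
  qed
qed

lemma Pm_AB: "mA (Pm b) \<diamondop> mB (Pm b) = un (3, ()) (0, ())"
  by (simp add: Pm_sel fm_alg un_mm)

lemma Pm_not_Kr: assumes "kiso (Pm b) (Kr s u w A B)" shows False
proof -
  from assms obtain f g where h: "kh (Pm b) (Kr s u w A B) f" "g \<diamondop> f = mE (Pm b)" unfolding kiso_def by blast
  have "f \<diamondop> (mA (Pm b) \<diamondop> mB (Pm b)) = (mA (Kr s u w A B) \<diamondop> mB (Kr s u w A B)) \<diamondop> f" by (simp only: kh_eqs[OF h(1)] mm_assoc)
  also have "mA (Kr s u w A B) \<diamondop> mB (Kr s u w A B) = 0" by (simp add: krn_mm un_mm)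
  finally have "g \<diamondop> (f \<diamondop> (mA (Pm b) \<diamondop> mB (Pm b))) = 0" by simp
  then have "mA (Pm b) \<diamondop> mB (Pm b) = 0" by (simp only: mm_asc[OF h(2)] vmod_eqs[OF vmod_Pm])
  then show False by (simp add: Pm_AB)
qed

text \<open>xi_1 xi_2 is the same matrix \<open>T\<close> in both modules, while \<open>T\<close>
  followed on its right by K is \<open>T\<close> up to the sign of the label. A homomorphism between
  different signs would kill \<open>T\<close>.\<close>

lemma Pm_inj: assumes "kiso (Pm b) (Pm b')" shows "b = b'"
proof (rule ccontr)
  assume "b \<noteq> b'"
  then have s: "sg b' = - sg b" by (cases b; cases b') (auto simp: sg_def)
  define T :: "(nat \<times> unit, nat \<times> unit) fm" where "T = un (3, ()) (0, ())"
  from assms obtain f g where h: "kh (Pm b) (Pm b') f" "g \<diamondop> f = mE (Pm b)" unfolding kiso_def by blast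
  have u: "f \<diamondop> T = T \<diamondop> f"
    using arg_cong2[OF Pm_AB[of b] Pm_AB[of b'], of "\<lambda>x y. f \<diamondop> x = y \<diamondop> f"] by (simp add: T_def mm_assoc kh_eqs[OF h(1)])
  have TK: "T \<diamondop> mK (Pm c) = sc (sg c) T" "mE (Pm c) \<diamondop> T = T" for c by (simp_all add: T_def Pm_sel fm_alg un_mm)
  have "sc (sg b) (f \<diamondop> T) = (f \<diamondop> T) \<diamondop> mK (Pm b)" by (simp only: mm_assoc TK mm_sc_r)
  also have "\<dots> = T \<diamondop> (f \<diamondop> mK (Pm b))" by (simp only: u mm_assoc)
  also have "\<dots> = (T \<diamondop> mK (Pm b')) \<diamondop> f" by (simp only: kh_eqs(3)[OF h(1)] mm_assoc)
  also have "\<dots> = - sc (sg b) (f \<diamondop> T)" by (simp only: TK s sc_minus_l mm_minus_l mm_sc_l u)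
  finally have "sc (sg b) (f \<diamondop> T) + sc (sg b) (f \<diamondop> T) = 0" by (simp only: eq_neg_iff_add_eq_0)
  then have "g \<diamondop> (sc (sg b) (f \<diamondop> T) + sc (sg b) (f \<diamondop> T)) = 0" by simp
  then have "sc (sg b) T + sc (sg b) T = 0" by (simp only: mm_add_r mm_sc_r mm_asc[OF h(2)] TK)
  then have "sc (1 / (2 * sg b)) (sc (2 * sg b) T) = 0" by (simp add: sc_add_l[symmetric])
  then show False using sg_nz[of b] by (simp add: sc_sc T_def)
qed

section \<open>From quadruples of matrices to algebra homomorphisms on the free algebra and
  back\<close>

section \<open>Representations of the free algebra\<close>

definition lin :: "('k \<Rightarrow> ('x \<Rightarrow>\<^sub>0 complex)) \<Rightarrow> ('k \<Rightarrow>\<^sub>0 complex) \<Rightarrow> ('x \<Rightarrow>\<^sub>0 complex)" where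
  "lin \<phi> p = (\<Sum>k\<in>Poly_Mapping.keys p. sc (Poly_Mapping.lookup p k) (\<phi> k))"

lemma lin_eq: "finite I \<Longrightarrow> Poly_Mapping.keys p \<subseteq> I \<Longrightarrow> lin \<phi> p = (\<Sum>k\<in>I. sc (Poly_Mapping.lookup p k) (\<phi> k))"
  unfolding lin_def by (rule sum.mono_neutral_left) (auto simp: in_keys_iff)
lemma lin_add: "lin \<phi> (p + q) = lin \<phi> p + lin \<phi> q"
proof -
  let ?S = "Poly_Mapping.keys p \<union> Poly_Mapping.keys q"
  have "lin \<phi> (p + q) = (\<Sum>k\<in>?S. sc (Poly_Mapping.lookup (p + q) k) (\<phi> k))"
    using keys_add[of p q] by (intro lin_eq) auto
  then show ?thesis by (simp add: lin_eq[of ?S] lookup_add sc_add_l sum.distrib)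
qed
lemma lin_single: "lin \<phi> (Poly_Mapping.single k c) = sc c (\<phi> k)"
  by (simp add: lin_def)
lemma lin_zero[simp]: "lin \<phi> 0 = 0" by (simp add: lin_def)
lemma lin_minus: "lin \<phi> (- p) = - lin \<phi> p"
  using lin_add[of \<phi> p "- p"] by (simp add: eq_neg_iff_add_eq_0 add.commute)
lemma lin_diff: "lin \<phi> (p - q) = lin \<phi> p - lin \<phi> q"
  using lin_add[of \<phi> p "- q"] by (simp add: lin_minus)
lemma lin_sum: "lin \<phi> (sum f I) = (\<Sum>i\<in>I. lin \<phi> (f i))"
  by (induction I rule: infinite_finite_induct) (auto simp: lin_add)
lemma sum_singles: "p = (\<Sum>k\<in>Poly_Mapping.keys p. Poly_Mapping.single k (Poly_Mapping.lookup p k))"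
proof (rule poly_mapping_eqI)
  fix x
  have "Poly_Mapping.lookup (\<Sum>k\<in>Poly_Mapping.keys p. Poly_Mapping.single k (Poly_Mapping.lookup p k)) x
      = (\<Sum>k\<in>Poly_Mapping.keys p. if k = x then Poly_Mapping.lookup p x else 0)"
    unfolding lookup_sum by (rule sum.cong) (auto simp: lookup_single when_def)
  then show "Poly_Mapping.lookup p x = Poly_Mapping.lookup (\<Sum>k\<in>Poly_Mapping.keys p. Poly_Mapping.single k (Poly_Mapping.lookup p k)) x"
    by (auto simp: in_keys_iff)
qed
lemma lin_mult:
  fixes \<phi> :: "'k::monoid_add \<Rightarrow> ('i, 'i) fm"
  assumes "\<And>k l. \<phi> (k + l) = \<phi> k \<diamondop> \<phi> l"
  shows "lin \<phi> (p * q) = lin \<phi> p \<diamondop> lin \<phi> q"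
proof -
  have "lin \<phi> (p * q) = lin \<phi> ((\<Sum>k\<in>Poly_Mapping.keys p. Poly_Mapping.single k (Poly_Mapping.lookup p k)) *
     (\<Sum>k\<in>Poly_Mapping.keys q. Poly_Mapping.single k (Poly_Mapping.lookup q k)))"
    by (simp only: sum_singles[symmetric])
  also have "\<dots> = lin \<phi> p \<diamondop> lin \<phi> q"
    by (simp add: sum_product mult_single lin_sum lin_single assms lin_def[of _ p] lin_def[of _ q] mm_sum_l mm_sum_r mm_sc_l mm_sc_r sc_sc)
      (subst sum.swap, simp add: sc_sum sc_sc mult.commute)
  finally show ?thesis .
qed

fun gop :: "'i kmod \<Rightarrow> k2_gen \<Rightarrow> ('i, 'i) fm" where
  "gop M GK = mK M" | "gop M GXi1 = mA M" | "gop M GXi2 = mB M"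
primrec wevl :: "'i kmod \<Rightarrow> k2_gen list \<Rightarrow> ('i, 'i) fm" where
  "wevl M [] = mE M" | "wevl M (g # gs) = gop M g \<diamondop> wevl M gs"
definition wev :: "'i kmod \<Rightarrow> k2_word \<Rightarrow> ('i, 'i) fm" where "wev M w = wevl M (letters w)"
abbreviation ev :: "'i kmod \<Rightarrow> k2_free \<Rightarrow> ('i, 'i) fm" where "ev M \<equiv> lin (wev M)"

lemma wevl_E: "vmod M \<Longrightarrow> mE M \<diamondop> wevl M gs = wevl M gs" "vmod M \<Longrightarrow> wevl M gs \<diamondop> mE M = wevl M gs"
proof -
  have "mE M \<diamondop> gop M g = gop M g" if "vmod M" for g using vmod_eqs[OF that] by (cases g) auto
  then show "vmod M \<Longrightarrow> mE M \<diamondop> wevl M gs = wevl M gs" by (cases gs) (auto simp: vmod_eqs mm_assoc[symmetric])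
  show "vmod M \<Longrightarrow> wevl M gs \<diamondop> mE M = wevl M gs" by (induction gs) (auto simp: vmod_eqs mm_assoc)
qed
lemma wevl_append: "vmod M \<Longrightarrow> wevl M (xs @ ys) = wevl M xs \<diamondop> wevl M ys"
  by (induction xs) (auto simp: wevl_E mm_assoc)
lemma wev_add: "vmod M \<Longrightarrow> wev M (u + v) = wev M u \<diamondop> wev M v"
  by (simp add: wev_def plus_k2_word_def wevl_append)
lemma ev_mult: "vmod M \<Longrightarrow> ev M (p * q) = ev M p \<diamondop> ev M q"
  by (rule lin_mult) (rule wev_add)
lemma wev_0: "wev M 0 = mE M" by (simp add: wev_def zero_k2_word_def)
lemma ev_1: "ev M 1 = mE M"
  by (simp add: single_one[symmetric] lin_single wev_0 del: single_one)
lemma ev_gen: "vmod M \<Longrightarrow> ev M kK = mK M" "vmod M \<Longrightarrow> ev M kXi1 = mA M" "vmod M \<Longrightarrow> ev M kXi2 = mB M"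
  by (simp_all add: kK_def kXi1_def kXi2_def of_word_def lin_single wev_def vmod_eqs)
lemma ev_E: assumes "vmod M" shows "mE M \<diamondop> ev M p = ev M p" "ev M p \<diamondop> mE M = ev M p"
  by (simp_all add: lin_def mm_sum_l mm_sum_r mm_sc_l mm_sc_r wev_def wevl_E assms)

lemma kh_ev: assumes f: "kh M N f" "vmod M" "vmod N" shows "f \<diamondop> ev M p = ev N p \<diamondop> f"
proof -
  have "f \<diamondop> wevl M gs = wevl N gs \<diamondop> f" for gs
  proof (induction gs)
    case (Cons g gs)
    have "f \<diamondop> gop M g = gop N g \<diamondop> f" using kh_eqs[OF f(1)] by (cases g) auto
    then show ?case using Cons by (simp add: mm_assoc[symmetric]) (simp add: mm_assoc)
  qed (simp add: kh_eqs[OF f(1)])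
  then show ?thesis by (simp add: lin_def mm_sum_l mm_sum_r mm_sc_l mm_sc_r wev_def)
qed

lemma ring_rta: "ring (ring_of_type_algebra :: 'a::ring_1 ring)"
proof -
  have "\<exists>y. x + y = 0 \<and> y + x = 0" for x :: 'a by (rule exI[of _ "- x"]) simp
  then show ?thesis unfolding ring_of_type_algebra_def
    by unfold_locales (auto simp: algebra_simps Units_def)
qed
lemma rta_simps: "carrier ring_of_type_algebra = UNIV" "x \<otimes>\<^bsub>ring_of_type_algebra\<^esub> y = x * y" "x \<oplus>\<^bsub>ring_of_type_algebra\<^esub> y = x + y"
  "\<one>\<^bsub>ring_of_type_algebra\<^esub> = 1" "\<zero>\<^bsub>ring_of_type_algebra\<^esub> = 0" for x y :: "'a::ring_1"
  by (simp_all add: ring_of_type_algebra_def)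

lemma rta_inv: assumes "ring (ring_of_type_algebra :: 'a ring)" shows "\<ominus>\<^bsub>ring_of_type_algebra\<^esub> x = - (x :: 'a::ring_1)"
proof -
  interpret ring "ring_of_type_algebra :: 'a ring" by (rule assms)
  show ?thesis by (rule minus_equality) (simp_all add: rta_simps)
qed

lemma ideal_rtaI:
  fixes I :: "'a::ring_1 set"
  assumes R: "ring (ring_of_type_algebra :: 'a ring)" and "0 \<in> I" "\<And>x y. x \<in> I \<Longrightarrow> y \<in> I \<Longrightarrow> x + y \<in> I" "\<And>x. x \<in> I \<Longrightarrow> - x \<in> I"
    "\<And>x y. x \<in> I \<Longrightarrow> y * x \<in> I" "\<And>x y. x \<in> I \<Longrightarrow> x * y \<in> I"
  shows "ideal I ring_of_type_algebra"
proof (rule idealI[OF R])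
  interpret ring "ring_of_type_algebra :: 'a ring" by (rule R)
  show "subgroup I (add_monoid ring_of_type_algebra)"
  proof (rule subgroup.intro)
    fix x assume "x \<in> I"
    then show "inv\<^bsub>add_monoid ring_of_type_algebra\<^esub> x \<in> I"
      using assms(4) rta_inv[OF R, of x] by (simp add: a_inv_def)
  qed (use assms in \<open>auto simp: rta_simps\<close>)
qed (use assms in \<open>auto simp: rta_simps\<close>)

lemma ev_ideal: assumes v: "vmod M" and p: "p \<in> k2_ideal" shows "ev M p = 0"
proof -
  have "ideal {p. ev M p = 0} ring_of_type_algebra"
    by (rule ideal_rtaI[OF ring_rta]) (auto simp: lin_add lin_minus ev_mult[OF v])
  moreover have "k2_relators \<subseteq> {p. ev M p = 0}"
    by (auto simp: k2_relators_def lin_add lin_diff ev_mult[OF v] ev_gen[OF v] ev_1 vmod_eqs[OF v])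
  ultimately show ?thesis using ring.genideal_minimal[OF ring_rta] p unfolding k2_ideal_def by blast
qed

definition to_mat :: "nat \<Rightarrow> (nat, nat) fm \<Rightarrow> complex mat" where "to_mat n A = mat n n (\<lambda>(i, j). ent A i j)"
definition Rp :: "nat \<Rightarrow> nat kmod \<Rightarrow> k2_rep" where "Rp n N = (\<lambda>p. to_mat n (ev N p))"
definition mod_of :: "k2_rep \<Rightarrow> nat kmod" where
  "mod_of R = KM (to_fm (R 1)) (to_fm (R kK)) (to_fm (R kXi1)) (to_fm (R kXi2))"

lemma to_mat_carrier[simp]: "to_mat n A \<in> carrier_mat n n" "dim_row (to_mat n A) = n" "dim_col (to_mat n A) = n"
  by (simp_all add: to_mat_def)
lemma to_fm_to_mat: "idn n \<diamondop> A = A \<Longrightarrow> A \<diamondop> idn n = A \<Longrightarrow> to_fm (to_mat n A) = A"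
  by (rule fm_eqI) (auto simp: ent_to_fm to_mat_def dg_l dg_r)
lemma to_mat_to_fm: "M \<in> carrier_mat n n \<Longrightarrow> to_mat n (to_fm M) = M"
  by (rule eq_matI) (auto simp: ent_to_fm to_mat_def)
lemma to_mat_mm: "A \<diamondop> idn n = A \<Longrightarrow> idn n \<diamondop> B = B \<Longrightarrow> to_mat n (A \<diamondop> B) = to_mat n A * to_mat n B"
  by (rule eq_matI) (simp_all add: to_mat_def ent_mm_idn scalar_prod_def atLeast0LessThan row_def col_def)
lemma to_mat_lin: "to_mat n (A + B) = to_mat n A + to_mat n B" "to_mat n (sc c A) = c \<cdot>\<^sub>m to_mat n A" "to_mat n 0 = 0\<^sub>m n n" "to_mat n (idn n) = 1\<^sub>m n"
  by (rule eq_matI; simp add: to_mat_def lookup_add ent_sc ent_dg)+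
lemma Rp_module:
  assumes v: "vmod N" and E: "mE N = idn n"
  shows "k2_module (Rp n N)" "mdim (Rp n N) = n" "mod_of (Rp n N) = N"
proof -
  have e: "idn n \<diamondop> ev N p = ev N p" "ev N p \<diamondop> idn n = ev N p" for p using ev_E[OF v] E by simp_all
  show d: "mdim (Rp n N) = n" by (simp add: mdim_def Rp_def)
  have s: "ev N (Poly_Mapping.single 0 c * p) = sc c (ev N p)" for c p
    by (simp add: ev_mult[OF v] lin_single wev_0 mm_sc_l ev_E[OF v])
  have s': "Rp n N (Poly_Mapping.single 0 c * p) = c \<cdot>\<^sub>m Rp n N p" for c p unfolding Rp_def s by (simp add: to_mat_lin)
  show "k2_module (Rp n N)" unfolding k2_module_def d
    by (intro conjI allI ballI; (rule s')?; (auto simp: Rp_def ev_1 E to_mat_lin lin_add ev_mult[OF v] to_mat_mm e ev_ideal[OF v])?)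
  show "mod_of (Rp n N) = N"
    by (cases N) (use ev_1[of N] ev_gen[OF v] e[of 1] e[of kK] e[of kXi1] e[of kXi2] in \<open>simp add: mod_of_def Rp_def to_fm_to_mat\<close>)
qed

lemma to_fm_lin: "M \<in> carrier_mat n n \<Longrightarrow> N \<in> carrier_mat n n \<Longrightarrow> to_fm (M + N) = to_fm M + to_fm N"
  "M \<in> carrier_mat n n \<Longrightarrow> to_fm (c \<cdot>\<^sub>m M) = sc c (to_fm M)" "to_fm (0\<^sub>m n n) = 0"
  by (rule fm_eqI; auto simp: ent_to_fm lookup_add ent_sc)+

text \<open>A representation is recovered from its values at 1 and the three generators: both sides
  agree on words by multiplicativity, hence everywhere by linearity.\<close>

lemma mod_of:
  assumes R: "k2_module R"
  shows "vmod (mod_of R)" "mE (mod_of R) = idn (mdim R)" "R = Rp (mdim R) (mod_of R)" "ev (mod_of R) p = to_fm (R p)"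
proof -
  let ?n = "mdim R"
  have c: "R p \<in> carrier_mat ?n ?n" "R 1 = 1\<^sub>m ?n" "R (p + q) = R p + R q" "R (p * q) = R p * R q"
    "R (Poly_Mapping.single 0 c * p) = c \<cdot>\<^sub>m R p" "p \<in> k2_ideal \<Longrightarrow> R p = 0\<^sub>m ?n ?n" for p q c
    using R unfolding k2_module_def by blast+
  have f: "to_fm (R (p + q)) = to_fm (R p) + to_fm (R q)" "to_fm (R (p * q)) = to_fm (R p) \<diamondop> to_fm (R q)" 
    "to_fm (R (Poly_Mapping.single 0 c * p)) = sc c (to_fm (R p))" for p q c
  proof -
    have "dim_col (R p) = dim_row (R q)" using c(1)[of p] c(1)[of q] by auto
    then show "to_fm (R (p * q)) = to_fm (R p) \<diamondop> to_fm (R q)" by (simp add: c(4) to_fm_mult)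
  qed (simp_all add: c(3,5) to_fm_lin(1)[OF c(1) c(1)] to_fm_lin(2)[OF c(1)])
  have f1: "to_fm (R 1) = idn ?n" by (simp add: c(2) to_fm_one)
  have f0: "to_fm (R 0) = 0" using f(1)[of 0 0] by simp
  have fd: "to_fm (R (p - q)) = to_fm (R p) - to_fm (R q)" for p q using f(1)[of "p - q" q] by simp
  have rel: "to_fm (R p) = 0" if "p \<in> k2_relators" for p
  proof -
    have "p \<in> k2_ideal" using ring.genideal_self[OF ring_rta, of k2_relators] that by (auto simp: k2_ideal_def rta_simps)
    then show ?thesis using c(6)[of p] by (simp add: to_fm_lin(3))
  qed
  show E: "mE (mod_of R) = idn ?n" by (simp add: mod_of_def f1)
  have l: "idn ?n \<diamondop> to_fm (R p) = to_fm (R p)" "to_fm (R p) \<diamondop> idn ?n = to_fm (R p)" for p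
    using f(2)[of 1 p] f(2)[of p 1] by (simp_all add: f1)
  show v: "vmod (mod_of R)"
    using rel[of "kK * kK - 1"] rel[of "kXi1 * kXi1"] rel[of "kXi2 * kXi2"] rel[of "kK * kXi1 + kXi1 * kK"]
      rel[of "kK * kXi2 + kXi2 * kK"] rel[of "kXi1 * kXi2 + kXi2 * kXi1"]
    by (simp add: vmod_def mod_of_def f1 l k2_relators_def fd f eq_neg_iff_add_eq_0 idn_idn1 add.commute)
  have w: "to_fm (R (of_word (Word gs))) = wevl (mod_of R) gs" for gs
  proof (induction gs)
    case Nil
    have "of_word (Word []) = 1" by (simp add: of_word_def zero_k2_word_def[symmetric])
    then show ?case by (simp add: f1 E)
  next
    case (Cons g gs)
    have "of_word (Word (g # gs)) = of_word (Word [g]) * of_word (Word gs)" by (simp add: of_word_def mult_single plus_k2_word_def)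
    then have "to_fm (R (of_word (Word (g # gs)))) = to_fm (R (of_word (Word [g]))) \<diamondop> wevl (mod_of R) gs" by (simp add: f Cons)
    also have "to_fm (R (of_word (Word [g]))) = gop (mod_of R) g"
      by (cases g) (simp_all add: mod_of_def kK_def kXi1_def kXi2_def)
    finally show ?case by simp
  qed
  show evR: "ev (mod_of R) p = to_fm (R p)" for p
  proof -
    have sg: "Poly_Mapping.single k x = Poly_Mapping.single 0 x * of_word k" for k x by (simp add: of_word_def mult_single)
    have "to_fm (R (sum g I)) = (\<Sum>i\<in>I. to_fm (R (g i)))" for g :: "k2_word \<Rightarrow> k2_free" and I
      by (induction I rule: infinite_finite_induct) (auto simp: f0 f)
    then have "to_fm (R p) = (\<Sum>k\<in>Poly_Mapping.keys p. to_fm (R (Poly_Mapping.single k (Poly_Mapping.lookup p k))))"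
      by (subst sum_singles) simp
    also have "\<dots> = ev (mod_of R) p"
      unfolding lin_def by (rule sum.cong[OF refl], subst sg) (metis f(3) w wev_def k2_word.exhaust letters.simps)
    finally show ?thesis by simp
  qed
  show "R = Rp ?n (mod_of R)" by (rule ext) (simp add: Rp_def evR to_mat_to_fm c(1))
qed

lemma Rp_iso:
  assumes v: "vmod M" "vmod N" and E: "mE M = idn m" "mE N = idn n" and i: "kiso M N"
  shows "(Rp m M, Rp n N) \<in> k2_iso"
proof -
  from i obtain f g where h: "kh M N f" "kh N M g" "g \<diamondop> f = mE M" "f \<diamondop> g = mE N" unfolding kiso_def by blast
  have "of_nat m = (of_nat n :: complex)" using kiso_tr(1)[OF v i] by (simp add: E tr_dg)
  then have mn: "m = n" by simp
  have fg: "idn n \<diamondop> f = f" "f \<diamondop> idn n = f" "idn n \<diamondop> g = g" "g \<diamondop> idn n = g"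
    using kh_eqs(1,2)[OF h(1)] kh_eqs(1,2)[OF h(2)] E mn by simp_all
  have e: "idn n \<diamondop> ev N p = ev N p" "ev M p \<diamondop> idn n = ev M p" "ev N p \<diamondop> idn n = ev N p" "idn n \<diamondop> ev M p = ev M p" for p
    using ev_E[OF v(1)] ev_E[OF v(2)] E mn by simp_all
  let ?P = "to_mat n f"
  have "to_mat n g * ?P = 1\<^sub>m n" "?P * to_mat n g = 1\<^sub>m n"
    using h(3,4) E mn by (simp_all add: to_mat_mm[symmetric] fg to_mat_lin)
  then have "invertible_mat ?P" unfolding invertible_mat_def inverts_mat_def by (intro conjI exI[of _ "to_mat n g"]) auto
  moreover have "?P * Rp m M p = Rp n N p * ?P" for p
    unfolding Rp_def mn by (simp add: to_mat_mm[symmetric] fg e kh_ev[OF h(1) v])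
  ultimately show ?thesis
    unfolding k2_iso_def using Rp_module[OF v(1) E(1)] Rp_module[OF v(2) E(2)] mn
    by (auto intro!: bexI[of _ ?P])
qed

lemma k2_iso_kiso: assumes "(R, R') \<in> k2_iso" shows "kiso (mod_of R) (mod_of R')"
proof -
  from assms obtain P where m: "k2_module R" "k2_module R'" and P: "P \<in> carrier_mat (mdim R') (mdim R)" "invertible_mat P" "\<And>p. P * R p = R' p * P"
    unfolding k2_iso_def by blast
  from P(2) obtain Q where Q: "P * Q = 1\<^sub>m (dim_row P)" "Q * P = 1\<^sub>m (dim_row Q)" and sq: "dim_row P = dim_col P"
    unfolding invertible_mat_def inverts_mat_def square_mat.simps by metis
  have d: "dim_row P = mdim R" "dim_col P = mdim R" "mdim R' = mdim R" using P(1) sq by auto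
  have dQ: "dim_col Q = mdim R" "dim_row Q = mdim R"
    using arg_cong[OF Q(1), of dim_col] arg_cong[OF Q(2), of dim_col] d by simp_all
  have c: "R p \<in> carrier_mat (mdim R) (mdim R)" "R' p \<in> carrier_mat (mdim R) (mdim R)" for p
    using m d(3) unfolding k2_module_def by simp_all
  let ?f = "to_fm P" and ?g = "to_fm Q"
  have fg: "?f \<diamondop> ?g = idn (mdim R)" "?g \<diamondop> ?f = idn (mdim R)"
    using Q d dQ by (simp_all add: to_fm_mult[symmetric] to_fm_one)
  have n: "idn (mdim R) \<diamondop> ?f = ?f" "?f \<diamondop> idn (mdim R) = ?f" "idn (mdim R) \<diamondop> ?g = ?g" "?g \<diamondop> idn (mdim R) = ?g"
    by (auto simp: dg_l dg_r ent_to_fm d dQ split: if_split_asm)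
  have fR: "?f \<diamondop> to_fm (R p) = to_fm (R' p) \<diamondop> ?f" for p
    using arg_cong[OF P(3)[of p], of to_fm] c[of p] d by (simp add: to_fm_mult)
  have E: "mE (mod_of R) = idn (mdim R)" "mE (mod_of R') = idn (mdim R)" using mod_of(2)[OF m(1)] mod_of(2)[OF m(2)] d by simp_all
  have kf: "kh (mod_of R) (mod_of R') ?f" unfolding kh_def E using n fR by (simp add: mod_of_def)
  have "kh (mod_of R') (mod_of R) ?g"
    by (rule kh_inverse[OF mod_of(1)[OF m(1)] mod_of(1)[OF m(2)] kf]) (simp_all add: E fg n)
  then show ?thesis unfolding kiso_def E using kf fg by blast
qed

text \<open>Transport of the module structure along \<open>V\<close>, with \<open>W\<close> its left
  inverse on the module.\<close>

definition conjm :: "('j, 'i) fm \<Rightarrow> ('i, 'j) fm \<Rightarrow> 'i kmod \<Rightarrow> 'j kmod" where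
  "conjm V W M = KM (V \<diamondop> mE M \<diamondop> W) (V \<diamondop> mK M \<diamondop> W) (V \<diamondop> mA M \<diamondop> W) (V \<diamondop> mB M \<diamondop> W)"

lemma conjm:
  assumes v: "vmod M" and W: "W \<diamondop> V = mE M"
  shows "vmod (conjm V W M)" "kiso M (conjm V W M)" "ev (conjm V W M) p = V \<diamondop> ev M p \<diamondop> W"
proof -
  note e = vmod_eqs[OF v] W W[THEN mm_asc]
  show v': "vmod (conjm V W M)" unfolding vmod_def conjm_def by (simp add: fm_alg e)
  have h: "kh M (conjm V W M) (V \<diamondop> mE M)" "kh (conjm V W M) M (mE M \<diamondop> W)"
    unfolding kh_def conjm_def by (simp_all add: fm_alg e)
  show "kiso M (conjm V W M)" unfolding kiso_def
    by (rule exI[of _ "V \<diamondop> mE M"], rule exI[of _ "mE M \<diamondop> W"]) (use h in \<open>simp add: conjm_def fm_alg e\<close>)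
  have "ev (conjm V W M) p = ev (conjm V W M) p \<diamondop> (V \<diamondop> mE M) \<diamondop> W"
    using ev_E(2)[OF v', of p] by (simp add: conjm_def mm_assoc)
  also have "\<dots> = V \<diamondop> ev M p \<diamondop> W" unfolding kh_ev[OF h(1) v v', symmetric] by (simp add: mm_assoc mm_asc[OF ev_E(1)[OF v]])
  finally show "ev (conjm V W M) p = V \<diamondop> ev M p \<diamondop> W" .
qed

lemma standardize:
  assumes v: "vmod M" shows "\<exists>n N. vmod N \<and> mE N = idn n \<and> kiso M (N :: nat kmod)"
proof -
  obtain n i r where f: "mE M = i \<diamondop> r" "r \<diamondop> i = idn n" "i \<diamondop> idn n = i" "idn n \<diamondop> r = r" "mE M \<diamondop> i = i"
    using idem_factor[OF vmod_eqs(1)[OF v]] by metis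
  have "mE (conjm r i M) = idn n" by (simp add: conjm_def mm_assoc f)
  then show ?thesis using conjm(1,2)[OF v f(1)[symmetric]] by blast
qed

lemma conj_pm:
  assumes v: "vmod M" and T: "finite T" "mE M = dg T" and f: "bij_betw f T {..<d}"
  shows "vmod (conjm (pm T f) (tp (pm T f)) M)" "mE (conjm (pm T f) (tp (pm T f)) M) = idn d"
    "kiso M (conjm (pm T f) (tp (pm T f)) M)"
    "x \<in> T \<Longrightarrow> y \<in> T \<Longrightarrow> ent (ev (conjm (pm T f) (tp (pm T f)) M) p) (f x) (f y) = ent (ev M p) x y"
proof -
  let ?V = "pm T f"
  have i: "inj_on f T" and r: "f ` T = {..<d}" using f by (auto simp: bij_betw_def)
  have W: "tp ?V \<diamondop> ?V = mE M"
    by (rule fm_eqI) (use T i in \<open>auto simp: ent_mm_pm ent_tp ent_pm ent_dg dest: inj_onD\<close>)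
  note c = conjm[OF v W]
  show "vmod (conjm ?V (tp ?V) M)" "kiso M (conjm ?V (tp ?V) M)" by (fact c)+
  have "?V \<diamondop> dg T = ?V" using T by (auto simp: dg_r ent_pm)
  then have E: "mE (conjm ?V (tp ?V) M) = ?V \<diamondop> tp ?V" by (simp add: conjm_def T)
  have "ent (?V \<diamondop> tp ?V) a b = ent (idn d) a b" for a b
  proof (cases "a \<in> f ` T")
    case True
    then obtain x where "x \<in> T" "a = f x" by auto
    then show ?thesis using True r T by (auto simp: ent_pm_mm(1)[OF T(1) i] ent_tp ent_pm ent_dg)
  next
    case False
    then show ?thesis using r by (auto simp: ent_pm_mm(2)[OF T(1) i] ent_dg)
  qed
  then show "mE (conjm ?V (tp ?V) M) = idn d" unfolding E by (rule fm_eqI)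
  have "ent (Z \<diamondop> tp ?V) k (f y) = ent Z k y" if "y \<in> T" for Z :: "('c, 'a) fm" and k y
    using ent_pm_mm(1)[OF T(1) i that, of "tp Z" k] ent_tp[of "?V \<diamondop> tp Z" k "f y"] by (simp add: tp_mm ent_tp)
  then show "x \<in> T \<Longrightarrow> y \<in> T \<Longrightarrow> ent (ev (conjm ?V (tp ?V) M) p) (f x) (f y) = ent (ev M p) x y"
    by (simp add: c(3) mm_assoc ent_pm_mm(1)[OF T(1) i])
qed

text \<open>This recognises a concrete matrix representation as a given module once its entries
  match under a numbering of the basis. The tensor product, the direct sum and the trivial module
  are identified in this way.\<close>

lemma Rp_pm:
  assumes v: "vmod M" and T: "finite T" "mE M = dg T" and f: "bij_betw f T {..<d}"
    and R: "\<And>p. R p \<in> carrier_mat d d" "\<And>p x y. x \<in> T \<Longrightarrow> y \<in> T \<Longrightarrow> R p $$ (f x, f y) = ent (ev M p) x y"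
  shows "k2_module R" "kiso M (mod_of R)"
proof -
  note c = conj_pm[OF v T f]
  have "R = Rp d (conjm (pm T f) (tp (pm T f)) M)"
  proof (rule ext, rule eq_matI)
    fix p i j assume "i < dim_row (Rp d (conjm (pm T f) (tp (pm T f)) M) p)" "j < dim_col (Rp d (conjm (pm T f) (tp (pm T f)) M) p)"
    then have ij: "i < d" "j < d" by (simp_all add: Rp_def)
    then obtain x y where "x \<in> T" "i = f x" "y \<in> T" "j = f y" using f unfolding bij_betw_def by (metis imageE lessThan_iff)
    then show "R p $$ (i, j) = Rp d (conjm (pm T f) (tp (pm T f)) M) p $$ (i, j)"
      using ij by (simp add: R(2) Rp_def to_mat_def c(4))
  qed (use R(1) in \<open>auto simp: Rp_def\<close>)
  then show "k2_module R" "kiso M (mod_of R)" using Rp_module[OF c(1,2)] c(3) by simp_all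
qed

lemma R_word: assumes "k2_module R" shows "R (of_word u) = to_mat (mdim R) (wev (mod_of R) u)"
  by (subst mod_of(3)[OF assms]) (simp add: Rp_def of_word_def lin_single)

definition act :: "'i kmod \<Rightarrow> 'j kmod \<Rightarrow> k2_free2 \<Rightarrow> ('i \<times> 'j, 'i \<times> 'j) fm" where
  "act M N = lin (\<lambda>w. wev M (fst w) \<boxtimes> wev N (snd w))"

lemma act_mult: "vmod M \<Longrightarrow> vmod N \<Longrightarrow> act M N (p * q) = act M N p \<diamondop> act M N q"
  unfolding act_def by (rule lin_mult) (simp add: krn_mm wev_add)
lemma krn_sum: "sum f I \<boxtimes> C = (\<Sum>i\<in>I. f i \<boxtimes> C)" "D \<boxtimes> sum g I = (\<Sum>i\<in>I. D \<boxtimes> g i)"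
  by (induction I rule: infinite_finite_induct) (auto simp: krn_add_l krn_add_r)
lemma act_tens: "act M N (p \<otimes>\<^sub>F q) = ev M p \<boxtimes> ev N q"
  by (simp add: tens_def act_def lin_sum lin_single lin_def[of _ p] lin_def[of _ q] krn_sum krn_sc_l krn_sc_r sc_sc sc_sum mult.commute) (rule sum.swap)
lemma act_scalar: "act M N (Poly_Mapping.single 0 c) = sc c (mE M \<boxtimes> mE N)"
  by (simp add: act_def lin_single wev_0)
text \<open>Both sides turn words into products, and on the generators the coproduct is the
  definition of \<open>kten\<close>.\<close>

lemma act_comult:
  assumes v: "vmod M" "vmod N" shows "act M N (comult p) = ev (kten M N) p"
proof -
  have g: "act M N (comult_gen g) = gop (kten M N) g" for g
    by (cases g) (simp_all add: act_tens ev_gen v ev_1, simp_all add: act_def lin_add, simp_all add: act_def[symmetric] act_tens ev_gen v ev_1)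
  have "act M N (prod_list (map comult_gen gs)) = wevl (kten M N) gs" for gs
    by (induction gs) (simp_all add: g act_mult[OF v] act_scalar[of M N 1, simplified])
  then have "act M N (Poly_Mapping.single 0 c * prod_list (map comult_gen (letters w))) = sc c (wev (kten M N) w)" for c w
    using wevl_E(1)[OF vmod_kten[OF v], of "letters w"] by (simp add: act_mult[OF v] act_scalar wev_def mm_sc_l)
  then show ?thesis by (simp add: comult_def lin_def[of _ p]) (simp add: act_def lin_sum)
qed

lemma tprod:
  assumes R: "k2_module R" "k2_module R'"
  shows "k2_module (tprod R R')" "kiso (kten (mod_of R) (mod_of R')) (mod_of (tprod R R'))"
proof -
  let ?m = "mdim R" and ?n = "mdim R'" and ?M = "mod_of R" and ?N = "mod_of R'"
  \<comment> \<open>The numbering of pairs is the one built into \<open>kron\<close>: the quotient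
    by \<open>?n\<close> is the first index, the remainder the second.\<close>
  let ?T = "{..<?m} \<times> {..<?n}" and ?f = "\<lambda>(a, b). a * ?n + b"
  note v = mod_of(1)[OF R(1)] mod_of(1)[OF R(2)]
  have E: "mE (kten ?M ?N) = dg ?T" by (simp add: mod_of(2)[OF R(1)] mod_of(2)[OF R(2)] dg_krn)
  have lt: "a * ?n + b < ?m * ?n" if "a < ?m" "b < ?n" for a b
  proof -
    have "a * ?n + b < Suc a * ?n" using that by simp
    also have "\<dots> \<le> ?m * ?n" using that by (intro mult_le_mono1) simp
    finally show ?thesis .
  qed
  have f: "bij_betw ?f ?T {..<?m * ?n}"
  proof (rule bij_betw_byWitness[where f' = "\<lambda>i. (i div ?n, i mod ?n)"])
    show "(\<lambda>i. (i div ?n, i mod ?n)) ` {..<?m * ?n} \<subseteq> ?T"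
      by (auto simp: less_mult_imp_div_less) (metis mod_less_divisor mult_0_right not_less_zero gr0I)
  qed (auto simp: lt)
  have x: "tprod R R' p \<in> carrier_mat (?m * ?n) (?m * ?n)" for p by (simp add: tprod_def outer_action_def)
  have y: "tprod R R' p $$ (?f x, ?f y) = ent (ev (kten ?M ?N) p) x y" if xy: "x \<in> ?T" "y \<in> ?T" for p x y
  proof -
    obtain a b c e where ab: "x = (a, b)" "y = (c, e)" "a < ?m" "b < ?n" "c < ?m" "e < ?n" using xy by auto
    have "kron (R (of_word u)) (R' (of_word w)) $$ (a * ?n + b, c * ?n + e) = ent (wev ?M u \<boxtimes> wev ?N w) x y" for u w
      using ab lt[of a b] lt[of c e] by (simp add: kron_def R_word[OF R(1)] R_word[OF R(2)] to_mat_def ent_krn)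
    then have "tprod R R' p $$ (?f x, ?f y) = (\<Sum>k\<in>Poly_Mapping.keys (comult p). Poly_Mapping.lookup (comult p) k * ent (wev ?M (fst k) \<boxtimes> wev ?N (snd k)) x y)"
      using ab lt[of a b] lt[of c e] by (simp add: tprod_def outer_action_def case_prod_beta)
    also have "\<dots> = ent (act ?M ?N (comult p)) x y" by (simp add: act_def lin_def lookup_sum ent_sc)
    finally show ?thesis by (simp add: act_comult[OF v])
  qed
  show "k2_module (tprod R R')" "kiso (kten ?M ?N) (mod_of (tprod R R'))"
    by (rule Rp_pm[OF vmod_kten[OF v] _ E f x y]; simp)+
qed

lemma ev_xsum: "ev (xsum M N) p = un True True \<boxtimes> ev M p + un False False \<boxtimes> ev N p"
proof -
  have g: "gop (xsum M N) g = un True True \<boxtimes> gop M g + un False False \<boxtimes> gop N g" for g by (cases g) simp_all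
  have "wevl (xsum M N) gs = un True True \<boxtimes> wevl M gs + un False False \<boxtimes> wevl N gs" for gs
    by (induction gs) (simp_all add: g fm_alg krn_alg un_mm)
  then show ?thesis by (simp add: lin_def wev_def krn_sum krn_sc_r sc_add sum.distrib)
qed

lemma dsum:
  assumes R: "k2_module R" "k2_module R'"
  shows "k2_module (dsum R R')" "is_dsum (mod_of (dsum R R')) (mod_of R) (mod_of R')"
proof -
  let ?m = "mdim R" and ?n = "mdim R'" and ?M = "mod_of R" and ?N = "mod_of R'"
  let ?T = "{True} \<times> {..<?m} \<union> {False} \<times> {..<?n}" and ?f = "\<lambda>(b, i). if b then i else ?m + i"
  note v = mod_of(1)[OF R(1)] mod_of(1)[OF R(2)]
  have vx: "vmod (xsum ?M ?N)" using v by (simp add: vmod_xsum)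
  have E: "mE (xsum ?M ?N) = dg ?T"
    by (rule fm_eqI) (auto simp: mod_of(2)[OF R(1)] mod_of(2)[OF R(2)] lookup_add ent_krn ent_un ent_dg)
  have f: "bij_betw ?f ?T {..<?m + ?n}"
    by (rule bij_betw_byWitness[where f' = "\<lambda>i. if i < ?m then (True, i) else (False, i - ?m)"]) auto
  have c: "R p \<in> carrier_mat ?m ?m" "R' p \<in> carrier_mat ?n ?n" for p using R unfolding k2_module_def by auto
  have x: "dsum R R' p \<in> carrier_mat (?m + ?n) (?m + ?n)" for p unfolding dsum_def using c by simp
  have y: "dsum R R' p $$ (?f x, ?f y) = ent (ev (xsum ?M ?N) p) x y" if xy: "x \<in> ?T" "y \<in> ?T" for p x y
  proof -
    have d: "dim_row (R p) = ?m" "dim_col (R p) = ?m" "dim_row (R' p) = ?n" "dim_col (R' p) = ?n" using c[of p] by auto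
    show ?thesis using xy d
      by (auto simp: dsum_def ev_xsum lookup_add ent_krn ent_un mod_of(4)[OF R(1)] mod_of(4)[OF R(2)] ent_to_fm)
  qed
  show "k2_module (dsum R R')" by (rule Rp_pm[OF vx _ E f x y]; simp)
  have "kiso (xsum ?M ?N) (mod_of (dsum R R'))" by (rule Rp_pm[OF vx _ E f x y]; simp)
  then show "is_dsum (mod_of (dsum R R')) ?M ?N"
    using is_dsum_cong[OF is_dsum_xsum[OF v]] kiso_refl v by blast
qed

lemma triv: "k2_module triv_module" "kiso (S 1) (mod_of triv_module)"
proof -
  have vS: "vmod (S 1)" by (simp add: vmod_def un_mm)
  have E: "mE (S 1) = dg {()}" by (simp add: dg_unit)
  have f: "bij_betw (\<lambda>_. 0) {()} {..<1::nat}" by (auto simp: bij_betw_def)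
  have "wevl (S 1) gs = sc (prod_list (map counit_gen gs)) (un () ())" for gs
  proof (induction gs)
    case (Cons g gs)
    then show ?case by (cases g) (simp_all add: un_mm mm_sc_l mm_sc_r)
  qed simp
  then have "ent (ev (S 1) p) () () = counit p" for p
    by (simp add: lin_def counit_def wev_def lookup_sum ent_sc ent_un)
  then have y: "triv_module p $$ (0, 0) = ent (ev (S 1) p) x y" for x y p by (simp add: triv_module_def)
  have x: "triv_module p \<in> carrier_mat 1 1" for p by (simp add: triv_module_def)
  show "k2_module triv_module" "kiso (S 1) (mod_of triv_module)" by (rule Rp_pm[OF vS _ E f x y]; simp)+
qed

section \<open>Ring structure on classes, multiplicities as functionals, the quotient as a
  type\<close>

section \<open>The Green ring\<close>

lemma k2_iso_iff: "(R, R') \<in> k2_iso \<longleftrightarrow> k2_module R \<and> k2_module R' \<and> kiso (mod_of R) (mod_of R')"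
proof
  assume a: "(R, R') \<in> k2_iso"
  then show "k2_module R \<and> k2_module R' \<and> kiso (mod_of R) (mod_of R')" using k2_iso_kiso[OF a] by (auto simp: k2_iso_def)
next
  assume "k2_module R \<and> k2_module R' \<and> kiso (mod_of R) (mod_of R')"
  then have R: "k2_module R" "k2_module R'" "kiso (mod_of R) (mod_of R')" by auto
  show "(R, R') \<in> k2_iso"
    using Rp_iso[OF mod_of(1)[OF R(1)] mod_of(1)[OF R(2)] mod_of(2)[OF R(1)] mod_of(2)[OF R(2)] R(3)]
    unfolding mod_of(3)[OF R(1), symmetric] mod_of(3)[OF R(2), symmetric] .
qed

text \<open>This names an isomorphism class of representations by a module over any index
  type.\<close>

definition cl :: "'i kmod \<Rightarrow> k2_rep set" where "cl M = {R. k2_module R \<and> kiso M (mod_of R)}"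

lemma iso_class_cl: "k2_module R \<Longrightarrow> iso_class R = cl (mod_of R)"
  by (auto simp: iso_class_def cl_def k2_iso_iff)
lemma cl_ne: assumes "vmod M" shows "\<exists>R. k2_module R \<and> kiso M (mod_of R)"
proof -
  obtain n and N :: "nat kmod" where "vmod N" "mE N = idn n" "kiso M N" using standardize[OF assms] by blast
  then show ?thesis using Rp_module[of N n] by auto
qed
lemma cl_cong: assumes "kiso M N" shows "cl M = cl N"
  unfolding cl_def using kiso_trans[OF assms] kiso_trans[OF kiso_sym[OF assms]] by blast
lemma cl_rep: assumes "vmod M" obtains R where "k2_module R" "kiso M (mod_of R)" "cl M = iso_class R"
  using cl_ne[OF assms] cl_cong iso_class_cl by metis
lemma cl_in: "vmod M \<Longrightarrow> cl M \<in> iso_classes"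
  by (erule cl_rep) (auto simp: iso_classes_def iso_class_def quotient_def)
lemma iso_classesE: assumes "C \<in> iso_classes" obtains M :: "nat kmod" where "vmod M" "C = cl M"
proof -
  obtain R where "k2_module R" "C = iso_class R" using assms by (auto simp: iso_classes_def iso_class_def quotient_def)
  then show ?thesis using that[OF mod_of(1)] iso_class_cl by blast
qed
lemma class_mult_cl: assumes v: "vmod M" "vmod N" shows "class_mult (cl M) (cl N) = cl (kten M N)"
proof -
  have "iso_class (tprod R R') = cl (kten M N)" if "R \<in> cl M" "R' \<in> cl N" for R R'
  proof -
    have m: "k2_module R" "k2_module R'" and k: "kiso M (mod_of R)" "kiso N (mod_of R')" using that by (auto simp: cl_def)
    show ?thesis using iso_class_cl[OF tprod(1)[OF m]] cl_cong[OF kiso_trans[OF kiso_kten[OF k] tprod(2)[OF m]]] by simp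
  qed
  moreover obtain R R' where "R \<in> cl M" "R' \<in> cl N" using cl_ne[OF v(1)] cl_ne[OF v(2)] by (auto simp: cl_def)
  ultimately show ?thesis unfolding class_mult_def by blast
qed

definition fr :: "'i kmod \<Rightarrow> (k2_rep set \<Rightarrow>\<^sub>0 int)" where "fr M = frag_of (cl M)"
abbreviation pmul :: "(k2_rep set \<Rightarrow>\<^sub>0 int) \<Rightarrow> (k2_rep set \<Rightarrow>\<^sub>0 int) \<Rightarrow> (k2_rep set \<Rightarrow>\<^sub>0 int)" where
  "pmul f g \<equiv> f \<otimes>\<^bsub>pre_green\<^esub> g"

lemma pg_simps:
  "carrier pre_green = {c. Poly_Mapping.keys c \<subseteq> iso_classes}" "f \<oplus>\<^bsub>pre_green\<^esub> g = f + g"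
  "\<zero>\<^bsub>pre_green\<^esub> = 0" "\<one>\<^bsub>pre_green\<^esub> = fr (S 1)"
  by (simp_all add: pre_green_def free_Abelian_group_def fr_def iso_class_cl[OF triv(1)] cl_cong[OF triv(2)])
lemma pmul_eq: "pmul f g = frag_extend (\<lambda>C. frag_extend (\<lambda>D. frag_of (class_mult C D)) g) f"
  by (simp add: pre_green_def)
lemma pmul_diff: "pmul (a - b) c = pmul a c - pmul b c" "pmul a (b - c) = pmul a b - pmul a c"
proof -
  show "pmul (a - b) c = pmul a c - pmul b c" by (simp add: pmul_eq frag_extend_diff)
  have "frag_cmul k (u - v) = frag_cmul k u - frag_cmul k v" for k and u v :: "k2_rep set \<Rightarrow>\<^sub>0 int"
    by (rule poly_mapping_eqI) (simp add: lookup_minus right_diff_distrib)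
  then show "pmul a (b - c) = pmul a b - pmul a c"
    unfolding pmul_eq frag_extend_diff by (simp add: frag_extend_def[of _ a] sum_subtractf)
qed
lemma pmul_0[simp]: "pmul 0 c = 0" "pmul c 0 = 0" using pmul_diff(1)[of 0 0 c] pmul_diff(2)[of c 0 0] by simp_all
lemma pmul_add: "pmul (a + b) c = pmul a c + pmul b c"
  using pmul_diff(1)[of a "0 - b" c] pmul_diff(1)[of 0 b c] by simp
lemma pmul_fr: "vmod M \<Longrightarrow> vmod N \<Longrightarrow> pmul (fr M) (fr N) = fr (kten M N)"
  by (simp add: pmul_eq fr_def class_mult_cl)
lemma fr_in: "vmod M \<Longrightarrow> fr M \<in> carrier pre_green"
  by (simp add: pg_simps fr_def cl_in)
lemma fr_cong: "kiso M N \<Longrightarrow> fr M = fr N" by (simp add: fr_def cl_cong)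

lemma pg_induct[consumes 1, case_names zero fr diff]:
  assumes c: "c \<in> carrier pre_green" and "P 0" "\<And>M :: nat kmod. vmod M \<Longrightarrow> P (fr M)"
    "\<And>a b. a \<in> carrier pre_green \<Longrightarrow> b \<in> carrier pre_green \<Longrightarrow> P a \<Longrightarrow> P b \<Longrightarrow> P (a - b)"
  shows "P c"
proof -
  have "Poly_Mapping.keys c \<subseteq> iso_classes" using c by (simp add: pg_simps)
  then have "c \<in> carrier pre_green \<and> P c"
  proof (induction c rule: frag_induction)
    case (one x)
    then show ?case by (rule iso_classesE) (use assms(3) fr_in in \<open>auto simp: fr_def\<close>)
  next
    case (diff a b)
    then show ?case using assms(4) keys_diff[of a b] by (auto simp: pg_simps)
  qed (use assms(2) in \<open>simp add: pg_simps\<close>)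
  then show ?thesis by simp
qed

lemma pg_diff_in: "a \<in> carrier pre_green \<Longrightarrow> b \<in> carrier pre_green \<Longrightarrow> a - b \<in> carrier pre_green"
  using keys_diff[of a b] by (auto simp: pg_simps)
lemma pmul_in: assumes "a \<in> carrier pre_green" "b \<in> carrier pre_green" shows "pmul a b \<in> carrier pre_green"
  using assms(1)
proof (induction a rule: pg_induct)
  case (fr M)
  show ?case using assms(2)
    by (induction b rule: pg_induct) (auto simp: pmul_diff pmul_fr fr fr_in vmod_kten pg_diff_in, simp_all add: pg_simps)
qed (auto simp: pmul_diff pg_diff_in, simp_all add: pg_simps)

lemma pmul_comm: assumes "a \<in> carrier pre_green" "b \<in> carrier pre_green" shows "pmul a b = pmul b a"
  using assms(1)
proof (induction a rule: pg_induct)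
  case (fr M)
  have k: "fr (kten M N) = fr (kten N M)" if "vmod N" for N :: "nat kmod" by (intro fr_cong kiso_kten_comm fr that)
  show ?case using assms(2)
    by (induction b rule: pg_induct) (auto simp: pmul_diff pmul_fr fr k)
qed (auto simp: pmul_diff)
lemma pmul_assoc: assumes "a \<in> carrier pre_green" "b \<in> carrier pre_green" "c \<in> carrier pre_green"
  shows "pmul (pmul a b) c = pmul a (pmul b c)"
  using assms(1)
proof (induction a rule: pg_induct)
  case (fr M)
  note M = fr
  show ?case using assms(2)
  proof (induction b rule: pg_induct)
    case (fr N)
    have k: "fr (kten (kten M N) Q) = fr (kten M (kten N Q))" if "vmod Q" for Q :: "nat kmod" by (intro fr_cong kiso_kten_assoc fr M that)
    show ?case using assms(3)
      by (induction c rule: pg_induct) (auto simp: pmul_diff pmul_fr vmod_kten fr M k)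
  qed (auto simp: pmul_diff)
qed (auto simp: pmul_diff)
lemma vmod_S1: "vmod (S 1)" by (simp add: vmod_def un_mm)
lemma pmul_one: assumes "a \<in> carrier pre_green" shows "pmul (fr (S 1)) a = a"
  using assms by (induction a rule: pg_induct) (auto simp: pmul_diff pmul_fr vmod_S1 intro: fr_cong kiso_S1)

lemma cring_pg: "cring pre_green"
proof (rule cringI)
  show "abelian_group pre_green"
  proof (rule abelian_groupI)
    fix x assume "x \<in> carrier pre_green"
    then have "- x \<in> carrier pre_green" using pg_diff_in[of 0 x] by (simp add: pg_simps)
    then show "\<exists>y\<in>carrier pre_green. y \<oplus>\<^bsub>pre_green\<^esub> x = \<zero>\<^bsub>pre_green\<^esub>" by (rule bexI[rotated]) (simp add: pg_simps)
  qed (auto simp: pg_simps algebra_simps dest!: subsetD[OF keys_add])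
  show "Group.comm_monoid pre_green"
    by (rule comm_monoidI) (auto simp: pmul_in pmul_assoc pmul_one pg_simps(4) fr_in vmod_S1 intro: pmul_comm)
qed (simp add: pg_simps pmul_add)

lemma dsum_relI:
  assumes v: "vmod M" "vmod M1" "vmod M2" and d: "is_dsum M M1 M2"
  shows "fr M - (fr M1 + fr M2) \<in> dsum_relations"
proof -
  obtain R1 R2 where R: "k2_module R1" "kiso M1 (mod_of R1)" "cl M1 = iso_class R1" "k2_module R2" "kiso M2 (mod_of R2)" "cl M2 = iso_class R2"
    using cl_rep[OF v(2)] cl_rep[OF v(3)] by metis
  have "is_dsum M (mod_of R1) (mod_of R2)" using is_dsum_cong[OF d kiso_refl[OF v(1)] R(2,5)] .
  then have "kiso M (mod_of (dsum R1 R2))" using is_dsum_unique dsum(2)[OF R(1,4)] by blast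
  then have c: "cl M = iso_class (dsum R1 R2)" by (simp add: cl_cong iso_class_cl[OF dsum(1)[OF R(1,4)]])
  show ?thesis unfolding dsum_relations_def fr_def c R(3) R(6) using R(1,4) by blast
qed
lemma dsum_relE:
  assumes "r \<in> dsum_relations"
  obtains M M1 M2 :: "nat kmod" where "vmod M" "vmod M1" "vmod M2" "is_dsum M M1 M2" "r = fr M - (fr M1 + fr M2)"
proof -
  obtain R R' where r: "r = frag_of (iso_class (dsum R R')) - (frag_of (iso_class R) + frag_of (iso_class R'))" "k2_module R" "k2_module R'"
    using assms by (auto simp: dsum_relations_def)
  have "r = fr (mod_of (dsum R R')) - (fr (mod_of R) + fr (mod_of R'))"
    unfolding r(1) fr_def iso_class_cl[OF dsum(1)[OF r(2,3)]] iso_class_cl[OF r(2)] iso_class_cl[OF r(3)] by (rule refl)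
  from that[OF mod_of(1)[OF dsum(1)[OF r(2,3)]] mod_of(1)[OF r(2)] mod_of(1)[OF r(3)] dsum(2)[OF r(2,3)] this] show ?thesis .
qed
lemma dsum_rel_in: "r \<in> dsum_relations \<Longrightarrow> r \<in> carrier pre_green"
proof (erule dsum_relE)
  fix M M1 M2 :: "nat kmod"
  assume v: "vmod M" "vmod M1" "vmod M2" and r: "r = fr M - (fr M1 + fr M2)"
  show "r \<in> carrier pre_green" using pg_diff_in[OF pg_diff_in[OF fr_in[OF v(1)] fr_in[OF v(2)]] fr_in[OF v(3)]] by (simp add: r diff_diff_eq)
qed

definition Hd :: "(k2_rep set \<Rightarrow>\<^sub>0 int) set" where "Hd = generate (add_monoid pre_green) dsum_relations"

lemma pg_inv: "x \<in> carrier pre_green \<Longrightarrow> inv\<^bsub>add_monoid pre_green\<^esub> x = - x"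
proof -
  interpret cring pre_green by (rule cring_pg)
  assume x: "x \<in> carrier pre_green"
  then have "- x \<in> carrier pre_green" using pg_diff_in[of 0 x] by (simp add: pg_simps)
  then have "\<ominus>\<^bsub>pre_green\<^esub> x = - x" using x by (intro minus_equality) (simp_all add: pg_simps(2,3))
  then show ?thesis by (simp add: a_inv_def)
qed
lemma Hd_induct[consumes 1, case_names zero rel minus add]:
  assumes "x \<in> Hd" "P 0" "\<And>r. r \<in> dsum_relations \<Longrightarrow> P r" "\<And>r. r \<in> dsum_relations \<Longrightarrow> P (- r)" "\<And>a b. P a \<Longrightarrow> P b \<Longrightarrow> P (a + b)"
  shows "P x"
  using assms(1) unfolding Hd_def
proof (induction rule: generate.induct)
  case (inv h)
  then show ?case using assms(4) pg_inv[OF dsum_rel_in[OF inv]] by simp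
qed (use assms(2-5) in \<open>auto simp: pg_simps(2,3)\<close>)

lemma Hd_subgroup: "subgroup Hd (add_monoid pre_green)"
proof -
  interpret cring pre_green by (rule cring_pg)
  show ?thesis unfolding Hd_def by (rule group.generate_is_subgroup[OF a_group]) (use dsum_rel_in in auto)
qed
lemma Hd_closed: "0 \<in> Hd" "a \<in> Hd \<Longrightarrow> b \<in> Hd \<Longrightarrow> a - b \<in> Hd"
proof -
  show "0 \<in> Hd" using subgroup.one_closed[OF Hd_subgroup] by (simp add: pg_simps)
  assume ab: "a \<in> Hd" "b \<in> Hd"
  have "b \<in> carrier pre_green" using subgroup.subset[OF Hd_subgroup] ab by auto
  then have "- b \<in> Hd" using subgroup.m_inv_closed[OF Hd_subgroup ab(2)] unfolding pg_inv[OF \<open>b \<in> carrier pre_green\<close>] by simp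
  then show "a - b \<in> Hd" using subgroup.m_closed[OF Hd_subgroup ab(1), of "- b"] by (simp add: pg_simps)
qed
lemma Hd_incl: "r \<in> dsum_relations \<Longrightarrow> r \<in> Hd" unfolding Hd_def by (rule generate.incl)
lemma Hd_mult: assumes "x \<in> Hd" "a \<in> carrier pre_green" shows "pmul x a \<in> Hd"
proof -
  have rel: "pmul r a \<in> Hd" if "r \<in> dsum_relations" for r
    using assms(2)
  proof (induction a rule: pg_induct)
    case (fr N)
    from that obtain M M1 M2 :: "nat kmod" where M: "vmod M" "vmod M1" "vmod M2" "is_dsum M M1 M2" "r = fr M - (fr M1 + fr M2)"
      by (rule dsum_relE)
    have "fr (kten M N) - (fr (kten M1 N) + fr (kten M2 N)) \<in> dsum_relations"
      using M fr by (intro dsum_relI) (auto simp: vmod_kten is_dsum_kten)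
    then show ?case using M fr by (simp add: pmul_diff pmul_add pmul_fr Hd_incl)
  qed (auto simp: pmul_diff Hd_closed)
  have p: "pmul (- x) y = - pmul x y" for x y using pmul_diff(1)[of 0 x y] by simp
  from assms(1) show ?thesis
  proof (induction rule: Hd_induct)
    case (minus r)
    then show ?case using Hd_closed(2)[OF Hd_closed(1) rel] by (simp add: p)
  next
    case (add a b)
    then show ?case using Hd_closed(2)[OF add(1) Hd_closed(2)[OF Hd_closed(1) add(2)]] by (simp add: pmul_add)
  qed (auto simp: rel Hd_closed)
qed
lemma ideal_Hd: "ideal Hd pre_green"
proof -
  interpret cring pre_green by (rule cring_pg)
  have "Hd \<subseteq> carrier pre_green" using subgroup.subset[OF Hd_subgroup] by simp
  then show ?thesis by (intro idealI ring_axioms Hd_subgroup) (auto simp: Hd_mult pmul_comm[symmetric])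
qed
lemma green_ring_Hd: "green_ring = pre_green Quot Hd" by (simp add: green_ring_def Hd_def)
lemma cring_green: "cring green_ring"
  unfolding green_ring_Hd by (rule ideal.quotient_is_cring[OF ideal_Hd cring_pg])

text \<open>The free abelian group on \<open>()\<close> stands for the integers, so that
  \<open>frag_extend\<close> provides the linear extension. The choice of a representative is
  harmless by \<open>kmult_iso\<close>.\<close>

definition pmlt :: "'n kmod \<Rightarrow> (k2_rep set \<Rightarrow>\<^sub>0 int) \<Rightarrow> int" where
  "pmlt N c = Poly_Mapping.lookup (frag_extend (\<lambda>C. frag_cmul (int (kmult N (mod_of (SOME R. R \<in> C)))) (frag_of ())) c) ()"
lemma pmlt_add: "pmlt N (a + b) = pmlt N a + pmlt N b" "pmlt N (a - b) = pmlt N a - pmlt N b" "pmlt N 0 = 0" "pmlt N (- a) = - pmlt N a"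
  by (simp_all add: pmlt_def frag_extend_add frag_extend_diff frag_extend_minus lookup_add lookup_minus)
lemma pmlt_fr: assumes "vmod M" shows "pmlt N (fr M) = int (kmult N M)"
proof -
  have "(SOME R. R \<in> cl M) \<in> cl M" using cl_ne[OF assms] by (intro someI_ex[of "\<lambda>R. R \<in> cl M"]) (auto simp: cl_def)
  then have "kiso M (mod_of (SOME R. R \<in> cl M))" by (simp add: cl_def)
  then show ?thesis by (simp add: pmlt_def fr_def kmult_iso)
qed
lemma pmlt_Hd: assumes "x \<in> Hd" shows "pmlt N x = 0"
proof -
  have "pmlt N r = 0" if "r \<in> dsum_relations" for r
    using that by (rule dsum_relE) (simp add: pmlt_add pmlt_fr kmult_dsum)
  with assms show ?thesis by (induction rule: Hd_induct) (auto simp: pmlt_add)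
qed

text \<open>As a type with class instances the quotient admits ordinary ring arithmetic and
  simplification, instead of computations with cosets.\<close>

typedef green = "carrier green_ring"
  using cring.cring_simprules(2)[OF cring_green] by blast

definition gq :: "(k2_rep set \<Rightarrow>\<^sub>0 int) \<Rightarrow> green" where "gq c = Abs_green (Hd +>\<^bsub>pre_green\<^esub> c)"

lemma coset_hom: "(+>\<^bsub>pre_green\<^esub>) Hd \<in> Ring.ring_hom pre_green green_ring"
  unfolding green_ring_Hd by (rule ideal.rcos_ring_hom[OF ideal_Hd])
lemma Rep_gq: "c \<in> carrier pre_green \<Longrightarrow> Rep_green (gq c) = Hd +>\<^bsub>pre_green\<^esub> c"
  unfolding gq_def using ring_hom_closed[OF coset_hom] by (simp add: Abs_green_inverse)
lemma gq_surj: obtains c where "c \<in> carrier pre_green" "x = gq c"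
proof -
  have "Rep_green x \<in> carrier green_ring" by (rule Rep_green)
  then obtain c where "c \<in> carrier pre_green" "Rep_green x = Hd +>\<^bsub>pre_green\<^esub> c"
    by (auto simp: green_ring_Hd FactRing_def A_RCOSETS_def')
  then show ?thesis using that by (metis Rep_gq Rep_green_inject)
qed

instantiation green :: comm_ring
begin
definition "x + y = Abs_green (Rep_green x \<oplus>\<^bsub>green_ring\<^esub> Rep_green y)"
definition "x * y = Abs_green (Rep_green x \<otimes>\<^bsub>green_ring\<^esub> Rep_green y)"
definition "- x = Abs_green (\<ominus>\<^bsub>green_ring\<^esub> Rep_green x)"
definition "0 = Abs_green \<zero>\<^bsub>green_ring\<^esub>"
definition "x - y = x + - (y :: green)"

lemma Rep_green_ring:
  "Rep_green (x + y) = Rep_green x \<oplus>\<^bsub>green_ring\<^esub> Rep_green y" "Rep_green (x * y) = Rep_green x \<otimes>\<^bsub>green_ring\<^esub> Rep_green y"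
  "Rep_green (- x) = \<ominus>\<^bsub>green_ring\<^esub> Rep_green x" "Rep_green 0 = \<zero>\<^bsub>green_ring\<^esub>"
proof -
  interpret cring green_ring by (rule cring_green)
  show "Rep_green (x + y) = Rep_green x \<oplus>\<^bsub>green_ring\<^esub> Rep_green y" "Rep_green (x * y) = Rep_green x \<otimes>\<^bsub>green_ring\<^esub> Rep_green y"
  "Rep_green (- x) = \<ominus>\<^bsub>green_ring\<^esub> Rep_green x" "Rep_green 0 = \<zero>\<^bsub>green_ring\<^esub>"
    using Rep_green[of x] Rep_green[of y]
    by (simp_all add: plus_green_def times_green_def uminus_green_def zero_green_def Abs_green_inverse)
qed

instance
proof
  interpret cring green_ring by (rule cring_green)
  fix a b c :: green
  note r = Rep_green_inject[symmetric] Rep_green_ring Rep_green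
  show "a + b + c = a + (b + c)" "0 + a = a" "a * b * c = a * (b * c)" "(a + b) * c = a * c + b * c"
    by (simp_all add: r a_assoc m_assoc l_distr)
  show "a + b = b + a" "a * b = b * a" by (simp_all add: r a_comm m_comm)
  show "- a + a = 0" by (simp add: r l_neg)
  show "a - b = a + - b" by (simp add: minus_green_def)
qed
end

lemma gq_hom: assumes "a \<in> carrier pre_green" "b \<in> carrier pre_green"
  shows "gq (a + b) = gq a + gq b" "gq (pmul a b) = gq a * gq b" "gq (a - b) = gq a - gq b"
proof -
  have add: "gq (u + v) = gq u + gq v" if "u \<in> carrier pre_green" "v \<in> carrier pre_green" for u v
  proof -
    have "u + v \<in> carrier pre_green" using that keys_add[of u v] by (auto simp: pg_simps)
    then show ?thesis using that ring_hom_add[OF coset_hom that] by (simp add: Rep_green_inject[symmetric] Rep_green_ring Rep_gq pg_simps(2))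
  qed
  show "gq (a + b) = gq a + gq b" by (rule add[OF assms])
  show "gq (pmul a b) = gq a * gq b"
    using assms ring_hom_mult[OF coset_hom assms] by (simp add: Rep_green_inject[symmetric] Rep_green_ring Rep_gq pmul_in)
  show "gq (a - b) = gq a - gq b" using add[OF pg_diff_in[OF assms] assms(2)] by (simp add: algebra_simps)
qed
lemma gq_zero: assumes "c \<in> carrier pre_green" shows "gq c = 0 \<longleftrightarrow> c \<in> Hd"
proof -
  interpret ideal Hd pre_green by (rule ideal_Hd)
  have "gq c = 0 \<longleftrightarrow> Hd +>\<^bsub>pre_green\<^esub> c = Hd"
    by (simp add: Rep_green_inject[symmetric] Rep_green_ring Rep_gq assms) (simp add: green_ring_Hd FactRing_def)
  also have "\<dots> \<longleftrightarrow> c \<in> Hd" using a_rcos_const a_rcos_self[OF assms] by blast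
  finally show ?thesis .
qed

instantiation green :: comm_ring_1
begin
definition "1 = gq (fr (S 1))"
instance
proof
  fix a :: green
  obtain c where c: "c \<in> carrier pre_green" "a = gq c" by (rule gq_surj)
  have s: "fr (S 1) \<in> carrier pre_green" by (simp add: fr_in vmod_S1)
  show "1 * a = a" using gq_hom(2)[OF s c(1)] c by (simp add: one_green_def pmul_one)
  \<comment> \<open>The ring is nontrivial: the trivial module occurs in itself with positive
    multiplicity, whereas multiplicities vanish on the relations.\<close>
  have "1 \<le> kmult (S 1) (S 1)" by (rule kmult_self[OF vmod_S1]) (simp add: tr_un)
  then have "pmlt (S 1) (fr (S 1)) \<noteq> 0" by (simp add: pmlt_fr vmod_S1)
  then show "(0 :: green) \<noteq> 1" using pmlt_Hd gq_zero[OF s] unfolding one_green_def by metis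
qed
end

definition gcl :: "'i kmod \<Rightarrow> green" where "gcl M = gq (fr M)"

lemma gcl_iso: "kiso M N \<Longrightarrow> gcl M = gcl N" by (simp add: gcl_def fr_cong)
lemma gcl_kten: "vmod M \<Longrightarrow> vmod N \<Longrightarrow> gcl (kten M N) = gcl M * gcl N"
  by (simp add: gcl_def gq_hom(2)[symmetric] fr_in pmul_fr)
lemma gcl_S1: "gcl (S 1) = 1" by (simp add: gcl_def one_green_def)
lemma gcl_dsum: assumes "vmod M" "vmod M1" "vmod M2" "is_dsum M M1 M2" shows "gcl M = gcl M1 + gcl M2"
proof -
  have i: "fr M \<in> carrier pre_green" "fr M1 \<in> carrier pre_green" "fr M2 \<in> carrier pre_green" using assms by (auto simp: fr_in)
  have s: "fr M1 + fr M2 \<in> carrier pre_green" using i keys_add[of "fr M1" "fr M2"] by (auto simp: pg_simps)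
  have "gq (fr M - (fr M1 + fr M2)) = 0"
    using gq_zero[OF pg_diff_in[OF i(1) s]] Hd_incl[OF dsum_relI[OF assms]] by blast
  then show ?thesis by (simp add: gq_hom i s gcl_def)
qed
lemma green_induct[case_names gcl diff]:
  assumes "\<And>M :: nat kmod. vmod M \<Longrightarrow> P (gcl M)" "\<And>a b. P a \<Longrightarrow> P b \<Longrightarrow> P (a - b)"
  shows "P x"
proof -
  obtain c where c: "c \<in> carrier pre_green" "x = gq c" by (rule gq_surj)
  have "P (gcl (mod_of triv_module))" using assms(1) mod_of(1) triv(1) by blast
  from assms(2)[OF this this] have P0: "P 0" by simp
  from c(1) have "P (gq c)"
  proof (induction rule: pg_induct)
    case zero
    have "gq 0 = 0" by (subst gq_zero) (simp_all add: Hd_closed pg_simps)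
    then show ?case using P0 by simp
  qed (use assms in \<open>auto simp: gcl_def gq_hom\<close>)
  then show ?thesis using c by simp
qed

definition gm :: "'n kmod \<Rightarrow> green \<Rightarrow> int" where "gm N x = pmlt N (SOME c. c \<in> carrier pre_green \<and> x = gq c)"
lemma gm_gq: assumes "c \<in> carrier pre_green" shows "gm N (gq c) = pmlt N c"
proof -
  define d where "d = (SOME d. d \<in> carrier pre_green \<and> gq c = gq d)"
  have d: "d \<in> carrier pre_green" "gq c = gq d" unfolding d_def using someI[of "\<lambda>d. d \<in> carrier pre_green \<and> gq c = gq d" c] assms by auto
  then have "gq (c - d) = 0" by (simp add: gq_hom assms)
  then have "c - d \<in> Hd" using gq_zero pg_diff_in assms d by blast
  then show ?thesis using pmlt_Hd[of "c - d" N] by (simp add: pmlt_add gm_def d_def)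
qed
lemma gm_diff: "gm N (x - y) = gm N x - gm N y"
proof -
  obtain c d where "c \<in> carrier pre_green" "x = gq c" "d \<in> carrier pre_green" "y = gq d" using gq_surj by metis
  then show ?thesis by (simp add: gq_hom(3)[symmetric] gm_gq pg_diff_in pmlt_add)
qed
lemma gm_gcl: "vmod M \<Longrightarrow> gm N (gcl M) = int (kmult N M)" by (simp add: gcl_def gm_gq fr_in pmlt_fr)

section \<open>The defining relations and the generation of the Green ring\<close>

section \<open>Relations in the Green ring\<close>

lemma S_Sn: "Sn s {()} = S s" by (simp add: Sn_def S_def dg_unit)

definition gg :: green where "gg = gcl (S (-1))"
text \<open>This is the projective cover of the sign module, not of the trivial one: source tensor
  source in y tensor z has K = -1, and its free part must give 2 x_1^2.\<close>

definition gp :: green where "gp = gcl (Pm False)"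
definition gy :: green where "gy = gcl ymod"
definition gz :: green where "gz = gcl (Lm (-1) 1)"
definition gX :: "nat \<Rightarrow> cp1 \<Rightarrow> green" where "gX n \<eta> = gcl (Xm 1 n \<eta>)"
definition gs :: "bool \<Rightarrow> green" where "gs b = gcl (S (sg b))"

lemma gcl_flip: "vmod M \<Longrightarrow> gcl (flip M) = gg * gcl M"
  using gcl_iso[OF kiso_Sm1, of M] by (simp add: gg_def gcl_kten vmod_S)
lemma flip_S: "flip (S s) = S (- s)" by (simp add: flip_def S_def sc_minus_l)
lemma gg2: "gg * gg = 1" using gcl_flip[of "S (-1)"] by (simp add: vmod_S flip_S gcl_S1 gg_def)
lemma gg2': "gg * (gg * x) = x" using gg2 by (metis mult.assoc mult_1)
lemma gs: "gs True = 1" "gs False = gg" by (simp_all add: gs_def sg_def gcl_S1 gg_def)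

lemma gcl_0: assumes "vmod M" "mE M = 0" shows "gcl M = 0"
proof -
  \<comment> \<open>The zero module is the direct sum of two copies of itself.\<close>
  have "is_dsum M M M" unfolding is_dsum_def by (intro exI[of _ 0]) (simp add: kh_lin assms)
  then have "gcl M = gcl M + gcl M" using gcl_dsum assms(1) by blast
  then show ?thesis by simp
qed

lemma dg_sing: "dg {x} = un x x" by (rule fm_eqI) (auto simp: ent_dg ent_un)
lemma gcl_sing: assumes "s * s = 1" shows "gcl (Sn s {x}) = gcl (S s)"
proof (rule gcl_iso)
  show "kiso (Sn s {x}) (S s)" unfolding kiso_def
    by (rule exI[of _ "un () x"], rule exI[of _ "un x ()"]) (simp add: kh_def dg_sing un_mm mm_sc_l mm_sc_r)
qed
lemma gcl_Sn: assumes "finite I" "s * s = 1" shows "gcl (Sn s I) = of_nat (card I) * gcl (S s)"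
  using assms(1)
proof induction
  case empty
  have "dg {} = (0 :: ('a, 'a) fm)" by (rule fm_eqI) (simp add: ent_dg)
  then show ?case by (simp add: gcl_0 vmod_Sn assms)
next
  case (insert x I)
  have e: "dg {x} + dg I = dg (insert x I)" using insert by (intro fm_eqI) (auto simp: ent_dg lookup_add)
  have z: "dg {} = (0 :: ('a, 'a) fm)" by (rule fm_eqI) (simp add: ent_dg)
  have "is_dsum (Sn s (insert x I)) (Sn s {x}) (Sn s I)" unfolding is_dsum_def
    by (rule exI[of _ "dg {x}"], rule exI[of _ "dg {x}"], rule exI[of _ "dg I"], rule exI[of _ "dg I"])
       (use insert in \<open>simp add: kh_def dg_mm mm_sc_l mm_sc_r e z Int_absorb1 Int_absorb2 subset_insertI\<close>)
  from gcl_dsum[OF vmod_Sn vmod_Sn vmod_Sn this] insert assms show ?case by (simp add: gcl_sing algebra_simps)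
qed

lemma gcl_isotypic:
  assumes v: "vmod N" and K: "mK N = sc s (mE N)" "s * s = 1" "mA N = 0" "mB N = 0"
  shows "\<exists>n. gcl N = of_nat n * gcl (S s) \<and> tr (mE N) = of_nat n"
proof -
  obtain n i r where f: "mE N = i \<diamondop> r" "r \<diamondop> i = idn n" "i \<diamondop> idn n = i"
    using idem_factor[OF vmod_eqs(1)[OF v]] by metis
  have "conjm r i N = Sn s {..<n}" by (simp add: conjm_def Sn_def K mm_assoc f mm_sc_l mm_sc_r)
  then have "kiso N (Sn s {..<n})" using conjm(2)[OF v f(1)[symmetric]] by simp
  moreover have "tr (mE N) = of_nat n" using tr_comm[of i r] by (simp add: f tr_dg)
  ultimately show ?thesis using gcl_iso gcl_Sn[of "{..<n}" s] K(2) by fastforce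
qed

lemma gcl_semisimple:
  assumes v: "vmod M" "mA M = 0" "mB M = 0"
  shows "\<exists>a b. gcl M = of_nat a + of_nat b * gg \<and> tr (mE M) = of_nat (a + b) \<and> tr (mK M) = of_nat a - of_nat b"
proof -
  note e = vmod_eqs[OF v(1)]
  define p where "p = sc (1/2) (mE M + mK M)"
  have Kp: "mK M \<diamondop> p = p" "mE M \<diamondop> p = p" "p \<diamondop> mE M = p" "p \<diamondop> mK M = p" by (simp_all add: p_def fm_alg e add.commute)
  have "p \<diamondop> p = sc (1/2) (p + p)" by (subst p_def) (simp add: fm_alg Kp)
  also have "\<dots> = p" by (rule fm_eqI) (simp add: ent_sc lookup_add)
  finally have pp: "p \<diamondop> p = p" .
  have kp: "kh M M p" by (simp add: kh_def Kp v)
  note c = cut[OF v(1) kp pp]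
  have s: "vmod (cut M (mE M - p))" "is_dsum M (cut M p) (cut M (mE M - p))"
    using summand[OF v(1) c(2,3)] pp by simp_all
  obtain n where n: "gcl (cut M p) = of_nat n * gcl (S 1)" "tr p = of_nat n"
    using gcl_isotypic[OF c(1), of 1] by (auto simp: Kp v)
  have "mK M - p = - (mE M - p)" by (rule fm_eqI) (simp add: p_def ent_sc lookup_add lookup_minus field_simps)
  then obtain m where m: "gcl (cut M (mE M - p)) = of_nat m * gcl (S (-1))" "tr (mE M - p) = of_nat m"
    using gcl_isotypic[OF s(1), of "-1"] by (auto simp: mm_diff_r e Kp v sc_minus_l)
  have t: "tr (mE M) = of_nat (n + m)" using n(2) m(2) by (simp add: tr_diff algebra_simps)
  have "tr p = (tr (mE M) + tr (mK M)) / 2" by (simp add: p_def tr_sc tr_add)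
  then have "tr (mK M) = of_nat n - of_nat m" using n(2) t by (simp add: field_simps)
  then show ?thesis using gcl_dsum[OF v(1) c(1) s] n m t by (intro exI[of _ n] exI[of _ m]) (simp add: gcl_S1 gg_def)
qed

lemma gp_P0: "gp = gcl P0m * gg" "gcl P0m = gg * gp" "gcl (Pm True) = gg * gp"
proof -
  have "gcl (kten P0m (S s)) = gcl P0m * gcl (S s)" if "s * s = 1" for s by (simp add: gcl_kten vmod_P0m vmod_S that)
  then show "gp = gcl P0m * gg" "gcl P0m = gg * gp" "gcl (Pm True) = gg * gp"
    by (simp_all add: gp_def Pm_def S_Sn sg_def gg_def[symmetric] gcl_S1 mult.commute[of _ gg] gg2')
qed

lemma gp_semis: assumes "vmod M" shows "gp * gcl M = gp * gcl (semis M)"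
proof -
  have "gcl P0m * gcl M = gcl P0m * gcl (semis M)"
    using gcl_dsum[OF _ _ vmod_zmod P0m_tensor[OF assms]] gcl_0[OF vmod_zmod] by (simp add: vmod_kten vmod_P0m vmod_semis assms gcl_kten)
  then have "gg * (gcl P0m * gcl M) = gg * (gcl P0m * gcl (semis M))" by simp
  then show ?thesis unfolding gp_P0(1) by (simp add: mult_ac)
qed
text \<open>Multiplication by \<open>gp\<close> remembers only the K-action, and the dimension and
  the trace of K determine the two eigenspace dimensions.\<close>

lemma trace_split:
  assumes t: "tr (mE M) = of_nat (a + b)" "tr (mK M) = of_nat a - of_nat b" and v: "vmod M"
  shows "gp * gcl M = gp * (of_nat a + of_nat b * gg)"
proof -
  obtain c d where c: "gcl (semis M) = of_nat c + of_nat d * gg" "tr (mE M) = of_nat (c + d)" "tr (mK M) = of_nat c - of_nat d"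
    using gcl_semisimple[of "semis M"] v by (auto simp: vmod_semis)
  have e: "(of_nat c :: complex) + of_nat d = of_nat a + of_nat b" "(of_nat c :: complex) - of_nat d = of_nat a - of_nat b" using c t by simp_all
  have "2 * (of_nat c :: complex) = 2 * of_nat a" using arg_cong2[OF e, of "(+)"] by simp
  then have "c = a" by simp
  moreover have "d = b" using e(1) calculation by simp
  ultimately show ?thesis using gp_semis[OF v] c(1) by simp
qed

lemma tr_mE_mK_Kr: "tr (mE (Kr s u w A B)) = of_nat (u + w)" "tr (mK (Kr s u w A B)) = s * (of_nat u - of_nat w)"
  by (simp_all add: tr_add tr_diff tr_sc tr_krn tr_un tr_dg)
lemma ymod_LTm: "ymod = LTm 1 1"
proof -
  have "sh (Suc 1) = un 1 0" by (rule fm_eqI) (auto simp: sh_def ent_pm ent_un)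
  moreover have "idn 1 = un 0 0" by (rule fm_eqI) (auto simp: ent_dg ent_un)
  ultimately show ?thesis by (simp add: ymod_def LTm_def numeral_2_eq_2)
qed

lemma gp_rel: "gp * gp = gp * (2 + 2 * gg)" "gp * gy = gp * (1 + 2 * gg)" "gp * gz = gp * (1 + 2 * gg)"
  "gp * gX n \<eta> = gp * (of_nat n + of_nat n * gg)"
proof -
  have "gp * gcl P0m = gp * (of_nat 2 + of_nat 2 * gg)"
    by (rule trace_split) (simp_all add: P0m_sel tr_add tr_diff tr_un vmod_P0m)
  then have "gp * gp = gp * (2 + 2 * gg) * gg" by (simp add: gp_P0(1) mult_ac)
  then show "gp * gp = gp * (2 + 2 * gg)" by (simp add: algebra_simps gg2 gg2')
  have "gp * gy = gp * (of_nat 1 + of_nat 2 * gg)" unfolding gy_def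
    by (rule trace_split) (simp_all add: ymod_LTm LTm_def tr_mE_mK_Kr vmod_std[unfolded LTm_def] del: Kr_sel)
  then show "gp * gy = gp * (1 + 2 * gg)" by simp
  have "gp * gz = gp * (of_nat 1 + of_nat 2 * gg)" unfolding gz_def
    by (rule trace_split) (simp_all add: Lm_def tr_mE_mK_Kr vmod_std[unfolded Lm_def] del: Kr_sel)
  then show "gp * gz = gp * (1 + 2 * gg)" by simp
  show "gp * gX n \<eta> = gp * (of_nat n + of_nat n * gg)" unfolding gX_def
    by (rule trace_split) (simp_all add: Xm_def tr_mE_mK_Kr vmod_std[unfolded Xm_def] del: Kr_sel)
qed

lemma P0_Sn: assumes "finite I" "s * s = 1" shows "gcl (kten P0m (Sn s I)) = of_nat (card I) * (gg * gp * gcl (S s))"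
  using assms by (simp add: gcl_kten vmod_P0m vmod_Sn gp_P0(2) gcl_Sn mult_ac)

lemma gy_mult:
  assumes s: "s * s = 1"
  shows "gy * gcl (Xm s n \<eta>) = of_nat n * (gg * gp * gcl (S s)) + gcl (Xm (- s) n \<eta>)"
    "gy * gcl (LTm s k) = of_nat k * (gg * gp * gcl (S s)) + gcl (LTm (- s) (Suc k))"
    "gy * gcl (Lm s (Suc k)) = of_nat (Suc (Suc k)) * (gg * gp * gcl (S s)) + gcl (Lm (- s) k)"
proof -
  have s': "(- s) * (- s) = 1" using s by simp
  note v = vmod_std[OF s] vmod_std[OF s'] vmod_ymod vmod_P0m
  show "gy * gcl (Xm s n \<eta>) = of_nat n * (gg * gp * gcl (S s)) + gcl (Xm (- s) n \<eta>)"
    using gcl_dsum[OF _ _ _ ymod_X[OF s]] P0_Sn[OF _ s, of "{..<n}"] v by (simp add: vmod_kten vmod_Sn s gy_def gcl_kten)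
  show "gy * gcl (LTm s k) = of_nat k * (gg * gp * gcl (S s)) + gcl (LTm (- s) (Suc k))"
    using gcl_dsum[OF _ _ _ ymod_LT[OF s]] P0_Sn[OF _ s, of "{..<k}"] v by (simp add: vmod_kten vmod_Sn s gy_def gcl_kten)
  show "gy * gcl (Lm s (Suc k)) = of_nat (Suc (Suc k)) * (gg * gp * gcl (S s)) + gcl (Lm (- s) k)"
    using gcl_dsum[OF _ _ _ ymod_L[OF s]] P0_Sn[OF _ s, of "{..<Suc (Suc k)}"] v by (simp add: vmod_kten vmod_Sn s gy_def gcl_kten del: of_nat_Suc)
qed

lemma gcl_L0: assumes s: "s * s = 1" shows "gcl (Lm s 0) = gcl (S s)" "gcl (LTm s 0) = gcl (S (- s))"
proof -
  have s': "(- s) * (- s) = 1" using s by simp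
  have z: "idn 0 = 0" "sh (Suc 0) = 0" by (rule fm_eqI, simp add: ent_dg sh_def ent_pm)+
  have "\<exists>n. gcl (Lm s 0) = of_nat n * gcl (S s) \<and> tr (mE (Lm s 0)) = of_nat n"
    by (rule gcl_isotypic) (simp_all add: vmod_std[OF s] s, simp_all add: Lm_def z)
  then show "gcl (Lm s 0) = gcl (S s)" by (auto simp: Lm_def tr_mE_mK_Kr simp del: Kr_sel)
  have "\<exists>n. gcl (LTm s 0) = of_nat n * gcl (S (- s)) \<and> tr (mE (LTm s 0)) = of_nat n"
    by (rule gcl_isotypic) (simp_all add: vmod_std[OF s] s, simp_all add: LTm_def z sc_minus_l sc_minus)
  then show "gcl (LTm s 0) = gcl (S (- s))" by (auto simp: LTm_def tr_mE_mK_Kr simp del: Kr_sel)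
qed

lemma gX_neg: "gcl (Xm (-1) n \<eta>) = gg * gX n \<eta>"
  using gcl_flip[OF vmod_std(3), of 1 n \<eta>] by (simp add: flip_std gX_def)
lemma gyz: "gy * gz = 1 + 2 * gp"
  using gy_mult(3)[of "-1" 0] by (simp add: gz_def gcl_L0 gcl_S1 gg_def[symmetric] mult_ac gg2')
lemma gyX: "gy * gX n \<eta> = of_nat n * gg * gp + gg * gX n \<eta>"
  using gy_mult(1)[of 1 n \<eta>] by (simp add: gX_def[symmetric] gX_neg gcl_S1 mult.assoc)
text \<open>Computing z (y X) once by \<open>gyz\<close> and once by \<open>gyX\<close> leaves an
  equation for g times z X, and g is its own inverse.\<close>

lemma gzX: "gz * gX n \<eta> = of_nat n * gp + gg * gX n \<eta>"
proof -
  have "gz * (gy * gX n \<eta>) = gX n \<eta> + 2 * (gp * gX n \<eta>)" using gyz by (simp add: mult.assoc[symmetric] mult.commute[of gz]) (simp add: algebra_simps)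
  then have "gg * (gz * gX n \<eta>) = gX n \<eta> + 2 * (gp * gX n \<eta>) - of_nat n * (gg * (gp * gz))"
    unfolding gyX by (simp add: algebra_simps)
  then have "gg * (gg * (gz * gX n \<eta>)) = gg * (gX n \<eta> + 2 * (gp * gX n \<eta>) - of_nat n * (gg * (gp * gz)))" by simp
  then show ?thesis unfolding gp_rel gg2' by (simp add: algebra_simps gg2 gg2')
qed
lemma gXX_same: assumes "1 \<le> n" "n \<le> t"
  shows "gX n \<eta> * gX t \<eta> = of_nat n * (of_nat t - 1) * gg * gp + gX n \<eta> + gg * gX n \<eta>"
proof -
  have v: "vmod (Xm 1 k \<eta>)" "vmod (Xm (-1) k \<eta>)" for k by (simp_all add: vmod_std)
  have x: "gcl (xsum (Xm 1 n \<eta>) (Xm (-1) n \<eta>)) = gX n \<eta> + gg * gX n \<eta>"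
    using gcl_dsum[OF _ v(1,2) is_dsum_xsum[OF v(1,2)], of n n] by (simp add: vmod_xsum v gX_neg gX_def[symmetric])
  have c: "of_nat (card ({..<n} \<times> {..<t - 1})) = (of_nat n * (of_nat t - 1) :: green)"
    using assms by (simp add: card_cartesian_product of_nat_diff)
  have "gX n \<eta> * gX t \<eta> = gcl (kten P0m (Sn 1 ({..<n} \<times> {..<t - 1}))) + gcl (xsum (Xm 1 n \<eta>) (Xm (-1) n \<eta>))"
    using gcl_dsum[OF _ _ _ kten_X_same[OF assms, of \<eta>]] by (simp add: vmod_kten vmod_Sn vmod_P0m vmod_xsum v gX_def gcl_kten)
  then show ?thesis using P0_Sn[of "{..<n} \<times> {..<t - 1}" 1] by (simp only: x c gcl_S1) (simp add: mult_ac add_ac)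
qed
lemma gXX_diff: assumes "\<eta> \<noteq> \<alpha>" shows "gX n \<eta> * gX t \<alpha> = of_nat n * of_nat t * gg * gp"
proof -
  have *: "gX n \<eta> * gX t \<alpha> = of_nat n * of_nat t * gg * gp" if "\<eta> \<noteq> \<alpha>" "\<eta> \<noteq> Infinity" for n t \<eta> \<alpha>
    using gcl_dsum[OF _ _ vmod_zmod kten_X_diff[OF that, of n t]] gcl_0[OF vmod_zmod] P0_Sn[of "{..<n} \<times> {..<t}" 1]
    by (simp add: vmod_kten vmod_Sn vmod_P0m vmod_std gX_def gcl_kten gcl_S1 card_cartesian_product mult.assoc)
  show ?thesis
  proof (cases "\<eta> = Infinity")
    case True
    then show ?thesis using *[of \<alpha> \<eta> t n] assms by (simp add: mult_ac)
  qed (use * assms in blast)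
qed

text \<open>The integral span of the two indecomposable projective classes.\<close>

definition Pr :: "green set" where "Pr = {of_int u * gp + of_int v * (gg * gp) | u v. True}"

lemma Pr_gp: "of_nat a * gp + of_nat b * (gg * gp) \<in> Pr"
  unfolding Pr_def by (intro CollectI exI[of _ "int a"] exI[of _ "int b"]) simp
lemma Pr_0: "0 \<in> Pr" using Pr_gp[of 0 0] by simp
lemma Pr_add: "x \<in> Pr \<Longrightarrow> y \<in> Pr \<Longrightarrow> x + y \<in> Pr" "x \<in> Pr \<Longrightarrow> y \<in> Pr \<Longrightarrow> x - y \<in> Pr"
proof -
  assume "x \<in> Pr" "y \<in> Pr"
  then obtain u v u' v' where "x = of_int u * gp + of_int v * (gg * gp)" "y = of_int u' * gp + of_int v' * (gg * gp)" by (auto simp: Pr_def)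
  then have "x + y = of_int (u + u') * gp + of_int (v + v') * (gg * gp)" "x - y = of_int (u - u') * gp + of_int (v - v') * (gg * gp)"
    by (simp_all add: algebra_simps)
  then show "x + y \<in> Pr" "x - y \<in> Pr" unfolding Pr_def by blast+
qed
lemma gp_gcl: assumes "vmod M" shows "\<exists>a b. gp * gcl M = of_nat a * gp + of_nat b * (gg * gp)"
proof -
  obtain a b where "gcl (semis M) = of_nat a + of_nat b * gg"
    using gcl_semisimple[of "semis M"] assms by (auto simp: vmod_semis)
  then have "gp * gcl M = of_nat a * gp + of_nat b * (gg * gp)" using gp_semis[OF assms] by (simp add: algebra_simps)
  then show ?thesis by blast
qed
lemma Pr_gcl: assumes "vmod M" "x \<in> Pr" shows "gcl M * x \<in> Pr"
proof -
  obtain a b where ab: "gp * gcl M = of_nat a * gp + of_nat b * (gg * gp)" using gp_gcl[OF assms(1)] by blast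
  obtain u v where x: "x = of_int u * gp + of_int v * (gg * gp)" using assms(2) by (auto simp: Pr_def)
  have "gcl M * x = of_int u * (gp * gcl M) + of_int v * (gg * (gp * gcl M))" by (simp add: x algebra_simps)
  also have "\<dots> = of_int (u * int a + v * int b) * gp + of_int (u * int b + v * int a) * (gg * gp)"
    unfolding ab by (simp add: algebra_simps gg2')
  finally show ?thesis unfolding Pr_def by blast
qed
lemma gp_Pr: "gp \<in> Pr" using Pr_gp[of 1 0] by simp
lemma P0_Pr: assumes "vmod M" shows "gcl (kten P0m M) \<in> Pr"
  using Pr_gcl[OF assms Pr_gp[of 0 1]] by (simp add: gcl_kten vmod_P0m assms gp_P0(2) mult.commute)

text \<open>By \<open>gy_mult\<close> each factor \<open>gy\<close> raises the index and flips the
  sign, starting from \<open>LTm s 0\<close>, which is the simple module of sign \<open>- s\<close>.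
  This is the origin of the parity condition.\<close>

lemma gy_pow: "gs (b = odd k) * gy ^ k - gcl (LTm (sg b) k) \<in> Pr"
proof (induction k arbitrary: b)
  case 0
  then show ?case using Pr_0 by (simp add: gcl_L0 sg_sq sg_not[symmetric] gs_def[symmetric])
next
  case (Suc k)
  have "gy * (gs ((\<not> b) = odd k) * gy ^ k - gcl (LTm (sg (\<not> b)) k)) \<in> Pr"
    unfolding gy_def[of] using Pr_gcl[OF vmod_ymod Suc[of "\<not> b"]] by (simp add: gy_def)
  moreover have "gcl (kten P0m (Sn (sg (\<not> b)) {..<k})) \<in> Pr" by (rule P0_Pr) (simp add: vmod_Sn sg_sq)
  moreover have "gy * gcl (LTm (sg (\<not> b)) k) = gcl (kten P0m (Sn (sg (\<not> b)) {..<k})) + gcl (LTm (sg b) (Suc k))"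
    using gy_mult(2)[OF sg_sq, of "\<not> b" k] P0_Sn[OF _ sg_sq, of "{..<k}" "\<not> b"] by (simp add: sg_not)
  moreover have "((\<not> b) = odd k) = (b = odd (Suc k))" by auto
  ultimately show ?case using Pr_add(1) by (simp add: algebra_simps) fastforce
qed

text \<open>\<open>gyz\<close> makes z an inverse of y modulo projectives, so multiplying the
  recursion of y on the \<open>Lm\<close> by z runs it backwards.\<close>

lemma gz_pow: "gs (b = even m) * gz ^ m - gcl (Lm (sg b) m) \<in> Pr"
proof (induction m arbitrary: b)
  case 0
  then show ?case using Pr_0 by (simp add: gcl_L0 sg_sq gs_def[symmetric])
next
  case (Suc m)
  let ?L = "gcl (Lm (sg b) (Suc m))" and ?L' = "gcl (Lm (sg (\<not> b)) m)"
  define q where "q = gcl (kten P0m (Sn (sg b) {..<Suc (Suc m)}))"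
  have vz: "vmod (Lm (-1) 1)" by (simp add: vmod_std)
  have q: "q \<in> Pr" unfolding q_def by (rule P0_Pr) (simp add: vmod_Sn sg_sq)
  have "gy * ?L = q + ?L'"
    using gy_mult(3)[OF sg_sq, of b m] P0_Sn[OF _ sg_sq, of "{..<Suc (Suc m)}" b] by (simp add: sg_not q_def)
  then have "gz * (gy * ?L) = gz * (q + ?L')" by simp
  then have "(gy * gz) * ?L = gz * q + gz * ?L'" by (simp add: distrib_left mult_ac)
  then have "gz * ?L' - ?L = (?L * gp + ?L * gp) - gz * q" unfolding gyz by (simp add: algebra_simps)
  moreover have "gz * q \<in> Pr" using Pr_gcl[OF vz q] by (simp add: gz_def)
  moreover have "?L * gp \<in> Pr" by (rule Pr_gcl) (simp_all add: gp_Pr vmod_std sg_sq)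
  ultimately have 1: "gz * ?L' - ?L \<in> Pr" using Pr_add by metis
  have 2: "gz * (gs ((\<not> b) = even m) * gz ^ m - ?L') \<in> Pr" using Pr_gcl[OF vz Suc[of "\<not> b"]] by (simp add: gz_def)
  have "((\<not> b) = even m) = (b = even (Suc m))" by auto
  then show ?case using Pr_add(1)[OF 1 2] by (simp add: algebra_simps)
qed

text \<open>Induction on the dimension: a nonzero module has a standard summand, whose class is
  built from the generators, and the complement is smaller and lives over the same index type.
  Powers of y and z give the standard classes up to \<open>Pr\<close>, which lies in
  \<open>A\<close>.\<close>

lemma gcl_closed:
  fixes M :: "'i kmod"
  assumes A: "1 \<in> A" "gg \<in> A" "gp \<in> A" "gy \<in> A" "gz \<in> A" "\<And>n \<eta>. 1 \<le> n \<Longrightarrow> gX n \<eta> \<in> A"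
    and c: "\<And>x y. x \<in> A \<Longrightarrow> y \<in> A \<Longrightarrow> x - y \<in> A" "\<And>x y. x \<in> A \<Longrightarrow> y \<in> A \<Longrightarrow> x * y \<in> A"
    and v: "vmod M"
  shows "gcl M \<in> A"
proof -
  have A0: "0 \<in> A" using c(1)[OF A(1) A(1)] by simp
  have add: "x + y \<in> A" if "x \<in> A" "y \<in> A" for x y using c(1)[OF that(1) c(1)[OF A0 that(2)]] by simp
  have nat: "of_nat n \<in> A" for n by (induction n) (auto simp: A0 A(1) add)
  have int: "of_int u \<in> A" for u by (cases u rule: int_diff_cases) (auto simp: c(1) nat)
  have Pr: "Pr \<subseteq> A" unfolding Pr_def using add c(2) int A by auto
  have gs: "gs b \<in> A" for b by (cases b) (simp_all add: gs A)
  have pow: "x ^ k \<in> A" if "x \<in> A" for x k by (induction k) (simp_all add: A(1) c(2) that)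
  have T: "gcl (LTm (sg b) k) \<in> A" for b k
    using c(1)[OF c(2)[OF gs[of "b = odd k"] pow[OF A(4), of k]] subsetD[OF Pr gy_pow[of b k]]] by simp
  have L: "gcl (Lm (sg b) k) \<in> A" for b k
    using c(1)[OF c(2)[OF gs[of "b = even k"] pow[OF A(5), of k]] subsetD[OF Pr gz_pow[of b k]]] by simp
  have X: "gcl (Xm (sg b) n \<eta>) \<in> A" if "1 \<le> n" for b n \<eta>
    using A(6)[OF that, of \<eta>] c(2)[OF A(2) A(6)[OF that, of \<eta>]] by (cases b) (simp_all add: sg_def gX_def[symmetric] gX_neg)
  have K: "gcl (Kr (sg b) u w P Q) \<in> A" if "std_pencil u w P Q" for b u w P Q
    using that by cases (use T L X in \<open>auto simp: LTm_def Lm_def Xm_def\<close>)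
  have P: "gcl (Pm b) \<in> A" for b by (cases b) (simp_all add: gp_P0(3) gp_def[symmetric] A c(2))
  obtain n where "tr (mE M) = of_nat n" using tr_idem[OF vmod_eqs(1)[OF v]] by auto
  with v show ?thesis
  proof (induction n arbitrary: M rule: less_induct)
    case (less n)
    have step: "gcl M \<in> A" if N: "vmod N" "gcl N \<in> A" "tr (mE N) = of_nat k" "0 < k" and M': "vmod M'" "is_dsum M N M'" for N :: "'n kmod" and M' :: "'i kmod" and k
    proof -
      obtain m where m: "tr (mE M') = of_nat m" using tr_idem[OF vmod_eqs(1)[OF M'(1)]] by auto
      have "(of_nat n :: complex) = of_nat (k + m)" using is_dsum_tr[OF M'(2)] less(3) N(3) m by simp
      then have "m < n" using N(4) by (simp only: of_nat_eq_iff)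
      then have "gcl M' \<in> A" using less(1)[OF _ M'(1) m] by blast
      then show ?thesis using gcl_dsum[OF less(2) N(1) M'] N(2) add by simp
    qed
    show ?case
    proof (cases "mE M = 0")
      case True
      then show ?thesis using gcl_0[OF less(2)] A0 by simp
    next
      case nz: False
      show ?thesis
      proof (cases "mA M \<diamondop> mB M = 0")
        case True
        obtain b u w P Q and M' :: "'i kmod" where sp: "std_pencil u w P Q" "vmod M'" "is_dsum M (Kr (sg b) u w P Q) M'"
          using kronecker_summand[OF less(2) True nz] by blast
        have p: "vmod (Kr (sg b) u w P Q)" "0 < u + w"
          using sp(1) by (cases, auto simp: vmod_std[unfolded LTm_def Lm_def Xm_def] sg_sq)+
        show ?thesis by (rule step[OF p(1) K[OF sp(1)] tr_mE_mK_Kr(1) p(2) sp(2,3)])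
      next
        case False
        obtain b and M' :: "'i kmod" where "vmod M'" "is_dsum M (Pm b) M'" using projective_summand[OF less(2) False] by blast
        moreover have "tr (mE (Pm b)) = of_nat 4" by (simp add: Pm_sel tr_add tr_un)
        ultimately show ?thesis using step[OF vmod_Pm P, of b 4] by simp
      qed
    qed
  qed
qed

lemma gm_simps: "gm N 0 = 0" "gm N (- x) = - gm N x" "gm N (x + y) = gm N x + gm N y" "gm N (of_int u * x) = u * gm N x"
proof -
  show 0: "gm N 0 = 0" using gm_diff[of N 0 0] by simp
  show m: "gm N (- x) = - gm N x" for x using gm_diff[of N 0 x] 0 by simp
  show a: "gm N (x + y) = gm N x + gm N y" for x y using gm_diff[of N x "- y"] m by simp
  have n: "gm N (of_nat k * x) = int k * gm N x" for k by (induction k) (simp_all add: 0 a algebra_simps)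
  show "gm N (of_int u * x) = u * gm N x" by (cases u rule: int_diff_cases) (simp add: left_diff_distrib gm_diff n)
qed

lemma kstd_not_Pm: "\<not> kiso (kstd l) (Pm b)"
  using Pm_not_Kr kiso_sym by (cases l) (fastforce simp: LTm_def Lm_def Xm_def)+
lemma gm_kstd: "gm (kstd l) (gcl (kstd l')) = (if l = l' then gm (kstd l) (gcl (kstd l)) else 0)" "gm (kstd l) (gcl (kstd l)) \<noteq> 0"
  using kmult_other[OF vmod_kstd vmod_kstd klocal_kstd klocal_kstd, of l l'] kstd_inj[of l l'] kmult_self[OF vmod_kstd tr_kstd_nz, of l]
  by (auto simp: gm_gcl vmod_kstd)
lemma gm_kstd_Pr: "x \<in> Pr \<Longrightarrow> gm (kstd l) x = 0"
  using kmult_other[OF vmod_kstd vmod_Pm klocal_kstd klocal_Pm kstd_not_Pm, of l]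
  by (auto simp: Pr_def gm_simps gp_P0(3)[symmetric] gm_gcl vmod_Pm) (simp add: gp_def gm_gcl vmod_Pm)
lemma gm_Pm: "gm (Pm b) (gcl (Pm b')) = (if b = b' then gm (Pm b) (gcl (Pm b)) else 0)" "gm (Pm b) (gcl (Pm b)) \<noteq> 0"
proof -
  have "tr (mE (Pm b)) \<noteq> 0" by (simp add: Pm_sel tr_add tr_un)
  then show "gm (Pm b) (gcl (Pm b')) = (if b = b' then gm (Pm b) (gcl (Pm b)) else 0)" "gm (Pm b) (gcl (Pm b)) \<noteq> 0"
    using kmult_other[OF vmod_Pm vmod_Pm klocal_Pm klocal_Pm, of b b'] Pm_inj[of b b'] kmult_self[OF vmod_Pm, of b]
    by (cases "kiso (Pm b) (Pm b')"; auto simp: gm_gcl vmod_Pm)+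
qed

section \<open>The evaluation map on polynomials, its vanishing on J, and its surjectivity\<close>

section \<open>Evaluating polynomials in the Green ring\<close>

definition mon :: "(gvar \<Rightarrow> 'r::comm_ring_1) \<Rightarrow> (gvar \<Rightarrow>\<^sub>0 nat) \<Rightarrow> 'r" where
  "mon v m = (\<Prod>x\<in>Poly_Mapping.keys m. v x ^ Poly_Mapping.lookup m x)"
definition evz :: "(gvar \<Rightarrow> 'r::comm_ring_1) \<Rightarrow> zx \<Rightarrow> 'r" where
  "evz v p = (\<Sum>m\<in>Poly_Mapping.keys p. of_int (Poly_Mapping.lookup p m) * mon v m)"

lemma mon_eq: "finite I \<Longrightarrow> Poly_Mapping.keys m \<subseteq> I \<Longrightarrow> mon v m = (\<Prod>x\<in>I. v x ^ Poly_Mapping.lookup m x)"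
  unfolding mon_def by (rule prod.mono_neutral_left) (auto simp: in_keys_iff)
lemma mon_add: "mon v (m + n) = mon v m * mon v n"
proof -
  let ?I = "Poly_Mapping.keys m \<union> Poly_Mapping.keys n"
  have "mon v (m + n) = (\<Prod>x\<in>?I. v x ^ Poly_Mapping.lookup (m + n) x)"
    using keys_add[of m n] by (intro mon_eq) auto
  then show ?thesis by (simp add: mon_eq[of ?I] lookup_add power_add prod.distrib)
qed
lemma evz_eq: "finite I \<Longrightarrow> Poly_Mapping.keys p \<subseteq> I \<Longrightarrow> evz v p = (\<Sum>m\<in>I. of_int (Poly_Mapping.lookup p m) * mon v m)"
  unfolding evz_def by (rule sum.mono_neutral_left) (auto simp: in_keys_iff)
lemma evz_add: "evz v (p + q) = evz v p + evz v q"
proof -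
  let ?I = "Poly_Mapping.keys p \<union> Poly_Mapping.keys q"
  have "evz v (p + q) = (\<Sum>m\<in>?I. of_int (Poly_Mapping.lookup (p + q) m) * mon v m)"
    using keys_add[of p q] by (intro evz_eq) auto
  then show ?thesis by (simp add: evz_eq[of ?I] lookup_add distrib_right sum.distrib)
qed
lemma evz_0: "evz v 0 = 0" by (simp add: evz_def)
lemma evz_minus: "evz v (- p) = - evz v p"
  using evz_add[of v p "- p"] by (simp add: evz_0 eq_neg_iff_add_eq_0 add.commute)
lemma evz_diff: "evz v (p - q) = evz v p - evz v q"
  using evz_add[of v p "- q"] by (simp add: evz_minus)
lemma evz_single: "evz v (Poly_Mapping.single m c) = of_int c * mon v m"
  by (simp add: evz_def)
lemma evz_sum: "evz v (sum f I) = (\<Sum>i\<in>I. evz v (f i))"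
  by (induction I rule: infinite_finite_induct) (auto simp: evz_add evz_0)
lemma evz_mult: "evz v (p * q) = evz v p * evz v q"
proof -
  have "evz v (p * q) = evz v ((\<Sum>k\<in>Poly_Mapping.keys p. Poly_Mapping.single k (Poly_Mapping.lookup p k)) *
     (\<Sum>k\<in>Poly_Mapping.keys q. Poly_Mapping.single k (Poly_Mapping.lookup q k)))"
    by (simp only: sum_singles[symmetric])
  also have "\<dots> = evz v p * evz v q"
    by (simp add: sum_product mult_single evz_sum evz_single mon_add evz_def[of _ p] evz_def[of _ q] mult_ac)
  finally show ?thesis .
qed
lemma evz_1: "evz v 1 = 1"
  by (simp add: single_one[symmetric] evz_single del: single_one) (simp add: mon_def)
lemma evz_power: "evz v (p ^ n) = evz v p ^ n" by (induction n) (simp_all add: evz_1 evz_mult)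
lemma evz_nat: "evz v (of_nat n) = of_nat n" by (induction n) (simp_all add: evz_0 evz_1 evz_add)
lemma evz_2: "evz v 2 = 2" using evz_nat[of v 2] by simp
lemmas evz_hom = evz_add evz_0 evz_minus evz_diff evz_mult evz_1 evz_power evz_nat evz_2
lemma evz_pvar: "evz v (pvar x) = v x" by (simp add: pvar_def evz_single mon_def)

text \<open>The ring obtained from the Green ring by adjoining a square root of $[P]$, the class of a
  projective cover of a simple module; the indeterminate $x_1$ is sent to this root.\<close>

datatype s2 = S2 (fa: green) (fb: green)

instantiation s2 :: comm_ring_1
begin
definition "x + y = S2 (fa x + fa y) (fb x + fb y)"
definition "x - y = S2 (fa x - fa y) (fb x - fb y)"
definition "- x = S2 (- fa x) (- fb x)"
definition "x * y = S2 (fa x * fa y + gp * fb x * fb y) (fa x * fb y + fb x * fa y)"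
definition "0 = S2 0 0"
definition "1 = S2 1 0"
instance
  by standard (simp_all add: plus_s2_def minus_s2_def uminus_s2_def times_s2_def zero_s2_def one_s2_def algebra_simps)
end

lemmas s2_defs = plus_s2_def minus_s2_def uminus_s2_def times_s2_def zero_s2_def one_s2_def
lemma s2_nat: "of_nat n = S2 (of_nat n) 0" by (induction n) (simp_all add: s2_defs)
lemma s2_2: "2 = S2 2 0" using s2_nat[of 2] by simp
lemma s2_pow: "S2 a 0 ^ k = S2 (a ^ k) 0" by (induction k) (simp_all add: s2_defs)

fun vv :: "gvar \<Rightarrow> s2" where
  "vv VG1 = S2 gg 0" | "vv VX1 = S2 0 1" | "vv VY1 = S2 gy 0" | "vv VZ1 = S2 gz 0"
| "vv (VX' n \<eta>) = S2 (gX (Rep_pos_nat n) \<eta>) 0"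

lemma ev_vars: "evz vv g1 = S2 gg 0" "evz vv x1 = S2 0 1" "evz vv y1 = S2 gy 0" "evz vv z1 = S2 gz 0"
  "1 \<le> n \<Longrightarrow> evz vv (X' n \<eta>) = S2 (gX n \<eta>) 0"
  by (simp_all add: g1_def x1_def y1_def z1_def X'_def evz_pvar Abs_pos_nat_inverse)

lemma ideal_J: "ideal J ring_of_type_algebra"
  unfolding J_def ZX_def by (rule ring.genideal_ideal[OF ring_rta]) (simp add: rta_simps)
lemma J_gen: "q \<in> J_gens \<Longrightarrow> q \<in> J"
  unfolding J_def ZX_def using ring.genideal_self[OF ring_rta, of J_gens] by (auto simp: rta_simps)
lemma J_closed: "0 \<in> J" "x \<in> J \<Longrightarrow> y \<in> J \<Longrightarrow> x + y \<in> J" "x \<in> J \<Longrightarrow> - x \<in> J" "x \<in> J \<Longrightarrow> a * x \<in> J" "x \<in> J \<Longrightarrow> y \<in> J \<Longrightarrow> x - y \<in> J"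
proof -
  interpret ideal J "ring_of_type_algebra :: zx ring" by (rule ideal_J)
  show 0: "0 \<in> J" using additive_subgroup.zero_closed[OF ideal.axioms(1)[OF ideal_J]] by (simp add: rta_simps)
  show a: "x \<in> J \<Longrightarrow> y \<in> J \<Longrightarrow> x + y \<in> J" for x y using additive_subgroup.a_closed[OF ideal.axioms(1)[OF ideal_J], of x y] by (simp add: rta_simps)
  show m: "x \<in> J \<Longrightarrow> a * x \<in> J" for x a using I_l_closed[of x a] by (simp add: rta_simps)
  show n: "x \<in> J \<Longrightarrow> - x \<in> J" for x using m[of x "- 1"] by simp
  show "x \<in> J \<Longrightarrow> y \<in> J \<Longrightarrow> x - y \<in> J" using a[of x "- y"] n[of y] by simp
qed

lemma ev_J: assumes "q \<in> J" shows "fa (evz vv q) = 0"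
proof -
  \<comment> \<open>The condition on the second component is what makes the set stable under
    multiplication by x_1, which moves \<open>gp\<close> times that component into the
    first.\<close>
  let ?K = "{q. fa (evz vv q) = 0 \<and> gp * fb (evz vv q) = 0}"
  have z: "gp * (c * b) = 0" "gp * (b * c) = 0" if "gp * b = 0" for b c :: green
    using that by (metis mult.left_commute mult.assoc mult_zero_left mult_zero_right)+
  have "ideal ?K ring_of_type_algebra"
    by (rule ideal_rtaI[OF ring_rta]) (auto simp: evz_hom s2_defs distrib_left mult.assoc z)
  moreover have "J_gens \<subseteq> ?K"
    unfolding J_gens_def
    by (auto simp: evz_hom ev_vars s2_nat s2_2 power2_eq_square power3_eq_cube s2_defs gg2 gp_rel gyz gyX gzX gXX_same gXX_diff)
      (simp_all add: algebra_simps gg2 gp_rel)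
  ultimately have "J \<subseteq> ?K" unfolding J_def ZX_def by (rule ring.genideal_minimal[OF ring_rta])
  then show ?thesis using assms by auto
qed

lemma ZT_closed: "1 \<in> ZX_tilde" "x \<in> ZX_tilde \<Longrightarrow> y \<in> ZX_tilde \<Longrightarrow> x + y \<in> ZX_tilde"
  "x \<in> ZX_tilde \<Longrightarrow> y \<in> ZX_tilde \<Longrightarrow> x * y \<in> ZX_tilde" "x \<in> ZX_tilde \<Longrightarrow> y \<in> ZX_tilde \<Longrightarrow> x - y \<in> ZX_tilde"
proof -
  show "1 \<in> ZX_tilde" using generate_ring.one[of ZX] by (simp add: ZX_tilde_def ZX_def rta_simps)
  show a: "x \<in> ZX_tilde \<Longrightarrow> y \<in> ZX_tilde \<Longrightarrow> x + y \<in> ZX_tilde" for x y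
    using generate_ring.eng_add[of x ZX _ y] by (simp add: ZX_tilde_def ZX_def rta_simps)
  show "x \<in> ZX_tilde \<Longrightarrow> y \<in> ZX_tilde \<Longrightarrow> x * y \<in> ZX_tilde"
    using generate_ring.eng_mult[of x ZX _ y] by (simp add: ZX_tilde_def ZX_def rta_simps)
  have "x \<in> ZX_tilde \<Longrightarrow> - x \<in> ZX_tilde" for x
    using generate_ring.a_inv[of x ZX] by (simp add: ZX_tilde_def ZX_def rta_inv[OF ring_rta])
  then show "x \<in> ZX_tilde \<Longrightarrow> y \<in> ZX_tilde \<Longrightarrow> x - y \<in> ZX_tilde" using a[of x "- y"] by simp
qed
lemma ZT_gen: "g1 \<in> ZX_tilde" "x1^2 \<in> ZX_tilde" "y1 \<in> ZX_tilde" "z1 \<in> ZX_tilde" "1 \<le> n \<Longrightarrow> X' n \<eta> \<in> ZX_tilde"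
  unfolding ZX_tilde_def by (rule generate_ring.incl; blast)+
lemma ZT_induct[consumes 1, case_names one gen minus add mult]:
  assumes "q \<in> ZX_tilde" "P 1" "\<And>h. h \<in> {g1, x1^2, y1, z1} \<union> {X' n \<eta> | n \<eta>. n \<ge> 1} \<Longrightarrow> P h" "\<And>x. P x \<Longrightarrow> P (- x)"
    "\<And>x y. P x \<Longrightarrow> P y \<Longrightarrow> P (x + y)" "\<And>x y. P x \<Longrightarrow> P y \<Longrightarrow> P (x * y)"
  shows "P q"
  using assms(1) unfolding ZX_tilde_def
proof (induction rule: generate_ring.induct)
  case (incl h) then show ?case by (rule assms(3))
next
  case (a_inv h) then show ?case using assms(4) by (simp add: ZX_def rta_inv[OF ring_rta])
qed (use assms(2,5,6) in \<open>simp_all add: ZX_def rta_simps\<close>)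

lemma ev_ZT: "q \<in> ZX_tilde \<Longrightarrow> fb (evz vv q) = 0"
  by (induction rule: ZT_induct) (auto simp: evz_hom ev_vars power2_eq_square s2_defs)
lemma ev_ZT_mult: "p \<in> ZX_tilde \<Longrightarrow> q \<in> ZX_tilde \<Longrightarrow> fa (evz vv (p * q)) = fa (evz vv p) * fa (evz vv q)"
  by (simp add: evz_hom times_s2_def ev_ZT)

lemma ev_surj: "\<exists>q\<in>ZX_tilde. fa (evz vv q) = x"
proof -
  let ?A = "(\<lambda>q. fa (evz vv q)) ` ZX_tilde"
  have d: "a - b \<in> ?A" if "a \<in> ?A" "b \<in> ?A" for a b
  proof -
    from that obtain p q where "p \<in> ZX_tilde" "q \<in> ZX_tilde" "a = fa (evz vv p)" "b = fa (evz vv q)" by auto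
    then show ?thesis using ZT_closed(4) by (intro image_eqI[of _ _ "p - q"]) (auto simp: evz_hom s2_defs)
  qed
  have m: "a * b \<in> ?A" if "a \<in> ?A" "b \<in> ?A" for a b
  proof -
    from that obtain p q where "p \<in> ZX_tilde" "q \<in> ZX_tilde" "a = fa (evz vv p)" "b = fa (evz vv q)" by auto
    then show ?thesis using ZT_closed(3) ev_ZT_mult by (intro image_eqI[of _ _ "p * q"]) auto
  qed
  have gens: "1 \<in> ?A" "gg \<in> ?A" "gp \<in> ?A" "gy \<in> ?A" "gz \<in> ?A"
    using imageI[OF ZT_closed(1), of "\<lambda>q. fa (evz vv q)"] imageI[OF ZT_gen(1), of "\<lambda>q. fa (evz vv q)"]
      imageI[OF ZT_gen(2), of "\<lambda>q. fa (evz vv q)"] imageI[OF ZT_gen(3), of "\<lambda>q. fa (evz vv q)"] imageI[OF ZT_gen(4), of "\<lambda>q. fa (evz vv q)"]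
    by (simp_all add: evz_hom ev_vars power2_eq_square s2_defs)
  have gXA: "gX n \<eta> \<in> ?A" if "1 \<le> n" for n \<eta>
    using imageI[OF ZT_gen(5)[OF that], of "\<lambda>q. fa (evz vv q)" \<eta>] by (simp add: ev_vars(5)[OF that])
  have "x \<in> ?A"
    by (induction x rule: green_induct) (auto intro: gcl_closed[of ?A] gens gXA d m)
  then show ?thesis by auto
qed

section \<open>Spanning set modulo J, linear independence of its image, and the isomorphism\<close>

section \<open>A normal form modulo \<open>J\<close>\<close>

definition gb :: "bool \<Rightarrow> zx" where "gb b = (if b then 1 else g1)"
text \<open>Label by label these polynomials evaluate to \<open>Pm\<close> and, up to projectives,
  to \<open>kstd\<close>; the parities in \<open>gb\<close> are the signs from \<open>gy_pow\<close>
  and \<open>gz_pow\<close>.\<close>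

fun bq :: "bool + klab \<Rightarrow> zx" where
  "bq (Inl b) = gb (\<not> b) * x1^2"
| "bq (Inr (KT b k)) = gb (b = odd k) * y1^k"
| "bq (Inr (KL b k)) = gb (b = even (Suc k)) * z1^Suc k"
| "bq (Inr (KX b n \<eta>)) = gb b * X' (Suc n) \<eta>"
definition NF :: "zx set" where "NF = {q. \<exists>c. q - frag_extend bq c \<in> J}"

lemma NF_bq: "bq l \<in> NF" unfolding NF_def using J_closed(1) by (intro CollectI exI[of _ "frag_of l"]) simp
lemma NF_diff: "x \<in> NF \<Longrightarrow> y \<in> NF \<Longrightarrow> x - y \<in> NF"
proof -
  assume "x \<in> NF" "y \<in> NF"
  then obtain c d where "x - frag_extend bq c \<in> J" "y - frag_extend bq d \<in> J" by (auto simp: NF_def)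
  then have "(x - frag_extend bq c) - (y - frag_extend bq d) \<in> J" by (rule J_closed(5))
  then have "(x - y) - frag_extend bq (c - d) \<in> J" by (simp add: frag_extend_diff algebra_simps)
  then show ?thesis by (auto simp: NF_def)
qed
lemma NF_0: "0 \<in> NF" unfolding NF_def using J_closed(1) by (intro CollectI exI[of _ 0]) simp
lemma NF_add: "x \<in> NF \<Longrightarrow> y \<in> NF \<Longrightarrow> x + y \<in> NF" using NF_diff[of x "0 - y"] NF_diff[OF NF_0, of y] by simp
lemma NF_nat: "x \<in> NF \<Longrightarrow> of_nat n * x \<in> NF" by (induction n) (auto simp: NF_0 NF_add distrib_right)
lemma NF_2: "x \<in> NF \<Longrightarrow> 2 * x \<in> NF" using NF_add[of x x] by simp
lemma NF_cong: assumes "r \<in> NF" "j \<in> J" "q = r + a * j" shows "q \<in> NF"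
proof -
  obtain c where "r - frag_extend bq c \<in> J" using assms(1) by (auto simp: NF_def)
  then have "(r - frag_extend bq c) + a * j \<in> J" using J_closed(2,4) assms(2) by blast
  then have "q - frag_extend bq c \<in> J" by (simp add: assms(3) algebra_simps)
  then show ?thesis by (auto simp: NF_def)
qed
lemma NF_mult: assumes "\<And>l. t * bq l \<in> NF" "q \<in> NF" shows "t * q \<in> NF"
proof -
  obtain c where c: "q - frag_extend bq c \<in> J" using assms(2) by (auto simp: NF_def)
  have "Poly_Mapping.keys c \<subseteq> UNIV" by simp
  then have "t * frag_extend bq c \<in> NF"
    by (induction c rule: frag_induction) (auto simp: NF_0 assms(1) frag_extend_diff right_diff_distrib NF_diff)
  then show ?thesis by (rule NF_cong[OF _ c, of _ _ t]) (simp add: algebra_simps)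
qed

text \<open>Generators of J that are odd in x_1 are multiplied by x_1, which gives rewriting rules
  inside the even subring.\<close>

lemma J_rel:
  "g1 * g1 - 1 \<in> J" "x1^2 * x1^2 - 2 * (x1^2 + g1 * x1^2) \<in> J" "y1 * x1^2 - (x1^2 + 2 * (g1 * x1^2)) \<in> J"
  "z1 * x1^2 - (x1^2 + 2 * (g1 * x1^2)) \<in> J" "y1 * z1 - (1 + 2 * x1^2) \<in> J"
proof -
  have g: "g1^2 - 1 \<in> J" "x1^3 - 2 * x1 * (1 + g1) \<in> J" "x1 * (y1 - 1 - 2 * g1) \<in> J" "x1 * (y1 - z1) \<in> J" "y1 * z1 - 1 - 2 * x1^2 \<in> J"
    by (rule J_gen, simp add: J_gens_def)+
  show "g1 * g1 - 1 \<in> J" using g(1) by (simp add: power2_eq_square)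
  show "x1^2 * x1^2 - 2 * (x1^2 + g1 * x1^2) \<in> J"
    using J_closed(4)[OF g(2), of x1] by (simp add: power2_eq_square power3_eq_cube algebra_simps)
  show y: "y1 * x1^2 - (x1^2 + 2 * (g1 * x1^2)) \<in> J"
    using J_closed(4)[OF g(3), of x1] by (simp add: power2_eq_square algebra_simps)
  show "z1 * x1^2 - (x1^2 + 2 * (g1 * x1^2)) \<in> J"
    using J_closed(5)[OF y J_closed(4)[OF g(4), of x1]] by (simp add: power2_eq_square algebra_simps)
  show "y1 * z1 - (1 + 2 * x1^2) \<in> J" using g(5) by (simp add: algebra_simps)
qed
lemma J_relX:
  assumes "1 \<le> n"
  shows "x1^2 * X' n \<eta> - of_nat n * (x1^2 + g1 * x1^2) \<in> J"
    "y1 * X' n \<eta> - (of_nat n * (g1 * x1^2) + g1 * X' n \<eta>) \<in> J" "z1 * X' n \<eta> - (of_nat n * x1^2 + g1 * X' n \<eta>) \<in> J"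
proof -
  have g: "x1 * X' n \<eta> - of_nat n * (1 + g1) * x1 \<in> J" "y1 * X' n \<eta> - of_nat n * g1 * x1^2 - g1 * X' n \<eta> \<in> J"
    "z1 * X' n \<eta> - of_nat n * x1^2 - g1 * X' n \<eta> \<in> J"
    by (rule J_gen, use assms in \<open>auto simp: J_gens_def\<close>)+
  show "x1^2 * X' n \<eta> - of_nat n * (x1^2 + g1 * x1^2) \<in> J"
    using J_closed(4)[OF g(1), of x1] by (simp add: power2_eq_square algebra_simps)
  show "y1 * X' n \<eta> - (of_nat n * (g1 * x1^2) + g1 * X' n \<eta>) \<in> J" "z1 * X' n \<eta> - (of_nat n * x1^2 + g1 * X' n \<eta>) \<in> J"
    using g(2,3) by (simp_all add: algebra_simps)
qed
lemma J_relXX: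
  "1 \<le> n \<Longrightarrow> 1 \<le> s \<Longrightarrow> \<eta> \<noteq> \<alpha> \<Longrightarrow> X' n \<eta> * X' s \<alpha> - of_nat n * (of_nat s * (g1 * x1^2)) \<in> J"
  "1 \<le> n \<Longrightarrow> n \<le> t \<Longrightarrow> X' n \<eta> * X' t \<eta> - (of_nat n * (of_nat (t - 1) * (g1 * x1^2)) + X' n \<eta> + g1 * X' n \<eta>) \<in> J"
proof -
  assume a: "1 \<le> n" "1 \<le> s" "\<eta> \<noteq> \<alpha>"
  then have "X' n \<eta> * X' s \<alpha> - of_nat n * of_nat s * g1 * x1^2 \<in> J_gens" unfolding J_gens_def by blast
  from J_gen[OF this] show "X' n \<eta> * X' s \<alpha> - of_nat n * (of_nat s * (g1 * x1^2)) \<in> J" by (simp add: mult.assoc)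
next
  assume a: "1 \<le> n" "n \<le> t"
  then have "X' n \<eta> * X' t \<eta> - of_nat n * (of_nat t - 1) * g1 * x1^2 - X' n \<eta> - g1 * X' n \<eta> \<in> J_gens" unfolding J_gens_def by blast
  from J_gen[OF this] have j: "X' n \<eta> * X' t \<eta> - of_nat n * (of_nat t - 1) * g1 * x1^2 - X' n \<eta> - g1 * X' n \<eta> \<in> J" .
  have "of_nat (t - 1) = (of_nat t - 1 :: zx)" using a by (simp add: of_nat_diff)
  then show "X' n \<eta> * X' t \<eta> - (of_nat n * (of_nat (t - 1) * (g1 * x1^2)) + X' n \<eta> + g1 * X' n \<eta>) \<in> J"
    using j by (simp only: mult.assoc diff_diff_eq)
qed

lemma NF_g: assumes "q \<in> NF" shows "g1 * q \<in> NF"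
proof (rule NF_mult[OF _ assms])
  fix l
  have *: "g1 * (gb b * w) \<in> NF" if "gb (\<not> b) * w \<in> NF" for b w
    by (rule NF_cong[OF that J_rel(1), of _ "if b then 0 else w"]) (simp add: gb_def algebra_simps)
  show "g1 * bq l \<in> NF"
  proof (cases l)
    case (Inl b)
    then show ?thesis using *[of "\<not> b" "x1^2"] NF_bq[of "Inl (\<not> b)"] by simp
  next
    case (Inr k)
    show ?thesis
    proof (cases k)
      case (KT b m)
      have "bq (Inr (KT (\<not> b) m)) = gb (\<not> (b = odd m)) * y1 ^ m" by (cases b; cases "odd m") simp_all
      then show ?thesis using *[of "b = odd m" "y1^m"] NF_bq[of "Inr (KT (\<not> b) m)"] Inr KT by simp
    next
      case (KL b m)
      have "bq (Inr (KL (\<not> b) m)) = gb (\<not> (b = even (Suc m))) * z1 ^ Suc m" by (cases b; cases "odd m") simp_all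
      then show ?thesis using *[of "b = even (Suc m)" "z1^Suc m"] NF_bq[of "Inr (KL (\<not> b) m)"] Inr KL by (simp del: power_Suc)
    next
      case (KX b m \<eta>)
      then show ?thesis using *[of b] NF_bq[of "Inr (KX (\<not> b) m \<eta>)"] Inr by simp
    qed
  qed
qed

lemma NF_mon: "x1^2 \<in> NF" "y1^k \<in> NF" "z1^k \<in> NF" "1 \<le> n \<Longrightarrow> X' n \<eta> \<in> NF"
proof -
  show "x1^2 \<in> NF" using NF_bq[of "Inl False"] by (simp add: gb_def)
  show y: "y1^k \<in> NF" for k using NF_bq[of "Inr (KT (odd k) k)"] by (simp add: gb_def)
  show "z1^k \<in> NF"
  proof (cases k)
    case 0
    then show ?thesis using y[of 0] by simp
  next
    case (Suc m)
    then show ?thesis using NF_bq[of "Inr (KL (even (Suc m)) m)"] by (simp add: gb_def)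
  qed
  show "1 \<le> n \<Longrightarrow> X' n \<eta> \<in> NF" using NF_bq[of "Inr (KX True (n - 1) \<eta>)"] by (simp add: gb_def)
qed

text \<open>\<open>NF\<close> is stable under \<open>g1\<close>, and \<open>g1\<close> commutes with
  \<open>t\<close>, so only the normal monomials without \<open>g1\<close> have to be
  tested.\<close>

lemma NF_multI:
  assumes "t * x1^2 \<in> NF" "\<And>k. t * y1^k \<in> NF" "\<And>k. t * z1^k \<in> NF" "\<And>n \<eta>. 1 \<le> n \<Longrightarrow> t * X' n \<eta> \<in> NF" and q: "q \<in> NF"
  shows "t * q \<in> NF"
proof (rule NF_mult[OF _ q])
  fix l
  have *: "t * (gb b * w) \<in> NF" if "t * w \<in> NF" for b w
    using NF_g[OF that] that by (cases b) (simp_all add: gb_def mult.left_commute)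
  show "t * bq l \<in> NF"
  proof (cases l)
    case (Inr k)
    show ?thesis
    proof (cases k)
      case (KT b m)
      show ?thesis unfolding Inr KT bq.simps by (rule *[OF assms(2)])
    next
      case (KL b m)
      show ?thesis unfolding Inr KL bq.simps by (rule *[OF assms(3)])
    next
      case (KX b m \<eta>)
      show ?thesis unfolding Inr KX bq.simps by (intro * assms(4)) simp
    qed
  qed (simp add: * assms(1))
qed

lemma NF_x_pow: "y1^k * x1^2 \<in> NF" "z1^k * x1^2 \<in> NF"
proof -
  have *: "w^k * x1^2 \<in> NF" if "w * x1^2 - (x1^2 + 2 * (g1 * x1^2)) \<in> J" for w k
  proof (induction k)
    case (Suc k)
    show ?case
      by (rule NF_cong[OF NF_add[OF Suc NF_2[OF NF_g[OF Suc]]] that, of _ "w^k"]) (simp add: algebra_simps)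
  qed (simp add: NF_mon)
  show "y1^k * x1^2 \<in> NF" "z1^k * x1^2 \<in> NF" using *[OF J_rel(3)] *[OF J_rel(4)] by blast+
qed

lemma NF_x: "q \<in> NF \<Longrightarrow> x1^2 * q \<in> NF"
proof (rule NF_multI)
  note U = NF_mon(1) NF_g[OF NF_mon(1)]
  show "x1^2 * x1^2 \<in> NF" by (rule NF_cong[OF NF_2[OF NF_add[OF U]] J_rel(2), of _ 1]) (simp add: algebra_simps)
  show "x1^2 * X' n \<eta> \<in> NF" if "1 \<le> n" for n \<eta>
    by (rule NF_cong[OF NF_nat[OF NF_add[OF U], of n] J_relX(1)[OF that, of \<eta>], of _ 1]) (simp add: algebra_simps)
  show "x1^2 * y1^k \<in> NF" "x1^2 * z1^k \<in> NF" for k using NF_x_pow[of k] by (simp_all add: mult.commute)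
qed

lemma NF_yX: assumes "1 \<le> n" shows "X' n \<eta> * y1^k \<in> NF" "X' n \<eta> * z1^k \<in> NF"
proof -
  show "X' n \<eta> * y1^k \<in> NF"
  proof (induction k)
    case (Suc k)
    show ?case
      by (rule NF_cong[OF NF_add[OF NF_nat[OF NF_g[OF NF_x_pow(1)], of n k] NF_g[OF Suc]] J_relX(2)[OF assms, of \<eta>], of _ "y1^k"]) (simp add: algebra_simps)
  qed (simp add: NF_mon(4)[OF assms])
  show "X' n \<eta> * z1^k \<in> NF"
  proof (induction k)
    case (Suc k)
    show ?case
      by (rule NF_cong[OF NF_add[OF NF_nat[OF NF_x_pow(2), of n k] NF_g[OF Suc]] J_relX(3)[OF assms, of \<eta>], of _ "z1^k"]) (simp add: algebra_simps)
  qed (simp add: NF_mon(4)[OF assms])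
qed

lemma NF_yz: "y1 * z1^k \<in> NF" "z1 * y1^k \<in> NF"
proof -
  show "y1 * z1^k \<in> NF"
  proof (cases k)
    case (Suc m)
    show ?thesis unfolding Suc
      by (rule NF_cong[OF NF_add[OF NF_mon(3) NF_2[OF NF_x_pow(2)], of m m] J_rel(5), of _ "z1^m"]) (simp add: algebra_simps)
  qed (use NF_mon(2)[of 1] in simp)
  show "z1 * y1^k \<in> NF"
  proof (cases k)
    case (Suc m)
    show ?thesis unfolding Suc
      by (rule NF_cong[OF NF_add[OF NF_mon(2) NF_2[OF NF_x_pow(1)], of m m] J_rel(5), of _ "y1^m"]) (simp add: algebra_simps)
  qed (use NF_mon(3)[of 1] in simp)
qed

lemma NF_XX: assumes "1 \<le> n" "1 \<le> t" shows "X' n \<eta> * X' t \<alpha> \<in> NF"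
proof -
  note U = NF_g[OF NF_mon(1)]
  have s: "X' n \<eta> * X' t \<eta> \<in> NF" if "1 \<le> n" "n \<le> t" for n t
    by (rule NF_cong[OF NF_add[OF NF_add[OF NF_nat[OF NF_nat[OF U, of "t - 1"], of n] NF_mon(4)[OF that(1), of \<eta>]] NF_g[OF NF_mon(4)[OF that(1), of \<eta>]]]
      J_relXX(2)[OF that, of \<eta>], of _ 1]) (simp add: algebra_simps)
  show ?thesis
  proof (cases "\<eta> = \<alpha>")
    case True
    then show ?thesis using s[OF assms(1), of t] s[OF assms(2), of n] by (cases "n \<le> t") (auto simp: mult.commute)
  next
    case False
    show ?thesis
      by (rule NF_cong[OF NF_nat[OF NF_nat[OF U, of t], of n] J_relXX(1)[OF assms False], of _ 1]) (simp add: algebra_simps)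
  qed
qed

text \<open>The multipliers that preserve \<open>NF\<close> form a ring; it contains the generators
  of the even subring, and a multiplier applied to 1 lies in \<open>NF\<close>.\<close>

lemma ZT_NF: assumes "q \<in> ZX_tilde" shows "q \<in> NF"
proof -
  have y: "y1 * r \<in> NF" if "r \<in> NF" for r
  proof (rule NF_multI[OF _ _ NF_yz(1) _ that])
    show "y1 * x1^2 \<in> NF" "y1 * y1^k \<in> NF" for k using NF_x_pow(1)[of 1] NF_mon(2)[of "Suc k"] by simp_all
    show "y1 * X' n \<eta> \<in> NF" if "1 \<le> n" for n \<eta> using NF_yX(1)[OF that, of \<eta> 1] by (simp add: mult.commute)
  qed
  have z: "z1 * r \<in> NF" if "r \<in> NF" for r
  proof (rule NF_multI[OF _ NF_yz(2) _ _ that])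
    show "z1 * x1^2 \<in> NF" "z1 * z1^k \<in> NF" for k using NF_x_pow(2)[of 1] NF_mon(3)[of "Suc k"] by simp_all
    show "z1 * X' n \<eta> \<in> NF" if "1 \<le> n" for n \<eta> using NF_yX(2)[OF that, of \<eta> 1] by (simp add: mult.commute)
  qed
  have X: "X' n \<eta> * r \<in> NF" if "1 \<le> n" "r \<in> NF" for n \<eta> r
    by (rule NF_multI[OF _ NF_yX[OF that(1)] NF_XX[OF that(1)] that(2)])
       (use NF_x[OF NF_mon(4)[OF that(1), of \<eta>]] in \<open>simp add: mult.commute\<close>)
  have "\<forall>r\<in>NF. q * r \<in> NF"
    using assms
  proof (induction rule: ZT_induct)
    case (gen h)
    then show ?case using y z X NF_g NF_x by auto
  next
    case (minus x)
    then show ?case using NF_diff[OF NF_0] by fastforce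
  qed (auto simp: distrib_right NF_add mult.assoc)
  moreover have "1 \<in> NF" using NF_mon(2)[of 0] by simp
  ultimately show ?thesis by force
qed

lemma frag_functional:
  fixes h :: "('a \<Rightarrow>\<^sub>0 int) \<Rightarrow> int"
  assumes "Poly_Mapping.keys c \<subseteq> A" "h 0 = 0" "\<And>a b. h (a - b) = h a - h b"
    and "\<And>i. i \<in> A \<Longrightarrow> h (frag_of i) = (if i = i0 then d else 0)"
  shows "h c = Poly_Mapping.lookup c i0 * d"
  using assms(1) by (induction c rule: frag_induction) (auto simp: assms lookup_minus left_diff_distrib lookup_single when_def)

lemma ev_bq: "fa (evz vv (bq (Inl b))) = gcl (Pm b)" "fa (evz vv (bq (Inr l))) - gcl (kstd l) \<in> Pr"
proof -
  have g: "evz vv (gb b) = S2 (gs b) 0" for b by (cases b) (simp_all add: gb_def evz_hom ev_vars gs one_s2_def)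
  show "fa (evz vv (bq (Inl b))) = gcl (Pm b)"
    by (cases b) (simp_all add: evz_hom g ev_vars power2_eq_square s2_defs gs gp_P0(3) gp_def[symmetric])
  show "fa (evz vv (bq (Inr l))) - gcl (kstd l) \<in> Pr"
  proof (cases l)
    case (KT b k)
    then show ?thesis using gy_pow[of b k] by (simp add: evz_hom g ev_vars s2_pow s2_defs)
  next
    case (KL b k)
    then show ?thesis using gz_pow[of b "Suc k"] by (simp add: evz_hom g ev_vars s2_pow s2_defs)
  next
    case (KX b n \<eta>)
    then show ?thesis using Pr_0 by (cases b) (simp_all add: evz_hom g ev_vars s2_defs gs sg_def gX_neg gX_def[symmetric])
  qed
qed

text \<open>Multiplicities of \<open>kstd l\<close> vanish on \<open>Pr\<close>, so they isolate the
  \<open>Inr\<close> coefficients in spite of the projective error terms. Once these coefficients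
  are gone, no error terms remain and the multiplicities of \<open>Pm\<close> isolate the
  \<open>Inl\<close> ones.\<close>

lemma ev_indep: assumes z: "fa (evz vv (frag_extend bq c)) = 0" shows "c = 0"
proof -
  have h: "gm N (fa (evz vv (frag_extend bq (a - b)))) = gm N (fa (evz vv (frag_extend bq a))) - gm N (fa (evz vv (frag_extend bq b)))"
    "gm N (fa (evz vv (frag_extend bq 0))) = 0" for N :: "'n kmod" and a b
    by (simp_all add: frag_extend_diff evz_hom s2_defs gm_diff gm_simps)
  have K: "Poly_Mapping.lookup c (Inr l) = 0" for l
  proof -
    have "gm (kstd l) (fa (evz vv (bq i))) = (if i = Inr l then gm (kstd l) (gcl (kstd l)) else 0)" for i
    proof (cases i)
      case (Inl b)
      have "gcl (Pm b) \<in> Pr" using Pr_gp[of 1 0] Pr_gp[of 0 1] by (cases b) (simp_all add: gp_P0(3) gp_def[symmetric])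
      then show ?thesis using Inl gm_kstd_Pr by (simp add: ev_bq del: bq.simps)
    next
      case (Inr l')
      have "gm (kstd l) (fa (evz vv (bq i))) = gm (kstd l) (gcl (kstd l'))"
        using gm_kstd_Pr[OF ev_bq(2)[of l'], of l] Inr by (simp add: gm_diff del: bq.simps kstd.simps)
      then show ?thesis using gm_kstd(1)[of l l'] Inr by (auto simp del: kstd.simps)
    qed
    then have "gm (kstd l) (fa (evz vv (frag_extend bq c))) = Poly_Mapping.lookup c (Inr l) * gm (kstd l) (gcl (kstd l))"
      by (intro frag_functional[where A = UNIV]) (auto simp: h evz_0 zero_s2_def gm_simps(1) simp del: kstd.simps)
    then show ?thesis using gm_kstd(2)[of l] by (simp add: z gm_simps del: kstd.simps)
  qed
  have P: "Poly_Mapping.lookup c (Inl b) = 0" for b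
  proof -
    have "gm (Pm b) (fa (evz vv (frag_extend bq c))) = Poly_Mapping.lookup c (Inl b) * gm (Pm b) (gcl (Pm b))"
    proof (rule frag_functional[where A = "range Inl"])
      show "Poly_Mapping.keys c \<subseteq> range Inl"
      proof
        fix i assume "i \<in> Poly_Mapping.keys c"
        then show "i \<in> range Inl" using K by (cases i) (auto simp: in_keys_iff)
      qed
      show "gm (Pm b) (fa (evz vv (frag_extend bq (frag_of i)))) = (if i = Inl b then gm (Pm b) (gcl (Pm b)) else 0)" if "i \<in> range Inl" for i
      proof -
        obtain b' where i: "i = Inl b'" using \<open>i \<in> range Inl\<close> by auto
        have "gm (Pm b) (fa (evz vv (frag_extend bq (frag_of i)))) = gm (Pm b) (gcl (Pm b'))" unfolding i frag_extend_of ev_bq(1) ..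
        also have "\<dots> = (if b = b' then gm (Pm b) (gcl (Pm b)) else 0)" by (rule gm_Pm(1))
        also have "\<dots> = (if i = Inl b then gm (Pm b) (gcl (Pm b)) else 0)" unfolding i sum.inject eq_commute[of b' b] ..
        finally show ?thesis .
      qed
    qed (simp_all add: h evz_0 zero_s2_def gm_simps(1))
    then show ?thesis using gm_Pm(2)[of b] by (simp add: z gm_simps)
  qed
  show "c = 0"
  proof (rule poly_mapping_eqI)
    fix i show "Poly_Mapping.lookup c i = Poly_Mapping.lookup 0 i" using K P by (cases i) auto
  qed
qed

lemma ev_ker: assumes "p \<in> ZX_tilde" "q \<in> ZX_tilde" shows "fa (evz vv p) = fa (evz vv q) \<longleftrightarrow> p - q \<in> J"
proof
  assume "p - q \<in> J"
  then show "fa (evz vv p) = fa (evz vv q)" using ev_J[of "p - q"] by (simp add: evz_hom s2_defs)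
next
  assume e: "fa (evz vv p) = fa (evz vv q)"
  obtain c where c: "(p - q) - frag_extend bq c \<in> J" using ZT_NF[OF ZT_closed(4)[OF assms]] by (auto simp: NF_def)
  have "fa (evz vv (frag_extend bq c)) = 0" using ev_J[OF c] e by (simp add: evz_hom s2_defs)
  then have "c = 0" by (rule ev_indep)
  then show "p - q \<in> J" using c by simp
qed

lemma coset_J: "J +>\<^bsub>ZX\<^esub> p = J +>\<^bsub>ZX\<^esub> q \<longleftrightarrow> p - q \<in> J"
proof -
  have e: "J +>\<^bsub>ZX\<^esub> r = (\<lambda>j. j + r) ` J" for r by (auto simp: a_r_coset_def r_coset_def ZX_def rta_simps)
  show ?thesis
  proof
    assume "J +>\<^bsub>ZX\<^esub> p = J +>\<^bsub>ZX\<^esub> q"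
    then have "p \<in> (\<lambda>j. j + q) ` J" using J_closed(1) by (metis e image_eqI add_0)
    then show "p - q \<in> J" by auto
  next
    assume j: "p - q \<in> J"
    have "j + p \<in> (\<lambda>j. j + q) ` J" "j + q \<in> (\<lambda>j. j + p) ` J" if "j \<in> J" for j
      using J_closed(2)[OF that j] J_closed(5)[OF that j]
      by (auto intro: image_eqI[of _ _ "j + (p - q)"] image_eqI[of _ _ "j - (p - q)"])
    then show "J +>\<^bsub>ZX\<^esub> p = J +>\<^bsub>ZX\<^esub> q" unfolding e by blast
  qed
qed

theorem theorem5p2:
  shows "green_ring \<simeq> ZX_tilde_mod_J"
proof -
  \<comment> \<open>The isomorphism is the inverse of evaluation: choose any even polynomial with
    the given value and take its coset. \<open>ev_ker\<close> makes the coset independent of the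
    choice and the map injective.\<close>
  define sel where "sel x = (SOME q. q \<in> ZX_tilde \<and> fa (evz vv q) = Abs_green x)" for x
  have sel: "sel x \<in> ZX_tilde" "fa (evz vv (sel x)) = Abs_green x" for x
    using someI_ex[of "\<lambda>q. q \<in> ZX_tilde \<and> fa (evz vv q) = Abs_green x"] ev_surj[of "Abs_green x"] unfolding sel_def by blast+
  define f where "f x = J +>\<^bsub>ZX\<^esub> sel x" for x
  have f: "f x = J +>\<^bsub>ZX\<^esub> q" if "q \<in> ZX_tilde" "fa (evz vv q) = Abs_green x" for x q
    unfolding f_def coset_J using ev_ker[OF sel(1)[of x] that(1)] sel(2) that(2) by simp
  have hom: "(+>\<^bsub>ZX\<^esub>) J \<in> Ring.ring_hom ZX (ZX Quot J)" unfolding ZX_def by (rule ideal.rcos_ring_hom[OF ideal_J])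
  have c: "p \<in> carrier ZX" for p by (simp add: ZX_def rta_simps)
  have "f \<in> Ring.ring_hom green_ring ZX_tilde_mod_J"
  proof (rule ring_hom_memI)
    fix x y assume x: "x \<in> carrier green_ring" and y: "y \<in> carrier green_ring"
    show "f x \<in> carrier ZX_tilde_mod_J" using sel(1) by (simp add: f_def ZX_tilde_mod_J_def)
    have "fa (evz vv (sel x * sel y)) = Abs_green (x \<otimes>\<^bsub>green_ring\<^esub> y)"
      by (simp add: ev_ZT_mult sel times_green_def Abs_green_inverse x y)
    from f[OF ZT_closed(3)[OF sel(1) sel(1)] this] show "f (x \<otimes>\<^bsub>green_ring\<^esub> y) = f x \<otimes>\<^bsub>ZX_tilde_mod_J\<^esub> f y"
      using ring_hom_mult[OF hom c c, of "sel x" "sel y"] by (simp add: f_def ZX_tilde_mod_J_def) (simp add: ZX_def rta_simps)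
    have "fa (evz vv (sel x + sel y)) = Abs_green (x \<oplus>\<^bsub>green_ring\<^esub> y)"
      by (simp add: evz_hom plus_s2_def sel plus_green_def Abs_green_inverse x y)
    from f[OF ZT_closed(2)[OF sel(1) sel(1)] this] show "f (x \<oplus>\<^bsub>green_ring\<^esub> y) = f x \<oplus>\<^bsub>ZX_tilde_mod_J\<^esub> f y"
      using ring_hom_add[OF hom c c, of "sel x" "sel y"] by (simp add: f_def ZX_tilde_mod_J_def) (simp add: ZX_def rta_simps)
  next
    have "\<one>\<^bsub>green_ring\<^esub> = Hd +>\<^bsub>pre_green\<^esub> fr (S 1)" by (simp add: green_ring_Hd FactRing_def pg_simps(4))
    then have "fa (evz vv 1) = Abs_green \<one>\<^bsub>green_ring\<^esub>" by (simp add: evz_hom one_s2_def one_green_def gq_def)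
    from f[OF ZT_closed(1) this] show "f \<one>\<^bsub>green_ring\<^esub> = \<one>\<^bsub>ZX_tilde_mod_J\<^esub>"
      using ring_hom_one[OF hom] by (simp add: ZX_tilde_mod_J_def) (simp add: ZX_def rta_simps)
  qed
  moreover have "bij_betw f (carrier green_ring) (carrier ZX_tilde_mod_J)"
  proof (rule bij_betw_imageI)
    show "inj_on f (carrier green_ring)"
    proof (rule inj_onI)
      fix x y assume xy: "x \<in> carrier green_ring" "y \<in> carrier green_ring" "f x = f y"
      then have "Abs_green x = Abs_green y" using ev_ker[OF sel(1) sel(1), of x y] by (simp add: f_def coset_J sel(2))
      then show "x = y" using xy by (simp add: Abs_green_inject)
    qed
    show "f ` carrier green_ring = carrier ZX_tilde_mod_J"
    proof
      show "f ` carrier green_ring \<subseteq> carrier ZX_tilde_mod_J" using sel(1) by (auto simp: f_def ZX_tilde_mod_J_def)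
      show "carrier ZX_tilde_mod_J \<subseteq> f ` carrier green_ring"
      proof
        fix K assume "K \<in> carrier ZX_tilde_mod_J"
        then obtain q where q: "q \<in> ZX_tilde" "K = J +>\<^bsub>ZX\<^esub> q" by (auto simp: ZX_tilde_mod_J_def)
        have "K = f (Rep_green (fa (evz vv q)))" using f[OF q(1), of "Rep_green (fa (evz vv q))"] q(2) by (simp add: Rep_green_inverse)
        then show "K \<in> f ` carrier green_ring" using Rep_green by blast
      qed
    qed
  qed
  ultimately show ?thesis unfolding is_ring_iso_def ring_iso_def by blast
qed

end
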